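(* The Carlsson module $K(1)$ with its internal product is isomorphic, as an unstable level algebra, to the free unstable level algebra generated by the unstable module $F(1)$.
   Context: Base field $\mathbb F=\mathbb F_2$. $\mathcal A$ is the mod 2 Steenrod algebra ($Sq^0=1$). $\mathcal U$ is the category of unstable modules: graded left $\mathcal A$-modules $M$ with $Sq^ix=0$ for $i>|x|$; $Sq_0x:=Sq^{|x|}x$. Tensor products carry the Cartan action $Sq^i(x\otimes y)=\sum_{k+l=i}Sq^kx\otimes Sq^ly$. $V^\sharp$ is the dual of a vector space $V$. $F(n)$ is the free unstable module on a generator $\iota_n$ of degree $n$: $\operatorname{Hom}_{\mathcal U}(F(n),M)\cong M^n$. A level algebra is a vector space with a commutative bilinear operation $\star$ satisfying $(a\star b)\star(c\star d)=(a\star c)\star(b\star d)$. An unstable level algebra is an unstable module $M$ with a graded level algebra structure $\star$ satisfying the Cartan formula $Sq^i(x\star y)=\sum_{k+l=i}Sq^kx\star Sq^ly$ and $Sq_0x=x\star x$ for all $x\in M$. The free unstable level algebra generated by $M\in\mathcal U$ is the value at $M$ of the left adjoint of the forgetful functor from unstable level algebras to $\mathcal U$. Brown–Gitler modules: $J(n)$ is the object of $\mathcal U$ representing $M\mapsto(M^n)^\sharp$, so $\operatorname{Hom}_{\mathcal U}(M,J(n))\cong(M^n)^\sharp$, and $J(n)^m\cong(F(m)^n)^\sharp$. The external product $\mu_{m,n}:J(n)\otimes J(m)\to J(n+m)$ is the only non-zero element of $\operatorname{Hom}_{\mathcal U}(J(n)\otimes J(m),J(n+m))\cong((J(n)\otimes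 J(m))^{n+m})^\sharp$. The map $\cdot Sq^n:J(2n)\to J(n)$ is the element of $\operatorname{Hom}_{\mathcal U}(J(2n),J(n))\cong(J(2n)^n)^\sharp\cong F(n)^{2n}$ corresponding to $Sq_0\iota_n$. The internal product of $J(n)$ is $J(n)\otimes J(n)\xrightarrow{\mu_{n,n}}J(2n)\xrightarrow{\cdot Sq^n}J(n)$. Carlsson module: $K(n)$ is the limit in $\mathcal U$ of $J(n)\xleftarrow{\cdot Sq^n}J(2n)\leftarrow\cdots\leftarrow J(2^qn)\xleftarrow{\cdot Sq^{2^qn}}J(2^{q+1}n)\leftarrow\cdots$; the internal products of the $J(2^qn)$ pass to the limit and define the internal product $K(n)\otimes K(n)\to K(n)$. *)

theory Defs
  imports Complex_Main "HOL-Algebra.Module" "HOL-Library.Z2"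
begin

section \<open>Vector spaces over the field with two elements\<close>

definition F2 :: "(bit, bit) module" where
  "F2 = \<lparr>carrier = UNIV, mult = (*), one = 1, zero = 0, add = (+), smult = (*)\<rparr>"

definition lin :: "(bit, 'a) module \<Rightarrow> (bit, 'b) module \<Rightarrow> ('a \<Rightarrow> 'b) set" where
  "lin V W = {f \<in> carrier V \<rightarrow> carrier W.
     (\<forall>x\<in>carrier V. \<forall>y\<in>carrier V. f (x \<oplus>\<^bsub>V\<^esub> y) = f x \<oplus>\<^bsub>W\<^esub> f y) \<and>
     (\<forall>c. \<forall>x\<in>carrier V. f (c \<odot>\<^bsub>V\<^esub> x) = c \<odot>\<^bsub>W\<^esub> f x)}"

text \<open>Functionals are normalised to vanish off the carrier.
  (The ring fields \<open>mult\<close> and \<open>one\<close> of the module record play no role.)\<close>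

definition dual :: "(bit, 'a) module \<Rightarrow> (bit, 'a \<Rightarrow> bit) module" where
  "dual V = \<lparr>carrier = {f \<in> lin V F2. \<forall>x. x \<notin> carrier V \<longrightarrow> f x = 0},
     mult = undefined, one = undefined,
     zero = (\<lambda>x. 0), add = (\<lambda>f g x. f x + g x), smult = (\<lambda>c f x. c * f x)\<rparr>"


section \<open>Unstable modules\<close>

text \<open>
  \<open>sq M i d\<close> is the operation $Sq^i$ on the component of degree \<open>d\<close>. The Steenrod algebra is the
  associative algebra generated by the $Sq^i$ subject to $Sq^0 = 1$ and the Adem relations
  $Sq^i Sq^j = \sum_k \binom{j-k-1}{i-2k} Sq^{i+j-k} Sq^k$ for $0 < i < 2j$, so a graded left module
  over it is a graded vector space with linear operations satisfying these relations. Unstable modules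
  vanish in negative degrees (because of $Sq^0 = 1$), so the grading is by \<open>nat\<close>.
  In the Adem relation $k \le i/2 < j$, so that no subtraction is truncated.
\<close>

record 'a umod =
  comp :: "nat \<Rightarrow> (bit, 'a) module"
  sq :: "nat \<Rightarrow> nat \<Rightarrow> 'a \<Rightarrow> 'a"

abbreviation el :: "('a, 'm) umod_scheme \<Rightarrow> nat \<Rightarrow> 'a set" where
  "el M d \<equiv> carrier (comp M d)"

definition Sq0 :: "('a, 'm) umod_scheme \<Rightarrow> nat \<Rightarrow> 'a \<Rightarrow> 'a" where
  "Sq0 M d x = sq M d d x"

locale unstable_module =
  fixes M :: "('a, 'm) umod_scheme"
  assumes vector_space: "module F2 (comp M d)"
    and sq_linear: "sq M i d \<in> lin (comp M d) (comp M (d + i))"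
    and sq_zero: "x \<in> el M d \<Longrightarrow> sq M 0 d x = x"
    and adem: "\<lbrakk>0 < i; i < 2 * j; x \<in> el M d\<rbrakk> \<Longrightarrow>
      sq M i (d + j) (sq M j d x) =
      (\<Oplus>\<^bsub>comp M (d + j + i)\<^esub> k \<in> {k. k \<le> i div 2 \<and> odd ((j - k - 1) choose (i - 2 * k))}.
         sq M (i + j - k) (d + k) (sq M k d x))"
    and unstable: "\<lbrakk>d < i; x \<in> el M d\<rbrakk> \<Longrightarrow> sq M i d x = \<zero>\<^bsub>comp M (d + i)\<^esub>"

text \<open>Morphisms are normalised to be \<open>undefined\<close> off the carriers, so that equality
  of morphisms is equality of functions.\<close>

definition umod_hom :: "('a, 'm) umod_scheme \<Rightarrow> ('b, 'n) umod_scheme \<Rightarrow> (nat \<Rightarrow> 'a \<Rightarrow> 'b) set" where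
  "umod_hom M N = {\<phi>.
     (\<forall>d. \<phi> d \<in> lin (comp M d) (comp N d) \<inter> extensional (el M d)) \<and>
     (\<forall>i d. \<forall>x\<in>el M d. \<phi> (d + i) (sq M i d x) = sq N i d (\<phi> d x))}"


section \<open>Unstable level algebras\<close>

record 'a ulalg = "'a umod" +
  star :: "nat \<Rightarrow> nat \<Rightarrow> 'a \<Rightarrow> 'a \<Rightarrow> 'a"

text \<open>\<open>star L a b x y\<close> is the product of \<open>x\<close> in degree \<open>a\<close> and \<open>y\<close> in degree \<open>b\<close>.\<close>

locale unstable_level_algebra = unstable_module L for L :: "('a, 'm) ulalg_scheme" +
  assumes star_linear1: "y \<in> el L b \<Longrightarrow> (\<lambda>x. star L a b x y) \<in> lin (comp L a) (comp L (a + b))"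
    and star_linear2: "x \<in> el L a \<Longrightarrow> (\<lambda>y. star L a b x y) \<in> lin (comp L b) (comp L (a + b))"
    and star_comm: "\<lbrakk>x \<in> el L a; y \<in> el L b\<rbrakk> \<Longrightarrow> star L a b x y = star L b a y x"
    and level: "\<lbrakk>x \<in> el L a; y \<in> el L b; z \<in> el L c; w \<in> el L e\<rbrakk> \<Longrightarrow>
      star L (a + b) (c + e) (star L a b x y) (star L c e z w) =
      star L (a + c) (b + e) (star L a c x z) (star L b e y w)"
    and cartan: "\<lbrakk>x \<in> el L a; y \<in> el L b\<rbrakk> \<Longrightarrow>
      sq L i (a + b) (star L a b x y) =
      (\<Oplus>\<^bsub>comp L (a + b + i)\<^esub> k \<in> {..i}. star L (a + k) (b + (i - k)) (sq L k a x) (sq L (i - k) b y))"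
    and Sq0_star: "x \<in> el L d \<Longrightarrow> Sq0 L d x = star L d d x x"

definition ula_hom :: "('a, 'm) ulalg_scheme \<Rightarrow> ('b, 'n) ulalg_scheme \<Rightarrow> (nat \<Rightarrow> 'a \<Rightarrow> 'b) set" where
  "ula_hom L L' = {\<phi> \<in> umod_hom L L'.
     \<forall>a b. \<forall>x\<in>el L a. \<forall>y\<in>el L b. \<phi> (a + b) (star L a b x y) = star L' a b (\<phi> a x) (\<phi> b y)}"

definition ula_isomorphic :: "('a, 'm) ulalg_scheme \<Rightarrow> ('b, 'n) ulalg_scheme \<Rightarrow> bool" where
  "ula_isomorphic L L' \<longleftrightarrow> unstable_level_algebra L \<and> unstable_level_algebra L' \<and>
     (\<exists>\<phi>\<in>ula_hom L L'. \<forall>d. bij_betw (\<phi> d) (el L d) (el L' d))"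


section \<open>Quotients of term algebras\<close>

text \<open>
  Free objects and tensor products are quotients of sets of terms by the smallest congruence that
  forces the required identities; the universal properties of the free objects are proved in
  \<open>F_universal\<close> and \<open>free_ula_universal\<close> below. Since only terms that are well-formed of a given degree matter,
  the congruences are partial equivalence relations: \<open>R t t\<close> says that \<open>t\<close> is well-formed.
\<close>

definition quot :: "('t \<Rightarrow> 't \<Rightarrow> bool) \<Rightarrow> 't \<Rightarrow> ('t \<Rightarrow> 't \<Rightarrow> 't) \<Rightarrow> (bit, 't set) module" where
  "quot R z p = \<lparr>carrier = {Collect (R t) | t. R t t},
     mult = undefined, one = undefined,
     zero = Collect (R z), add = (\<lambda>X Y. \<Union>s\<in>X. \<Union>t\<in>Y. Collect (R (p s t))),
     smult = (\<lambda>c X. if c = 0 then Collect (R z) else X)\<rparr>"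


section \<open>The free unstable module on one generator\<close>

datatype fterm = FGen | FZero | FAdd fterm fterm | FSq nat fterm

definition fsum :: "fterm list \<Rightarrow> fterm" where
  "fsum ts = foldr FAdd ts FZero"

text \<open>\<open>frel n d s t\<close>: the terms \<open>s\<close> and \<open>t\<close> are well-formed of degree \<open>d\<close>, when the generator
  is given degree \<open>n\<close>, and their equality is a consequence of the axioms of unstable modules.\<close>

inductive frel :: "nat \<Rightarrow> nat \<Rightarrow> fterm \<Rightarrow> fterm \<Rightarrow> bool" for n where
  gen: "frel n n FGen FGen"
| zero: "frel n d FZero FZero"
| add: "frel n d s s' \<Longrightarrow> frel n d t t' \<Longrightarrow> frel n d (FAdd s t) (FAdd s' t')"
| sq: "frel n d t t' \<Longrightarrow> frel n (d + i) (FSq i t) (FSq i t')"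
| sym: "frel n d s t \<Longrightarrow> frel n d t s"
| trans: "frel n d s t \<Longrightarrow> frel n d t u \<Longrightarrow> frel n d s u"
| add_assoc: "frel n d s s \<Longrightarrow> frel n d t t \<Longrightarrow> frel n d u u \<Longrightarrow>
    frel n d (FAdd (FAdd s t) u) (FAdd s (FAdd t u))"
| add_comm: "frel n d s s \<Longrightarrow> frel n d t t \<Longrightarrow> frel n d (FAdd s t) (FAdd t s)"
| add_zero: "frel n d t t \<Longrightarrow> frel n d (FAdd FZero t) t"
| add_self: "frel n d t t \<Longrightarrow> frel n d (FAdd t t) FZero"
| sq_add: "frel n d s s \<Longrightarrow> frel n d t t \<Longrightarrow>
    frel n (d + i) (FSq i (FAdd s t)) (FAdd (FSq i s) (FSq i t))"
| sq_zero: "frel n d t t \<Longrightarrow> frel n d (FSq 0 t) t"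
| adem: "0 < i \<Longrightarrow> i < 2 * j \<Longrightarrow> frel n d t t \<Longrightarrow>
    frel n (d + j + i) (FSq i (FSq j t))
      (fsum (map (\<lambda>k. FSq (i + j - k) (FSq k t))
        (filter (\<lambda>k. odd ((j - k - 1) choose (i - 2 * k))) [0..<Suc (i div 2)])))"
| unstable: "d < i \<Longrightarrow> frel n d t t \<Longrightarrow> frel n (d + i) (FSq i t) FZero"

definition F :: "nat \<Rightarrow> fterm set umod" where
  "F n = \<lparr>comp = (\<lambda>d. quot (frel n d) FZero FAdd),
     sq = (\<lambda>i d X. \<Union>t\<in>X. Collect (frel n (d + i) (FSq i t)))\<rparr>"

definition iota :: "nat \<Rightarrow> fterm set" where
  "iota n = Collect (frel n n FGen)"

text \<open>The morphism $F(n) \to M$ that sends the generator to a given element of degree \<open>n\<close>;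
  see \<open>F_universal\<close> below.\<close>

definition classify :: "('a, 'm) umod_scheme \<Rightarrow> nat \<Rightarrow> 'a \<Rightarrow> nat \<Rightarrow> fterm set \<Rightarrow> 'a" where
  "classify M n x = (THE \<phi>. \<phi> \<in> umod_hom (F n) M \<and> \<phi> n (iota n) = x)"


section \<open>The free unstable level algebra on an unstable module\<close>

datatype 'a lterm = LGen 'a | LZero | LAdd "'a lterm" "'a lterm" | LSq nat "'a lterm"
  | LStar nat "'a lterm" nat "'a lterm"

definition lsum :: "'a lterm list \<Rightarrow> 'a lterm" where
  "lsum ts = foldr LAdd ts LZero"

inductive lrel :: "('a, 'm) umod_scheme \<Rightarrow> nat \<Rightarrow> 'a lterm \<Rightarrow> 'a lterm \<Rightarrow> bool" for M where
  gen: "x \<in> el M d \<Longrightarrow> lrel M d (LGen x) (LGen x)"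
| zero: "lrel M d LZero LZero"
| add: "lrel M d s s' \<Longrightarrow> lrel M d t t' \<Longrightarrow> lrel M d (LAdd s t) (LAdd s' t')"
| sq: "lrel M d t t' \<Longrightarrow> lrel M (d + i) (LSq i t) (LSq i t')"
| star: "lrel M a s s' \<Longrightarrow> lrel M b t t' \<Longrightarrow> lrel M (a + b) (LStar a s b t) (LStar a s' b t')"
| sym: "lrel M d s t \<Longrightarrow> lrel M d t s"
| trans: "lrel M d s t \<Longrightarrow> lrel M d t u \<Longrightarrow> lrel M d s u"
| add_assoc: "lrel M d s s \<Longrightarrow> lrel M d t t \<Longrightarrow> lrel M d u u \<Longrightarrow>
    lrel M d (LAdd (LAdd s t) u) (LAdd s (LAdd t u))"
| add_comm: "lrel M d s s \<Longrightarrow> lrel M d t t \<Longrightarrow> lrel M d (LAdd s t) (LAdd t s)"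
| add_zero: "lrel M d t t \<Longrightarrow> lrel M d (LAdd LZero t) t"
| add_self: "lrel M d t t \<Longrightarrow> lrel M d (LAdd t t) LZero"
| gen_add: "x \<in> el M d \<Longrightarrow> y \<in> el M d \<Longrightarrow>
    lrel M d (LGen (x \<oplus>\<^bsub>comp M d\<^esub> y)) (LAdd (LGen x) (LGen y))"
| gen_sq: "x \<in> el M d \<Longrightarrow> lrel M (d + i) (LGen (sq M i d x)) (LSq i (LGen x))"
| sq_add: "lrel M d s s \<Longrightarrow> lrel M d t t \<Longrightarrow>
    lrel M (d + i) (LSq i (LAdd s t)) (LAdd (LSq i s) (LSq i t))"
| sq_zero: "lrel M d t t \<Longrightarrow> lrel M d (LSq 0 t) t"
| adem: "0 < i \<Longrightarrow> i < 2 * j \<Longrightarrow> lrel M d t t \<Longrightarrow>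
    lrel M (d + j + i) (LSq i (LSq j t))
      (lsum (map (\<lambda>k. LSq (i + j - k) (LSq k t))
        (filter (\<lambda>k. odd ((j - k - 1) choose (i - 2 * k))) [0..<Suc (i div 2)])))"
| unstable: "d < i \<Longrightarrow> lrel M d t t \<Longrightarrow> lrel M (d + i) (LSq i t) LZero"
| star_add: "lrel M a s s \<Longrightarrow> lrel M a s' s' \<Longrightarrow> lrel M b t t \<Longrightarrow>
    lrel M (a + b) (LStar a (LAdd s s') b t) (LAdd (LStar a s b t) (LStar a s' b t))"
| star_comm: "lrel M a s s \<Longrightarrow> lrel M b t t \<Longrightarrow>
    lrel M (a + b) (LStar a s b t) (LStar b t a s)"
| level: "lrel M a s s \<Longrightarrow> lrel M b t t \<Longrightarrow> lrel M c u u \<Longrightarrow> lrel M e v v \<Longrightarrow>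
    lrel M ((a + b) + (c + e))
      (LStar (a + b) (LStar a s b t) (c + e) (LStar c u e v))
      (LStar (a + c) (LStar a s c u) (b + e) (LStar b t e v))"
| cartan: "lrel M a s s \<Longrightarrow> lrel M b t t \<Longrightarrow>
    lrel M (a + b + i) (LSq i (LStar a s b t))
      (lsum (map (\<lambda>k. LStar (a + k) (LSq k s) (b + (i - k)) (LSq (i - k) t)) [0..<Suc i]))"
| square: "lrel M d t t \<Longrightarrow> lrel M (d + d) (LSq d t) (LStar d t d t)"

definition free_ula :: "('a, 'm) umod_scheme \<Rightarrow> 'a lterm set ulalg" where
  "free_ula M = \<lparr>comp = (\<lambda>d. quot (lrel M d) LZero LAdd),
     sq = (\<lambda>i d X. \<Union>t\<in>X. Collect (lrel M (d + i) (LSq i t))),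
     star = (\<lambda>a b X Y. \<Union>s\<in>X. \<Union>t\<in>Y. Collect (lrel M (a + b) (LStar a s b t)))\<rparr>"

definition free_ula_unit :: "('a, 'm) umod_scheme \<Rightarrow> nat \<Rightarrow> 'a \<Rightarrow> 'a lterm set" where
  "free_ula_unit M d = (\<lambda>x\<in>el M d. Collect (lrel M d (LGen x)))"


section \<open>Tensor products\<close>

text \<open>\<open>TPure a x b y\<close> is the pure tensor of \<open>x\<close> in degree \<open>a\<close> and \<open>y\<close> in degree \<open>b\<close>.\<close>

datatype ('a, 'b) tterm = TPure nat 'a nat 'b | TZero | TAdd "('a, 'b) tterm" "('a, 'b) tterm"

definition tsum :: "('a, 'b) tterm list \<Rightarrow> ('a, 'b) tterm" where
  "tsum ts = foldr TAdd ts TZero"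

inductive trel :: "('a, 'm) umod_scheme \<Rightarrow> ('b, 'n) umod_scheme \<Rightarrow> nat \<Rightarrow>
    ('a, 'b) tterm \<Rightarrow> ('a, 'b) tterm \<Rightarrow> bool" for M N where
  pure: "x \<in> el M a \<Longrightarrow> y \<in> el N b \<Longrightarrow> trel M N (a + b) (TPure a x b y) (TPure a x b y)"
| zero: "trel M N d TZero TZero"
| add: "trel M N d s s' \<Longrightarrow> trel M N d t t' \<Longrightarrow> trel M N d (TAdd s t) (TAdd s' t')"
| sym: "trel M N d s t \<Longrightarrow> trel M N d t s"
| trans: "trel M N d s t \<Longrightarrow> trel M N d t u \<Longrightarrow> trel M N d s u"
| add_assoc: "trel M N d s s \<Longrightarrow> trel M N d t t \<Longrightarrow> trel M N d u u \<Longrightarrow>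
    trel M N d (TAdd (TAdd s t) u) (TAdd s (TAdd t u))"
| add_comm: "trel M N d s s \<Longrightarrow> trel M N d t t \<Longrightarrow> trel M N d (TAdd s t) (TAdd t s)"
| add_zero: "trel M N d t t \<Longrightarrow> trel M N d (TAdd TZero t) t"
| add_self: "trel M N d t t \<Longrightarrow> trel M N d (TAdd t t) TZero"
| pure_add1: "x \<in> el M a \<Longrightarrow> x' \<in> el M a \<Longrightarrow> y \<in> el N b \<Longrightarrow>
    trel M N (a + b) (TPure a (x \<oplus>\<^bsub>comp M a\<^esub> x') b y) (TAdd (TPure a x b y) (TPure a x' b y))"
| pure_add2: "x \<in> el M a \<Longrightarrow> y \<in> el N b \<Longrightarrow> y' \<in> el N b \<Longrightarrow>
    trel M N (a + b) (TPure a x b (y \<oplus>\<^bsub>comp N b\<^esub> y')) (TAdd (TPure a x b y) (TPure a x b y'))"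

fun tsq :: "('a, 'm) umod_scheme \<Rightarrow> ('b, 'n) umod_scheme \<Rightarrow> nat \<Rightarrow> ('a, 'b) tterm \<Rightarrow> ('a, 'b) tterm" where
  "tsq M N i (TPure a x b y) =
     tsum (map (\<lambda>k. TPure (a + k) (sq M k a x) (b + (i - k)) (sq N (i - k) b y)) [0..<Suc i])"
| "tsq M N i TZero = TZero"
| "tsq M N i (TAdd s t) = TAdd (tsq M N i s) (tsq M N i t)"

definition tensor :: "('a, 'm) umod_scheme \<Rightarrow> ('b, 'n) umod_scheme \<Rightarrow> ('a, 'b) tterm set umod" where
  "tensor M N = \<lparr>comp = (\<lambda>d. quot (trel M N d) TZero TAdd),
     sq = (\<lambda>i d X. \<Union>t\<in>X. Collect (trel M N (d + i) (tsq M N i t)))\<rparr>"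

definition pure_tensor ::
    "('a, 'm) umod_scheme \<Rightarrow> ('b, 'n) umod_scheme \<Rightarrow> nat \<Rightarrow> nat \<Rightarrow> 'a \<Rightarrow> 'b \<Rightarrow> ('a, 'b) tterm set" where
  "pure_tensor M N a b x y = Collect (trel M N (a + b) (TPure a x b y))"


section \<open>Brown--Gitler modules\<close>

text \<open>
  $J(n)^m = (F(m)^n)^\sharp$. By Yoneda, $Sq^i : J(n)^m \to J(n)^{m+i}$ is dual to the component in
  degree \<open>n\<close> of the morphism $F(m+i) \to F(m)$ with $\iota_{m+i} \mapsto Sq^i \iota_m$. The universal
  functional on $J(n)^n$ is evaluation at $\iota_n$; see \<open>J_represents\<close> below.
\<close>

definition J :: "nat \<Rightarrow> (fterm set \<Rightarrow> bit) umod" where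
  "J n = \<lparr>comp = (\<lambda>m. dual (comp (F m) n)),
     sq = (\<lambda>i m f \<theta>. if \<theta> \<in> el (F (m + i)) n
        then f (classify (F m) (m + i) (sq (F m) i m (iota m)) n \<theta>) else 0)\<rparr>"

text \<open>The morphism $M \to J(n)$ corresponding to a functional on $M^n$.\<close>

definition represent ::
    "nat \<Rightarrow> ('a, 'm) umod_scheme \<Rightarrow> ('a \<Rightarrow> bit) \<Rightarrow> nat \<Rightarrow> 'a \<Rightarrow> fterm set \<Rightarrow> bit" where
  "represent n M \<omega> = (THE \<phi>. \<phi> \<in> umod_hom M (J n) \<and> (\<forall>x\<in>el M n. \<phi> n x (iota n) = \<omega> x))"

text \<open>The morphism $\cdot Sq^n : J(2n) \to J(n)$. An element of $F(n)^{2n}$ is identified with the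
  functional on $J(2n)^n = (F(n)^{2n})^\sharp$ given by evaluation.\<close>

definition dot_Sq :: "nat \<Rightarrow> nat \<Rightarrow> (fterm set \<Rightarrow> bit) \<Rightarrow> fterm set \<Rightarrow> bit" where
  "dot_Sq n = represent n (J (2 * n)) (\<lambda>f. f (Sq0 (F n) n (iota n)))"

definition ext_prod :: "nat \<Rightarrow> nat \<Rightarrow> nat \<Rightarrow>
    (fterm set \<Rightarrow> bit, fterm set \<Rightarrow> bit) tterm set \<Rightarrow> fterm set \<Rightarrow> bit" where
  "ext_prod n m = (THE \<phi>. \<phi> \<in> umod_hom (tensor (J n) (J m)) (J (n + m)) \<and>
     (\<exists>d. \<exists>x\<in>el (tensor (J n) (J m)) d. \<phi> d x \<noteq> \<zero>\<^bsub>comp (J (n + m)) d\<^esub>))"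

definition int_prod :: "nat \<Rightarrow> nat \<Rightarrow> nat \<Rightarrow>
    (fterm set \<Rightarrow> bit) \<Rightarrow> (fterm set \<Rightarrow> bit) \<Rightarrow> fterm set \<Rightarrow> bit" where
  "int_prod n a b x y =
     dot_Sq n (a + b) (ext_prod n n (a + b) (pure_tensor (J n) (J n) a b x y))"


section \<open>Carlsson modules\<close>

text \<open>Limits of unstable modules are computed degreewise; an element of the limit is a compatible
  sequence whose \<open>q\<close>-th entry is in $J(2^q n)$.\<close>

definition K :: "nat \<Rightarrow> (nat \<Rightarrow> fterm set \<Rightarrow> bit) ulalg" where
  "K n = \<lparr>comp = (\<lambda>d. \<lparr>
       carrier = {x. \<forall>q. x q \<in> el (J (2 ^ q * n)) d \<and> dot_Sq (2 ^ q * n) d (x (Suc q)) = x q},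
       mult = undefined, one = undefined,
       zero = (\<lambda>q. \<zero>\<^bsub>comp (J (2 ^ q * n)) d\<^esub>),
       add = (\<lambda>x y q. x q \<oplus>\<^bsub>comp (J (2 ^ q * n)) d\<^esub> y q),
       smult = (\<lambda>c x q. c \<odot>\<^bsub>comp (J (2 ^ q * n)) d\<^esub> x q)\<rparr>),
     sq = (\<lambda>i d x q. sq (J (2 ^ q * n)) i d (x q)),
     star = (\<lambda>a b x y q. int_prod (2 ^ q * n) a b (x q) (y q))\<rparr>"


section \<open>Linear algebra over the field with two elements\<close>

lemma F2_simps [simp]: "carrier F2 = UNIV" "zero F2 = 0" "one F2 = 1" "add F2 x y = x + y"
  "mult F2 x y = x * y" "smult F2 x y = x * y"
  by (simp_all add: F2_def)

lemma F2_cring: "cring F2"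
proof (rule cringI)
  show "abelian_group F2"
  proof (rule abelian_groupI)
    fix x assume "x \<in> carrier F2"
    show "\<exists>y\<in>carrier F2. y \<oplus>\<^bsub>F2\<^esub> x = \<zero>\<^bsub>F2\<^esub>"
      by (rule bexI[of _ x]) (simp_all)
  qed (unfold F2_simps, (rule UNIV_I add.assoc add.commute add_0_left)+)
  show "Group.comm_monoid F2"
    by (rule comm_monoidI) (simp_all add: ac_simps)
qed (simp_all only: F2_simps distrib_right)

lemma F2_moduleI:
  assumes "\<And>x y. x \<in> carrier V \<Longrightarrow> y \<in> carrier V \<Longrightarrow> x \<oplus>\<^bsub>V\<^esub> y \<in> carrier V"
    and "\<zero>\<^bsub>V\<^esub> \<in> carrier V"
    and "\<And>x y z. x \<in> carrier V \<Longrightarrow> y \<in> carrier V \<Longrightarrow> z \<in> carrier V \<Longrightarrow>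
      (x \<oplus>\<^bsub>V\<^esub> y) \<oplus>\<^bsub>V\<^esub> z = x \<oplus>\<^bsub>V\<^esub> (y \<oplus>\<^bsub>V\<^esub> z)"
    and "\<And>x y. x \<in> carrier V \<Longrightarrow> y \<in> carrier V \<Longrightarrow> x \<oplus>\<^bsub>V\<^esub> y = y \<oplus>\<^bsub>V\<^esub> x"
    and "\<And>x. x \<in> carrier V \<Longrightarrow> \<zero>\<^bsub>V\<^esub> \<oplus>\<^bsub>V\<^esub> x = x"
    and "\<And>x. x \<in> carrier V \<Longrightarrow> x \<oplus>\<^bsub>V\<^esub> x = \<zero>\<^bsub>V\<^esub>"
    and "\<And>x. x \<in> carrier V \<Longrightarrow> 0 \<odot>\<^bsub>V\<^esub> x = \<zero>\<^bsub>V\<^esub>"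
    and "\<And>x. x \<in> carrier V \<Longrightarrow> 1 \<odot>\<^bsub>V\<^esub> x = x"
  shows "module F2 V"
proof (rule moduleI[OF F2_cring])
  show "abelian_group V" 
  proof (rule abelian_groupI)
    fix x assume "x \<in> carrier V"
    then show "\<exists>y\<in>carrier V. y \<oplus>\<^bsub>V\<^esub> x = \<zero>\<^bsub>V\<^esub>" using assms(6) by blast
  qed (rule assms; assumption)+
  fix a b x y assume x: "x \<in> carrier V" and y: "y \<in> carrier V"
  have c: "c = 0 \<or> c = 1" for c :: bit by (cases c) simp_all
  note zx = assms(5,6,7,8)[OF x] and zy = assms(5,6,7,8)[OF y]
  have xz: "x \<oplus>\<^bsub>V\<^esub> \<zero>\<^bsub>V\<^esub> = x" using assms(4)[OF x assms(2)] zx by simp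
  have z0: "\<zero>\<^bsub>V\<^esub> \<oplus>\<^bsub>V\<^esub> \<zero>\<^bsub>V\<^esub> = \<zero>\<^bsub>V\<^esub>" by (rule assms(5)[OF assms(2)])
  note z = assms(7,8)[OF assms(2)]
  show "a \<odot>\<^bsub>V\<^esub> x \<in> carrier V" using c[of a] zx x assms(2) by auto
  show "a \<odot>\<^bsub>V\<^esub> (x \<oplus>\<^bsub>V\<^esub> y) = a \<odot>\<^bsub>V\<^esub> x \<oplus>\<^bsub>V\<^esub> a \<odot>\<^bsub>V\<^esub> y"
    using c[of a] zx zy z0 assms(7,8)[OF assms(1)[OF x y]] by auto
  show "(a \<oplus>\<^bsub>F2\<^esub> b) \<odot>\<^bsub>V\<^esub> x = a \<odot>\<^bsub>V\<^esub> x \<oplus>\<^bsub>V\<^esub> b \<odot>\<^bsub>V\<^esub> x"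
    using c[of a] c[of b] zx xz z0 by auto
  show "(a \<otimes>\<^bsub>F2\<^esub> b) \<odot>\<^bsub>V\<^esub> x = a \<odot>\<^bsub>V\<^esub> (b \<odot>\<^bsub>V\<^esub> x)"
    using c[of a] c[of b] zx z by auto
  show "\<one>\<^bsub>F2\<^esub> \<odot>\<^bsub>V\<^esub> x = x" using zx by simp
qed

lemma F2_add_self:
  assumes "module F2 V" "x \<in> carrier V"
  shows "x \<oplus>\<^bsub>V\<^esub> x = \<zero>\<^bsub>V\<^esub>"
proof -
  interpret V: Module.module F2 V by fact
  have "x \<oplus>\<^bsub>V\<^esub> x = 1 \<odot>\<^bsub>V\<^esub> x \<oplus>\<^bsub>V\<^esub> 1 \<odot>\<^bsub>V\<^esub> x"
    using V.smult_one[OF assms(2)] by simp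
  also have "\<dots> = (1 + 1) \<odot>\<^bsub>V\<^esub> x" using V.smult_l_distr[of 1 1 x] assms(2) by simp
  also have "\<dots> = \<zero>\<^bsub>V\<^esub>" using V.smult_l_null[OF assms(2)] by simp
  finally show ?thesis .
qed

lemma linI:
  assumes "module F2 V" "module F2 W" "\<And>x. x \<in> carrier V \<Longrightarrow> f x \<in> carrier W"
    and "\<And>x y. x \<in> carrier V \<Longrightarrow> y \<in> carrier V \<Longrightarrow> f (x \<oplus>\<^bsub>V\<^esub> y) = f x \<oplus>\<^bsub>W\<^esub> f y"
  shows "f \<in> lin V W"
proof -
  interpret V: Module.module F2 V by fact
  interpret W: Module.module F2 W by fact
  have z: "f \<zero>\<^bsub>V\<^esub> = \<zero>\<^bsub>W\<^esub>"
    using assms(4)[of "\<zero>\<^bsub>V\<^esub>" "\<zero>\<^bsub>V\<^esub>"] F2_add_self[OF assms(2) assms(3)[of "\<zero>\<^bsub>V\<^esub>"]] by simp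
  have "f (c \<odot>\<^bsub>V\<^esub> x) = c \<odot>\<^bsub>W\<^esub> f x" if "x \<in> carrier V" for c x
  proof -
    consider "c = 0" | "c = 1" by (cases c) auto
    then show ?thesis
    proof cases
    case 1 then show ?thesis using V.smult_l_null[OF that] W.smult_l_null[OF assms(3)[OF that]] z by simp
  next
    case 2 then show ?thesis using V.smult_one[OF that] W.smult_one[OF assms(3)[OF that]] by simp
  qed
  qed
  then show ?thesis using assms(3,4) by (auto simp: lin_def)
qed

lemma linD:
  assumes "f \<in> lin V W"
  shows lin_closed: "x \<in> carrier V \<Longrightarrow> f x \<in> carrier W"
    and lin_add: "x \<in> carrier V \<Longrightarrow> y \<in> carrier V \<Longrightarrow> f (x \<oplus>\<^bsub>V\<^esub> y) = f x \<oplus>\<^bsub>W\<^esub> f y"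
  using assms by (auto simp: lin_def)

lemma lin_zero:
  assumes "module F2 V" "module F2 W" "f \<in> lin V W"
  shows "f \<zero>\<^bsub>V\<^esub> = \<zero>\<^bsub>W\<^esub>"
proof -
  interpret V: Module.module F2 V by fact
  show ?thesis
    using lin_add[OF assms(3), of "\<zero>\<^bsub>V\<^esub>" "\<zero>\<^bsub>V\<^esub>"]
      F2_add_self[OF assms(2) lin_closed[OF assms(3), of "\<zero>\<^bsub>V\<^esub>"]] by simp
qed

lemma lin_finsum:
  assumes "module F2 V" "module F2 W" "f \<in> lin V W" "finite A" "g \<in> A \<rightarrow> carrier V"
  shows "f (\<Oplus>\<^bsub>V\<^esub>k\<in>A. g k) = (\<Oplus>\<^bsub>W\<^esub>k\<in>A. f (g k))"
  using assms(4,5)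
proof (induction A)
  case empty
  interpret V: Module.module F2 V by fact
  interpret W: Module.module F2 W by fact
  show ?case using lin_zero[OF assms(1-3)] by simp
next
  case (insert a A)
  interpret V: Module.module F2 V by fact
  interpret W: Module.module F2 W by fact
  have "(\<lambda>k. f (g k)) \<in> A \<rightarrow> carrier W" "f (g a) \<in> carrier W"
    using insert lin_closed[OF assms(3)] by auto
  then show ?case using insert by (simp add: V.finsum_insert W.finsum_insert lin_add[OF assms(3)] Pi_iff)
qed

lemma lin_comp: "f \<in> lin U V \<Longrightarrow> g \<in> lin V W \<Longrightarrow> (\<lambda>x. g (f x)) \<in> lin U W"
  by (auto simp: lin_def Pi_iff)

lemma finsum_foldr:
  assumes "abelian_monoid G" "distinct ks" "\<And>k. k \<in> set ks \<Longrightarrow> f k \<in> carrier G"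
  shows "foldr (\<lambda>k a. f k \<oplus>\<^bsub>G\<^esub> a) ks \<zero>\<^bsub>G\<^esub> = (\<Oplus>\<^bsub>G\<^esub>k\<in>set ks. f k)"
  using assms(2,3)
proof (induction ks)
  interpret abelian_monoid G by fact
  case Nil show ?case by simp
next
  interpret abelian_monoid G by fact
  case (Cons k ks)
  then have "f \<in> set ks \<rightarrow> carrier G" by auto
  with Cons show ?case by simp
qed

lemma dual_module:
  assumes "module F2 V" shows "module F2 (dual V)"
proof -
  interpret V: Module.module F2 V by fact
  have F: "f \<in> carrier (dual V) \<longleftrightarrow>
    (\<forall>x\<in>carrier V. \<forall>y\<in>carrier V. f (x \<oplus>\<^bsub>V\<^esub> y) = f x + f y) \<and>
    (\<forall>c. \<forall>x\<in>carrier V. f (c \<odot>\<^bsub>V\<^esub> x) = c * f x) \<and> (\<forall>x. x \<notin> carrier V \<longrightarrow> f x = 0)" for f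
    by (auto simp: dual_def lin_def)
  have D: "zero (dual V) = (\<lambda>x. 0)" "add (dual V) f g = (\<lambda>x. f x + g x)"
    "smult (dual V) c f = (\<lambda>x. c * f x)" for f g c
    by (simp_all add: dual_def)
  have S: "b + b = 0" for b :: bit by (cases b) simp_all
  show ?thesis
  proof (rule F2_moduleI)
    fix f g assume f: "f \<in> carrier (dual V)" and g: "g \<in> carrier (dual V)"
    have a: "f (x \<oplus>\<^bsub>V\<^esub> y) + g (x \<oplus>\<^bsub>V\<^esub> y) = f x + g x + (f y + g y)"
      if "x \<in> carrier V" "y \<in> carrier V" for x y
    proof -
      have "f (x \<oplus>\<^bsub>V\<^esub> y) = f x + f y" "g (x \<oplus>\<^bsub>V\<^esub> y) = g x + g y"
        using f g that by (simp_all only: F)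
      then show ?thesis by (simp only: ac_simps)
    qed
    have b: "f (c \<odot>\<^bsub>V\<^esub> x) + g (c \<odot>\<^bsub>V\<^esub> x) = c * (f x + g x)" if "x \<in> carrier V" for c x
    proof -
      have "f (c \<odot>\<^bsub>V\<^esub> x) = c * f x" "g (c \<odot>\<^bsub>V\<^esub> x) = c * g x"
        using f g that by (simp_all only: F)
      then show ?thesis by (simp only: distrib_left)
    qed
    have c: "f x + g x = 0" if "x \<notin> carrier V" for x using f g that by (simp only: F) simp
    show "f \<oplus>\<^bsub>dual V\<^esub> g \<in> carrier (dual V)" unfolding F D by (intro conjI ballI allI impI) (erule (1) a, erule b, erule c)
  next
    show "\<zero>\<^bsub>dual V\<^esub> \<in> carrier (dual V)" unfolding F D by simp
  qed (simp_all only: D add.assoc add.commute add.left_commute S mult_zero_left mult_1_left add_0_left add_0_right)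
qed

lemma F2_module: "module F2 F2"
proof (rule F2_moduleI)
  fix x :: bit show "x \<oplus>\<^bsub>F2\<^esub> x = \<zero>\<^bsub>F2\<^esub>" by (cases x) simp_all
qed (simp_all only: F2_simps UNIV_I add.assoc add.commute add.left_commute mult_zero_left mult_1_left add_0_left add_0_right)

lemma dual_iff:
  assumes "module F2 V"
  shows "f \<in> carrier (dual V) \<longleftrightarrow>
    (\<forall>x\<in>carrier V. \<forall>y\<in>carrier V. f (x \<oplus>\<^bsub>V\<^esub> y) = f x + f y) \<and> (\<forall>x. x \<notin> carrier V \<longrightarrow> f x = 0)"
proof
  assume "f \<in> carrier (dual V)"
  then show "(\<forall>x\<in>carrier V. \<forall>y\<in>carrier V. f (x \<oplus>\<^bsub>V\<^esub> y) = f x + f y) \<and> (\<forall>x. x \<notin> carrier V \<longrightarrow> f x = 0)"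
    by (simp only: dual_def lin_def F2_simps mem_Collect_eq partial_object.simps) blast
next
  assume *: "(\<forall>x\<in>carrier V. \<forall>y\<in>carrier V. f (x \<oplus>\<^bsub>V\<^esub> y) = f x + f y) \<and> (\<forall>x. x \<notin> carrier V \<longrightarrow> f x = 0)"
  have "f \<in> lin V F2"
  proof (rule linI[OF assms F2_module])
    show "f x \<in> carrier F2" for x by simp
    show "f (x \<oplus>\<^bsub>V\<^esub> y) = f x \<oplus>\<^bsub>F2\<^esub> f y" if "x \<in> carrier V" "y \<in> carrier V" for x y
      unfolding F2_simps using * that by blast
  qed
  then show "f \<in> carrier (dual V)" using * unfolding dual_def by simp
qed

lemma umod_homD:
  assumes "\<phi> \<in> umod_hom M N"
  shows umod_hom_lin: "\<phi> d \<in> lin (comp M d) (comp N d)"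
    and umod_hom_ext: "x \<notin> el M d \<Longrightarrow> \<phi> d x = undefined"
    and umod_hom_sq: "x \<in> el M d \<Longrightarrow> \<phi> (d + i) (sq M i d x) = sq N i d (\<phi> d x)"
    and umod_hom_closed: "x \<in> el M d \<Longrightarrow> \<phi> d x \<in> el N d"
    and umod_hom_add: "x \<in> el M d \<Longrightarrow> y \<in> el M d \<Longrightarrow>
      \<phi> d (x \<oplus>\<^bsub>comp M d\<^esub> y) = \<phi> d x \<oplus>\<^bsub>comp N d\<^esub> \<phi> d y"
  using assms by (auto simp: umod_hom_def extensional_def lin_def)

lemma umod_homI:
  assumes "\<And>d. module F2 (comp M d)" "\<And>d. module F2 (comp N d)"
    "\<And>d x. x \<in> el M d \<Longrightarrow> \<phi> d x \<in> el N d"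
    "\<And>d x y. x \<in> el M d \<Longrightarrow> y \<in> el M d \<Longrightarrow> \<phi> d (x \<oplus>\<^bsub>comp M d\<^esub> y) = \<phi> d x \<oplus>\<^bsub>comp N d\<^esub> \<phi> d y"
    "\<And>d x i. x \<in> el M d \<Longrightarrow> \<phi> (d + i) (sq M i d x) = sq N i d (\<phi> d x)"
    "\<And>d x. x \<notin> el M d \<Longrightarrow> \<phi> d x = undefined"
  shows "\<phi> \<in> umod_hom M N"
  using assms by (auto simp: umod_hom_def extensional_def intro!: linI)

locale f2_quot =
  fixes R :: "'t \<Rightarrow> 't \<Rightarrow> bool" and z :: 't and p :: "'t \<Rightarrow> 't \<Rightarrow> 't"
  assumes R_sym: "R s t \<Longrightarrow> R t s"
    and R_trans: "R s t \<Longrightarrow> R t u \<Longrightarrow> R s u"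
    and R_zero: "R z z"
    and R_add: "R s s' \<Longrightarrow> R t t' \<Longrightarrow> R (p s t) (p s' t')"
    and R_assoc: "R s s \<Longrightarrow> R t t \<Longrightarrow> R u u \<Longrightarrow> R (p (p s t) u) (p s (p t u))"
    and R_comm: "R s s \<Longrightarrow> R t t \<Longrightarrow> R (p s t) (p t s)"
    and R_add_zero: "R t t \<Longrightarrow> R (p z t) t"
    and R_add_self: "R t t \<Longrightarrow> R (p t t) z"
begin

lemma refl1: "R s t \<Longrightarrow> R s s" and refl2: "R s t \<Longrightarrow> R t t"
  using R_sym R_trans by blast+

lemma cls_eq: "R s t \<Longrightarrow> Collect (R s) = Collect (R t)"
  using R_sym R_trans by blast

lemma cls_eqD: "Collect (R s) = Collect (R t) \<Longrightarrow> R t t \<Longrightarrow> R s t"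
  by blast

lemma carrier_quot: "carrier (quot R z p) = {Collect (R t) | t. R t t}"
  by (simp add: quot_def)

lemma cls_in: "R t t \<Longrightarrow> Collect (R t) \<in> carrier (quot R z p)"
  by (auto simp: quot_def)

lemma zero_quot: "\<zero>\<^bsub>quot R z p\<^esub> = Collect (R z)"
  by (simp add: quot_def)

lemma lift1: "R t t \<Longrightarrow> (\<And>u. R t u \<Longrightarrow> f u = f t) \<Longrightarrow> (\<Union>u\<in>Collect (R t). f u) = f t"
  by blast

lemma lift2: "R s s \<Longrightarrow> R t t \<Longrightarrow> (\<And>u v. R s u \<Longrightarrow> R t v \<Longrightarrow> f u v = f s t) \<Longrightarrow>
    (\<Union>u\<in>Collect (R s). \<Union>v\<in>Collect (R t). f u v) = f s t"
  by blast

lemma add_quot: "R s s \<Longrightarrow> R t t \<Longrightarrow>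
    Collect (R s) \<oplus>\<^bsub>quot R z p\<^esub> Collect (R t) = Collect (R (p s t))"
  unfolding quot_def by simp (rule lift2, assumption, assumption, metis cls_eq R_add R_sym)

lemma module_quot: "module F2 (quot R z p)"
proof (rule F2_moduleI)
  show "\<zero>\<^bsub>quot R z p\<^esub> \<in> carrier (quot R z p)" by (simp add: zero_quot cls_in R_zero)
  fix X assume "X \<in> carrier (quot R z p)"
  then obtain s where s: "R s s" "X = Collect (R s)" by (auto simp: carrier_quot)
  show "\<zero>\<^bsub>quot R z p\<^esub> \<oplus>\<^bsub>quot R z p\<^esub> X = X"
    using s by (simp add: zero_quot add_quot R_zero cls_eq[OF R_add_zero])
  show "X \<oplus>\<^bsub>quot R z p\<^esub> X = \<zero>\<^bsub>quot R z p\<^esub>"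
    using s by (simp add: zero_quot add_quot cls_eq[OF R_add_self])
  show "0 \<odot>\<^bsub>quot R z p\<^esub> X = \<zero>\<^bsub>quot R z p\<^esub>" "1 \<odot>\<^bsub>quot R z p\<^esub> X = X"
    by (simp_all add: quot_def)
  fix Y assume "Y \<in> carrier (quot R z p)"
  then obtain t where t: "R t t" "Y = Collect (R t)" by (auto simp: carrier_quot)
  show "X \<oplus>\<^bsub>quot R z p\<^esub> Y \<in> carrier (quot R z p)"
    using s t by (simp add: add_quot cls_in R_add)
  show "X \<oplus>\<^bsub>quot R z p\<^esub> Y = Y \<oplus>\<^bsub>quot R z p\<^esub> X"
    using s t by (simp add: add_quot cls_eq[OF R_comm])
  fix Z assume "Z \<in> carrier (quot R z p)"
  then obtain u where u: "R u u" "Z = Collect (R u)" by (auto simp: carrier_quot)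
  show "(X \<oplus>\<^bsub>quot R z p\<^esub> Y) \<oplus>\<^bsub>quot R z p\<^esub> Z = X \<oplus>\<^bsub>quot R z p\<^esub> (Y \<oplus>\<^bsub>quot R z p\<^esub> Z)"
    using s t u by (simp add: add_quot R_add cls_eq[OF R_assoc])
qed

lemma sum_quot:
  assumes "distinct ks" "\<And>k. k \<in> set ks \<Longrightarrow> R (f k) (f k)"
  shows "R (foldr p (map f ks) z) (foldr p (map f ks) z) \<and>
    Collect (R (foldr p (map f ks) z)) = (\<Oplus>\<^bsub>quot R z p\<^esub>k\<in>set ks. Collect (R (f k)))"
  using assms
proof (induction ks)
  interpret Module.module F2 "quot R z p" by (rule module_quot)
  case Nil then show ?case by (simp add: zero_quot R_zero)
next
  interpret Module.module F2 "quot R z p" by (rule module_quot)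
  case (Cons k ks)
  then have "(\<lambda>k. Collect (R (f k))) \<in> set ks \<rightarrow> carrier (quot R z p)" by (auto intro: cls_in)
  with Cons show ?case by (simp add: cls_in add_quot R_add flip: add_quot)
qed

end


section \<open>The universal property of \<open>F n\<close>\<close>

interpretation frel: f2_quot "frel n d" FZero FAdd
  by unfold_locales (fact frel.sym frel.trans frel.zero frel.add frel.add_assoc frel.add_comm frel.add_zero frel.add_self)+

lemma comp_F: "comp (F n) d = quot (frel n d) FZero FAdd"
  by (simp add: F_def)

lemma sq_F: "frel n d t t \<Longrightarrow> sq (F n) i d (Collect (frel n d t)) = Collect (frel n (d + i) (FSq i t))"
proof -
  assume t: "frel n d t t"
  have "(\<Union>u\<in>Collect (frel n d t). Collect (frel n (d + i) (FSq i u))) = Collect (frel n (d + i) (FSq i t))"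
    by (rule frel.lift1[OF t, where f = "\<lambda>u. Collect (frel n (d + i) (FSq i u))"])
      (rule frel.cls_eq, rule frel.sq, erule frel.sym)
  then show ?thesis by (simp only: F_def umod.simps)
qed

lemma iota_in: "iota n \<in> el (F n) n"
  by (simp add: comp_F iota_def frel.cls_in frel.gen)

lemma F_unstable: "unstable_module (F n)"
proof (rule unstable_module.intro)
  show m: "module F2 (comp (F n) d)" for d by (simp add: comp_F frel.module_quot)
  show "sq (F n) i d \<in> lin (comp (F n) d) (comp (F n) (d + i))" for i d
  proof (rule linI[OF m m])
    fix X assume "X \<in> el (F n) d"
    then obtain s where s: "frel n d s s" "X = Collect (frel n d s)"
      by (auto simp: comp_F frel.carrier_quot)
    then show "sq (F n) i d X \<in> el (F n) (d + i)"
      by (simp add: sq_F) (simp add: comp_F frel.cls_in frel.sq)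
    fix Y assume "Y \<in> el (F n) d"
    then obtain t where t: "frel n d t t" "Y = Collect (frel n d t)"
      by (auto simp: comp_F frel.carrier_quot)
    show "sq (F n) i d (X \<oplus>\<^bsub>comp (F n) d\<^esub> Y) = sq (F n) i d X \<oplus>\<^bsub>comp (F n) (d + i)\<^esub> sq (F n) i d Y"
      using s t by (simp add: comp_F frel.add_quot sq_F frel.add frel.sq frel.cls_eq[OF frel.sq_add])
  qed
next
  fix X d i j assume "X \<in> el (F n) d"
  then obtain t where t: "frel n d t t" "X = Collect (frel n d t)"
    by (auto simp: comp_F frel.carrier_quot)
  show "sq (F n) 0 d X = X" using t frel.cls_eq[OF frel.sq_zero[OF t(1)]] by (simp add: sq_F)
  show "sq (F n) i d X = \<zero>\<^bsub>comp (F n) (d + i)\<^esub>" if "d < i"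
    using t that by (simp add: sq_F comp_F frel.zero_quot frel.cls_eq[OF frel.unstable])
  assume ij: "0 < i" "i < 2 * j"
  let ?ks = "filter (\<lambda>k. odd ((j - k - 1) choose (i - 2 * k))) [0..<Suc (i div 2)]"
  let ?f = "\<lambda>k. FSq (i + j - k) (FSq k t)"
  have ks: "set ?ks = {k. k \<le> i div 2 \<and> odd ((j - k - 1) choose (i - 2 * k))}"
    by (auto simp del: upt_Suc)
  have deg: "d + k + (i + j - k) = d + j + i" if "k \<in> set ?ks" for k using that[unfolded ks] ij by auto
  have f: "frel n (d + j + i) (?f k) (?f k)" if "k \<in> set ?ks" for k
    using frel.sq[OF frel.sq[OF t(1), of k], of "i + j - k"] deg[OF that] by simp
  have "sq (F n) i (d + j) (sq (F n) j d X) = Collect (frel n (d + j + i) (FSq i (FSq j t)))"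
    using t by (simp add: sq_F frel.sq)
  also have "\<dots> = Collect (frel n (d + j + i) (fsum (map ?f ?ks)))"
    by (rule frel.cls_eq[OF frel.adem[OF ij t(1)]])
  also have "\<dots> = (\<Oplus>\<^bsub>comp (F n) (d + j + i)\<^esub>k\<in>set ?ks. Collect (frel n (d + j + i) (?f k)))"
    unfolding fsum_def comp_F by (rule frel.sum_quot[THEN conjunct2]) (use f in auto)
  also have "\<dots> = (\<Oplus>\<^bsub>comp (F n) (d + j + i)\<^esub>k\<in>set ?ks. sq (F n) (i + j - k) (d + k) (sq (F n) k d X))"
  proof -
    interpret Module.module F2 "comp (F n) (d + j + i)" by (simp add: comp_F frel.module_quot)
    have e: "sq (F n) (i + j - k) (d + k) (sq (F n) k d X) = Collect (frel n (d + j + i) (?f k))"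
      if "k \<in> set ?ks" for k
      using sq_F[OF frel.sq[OF t(1), of k], of "i + j - k"] sq_F[OF t(1), of k] t(2)
      unfolding deg[OF that] by simp
    show ?thesis
    proof (rule finsum_cong'[OF refl])
      fix k assume k: "k \<in> set ?ks"
      show "Collect (frel n (d + j + i) (?f k)) = sq (F n) (i + j - k) (d + k) (sq (F n) k d X)"
        by (rule e[OF k, symmetric])
    next
      show "(\<lambda>k. sq (F n) (i + j - k) (d + k) (sq (F n) k d X)) \<in> set ?ks \<rightarrow> el (F n) (d + j + i)"
        by (rule Pi_I) (simp only: e, simp only: comp_F, rule frel.cls_in, rule f)
    qed
  qed
  finally show "sq (F n) i (d + j) (sq (F n) j d X) =
      (\<Oplus>\<^bsub>comp (F n) (d + j + i)\<^esub>k\<in>{k. k \<le> i div 2 \<and> odd ((j - k - 1) choose (i - 2 * k))}.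
         sq (F n) (i + j - k) (d + k) (sq (F n) k d X))"
    unfolding ks .
qed

primrec feval :: "('a, 'm) umod_scheme \<Rightarrow> 'a \<Rightarrow> nat \<Rightarrow> fterm \<Rightarrow> 'a" where
  "feval M x d FGen = x"
| "feval M x d FZero = \<zero>\<^bsub>comp M d\<^esub>"
| "feval M x d (FAdd s t) = feval M x d s \<oplus>\<^bsub>comp M d\<^esub> feval M x d t"
| "feval M x d (FSq i t) = sq M i (d - i) (feval M x (d - i) t)"

primrec fwf :: "nat \<Rightarrow> nat \<Rightarrow> fterm \<Rightarrow> bool" where
  "fwf n d FGen \<longleftrightarrow> d = n"
| "fwf n d FZero \<longleftrightarrow> True"
| "fwf n d (FAdd s t) \<longleftrightarrow> fwf n d s \<and> fwf n d t"
| "fwf n d (FSq i t) \<longleftrightarrow> i \<le> d \<and> fwf n (d - i) t"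

lemma fwf_fsum: "fwf n d (fsum ts) \<longleftrightarrow> (\<forall>t\<in>set ts. fwf n d t)"
  unfolding fsum_def by (induction ts) simp_all

lemma fwf_iff: "fwf n d t \<longleftrightarrow> frel n d t t"
proof
  show "fwf n d t \<Longrightarrow> frel n d t t"
  proof (induction t arbitrary: d)
    case (FSq i t) then show ?case using frel.sq[of n "d - i" t t i] by simp
  qed (auto intro: frel.gen frel.zero frel.add)
  have w: "frel n d s t \<Longrightarrow> fwf n d s \<and> fwf n d t" for s t
  proof (induction rule: frel.induct)
    case (adem i j d t)
    have "d + j + i - (i + j - k) - k = d" if "k \<le> i div 2" for k using that adem by auto
    then show ?case using adem by (auto simp: fwf_fsum)
  qed simp_all
  show "frel n d t t \<Longrightarrow> fwf n d t" by (drule w, erule conjunct1)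
qed

lemma foldr_map_eval:
  assumes "e z = z'" "\<And>s t. e (p s t) = p' (e s) (e t)"
  shows "e (foldr p (map f ks) z) = foldr (\<lambda>k. p' (e (f k))) ks z'"
proof (induction ks)
  case Nil show ?case by (simp add: assms(1))
next
  case (Cons k ks) then show ?case by (simp only: list.map foldr_Cons o_apply assms(2))
qed

context unstable_module begin

interpretation V: Module.module F2 "comp M d" for d by (rule vector_space)

lemmas sq_closed = lin_closed[OF sq_linear]
lemmas sq_plus = lin_add[OF sq_linear]
lemmas sq_zero' = sq_zero and adem' = adem and unstable' = unstable

lemma feval_sound:
  assumes "x \<in> el M n" "frel n d s t"
  shows "feval M x d s = feval M x d t \<and> feval M x d s \<in> el M d"
  using assms(2)
proof (induction rule: frel.induct)
  case (sq d t t' i)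
  have e: "feval M x d t' = feval M x d t" and c: "feval M x d t \<in> el M d"
    by (rule sq.IH[THEN conjunct1, symmetric], rule sq.IH[THEN conjunct2])
  show ?case unfolding feval.simps add_diff_cancel_right' e by (intro conjI refl sq_closed c)
next
  case (add_assoc d s t u) then show ?case by (simp add: V.a_assoc)
next
  case (add_comm d s t) then show ?case by (simp add: V.a_comm)
next
  case (add_self d t) then show ?case by (simp add: F2_add_self[OF vector_space])
next
  case (sq_add d s t i) then show ?case by (simp add: sq_closed sq_plus)
next
  case (sq_zero d t) then show ?case by (simp add: sq_zero')
next
  case (unstable d i t) then show ?case by (simp add: unstable')
next
  case (adem i j d t)
  let ?ks = "filter (\<lambda>k. odd ((j - k - 1) choose (i - 2 * k))) [0..<Suc (i div 2)]"
  let ?D = "d + j + i"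
  let ?f = "\<lambda>k. FSq (i + j - k) (FSq k t)"
  let ?y = "feval M x d t"
  have y: "?y \<in> el M d" using adem by simp
  have ks: "set ?ks = {k. k \<le> i div 2 \<and> odd ((j - k - 1) choose (i - 2 * k))}"
    by (auto simp del: upt_Suc)
  have e: "feval M x ?D (?f k) = sq M (i + j - k) (d + k) (sq M k d ?y)" if "k \<in> set ?ks" for k
  proof -
    have "?D - (i + j - k) = d + k" using that[unfolded ks] adem(1,2) by auto
    then show ?thesis by simp
  qed
  have c: "sq M (i + j - k) (d + k) (sq M k d ?y) \<in> el M ?D" if "k \<in> set ?ks" for k
  proof -
    have "d + k + (i + j - k) = ?D" using that[unfolded ks] adem(1,2) by auto
    then show ?thesis using sq_closed[OF sq_closed[OF y, of k], of "i + j - k"] by (simp only:)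
  qed
  have "feval M x ?D (fsum (map ?f ?ks)) =
      foldr (\<lambda>k a. feval M x ?D (?f k) \<oplus>\<^bsub>comp M ?D\<^esub> a) ?ks \<zero>\<^bsub>comp M ?D\<^esub>"
    unfolding fsum_def by (rule foldr_map_eval) simp_all
  also have "\<dots> = (\<Oplus>\<^bsub>comp M ?D\<^esub>k\<in>set ?ks. feval M x ?D (?f k))"
    by (rule finsum_foldr[OF V.abelian_monoid_axioms], simp, simp only: e c)
  also have "\<dots> = (\<Oplus>\<^bsub>comp M ?D\<^esub>k\<in>set ?ks. sq M (i + j - k) (d + k) (sq M k d ?y))"
  proof (rule V.finsum_cong'[OF refl])
    show "(\<lambda>k. sq M (i + j - k) (d + k) (sq M k d ?y)) \<in> set ?ks \<rightarrow> el M ?D"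
      by (rule Pi_I) (rule c)
  qed (rule e)
  also have "\<dots> = sq M i (d + j) (sq M j d ?y)"
    unfolding ks by (rule adem'[symmetric]) (rule adem.hyps y)+
  finally show ?case using y by (simp add: sq_closed)
next
  case gen show ?case using assms(1) by simp
next
  case (zero d) show ?case by simp
next
  case (add d s s' t t')
  show ?case unfolding feval.simps add.IH[THEN conjunct1, symmetric]
    by (intro conjI refl V.a_closed add.IH[THEN conjunct2])
next
  case (sym d s t)
  have "feval M x d t \<in> el M d" by (subst sym.IH[THEN conjunct1, symmetric]) (rule sym.IH[THEN conjunct2])
  then show ?case by (intro conjI sym.IH[THEN conjunct1, symmetric])
next
  case (trans d s t u)
  show ?case by (intro conjI trans.IH(1)[THEN conjunct2] HOL.trans[OF trans.IH(1)[THEN conjunct1] trans.IH(2)[THEN conjunct1]])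
next
  case (add_zero d t) then show ?case by simp
qed

theorem F_universal:
  assumes x: "x \<in> el M n"
  shows "\<exists>!\<phi>. \<phi> \<in> umod_hom (F n) M \<and> \<phi> n (iota n) = x"
proof (rule ex_ex1I)
  define \<phi> where "\<phi> = (\<lambda>d. \<lambda>X\<in>el (F n) d. feval M x d (SOME t. t \<in> X))"
  have \<phi>: "\<phi> d (Collect (frel n d t)) = feval M x d t" if t: "frel n d t t" for d t
  proof -
    have "frel n d t (SOME u. frel n d t u)" using t by (rule someI)
    then show ?thesis
      using feval_sound[OF x, of d t "SOME u. frel n d t u"] t by (simp add: \<phi>_def comp_F frel.cls_in)
  qed
  have "\<phi> \<in> umod_hom (F n) M"
  proof (rule umod_homI)
    show "module F2 (comp (F n) d)" for d by (simp add: comp_F frel.module_quot)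
    show "X \<notin> el (F n) d \<Longrightarrow> \<phi> d X = undefined" for X d by (simp add: \<phi>_def)
    fix d i X assume "X \<in> el (F n) d"
    then obtain s where s: "frel n d s s" "X = Collect (frel n d s)"
      by (auto simp: comp_F frel.carrier_quot)
    then show "\<phi> d X \<in> el M d" using feval_sound[OF x s(1)] by (simp add: \<phi>)
    show "\<phi> (d + i) (sq (F n) i d X) = sq M i d (\<phi> d X)"
      using s by (simp add: sq_F \<phi> frel.sq)
    fix Y assume "Y \<in> el (F n) d"
    then obtain t where t: "frel n d t t" "Y = Collect (frel n d t)"
      by (auto simp: comp_F frel.carrier_quot)
    then show "\<phi> d (X \<oplus>\<^bsub>comp (F n) d\<^esub> Y) = \<phi> d X \<oplus>\<^bsub>comp M d\<^esub> \<phi> d Y"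
      using s by (simp add: comp_F frel.add_quot \<phi> frel.add)
  qed (rule vector_space)
  moreover have "\<phi> n (iota n) = x" by (simp add: iota_def \<phi> frel.gen)
  ultimately show "\<exists>\<phi>. \<phi> \<in> umod_hom (F n) M \<and> \<phi> n (iota n) = x" by blast
next
  have *: "\<phi> d (Collect (frel n d t)) = feval M x d t"
    if \<phi>: "\<phi> \<in> umod_hom (F n) M" "\<phi> n (iota n) = x" and "fwf n d t" for \<phi> d t
    using that(3)
  proof (induction t arbitrary: d)
    case FGen then show ?case using \<phi>(2) by (simp add: iota_def)
  next
    case FZero
    have "\<phi> d \<zero>\<^bsub>comp (F n) d\<^esub> = \<zero>\<^bsub>comp M d\<^esub>"
      by (rule lin_zero[OF _ vector_space umod_hom_lin[OF \<phi>(1)]]) (simp add: comp_F frel.module_quot)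
    then show ?case by (simp add: comp_F frel.zero_quot)
  next
    case (FAdd s t)
    then have "frel n d s s" "frel n d t t" by (simp_all flip: fwf_iff)
    then show ?case using FAdd.IH[of d] umod_hom_add[OF \<phi>(1), of "Collect (frel n d s)" d "Collect (frel n d t)"]
      by (simp add: comp_F frel.add_quot frel.cls_in fwf_iff)
  next
    case (FSq i t)
    then have "frel n (d - i) t t" "i \<le> d" by (simp_all flip: fwf_iff)
    moreover from this have "Collect (frel n (d - i) t) \<in> el (F n) (d - i)"
      by (simp add: comp_F frel.cls_in)
    ultimately show ?case using FSq.IH[of "d - i"] umod_hom_sq[OF \<phi>(1), of "Collect (frel n (d - i) t)" "d - i" i]
      by (simp add: sq_F fwf_iff)
  qed
  fix \<phi> \<psi>
  assume a: "\<phi> \<in> umod_hom (F n) M \<and> \<phi> n (iota n) = x" and b: "\<psi> \<in> umod_hom (F n) M \<and> \<psi> n (iota n) = x"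
  have eq: "\<phi> d X = \<psi> d X" for d X
  proof (cases "X \<in> el (F n) d")
    case True
    then obtain s where s: "frel n d s s" "X = Collect (frel n d s)"
      by (auto simp: comp_F frel.carrier_quot)
    then show ?thesis using *[of \<phi> d s] *[of \<psi> d s] a b by (simp add: fwf_iff)
  next
    case False then show ?thesis 
      using umod_hom_ext[OF a[THEN conjunct1] False] umod_hom_ext[OF b[THEN conjunct1] False] by simp
  qed
  show "\<phi> = \<psi>" by (rule ext, rule ext, rule eq)
qed

end


section \<open>\<open>J n\<close> is unstable and represents the dual of the component of degree \<open>n\<close>\<close>

lemma umod_hom_comp:
  assumes "\<phi> \<in> umod_hom M N" "\<psi> \<in> umod_hom N P"
    "\<And>i d x. x \<in> el M d \<Longrightarrow> sq M i d x \<in> el M (d + i)"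
    "\<And>d. module F2 (comp M d)" "\<And>d. module F2 (comp P d)"
  shows "(\<lambda>d. \<lambda>x\<in>el M d. \<psi> d (\<phi> d x)) \<in> umod_hom M P"
proof (rule umod_homI)
  note [simp] = umod_hom_closed[OF assms(1)] umod_hom_closed[OF assms(2)] assms(3)
  fix d x i assume x: "x \<in> el M d"
  show "(\<lambda>x\<in>el M d. \<psi> d (\<phi> d x)) x \<in> el P d" using x by simp
  show "(\<lambda>x\<in>el M (d + i). \<psi> (d + i) (\<phi> (d + i) x)) (sq M i d x) = sq P i d ((\<lambda>x\<in>el M d. \<psi> d (\<phi> d x)) x)"
    using x by (simp add: umod_hom_sq[OF assms(1)] umod_hom_sq[OF assms(2)])
  fix y assume y: "y \<in> el M d"
  interpret Module.module F2 "comp M d" by (rule assms(4))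
  show "(\<lambda>x\<in>el M d. \<psi> d (\<phi> d x)) (x \<oplus>\<^bsub>comp M d\<^esub> y) =
      (\<lambda>x\<in>el M d. \<psi> d (\<phi> d x)) x \<oplus>\<^bsub>comp P d\<^esub> (\<lambda>x\<in>el M d. \<psi> d (\<phi> d x)) y"
    using x y by (simp add: umod_hom_add[OF assms(1)] umod_hom_add[OF assms(2)])
qed (use assms in simp_all)

context unstable_module begin

interpretation V: Module.module F2 "comp M d" for d by (rule vector_space)

lemma classify_hom: "x \<in> el M n \<Longrightarrow> classify M n x \<in> umod_hom (F n) M"
  and classify_iota: "x \<in> el M n \<Longrightarrow> classify M n x n (iota n) = x"
  using theI'[OF F_universal[of x n]] unfolding classify_def by blast+

lemma classify_unique:
  assumes "\<phi> \<in> umod_hom (F n) M" "\<phi> n (iota n) = x"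
  shows "classify M n x = \<phi>"
proof -
  have "x \<in> el M n" using umod_hom_closed[OF assms(1) iota_in] assms(2) by simp
  from the1_equality[OF F_universal[OF this], of \<phi>] show ?thesis unfolding classify_def using assms by blast
qed

lemma classify_closed: "x \<in> el M n \<Longrightarrow> \<theta> \<in> el (F n) d \<Longrightarrow> classify M n x d \<theta> \<in> el M d"
  by (rule umod_hom_closed[OF classify_hom])

lemma F_sq_closed: "x \<in> el (F n) d \<Longrightarrow> sq (F n) i d x \<in> el (F n) (d + i)"
  by (rule lin_closed[OF unstable_module.sq_linear[OF F_unstable]])

lemma classify_comp:
  assumes x: "x \<in> el M m" and \<phi>: "\<phi> \<in> umod_hom M N" and N: "unstable_module N" and \<theta>: "\<theta> \<in> el (F m) d"
  shows "classify N m (\<phi> m x) d \<theta> = \<phi> d (classify M m x d \<theta>)"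
proof -
  have "(\<lambda>d. \<lambda>\<theta>\<in>el (F m) d. \<phi> d (classify M m x d \<theta>)) \<in> umod_hom (F m) N"
    by (rule umod_hom_comp[OF classify_hom[OF x] \<phi>])
      (simp_all add: F_sq_closed unstable_module.vector_space[OF F_unstable] unstable_module.vector_space[OF N])
  from unstable_module.classify_unique[OF N this, of "\<phi> m x"]
  show ?thesis using \<theta> by (simp add: iota_in classify_iota[OF x])
qed

lemma classify_linear:
  assumes \<theta>: "\<theta> \<in> el (F n) d"
  shows "(\<lambda>x. classify M n x d \<theta>) \<in> lin (comp M n) (comp M d)"
proof (rule linI[OF vector_space vector_space])
  show "classify M n x d \<theta> \<in> el M d" if "x \<in> el M n" for x by (rule classify_closed[OF that \<theta>])
  fix x y assume x: "x \<in> el M n" and y: "y \<in> el M n"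
  let ?\<phi> = "\<lambda>d. \<lambda>\<theta>\<in>el (F n) d. classify M n x d \<theta> \<oplus>\<^bsub>comp M d\<^esub> classify M n y d \<theta>"
  have "?\<phi> \<in> umod_hom (F n) M"
  proof (rule umod_homI)
    show "module F2 (comp (F n) d)" for d by (rule unstable_module.vector_space[OF F_unstable])
    show "module F2 (comp M d)" for d by (rule vector_space)
    fix d \<theta> i assume \<theta>: "\<theta> \<in> el (F n) d"
    note c = classify_closed[OF x \<theta>] classify_closed[OF y \<theta>]
    show "?\<phi> d \<theta> \<in> el M d" using \<theta> c by simp
    show "?\<phi> (d + i) (sq (F n) i d \<theta>) = sq M i d (?\<phi> d \<theta>)"
      using \<theta> c by (simp add: F_sq_closed umod_hom_sq[OF classify_hom[OF x]] umod_hom_sq[OF classify_hom[OF y]] sq_plus)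
    fix \<xi> assume \<xi>: "\<xi> \<in> el (F n) d"
    interpret FV: Module.module F2 "comp (F n) d" by (rule unstable_module.vector_space[OF F_unstable])
    note c = c classify_closed[OF x \<xi>] classify_closed[OF y \<xi>]
    show "?\<phi> d (\<theta> \<oplus>\<^bsub>comp (F n) d\<^esub> \<xi>) = ?\<phi> d \<theta> \<oplus>\<^bsub>comp M d\<^esub> ?\<phi> d \<xi>"
      using \<theta> \<xi> c by (simp add: umod_hom_add[OF classify_hom[OF x]] umod_hom_add[OF classify_hom[OF y]]
        V.a_ac)
  qed simp
  from classify_unique[OF this, of "x \<oplus>\<^bsub>comp M n\<^esub> y"]
  show "classify M n (x \<oplus>\<^bsub>comp M n\<^esub> y) d \<theta> = classify M n x d \<theta> \<oplus>\<^bsub>comp M d\<^esub> classify M n y d \<theta>"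
    using \<theta> by (simp add: iota_in classify_iota[OF x] classify_iota[OF y])
qed

end

text \<open>The action of $\xi \in F(m)^p$ as an operation $J(n)^m \to J(n)^p$.\<close>

definition J_act :: "nat \<Rightarrow> nat \<Rightarrow> nat \<Rightarrow> fterm set \<Rightarrow> (fterm set \<Rightarrow> bit) \<Rightarrow> fterm set \<Rightarrow> bit" where
  "J_act n m p \<xi> f = (\<lambda>\<theta>. if \<theta> \<in> el (F p) n then f (classify (F m) p \<xi> n \<theta>) else 0)"

lemma F_vector_space: "module F2 (comp (F n) d)"
  by (rule unstable_module.vector_space[OF F_unstable])

lemma comp_J: "comp (J n) m = dual (comp (F m) n)"
  by (simp add: J_def)

lemma J_vector_space: "module F2 (comp (J n) d)"
  unfolding comp_J by (rule dual_module[OF F_vector_space])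

lemma el_J: "f \<in> el (J n) m \<longleftrightarrow>
    (\<forall>x\<in>el (F m) n. \<forall>y\<in>el (F m) n. f (x \<oplus>\<^bsub>comp (F m) n\<^esub> y) = f x + f y) \<and> (\<forall>x. x \<notin> el (F m) n \<longrightarrow> f x = 0)"
  unfolding comp_J by (rule dual_iff[OF F_vector_space])

lemma add_J: "f \<oplus>\<^bsub>comp (J n) m\<^esub> g = (\<lambda>\<theta>. f \<theta> + g \<theta>)"
  by (simp add: comp_J dual_def)

lemma zero_J: "\<zero>\<^bsub>comp (J n) m\<^esub> = (\<lambda>\<theta>. 0)"
  by (simp add: comp_J dual_def)

lemma sq_J: "sq (J n) i m f = J_act n m (m + i) (sq (F m) i m (iota m)) f"
  by (simp add: J_def J_act_def)

interpretation Fn: unstable_module "F n" for n by (rule F_unstable)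

lemma J_act_closed:
  assumes f: "f \<in> el (J n) m" and \<xi>: "\<xi> \<in> el (F m) p"
  shows "J_act n m p \<xi> f \<in> el (J n) p"
  unfolding el_J
proof (intro conjI ballI allI impI)
  fix x y assume x: "x \<in> el (F p) n" and y: "y \<in> el (F p) n"
  interpret V: Module.module F2 "comp (F p) n" by (rule F_vector_space)
  have "x \<oplus>\<^bsub>comp (F p) n\<^esub> y \<in> el (F p) n" using x y by simp
  then show "J_act n m p \<xi> f (x \<oplus>\<^bsub>comp (F p) n\<^esub> y) = J_act n m p \<xi> f x + J_act n m p \<xi> f y"
    using x y f[unfolded el_J] Fn.classify_closed[OF \<xi> x] Fn.classify_closed[OF \<xi> y]
    by (simp only: J_act_def if_True umod_hom_add[OF Fn.classify_hom[OF \<xi>]])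
qed (simp add: J_act_def)

lemma J_act_linear1:
  assumes \<xi>: "\<xi> \<in> el (F m) p"
  shows "J_act n m p \<xi> \<in> lin (comp (J n) m) (comp (J n) p)"
  by (rule linI[OF J_vector_space J_vector_space J_act_closed[OF _ \<xi>]])
    (auto simp only: add_J J_act_def fun_eq_iff if_True if_False add_0_left split: if_split)

lemma J_act_linear2:
  assumes f: "f \<in> el (J n) m"
  shows "(\<lambda>\<xi>. J_act n m p \<xi> f) \<in> lin (comp (F m) p) (comp (J n) p)"
proof (rule linI[OF F_vector_space J_vector_space J_act_closed[OF f]])
  fix \<xi> \<zeta> assume \<xi>: "\<xi> \<in> el (F m) p" and \<zeta>: "\<zeta> \<in> el (F m) p"
  have "J_act n m p (\<xi> \<oplus>\<^bsub>comp (F m) p\<^esub> \<zeta>) f \<theta> = J_act n m p \<xi> f \<theta> + J_act n m p \<zeta> f \<theta>" for \<theta>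
  proof (cases "\<theta> \<in> el (F p) n")
    case True
    show ?thesis unfolding J_act_def lin_add[OF Fn.classify_linear[OF True] \<xi> \<zeta>]
      using True f[unfolded el_J] Fn.classify_closed[OF \<xi> True] Fn.classify_closed[OF \<zeta> True]
      by (simp only: if_True)
  qed (simp add: J_act_def)
  then show "J_act n m p (\<xi> \<oplus>\<^bsub>comp (F m) p\<^esub> \<zeta>) f = J_act n m p \<xi> f \<oplus>\<^bsub>comp (J n) p\<^esub> J_act n m p \<zeta> f"
    unfolding add_J by (rule ext)
qed

lemma J_act_act:
  assumes \<xi>: "\<xi> \<in> el (F m) p" and \<zeta>: "\<zeta> \<in> el (F p) q"
  shows "J_act n p q \<zeta> (J_act n m p \<xi> f) = J_act n m q (classify (F m) p \<xi> q \<zeta>) f"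
proof
  fix \<theta>
  show "J_act n p q \<zeta> (J_act n m p \<xi> f) \<theta> = J_act n m q (classify (F m) p \<xi> q \<zeta>) f \<theta>"
  proof (cases "\<theta> \<in> el (F q) n")
    case True
    then show ?thesis
      using Fn.classify_closed[OF \<zeta> True]
        Fn.classify_comp[OF \<zeta> Fn.classify_hom[OF \<xi>] F_unstable True]
      by (simp add: J_act_def)
  qed (simp add: J_act_def)
qed

lemma classify_F_iota:
  assumes \<theta>: "\<theta> \<in> el (F m) d"
  shows "classify (F m) m (iota m) d \<theta> = \<theta>"
proof -
  have "(\<lambda>d. \<lambda>x\<in>el (F m) d. x) \<in> umod_hom (F m) (F m)"
  proof (rule umod_homI[OF F_vector_space F_vector_space])
    fix d x y assume "x \<in> el (F m) d" "y \<in> el (F m) d"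
    moreover have "x \<oplus>\<^bsub>comp (F m) d\<^esub> y \<in> el (F m) d"
    proof -
      interpret V: Module.module F2 "comp (F m) d" by (rule F_vector_space)
      show ?thesis using calculation by simp
    qed
    ultimately show "(\<lambda>x\<in>el (F m) d. x) (x \<oplus>\<^bsub>comp (F m) d\<^esub> y) =
        (\<lambda>x\<in>el (F m) d. x) x \<oplus>\<^bsub>comp (F m) d\<^esub> (\<lambda>x\<in>el (F m) d. x) y" by simp
  qed (simp_all add: Fn.sq_closed)
  from Fn.classify_unique[OF this, of "iota m"] show ?thesis using \<theta> by (simp add: iota_in)
qed

lemma J_act_iota:
  assumes f: "f \<in> el (J n) m" shows "J_act n m m (iota m) f = f"
  using f by (auto simp: J_act_def classify_F_iota el_J fun_eq_iff)

lemma J_act_sq: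
  assumes \<xi>: "\<xi> \<in> el (F m) p"
  shows "sq (J n) i p (J_act n m p \<xi> f) = J_act n m (p + i) (sq (F m) i p \<xi>) f"
  unfolding sq_J J_act_act[OF \<xi> Fn.sq_closed[OF iota_in]]
  by (simp only: umod_hom_sq[OF Fn.classify_hom[OF \<xi>] iota_in] Fn.classify_iota[OF \<xi>])

theorem J_unstable: "unstable_module (J n)"
proof (rule unstable_module.intro)
  show "module F2 (comp (J n) d)" for d by (rule J_vector_space)
  show "sq (J n) i d \<in> lin (comp (J n) d) (comp (J n) (d + i))" for i d
    unfolding sq_J[abs_def] by (rule J_act_linear1[OF Fn.sq_closed[OF iota_in]])
  fix i j d f assume f: "f \<in> el (J n) d"
  have S: "sq (J n) i d f = J_act n d (d + i) (sq (F d) i d (iota d)) f" for i by (rule sq_J)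
  show "sq (J n) 0 d f = f"
    using J_act_iota[OF f] by (simp add: S Fn.sq_zero'[OF iota_in])
  show "sq (J n) i d f = \<zero>\<^bsub>comp (J n) (d + i)\<^esub>" if "d < i"
    unfolding S Fn.unstable'[OF that iota_in]
    by (rule lin_zero[OF F_vector_space J_vector_space J_act_linear2[OF f]])
  assume ij: "0 < i" "i < 2 * j"
  let ?A = "{k. k \<le> i div 2 \<and> odd ((j - k - 1) choose (i - 2 * k))}"
  let ?g = "\<lambda>k. sq (F d) (i + j - k) (d + k) (sq (F d) k d (iota d))"
  have deg: "d + k + (i + j - k) = d + j + i" if "k \<in> ?A" for k using that ij by auto
  have g: "?g k \<in> el (F d) (d + j + i)" if "k \<in> ?A" for k
    using Fn.sq_closed[OF Fn.sq_closed[OF iota_in, of d k], of "i + j - k"] unfolding deg[OF that] .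
  have "sq (J n) i (d + j) (sq (J n) j d f) =
      J_act n d (d + j + i) (sq (F d) i (d + j) (sq (F d) j d (iota d))) f"
    unfolding S by (rule J_act_sq[OF Fn.sq_closed[OF iota_in]])
  also have "\<dots> = J_act n d (d + j + i) (\<Oplus>\<^bsub>comp (F d) (d + j + i)\<^esub>k\<in>?A. ?g k) f"
    by (simp only: Fn.adem'[OF ij iota_in])
  also have "\<dots> = (\<Oplus>\<^bsub>comp (J n) (d + j + i)\<^esub>k\<in>?A. J_act n d (d + j + i) (?g k) f)"
    by (rule lin_finsum[OF F_vector_space J_vector_space J_act_linear2[OF f]]) (use g in auto)
  also have "\<dots> = (\<Oplus>\<^bsub>comp (J n) (d + j + i)\<^esub>k\<in>?A. sq (J n) (i + j - k) (d + k) (sq (J n) k d f))"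
  proof -
    interpret JV: Module.module F2 "comp (J n) (d + j + i)" by (rule J_vector_space)
    have e: "J_act n d (d + j + i) (?g k) f = sq (J n) (i + j - k) (d + k) (sq (J n) k d f)"
      if "k \<in> ?A" for k
      using J_act_sq[OF Fn.sq_closed[OF iota_in], of n "i + j - k" d k f]
      unfolding deg[OF that] S by simp
    show ?thesis
    proof (rule JV.finsum_cong'[OF refl _ e])
      show "(\<lambda>k. sq (J n) (i + j - k) (d + k) (sq (J n) k d f)) \<in> ?A \<rightarrow> el (J n) (d + j + i)"
        by (rule Pi_I, subst e[symmetric], assumption, rule J_act_closed[OF f g])
    qed
  qed
  finally show "sq (J n) i (d + j) (sq (J n) j d f) =
      (\<Oplus>\<^bsub>comp (J n) (d + j + i)\<^esub>k\<in>?A. sq (J n) (i + j - k) (d + k) (sq (J n) k d f))" .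
qed

lemma classify_J:
  assumes f: "f \<in> el (J n) m" and \<xi>: "\<xi> \<in> el (F m) p"
  shows "classify (J n) m f p \<xi> = J_act n m p \<xi> f"
proof -
  have "(\<lambda>p. \<lambda>\<xi>\<in>el (F m) p. J_act n m p \<xi> f) \<in> umod_hom (F m) (J n)"
  proof (rule umod_homI[OF F_vector_space J_vector_space])
    fix d x y assume xy: "x \<in> el (F m) d" "y \<in> el (F m) d"
    interpret V: Module.module F2 "comp (F m) d" by (rule F_vector_space)
    show "(\<lambda>\<xi>\<in>el (F m) d. J_act n m d \<xi> f) (x \<oplus>\<^bsub>comp (F m) d\<^esub> y) =
        (\<lambda>\<xi>\<in>el (F m) d. J_act n m d \<xi> f) x \<oplus>\<^bsub>comp (J n) d\<^esub> (\<lambda>\<xi>\<in>el (F m) d. J_act n m d \<xi> f) y"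
      using xy lin_add[OF J_act_linear2[OF f] xy] by simp
  qed (simp_all add: Fn.sq_closed J_act_closed[OF f] J_act_sq)
  from unstable_module.classify_unique[OF J_unstable this, of f] show ?thesis
    using \<xi> by (simp add: iota_in J_act_iota[OF f])
qed

lemma (in unstable_module) J_represents:
  assumes \<omega>: "\<omega> \<in> lin (comp M n) F2"
  shows "\<exists>!\<phi>. \<phi> \<in> umod_hom M (J n) \<and> (\<forall>x\<in>el M n. \<phi> n x (iota n) = \<omega> x)"
proof (rule ex_ex1I)
  interpret V: Module.module F2 "comp M d" for d by (rule vector_space)
  define \<phi> where "\<phi> = (\<lambda>m. \<lambda>x\<in>el M m. \<lambda>\<theta>. if \<theta> \<in> el (F m) n then \<omega> (classify M m x n \<theta>) else 0)"
  have \<phi>: "\<phi> m x \<theta> = (if \<theta> \<in> el (F m) n then \<omega> (classify M m x n \<theta>) else 0)" if "x \<in> el M m" for m x \<theta>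
    using that by (simp add: \<phi>_def)
  have "\<phi> \<in> umod_hom M (J n)"
  proof (rule umod_homI[OF vector_space J_vector_space])
    fix m x i assume x: "x \<in> el M m"
    show "\<phi> m x \<in> el (J n) m" unfolding el_J
    proof (intro conjI ballI allI impI)
      fix \<theta> \<xi> assume \<theta>: "\<theta> \<in> el (F m) n" and \<xi>: "\<xi> \<in> el (F m) n"
      interpret FV: Module.module F2 "comp (F m) n" by (rule F_vector_space)
      have "\<theta> \<oplus>\<^bsub>comp (F m) n\<^esub> \<xi> \<in> el (F m) n" using \<theta> \<xi> by simp
      then show "\<phi> m x (\<theta> \<oplus>\<^bsub>comp (F m) n\<^esub> \<xi>) = \<phi> m x \<theta> + \<phi> m x \<xi>"
        using \<theta> \<xi> lin_add[OF \<omega> classify_closed[OF x \<theta>] classify_closed[OF x \<xi>]]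
        by (simp only: \<phi>[OF x] if_True umod_hom_add[OF classify_hom[OF x]] F2_simps)
    qed (simp add: \<phi>[OF x])
    show "\<phi> (m + i) (sq M i m x) = sq (J n) i m (\<phi> m x)"
    proof
      fix \<theta>
      show "\<phi> (m + i) (sq M i m x) \<theta> = sq (J n) i m (\<phi> m x) \<theta>"
      proof (cases "\<theta> \<in> el (F (m + i)) n")
        case True
        have c: "classify (F m) (m + i) (sq (F m) i m (iota m)) n \<theta> \<in> el (F m) n"
          by (rule Fn.classify_closed[OF Fn.sq_closed[OF iota_in] True])
        have "classify M (m + i) (classify M m x (m + i) (sq (F m) i m (iota m))) n \<theta> =
            classify M m x n (classify (F m) (m + i) (sq (F m) i m (iota m)) n \<theta>)"
          by (rule Fn.classify_comp[OF Fn.sq_closed[OF iota_in] classify_hom[OF x] unstable_module_axioms True])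
        then have "classify M (m + i) (sq M i m x) n \<theta> =
            classify M m x n (classify (F m) (m + i) (sq (F m) i m (iota m)) n \<theta>)"
          by (simp only: umod_hom_sq[OF classify_hom[OF x] iota_in] classify_iota[OF x])
        then show ?thesis using True c
          by (simp only: \<phi>[OF sq_closed[OF x]] sq_J J_act_def \<phi>[OF x] if_True)
      qed (simp add: \<phi>[OF sq_closed[OF x]] sq_J J_act_def)
    qed
    fix y assume y: "y \<in> el M m"
    have "\<phi> m (x \<oplus>\<^bsub>comp M m\<^esub> y) \<theta> = \<phi> m x \<theta> + \<phi> m y \<theta>" for \<theta>
    proof (cases "\<theta> \<in> el (F m) n")
      case True
      show ?thesis
        using True lin_add[OF \<omega> classify_closed[OF x True] classify_closed[OF y True]]
        by (simp only: \<phi>[OF x] \<phi>[OF y] \<phi>[OF V.a_closed[OF x y]] if_True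
          lin_add[OF classify_linear[OF True] x y] F2_simps)
    qed (simp add: \<phi>[OF x] \<phi>[OF y] \<phi>[OF V.a_closed[OF x y]])
    then show "\<phi> m (x \<oplus>\<^bsub>comp M m\<^esub> y) = \<phi> m x \<oplus>\<^bsub>comp (J n) m\<^esub> \<phi> m y"
      unfolding add_J by (rule ext)
  qed (simp add: \<phi>_def)
  moreover have "\<phi> n x (iota n) = \<omega> x" if "x \<in> el M n" for x
    using that by (simp add: \<phi> iota_in classify_iota)
  ultimately show "\<exists>\<phi>. \<phi> \<in> umod_hom M (J n) \<and> (\<forall>x\<in>el M n. \<phi> n x (iota n) = \<omega> x)" by blast
next
  have *: "\<phi> m x \<theta> = \<omega> (classify M m x n \<theta>)"
    if \<phi>: "\<phi> \<in> umod_hom M (J n)" "\<forall>x\<in>el M n. \<phi> n x (iota n) = \<omega> x" and x: "x \<in> el M m" and \<theta>: "\<theta> \<in> el (F m) n"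
    for \<phi> m x \<theta>
  proof -
    note f = umod_hom_closed[OF \<phi>(1) x]
    have "\<phi> m x \<theta> = J_act n m n \<theta> (\<phi> m x) (iota n)"
      by (simp only: J_act_def iota_in if_True Fn.classify_iota[OF \<theta>])
    also have "\<dots> = classify (J n) m (\<phi> m x) n \<theta> (iota n)"
      by (simp only: classify_J[OF f \<theta>])
    also have "\<dots> = \<phi> n (classify M m x n \<theta>) (iota n)"
      by (simp only: classify_comp[OF x \<phi>(1) J_unstable \<theta>])
    also have "\<dots> = \<omega> (classify M m x n \<theta>)"
      using \<phi>(2) classify_closed[OF x \<theta>] by (rule bspec)
    finally show ?thesis .
  qed
  fix \<phi> \<psi>
  assume a: "\<phi> \<in> umod_hom M (J n) \<and> (\<forall>x\<in>el M n. \<phi> n x (iota n) = \<omega> x)"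
    and b: "\<psi> \<in> umod_hom M (J n) \<and> (\<forall>x\<in>el M n. \<psi> n x (iota n) = \<omega> x)"
  have "\<phi> m x = \<psi> m x" for m x
  proof (cases "x \<in> el M m")
    case x: True
    show ?thesis
    proof
      fix \<theta> show "\<phi> m x \<theta> = \<psi> m x \<theta>"
      proof (cases "\<theta> \<in> el (F m) n")
        case True
        then show ?thesis using *[OF _ _ x True, of \<phi>] *[OF _ _ x True, of \<psi>] a b by simp
      next
        case False
        then show ?thesis
          using umod_hom_closed[OF a[THEN conjunct1] x] umod_hom_closed[OF b[THEN conjunct1] x]
          by (simp add: el_J)
      qed
    qed
  next
    case False then show ?thesis
      using umod_hom_ext[OF a[THEN conjunct1] False] umod_hom_ext[OF b[THEN conjunct1] False] by simp
  qed
  then show "\<phi> = \<psi>" by (simp add: fun_eq_iff)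
qed


section \<open>The universal property of \<open>free_ula M\<close>\<close>

interpretation lrel: f2_quot "lrel M d" LZero LAdd
  by unfold_locales (fact lrel.sym lrel.trans lrel.zero lrel.add lrel.add_assoc lrel.add_comm lrel.add_zero lrel.add_self)+

lemma comp_free_ula: "comp (free_ula M) d = quot (lrel M d) LZero LAdd"
  by (simp add: free_ula_def)

lemma sq_free_ula:
  "lrel M d t t \<Longrightarrow> sq (free_ula M) i d (Collect (lrel M d t)) = Collect (lrel M (d + i) (LSq i t))"
proof -
  assume t: "lrel M d t t"
  have "(\<Union>u\<in>Collect (lrel M d t). Collect (lrel M (d + i) (LSq i u))) = Collect (lrel M (d + i) (LSq i t))"
    by (rule lrel.lift1[OF t, where f = "\<lambda>u. Collect (lrel M (d + i) (LSq i u))"])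
      (rule lrel.cls_eq, rule lrel.sq, erule lrel.sym)
  then show ?thesis by (simp only: free_ula_def umod.simps)
qed

lemma star_free_ula:
  "lrel M a s s \<Longrightarrow> lrel M b t t \<Longrightarrow> star (free_ula M) a b (Collect (lrel M a s)) (Collect (lrel M b t)) =
    Collect (lrel M (a + b) (LStar a s b t))"
proof -
  assume s: "lrel M a s s" and t: "lrel M b t t"
  have "Collect (lrel M (a + b) (LStar a u b v)) = Collect (lrel M (a + b) (LStar a s b t))"
    if "lrel M a s u" "lrel M b t v" for u v
    by (rule lrel.cls_eq, rule lrel.star) (rule that[THEN lrel.sym])+
  then have "(\<Union>u\<in>Collect (lrel M a s). \<Union>v\<in>Collect (lrel M b t). Collect (lrel M (a + b) (LStar a u b v))) =
      Collect (lrel M (a + b) (LStar a s b t))"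
    using s t by blast
  then show ?thesis by (simp only: free_ula_def umod.simps ulalg.simps)
qed

lemma el_free_ulaE:
  assumes "X \<in> el (free_ula M) d"
  obtains t where "lrel M d t t" "X = Collect (lrel M d t)"
  using assms by (auto simp: comp_free_ula lrel.carrier_quot)

lemma cls_in_free_ula: "lrel M d t t \<Longrightarrow> Collect (lrel M d t) \<in> el (free_ula M) d"
  unfolding comp_free_ula by (rule lrel.cls_in)

lemma free_ula_vector_space: "module F2 (comp (free_ula M) d)"
  by (simp add: comp_free_ula lrel.module_quot)

lemma add_free_ula: "lrel M d s s \<Longrightarrow> lrel M d t t \<Longrightarrow>
    Collect (lrel M d s) \<oplus>\<^bsub>comp (free_ula M) d\<^esub> Collect (lrel M d t) = Collect (lrel M d (LAdd s t))"
  unfolding comp_free_ula by (rule lrel.add_quot)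

lemma lsum_free_ula:
  assumes "distinct ks" "\<And>k. k \<in> set ks \<Longrightarrow> lrel M d (f k) (f k)"
    and "\<And>k. k \<in> set ks \<Longrightarrow> g k = Collect (lrel M d (f k))"
  shows "Collect (lrel M d (lsum (map f ks))) = (\<Oplus>\<^bsub>comp (free_ula M) d\<^esub>k\<in>set ks. g k)"
proof -
  interpret Module.module F2 "comp (free_ula M) d" by (rule free_ula_vector_space)
  have "Collect (lrel M d (lsum (map f ks))) = (\<Oplus>\<^bsub>comp (free_ula M) d\<^esub>k\<in>set ks. Collect (lrel M d (f k)))"
    unfolding lsum_def comp_free_ula by (rule lrel.sum_quot[THEN conjunct2, OF assms(1,2)])
  also have "\<dots> = (\<Oplus>\<^bsub>comp (free_ula M) d\<^esub>k\<in>set ks. g k)"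
  proof (rule finsum_cong'[OF refl])
    show "g \<in> set ks \<rightarrow> el (free_ula M) d"
      by (rule Pi_I) (simp only: assms(3), rule cls_in_free_ula, rule assms(2))
  qed (simp only: assms(3))
  finally show ?thesis .
qed

lemma free_ula_unstable: "unstable_module (free_ula M)"
proof (rule unstable_module.intro)
  show "module F2 (comp (free_ula M) d)" for d by (rule free_ula_vector_space)
  show "sq (free_ula M) i d \<in> lin (comp (free_ula M) d) (comp (free_ula M) (d + i))" for i d
  proof (rule linI[OF free_ula_vector_space free_ula_vector_space])
    fix X assume "X \<in> el (free_ula M) d"
    then obtain s where s: "lrel M d s s" "X = Collect (lrel M d s)" by (rule el_free_ulaE)
    then show "sq (free_ula M) i d X \<in> el (free_ula M) (d + i)"
      by (simp add: sq_free_ula cls_in_free_ula lrel.sq)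
    fix Y assume "Y \<in> el (free_ula M) d"
    then obtain t where t: "lrel M d t t" "Y = Collect (lrel M d t)" by (rule el_free_ulaE)
    show "sq (free_ula M) i d (X \<oplus>\<^bsub>comp (free_ula M) d\<^esub> Y) =
        sq (free_ula M) i d X \<oplus>\<^bsub>comp (free_ula M) (d + i)\<^esub> sq (free_ula M) i d Y"
      using s t by (simp add: add_free_ula sq_free_ula lrel.add lrel.sq lrel.cls_eq[OF lrel.sq_add])
  qed
next
  fix X d i j assume "X \<in> el (free_ula M) d"
  then obtain t where t: "lrel M d t t" "X = Collect (lrel M d t)" by (rule el_free_ulaE)
  show "sq (free_ula M) 0 d X = X" using t lrel.cls_eq[OF lrel.sq_zero[OF t(1)]] by (simp add: sq_free_ula)
  show "sq (free_ula M) i d X = \<zero>\<^bsub>comp (free_ula M) (d + i)\<^esub>" if "d < i"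
    using t that by (simp add: sq_free_ula comp_free_ula lrel.zero_quot lrel.cls_eq[OF lrel.unstable])
  assume ij: "0 < i" "i < 2 * j"
  let ?ks = "filter (\<lambda>k. odd ((j - k - 1) choose (i - 2 * k))) [0..<Suc (i div 2)]"
  let ?f = "\<lambda>k. LSq (i + j - k) (LSq k t)"
  have ks: "set ?ks = {k. k \<le> i div 2 \<and> odd ((j - k - 1) choose (i - 2 * k))}"
    by (auto simp del: upt_Suc)
  have deg: "d + k + (i + j - k) = d + j + i" if "k \<in> set ?ks" for k using that[unfolded ks] ij by auto
  have "sq (free_ula M) i (d + j) (sq (free_ula M) j d X) = Collect (lrel M (d + j + i) (LSq i (LSq j t)))"
    using t by (simp add: sq_free_ula lrel.sq)
  also have "\<dots> = Collect (lrel M (d + j + i) (lsum (map ?f ?ks)))"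
    by (rule lrel.cls_eq[OF lrel.adem[OF ij t(1)]])
  also have "\<dots> = (\<Oplus>\<^bsub>comp (free_ula M) (d + j + i)\<^esub>k\<in>set ?ks. sq (free_ula M) (i + j - k) (d + k) (sq (free_ula M) k d X))"
  proof (rule lsum_free_ula)
    fix k assume k: "k \<in> set ?ks"
    show "lrel M (d + j + i) (?f k) (?f k)"
      using lrel.sq[OF lrel.sq[OF t(1), of k], of "i + j - k"] unfolding deg[OF k] .
    show "sq (free_ula M) (i + j - k) (d + k) (sq (free_ula M) k d X) = Collect (lrel M (d + j + i) (?f k))"
      using sq_free_ula[OF lrel.sq[OF t(1), of k], of "i + j - k"] sq_free_ula[OF t(1), of k] t(2)
      unfolding deg[OF k] by simp
  qed simp
  finally show "sq (free_ula M) i (d + j) (sq (free_ula M) j d X) =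
      (\<Oplus>\<^bsub>comp (free_ula M) (d + j + i)\<^esub>k\<in>{k. k \<le> i div 2 \<and> odd ((j - k - 1) choose (i - 2 * k))}.
         sq (free_ula M) (i + j - k) (d + k) (sq (free_ula M) k d X))"
    unfolding ks .
qed

theorem free_ula_level_algebra: "unstable_level_algebra (free_ula M)"
proof (intro unstable_level_algebra.intro unstable_level_algebra_axioms.intro free_ula_unstable)
  have add1: "star (free_ula M) a b (X \<oplus>\<^bsub>comp (free_ula M) a\<^esub> X') Y =
      star (free_ula M) a b X Y \<oplus>\<^bsub>comp (free_ula M) (a + b)\<^esub> star (free_ula M) a b X' Y"
    if "X \<in> el (free_ula M) a" "X' \<in> el (free_ula M) a" "Y \<in> el (free_ula M) b" for a b X X' Y
  proof -
    note h = that
    obtain s where s: "lrel M a s s" "X = Collect (lrel M a s)" using h(1) by (rule el_free_ulaE)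
    obtain s' where s': "lrel M a s' s'" "X' = Collect (lrel M a s')" using h(2) by (rule el_free_ulaE)
    obtain t where t: "lrel M b t t" "Y = Collect (lrel M b t)" using h(3) by (rule el_free_ulaE)
    show ?thesis
      using s s' t by (simp add: add_free_ula star_free_ula lrel.add lrel.star lrel.cls_eq[OF lrel.star_add])
  qed
  have closed: "star (free_ula M) a b X Y \<in> el (free_ula M) (a + b)"
    if "X \<in> el (free_ula M) a" "Y \<in> el (free_ula M) b" for a b X Y
  proof -
    note h = that
    obtain s where s: "lrel M a s s" "X = Collect (lrel M a s)" using h(1) by (rule el_free_ulaE)
    obtain t where t: "lrel M b t t" "Y = Collect (lrel M b t)" using h(2) by (rule el_free_ulaE)
    show ?thesis using s t by (simp add: star_free_ula cls_in_free_ula lrel.star)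
  qed
  show comm: "star (free_ula M) a b X Y = star (free_ula M) b a Y X"
    if "X \<in> el (free_ula M) a" "Y \<in> el (free_ula M) b" for a b X Y
  proof -
    note h = that
    obtain s where s: "lrel M a s s" "X = Collect (lrel M a s)" using h(1) by (rule el_free_ulaE)
    obtain t where t: "lrel M b t t" "Y = Collect (lrel M b t)" using h(2) by (rule el_free_ulaE)
    show ?thesis using s t lrel.cls_eq[OF lrel.star_comm[OF s(1) t(1)]]
      by (simp add: star_free_ula add.commute[of b a])
  qed
  show "(\<lambda>x. star (free_ula M) a b x y) \<in> lin (comp (free_ula M) a) (comp (free_ula M) (a + b))"
    if "y \<in> el (free_ula M) b" for a b y
    by (rule linI[OF free_ula_vector_space free_ula_vector_space closed[OF _ that] add1[OF _ _ that]])
  show "(\<lambda>y. star (free_ula M) a b x y) \<in> lin (comp (free_ula M) b) (comp (free_ula M) (a + b))"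
    if x: "x \<in> el (free_ula M) a" for a b x
  proof (rule linI[OF free_ula_vector_space free_ula_vector_space closed[OF x]])
    fix y z assume y: "y \<in> el (free_ula M) b" and z: "z \<in> el (free_ula M) b"
    interpret Module.module F2 "comp (free_ula M) b" by (rule free_ula_vector_space)
    show "star (free_ula M) a b x (y \<oplus>\<^bsub>comp (free_ula M) b\<^esub> z) =
        star (free_ula M) a b x y \<oplus>\<^bsub>comp (free_ula M) (a + b)\<^esub> star (free_ula M) a b x z"
      using add1[OF y z x] unfolding comm[OF x a_closed[OF y z]] comm[OF x y] comm[OF x z]
      by (simp only: add.commute[of b a])
  qed
  show "star (free_ula M) (a + b) (c + e) (star (free_ula M) a b x y) (star (free_ula M) c e z w) =
      star (free_ula M) (a + c) (b + e) (star (free_ula M) a c x z) (star (free_ula M) b e y w)"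
    if "x \<in> el (free_ula M) a" "y \<in> el (free_ula M) b" "z \<in> el (free_ula M) c" "w \<in> el (free_ula M) e"
    for a b c e x y z w
  proof -
    note h = that
    obtain s where s: "lrel M a s s" "x = Collect (lrel M a s)" using h(1) by (rule el_free_ulaE)
    obtain t where t: "lrel M b t t" "y = Collect (lrel M b t)" using h(2) by (rule el_free_ulaE)
    obtain u where u: "lrel M c u u" "z = Collect (lrel M c u)" using h(3) by (rule el_free_ulaE)
    obtain v where v: "lrel M e v v" "w = Collect (lrel M e v)" using h(4) by (rule el_free_ulaE)
    have d: "a + c + (b + e) = a + b + (c + e)" by simp
    show ?thesis using lrel.cls_eq[OF lrel.level[OF s(1) t(1) u(1) v(1)]] s t u v
      by (simp only: star_free_ula lrel.star d)
  qed
  show "Sq0 (free_ula M) d x = star (free_ula M) d d x x" if "x \<in> el (free_ula M) d" for d x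
  proof -
    note h = that
    obtain t where t: "lrel M d t t" "x = Collect (lrel M d t)" using h by (rule el_free_ulaE)
    show ?thesis using lrel.cls_eq[OF lrel.square[OF t(1)]] t
      by (simp add: Sq0_def sq_free_ula star_free_ula)
  qed
  show "sq (free_ula M) i (a + b) (star (free_ula M) a b x y) =
      (\<Oplus>\<^bsub>comp (free_ula M) (a + b + i)\<^esub>k\<in>{..i}.
        star (free_ula M) (a + k) (b + (i - k)) (sq (free_ula M) k a x) (sq (free_ula M) (i - k) b y))"
    if "x \<in> el (free_ula M) a" "y \<in> el (free_ula M) b" for a b i x y
  proof -
    note h = that
    obtain s where s: "lrel M a s s" "x = Collect (lrel M a s)" using h(1) by (rule el_free_ulaE)
    obtain t where t: "lrel M b t t" "y = Collect (lrel M b t)" using h(2) by (rule el_free_ulaE)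
    let ?f = "\<lambda>k. LStar (a + k) (LSq k s) (b + (i - k)) (LSq (i - k) t)"
    have ks: "{..i} = set [0..<Suc i]" by (auto simp del: upt_Suc)
    have "sq (free_ula M) i (a + b) (star (free_ula M) a b x y) =
        Collect (lrel M (a + b + i) (LSq i (LStar a s b t)))"
      using s t by (simp add: star_free_ula sq_free_ula lrel.star)
    also have "\<dots> = Collect (lrel M (a + b + i) (lsum (map ?f [0..<Suc i])))"
      by (rule lrel.cls_eq[OF lrel.cartan[OF s(1) t(1)]])
    also have "\<dots> = (\<Oplus>\<^bsub>comp (free_ula M) (a + b + i)\<^esub>k\<in>set [0..<Suc i].
        star (free_ula M) (a + k) (b + (i - k)) (sq (free_ula M) k a x) (sq (free_ula M) (i - k) b y))"
    proof (rule lsum_free_ula)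
      fix k assume "k \<in> set [0..<Suc i]"
      then have d: "a + k + (b + (i - k)) = a + b + i" unfolding ks[symmetric] by simp
      note sk = lrel.sq[OF s(1), of k] and tk = lrel.sq[OF t(1), of "i - k"]
      show "lrel M (a + b + i) (?f k) (?f k)" using lrel.star[OF sk tk] unfolding d .
      show "star (free_ula M) (a + k) (b + (i - k)) (sq (free_ula M) k a x) (sq (free_ula M) (i - k) b y) =
          Collect (lrel M (a + b + i) (?f k))"
        using star_free_ula[OF sk tk] unfolding d s(2) t(2) sq_free_ula[OF s(1)] sq_free_ula[OF t(1)] .
    qed simp
    finally show ?thesis unfolding ks .
  qed
qed

lemma free_ula_unit_hom:
  assumes "unstable_module M" shows "free_ula_unit M \<in> umod_hom M (free_ula M)"
proof -
  interpret unstable_module M by fact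
  show ?thesis
  proof (rule umod_homI[OF vector_space free_ula_vector_space])
    fix d x i assume x: "x \<in> el M d"
    show "free_ula_unit M d x \<in> el (free_ula M) d"
      using x by (simp add: free_ula_unit_def cls_in_free_ula lrel.gen)
    show "free_ula_unit M (d + i) (sq M i d x) = sq (free_ula M) i d (free_ula_unit M d x)"
      using x sq_closed[OF x] by (simp add: free_ula_unit_def sq_free_ula lrel.gen lrel.cls_eq[OF lrel.gen_sq])
    fix y assume y: "y \<in> el M d"
    interpret V: Module.module F2 "comp M d" by (rule vector_space)
    show "free_ula_unit M d (x \<oplus>\<^bsub>comp M d\<^esub> y) =
        free_ula_unit M d x \<oplus>\<^bsub>comp (free_ula M) d\<^esub> free_ula_unit M d y"
      using x y by (simp add: free_ula_unit_def add_free_ula lrel.gen lrel.cls_eq[OF lrel.gen_add])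
  qed (simp add: free_ula_unit_def)
qed

primrec lwf :: "('a, 'm) umod_scheme \<Rightarrow> nat \<Rightarrow> 'a lterm \<Rightarrow> bool" where
  "lwf M d (LGen x) \<longleftrightarrow> x \<in> el M d"
| "lwf M d LZero \<longleftrightarrow> True"
| "lwf M d (LAdd s t) \<longleftrightarrow> lwf M d s \<and> lwf M d t"
| "lwf M d (LSq i t) \<longleftrightarrow> i \<le> d \<and> lwf M (d - i) t"
| "lwf M d (LStar a s b t) \<longleftrightarrow> d = a + b \<and> lwf M a s \<and> lwf M b t"

lemma lwf_lsum: "lwf M d (lsum ts) \<longleftrightarrow> (\<forall>t\<in>set ts. lwf M d t)"
  unfolding lsum_def by (induction ts) simp_all

lemma lwf_iff:
  assumes "unstable_module M" shows "lwf M d t \<longleftrightarrow> lrel M d t t"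
proof
  interpret unstable_module M by fact
  interpret V: Module.module F2 "comp M d" for d by (rule vector_space)
  show "lwf M d t \<Longrightarrow> lrel M d t t"
  proof (induction t arbitrary: d)
    case (LSq i t) then show ?case using lrel.sq[of M "d - i" t t i] by simp
  qed (auto intro: lrel.gen lrel.zero lrel.add lrel.star)
  have w: "lrel M d s t \<Longrightarrow> lwf M d s \<and> lwf M d t" for s t
  proof (induction rule: lrel.induct)
    case (adem i j d t)
    have "d + j + i - (i + j - k) - k = d" if "k \<le> i div 2" for k using that adem by auto
    then show ?case using adem by (auto simp: lwf_lsum)
  next
    case (cartan a s b t i)
    then show ?case by (auto simp: lwf_lsum)
  qed (simp_all add: sq_closed)
  show "lrel M d t t \<Longrightarrow> lwf M d t" by (drule w, erule conjunct1)
qed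

primrec leval :: "('a, 'm) ulalg_scheme \<Rightarrow> (nat \<Rightarrow> 'b \<Rightarrow> 'a) \<Rightarrow> nat \<Rightarrow> 'b lterm \<Rightarrow> 'a" where
  "leval L \<phi> d (LGen x) = \<phi> d x"
| "leval L \<phi> d LZero = \<zero>\<^bsub>comp L d\<^esub>"
| "leval L \<phi> d (LAdd s t) = leval L \<phi> d s \<oplus>\<^bsub>comp L d\<^esub> leval L \<phi> d t"
| "leval L \<phi> d (LSq i t) = sq L i (d - i) (leval L \<phi> (d - i) t)"
| "leval L \<phi> d (LStar a s b t) = star L a b (leval L \<phi> a s) (leval L \<phi> b t)"

context unstable_level_algebra begin

interpretation V: Module.module F2 "comp L d" for d by (rule vector_space)

lemmas star_closed = lin_closed[OF star_linear1]
lemmas star_plus = lin_add[OF star_linear1]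
lemmas star_comm' = star_comm and level' = level and cartan' = cartan

lemma leval_lsum:
  assumes "distinct ks" "\<And>k. k \<in> set ks \<Longrightarrow> leval L \<phi> d (f k) = g k" "\<And>k. k \<in> set ks \<Longrightarrow> g k \<in> el L d"
  shows "leval L \<phi> d (lsum (map f ks)) = (\<Oplus>\<^bsub>comp L d\<^esub>k\<in>set ks. g k)"
proof -
  have "leval L \<phi> d (lsum (map f ks)) =
      foldr (\<lambda>k a. leval L \<phi> d (f k) \<oplus>\<^bsub>comp L d\<^esub> a) ks \<zero>\<^bsub>comp L d\<^esub>"
    unfolding lsum_def by (rule foldr_map_eval) simp_all
  also have "\<dots> = (\<Oplus>\<^bsub>comp L d\<^esub>k\<in>set ks. leval L \<phi> d (f k))"
    by (rule finsum_foldr[OF V.abelian_monoid_axioms assms(1)]) (simp only: assms(2,3))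
  also have "\<dots> = (\<Oplus>\<^bsub>comp L d\<^esub>k\<in>set ks. g k)"
  proof (rule V.finsum_cong'[OF refl])
    show "g \<in> set ks \<rightarrow> el L d" by (rule Pi_I) (rule assms(3))
  qed (rule assms(2))
  finally show ?thesis .
qed

lemma leval_sound:
  assumes \<phi>: "\<phi> \<in> umod_hom M L" and rel: "lrel M d s t"
  shows "leval L \<phi> d s = leval L \<phi> d t \<and> leval L \<phi> d s \<in> el L d"
  using rel
proof (induction rule: lrel.induct)
  case (gen x d) then show ?case by (simp add: umod_hom_closed[OF \<phi>])
next
  case (zero d) show ?case by simp
next
  case (add d s s' t t')
  show ?case unfolding leval.simps add.IH[THEN conjunct1, symmetric]
    by (intro conjI refl V.a_closed add.IH[THEN conjunct2])
next
  case (sq d t t' i)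
  show ?case unfolding leval.simps add_diff_cancel_right' sq.IH[THEN conjunct1, symmetric]
    by (intro conjI refl sq_closed sq.IH[THEN conjunct2])
next
  case (star a s s' b t t')
  show ?case unfolding leval.simps star.IH[THEN conjunct1, symmetric]
    by (intro conjI refl star_closed star.IH[THEN conjunct2])
next
  case (sym d s t)
  have "leval L \<phi> d t \<in> el L d" by (subst sym.IH[THEN conjunct1, symmetric]) (rule sym.IH[THEN conjunct2])
  then show ?case by (intro conjI sym.IH[THEN conjunct1, symmetric])
next
  case (trans d s t u)
  show ?case by (intro conjI trans.IH(1)[THEN conjunct2] HOL.trans[OF trans.IH(1)[THEN conjunct1] trans.IH(2)[THEN conjunct1]])
next
  case (add_assoc d s t u) then show ?case by (simp add: V.a_assoc)
next
  case (add_comm d s t) then show ?case by (simp add: V.a_comm)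
next
  case (add_zero d t) then show ?case by simp
next
  case (add_self d t) then show ?case by (simp add: F2_add_self[OF vector_space])
next
  case (gen_add x d y)
  then show ?case by (simp add: umod_hom_add[OF \<phi>] umod_hom_closed[OF \<phi>])
next
  case (gen_sq x d i)
  then show ?case by (simp add: umod_hom_sq[OF \<phi>] umod_hom_closed[OF \<phi>] sq_closed)
next
  case (sq_add d s t i) then show ?case by (simp add: sq_closed sq_plus)
next
  case (sq_zero d t) then show ?case by (simp add: sq_zero')
next
  case (unstable d i t) then show ?case by (simp add: unstable')
next
  case (star_add a s s' b t) then show ?case by (simp add: star_plus star_closed)
next
  case (star_comm a s b t)
  then show ?case using star_comm'[of "leval L \<phi> a s" a "leval L \<phi> b t" b]
      star_closed[of "leval L \<phi> b t" b "leval L \<phi> a s" a] by simp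
next
  case (level a s b t c u e v)
  then have "star L (a + b) (c + e) (star L a b (leval L \<phi> a s) (leval L \<phi> b t))
      (star L c e (leval L \<phi> c u) (leval L \<phi> e v)) \<in> el L (a + b + (c + e))"
    by (intro star_closed) simp_all
  with level show ?case
    using level'[of "leval L \<phi> a s" a "leval L \<phi> b t" b "leval L \<phi> c u" c "leval L \<phi> e v" e]
    by simp
next
  case (square d t)
  then show ?case using Sq0_star[of "leval L \<phi> d t" d] by (simp add: Sq0_def star_closed)
next
  case (adem i j d t)
  let ?ks = "filter (\<lambda>k. odd ((j - k - 1) choose (i - 2 * k))) [0..<Suc (i div 2)]"
  let ?D = "d + j + i"
  let ?y = "leval L \<phi> d t"
  have y: "?y \<in> el L d" using adem by simp
  have ks: "set ?ks = {k. k \<le> i div 2 \<and> odd ((j - k - 1) choose (i - 2 * k))}"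
    by (auto simp del: upt_Suc)
  have "leval L \<phi> ?D (lsum (map (\<lambda>k. LSq (i + j - k) (LSq k t)) ?ks)) =
      (\<Oplus>\<^bsub>comp L ?D\<^esub>k\<in>set ?ks. sq L (i + j - k) (d + k) (sq L k d ?y))"
  proof (rule leval_lsum)
    fix k assume k: "k \<in> set ?ks"
    have "?D - (i + j - k) = d + k" using k[unfolded ks] adem(1,2) by auto
    then show "leval L \<phi> ?D (LSq (i + j - k) (LSq k t)) = sq L (i + j - k) (d + k) (sq L k d ?y)" by simp
    have "d + k + (i + j - k) = ?D" using k[unfolded ks] adem(1,2) by auto
    then show "sq L (i + j - k) (d + k) (sq L k d ?y) \<in> el L ?D"
      using sq_closed[OF sq_closed[OF y, of k], of "i + j - k"] by (simp only:)
  qed simp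
  also have "\<dots> = sq L i (d + j) (sq L j d ?y)"
    unfolding ks by (rule adem'[symmetric]) (rule adem.hyps y)+
  finally show ?case using y by (simp add: sq_closed)
next
  case (cartan a s b t i)
  let ?x = "leval L \<phi> a s" and ?y = "leval L \<phi> b t"
  have x: "?x \<in> el L a" and y: "?y \<in> el L b" using cartan by simp_all
  have ks: "{..i} = set [0..<Suc i]" by (auto simp del: upt_Suc)
  have "leval L \<phi> (a + b + i) (lsum (map (\<lambda>k. LStar (a + k) (LSq k s) (b + (i - k)) (LSq (i - k) t)) [0..<Suc i])) =
      (\<Oplus>\<^bsub>comp L (a + b + i)\<^esub>k\<in>set [0..<Suc i]. star L (a + k) (b + (i - k)) (sq L k a ?x) (sq L (i - k) b ?y))"
  proof (rule leval_lsum)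
    fix k assume "k \<in> set [0..<Suc i]"
    then have d: "a + k + (b + (i - k)) = a + b + i" unfolding ks[symmetric] by simp
    show "star L (a + k) (b + (i - k)) (sq L k a ?x) (sq L (i - k) b ?y) \<in> el L (a + b + i)"
      using star_closed[OF sq_closed[OF y, of "i - k"] sq_closed[OF x, of k]] unfolding d .
  qed simp_all
  also have "\<dots> = sq L i (a + b) (star L a b ?x ?y)" unfolding ks[symmetric] by (rule cartan'[symmetric, OF x y])
  finally show ?case using x y by (simp add: sq_closed star_closed)
qed

theorem free_ula_universal:
  assumes M: "unstable_module M" and \<phi>: "\<phi> \<in> umod_hom M L"
  shows "\<exists>!\<psi>. \<psi> \<in> ula_hom (free_ula M) L \<and> (\<forall>d. \<forall>x\<in>el M d. \<psi> d (free_ula_unit M d x) = \<phi> d x)"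
proof (rule ex_ex1I)
  define \<psi> where "\<psi> = (\<lambda>d. \<lambda>X\<in>el (free_ula M) d. leval L \<phi> d (SOME t. t \<in> X))"
  have \<psi>: "\<psi> d (Collect (lrel M d t)) = leval L \<phi> d t" if t: "lrel M d t t" for d t
  proof -
    have "lrel M d t (SOME u. lrel M d t u)" using t by (rule someI)
    then show ?thesis
      using leval_sound[OF \<phi>, of d t "SOME u. lrel M d t u"] t by (simp add: \<psi>_def cls_in_free_ula)
  qed
  have "\<psi> \<in> umod_hom (free_ula M) L"
  proof (rule umod_homI[OF free_ula_vector_space vector_space])
    fix d i X assume "X \<in> el (free_ula M) d"
    then obtain s where s: "lrel M d s s" "X = Collect (lrel M d s)" by (rule el_free_ulaE)
    then show "\<psi> d X \<in> el L d" using leval_sound[OF \<phi> s(1)] by (simp add: \<psi>)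
    show "\<psi> (d + i) (sq (free_ula M) i d X) = sq L i d (\<psi> d X)"
      using s by (simp add: sq_free_ula \<psi> lrel.sq)
    fix Y assume "Y \<in> el (free_ula M) d"
    then obtain t where t: "lrel M d t t" "Y = Collect (lrel M d t)" by (rule el_free_ulaE)
    then show "\<psi> d (X \<oplus>\<^bsub>comp (free_ula M) d\<^esub> Y) = \<psi> d X \<oplus>\<^bsub>comp L d\<^esub> \<psi> d Y"
      using s by (simp add: add_free_ula \<psi> lrel.add)
  qed (simp add: \<psi>_def)
  moreover have "\<psi> (a + b) (star (free_ula M) a b X Y) = star L a b (\<psi> a X) (\<psi> b Y)"
    if "X \<in> el (free_ula M) a" "Y \<in> el (free_ula M) b" for a b X Y
  proof -
    note h = that
    obtain s where s: "lrel M a s s" "X = Collect (lrel M a s)" using h(1) by (rule el_free_ulaE)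
    obtain t where t: "lrel M b t t" "Y = Collect (lrel M b t)" using h(2) by (rule el_free_ulaE)
    show ?thesis using s t by (simp add: star_free_ula \<psi> lrel.star)
  qed
  moreover have "\<psi> d (free_ula_unit M d x) = \<phi> d x" if "x \<in> el M d" for d x
    using that by (simp add: free_ula_unit_def \<psi> lrel.gen)
  ultimately show "\<exists>\<psi>. \<psi> \<in> ula_hom (free_ula M) L \<and> (\<forall>d. \<forall>x\<in>el M d. \<psi> d (free_ula_unit M d x) = \<phi> d x)"
    by (intro exI[of _ \<psi>]) (simp add: ula_hom_def)
next
  have *: "\<psi> d (Collect (lrel M d t)) = leval L \<phi> d t"
    if \<psi>: "\<psi> \<in> ula_hom (free_ula M) L" "\<forall>d. \<forall>x\<in>el M d. \<psi> d (free_ula_unit M d x) = \<phi> d x" and "lwf M d t"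
    for \<psi> d t
    using that(3)
  proof (induction t arbitrary: d)
    have h: "\<psi> \<in> umod_hom (free_ula M) L" using \<psi>(1) by (simp add: ula_hom_def)
    {
      case (LGen x) then show ?case using \<psi>(2)[rule_format, of x d] by (simp add: free_ula_unit_def)
    next
      case LZero
      have "\<psi> d \<zero>\<^bsub>comp (free_ula M) d\<^esub> = \<zero>\<^bsub>comp L d\<^esub>"
        by (rule lin_zero[OF free_ula_vector_space vector_space umod_hom_lin[OF h]])
      then show ?case by (simp add: comp_free_ula lrel.zero_quot)
    next
      case (LAdd s t)
      then have st: "lrel M d s s" "lrel M d t t" by (simp_all flip: lwf_iff[OF M])
      then show ?case using LAdd.IH[of d] LAdd.prems
          umod_hom_add[OF h cls_in_free_ula[OF st(1)] cls_in_free_ula[OF st(2)]]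
        by (simp add: add_free_ula)
    next
      case (LSq i t)
      then have t: "lrel M (d - i) t t" "i \<le> d" by (simp_all flip: lwf_iff[OF M])
      then show ?case using LSq.IH[of "d - i"] LSq.prems umod_hom_sq[OF h cls_in_free_ula[OF t(1)], of i]
        by (simp add: sq_free_ula)
    next
      case (LStar a s b t)
      then have st: "lrel M a s s" "lrel M b t t" by (simp_all flip: lwf_iff[OF M])
      have "\<psi> (a + b) (star (free_ula M) a b (Collect (lrel M a s)) (Collect (lrel M b t))) =
          star L a b (\<psi> a (Collect (lrel M a s))) (\<psi> b (Collect (lrel M b t)))"
        using \<psi>(1) cls_in_free_ula[OF st(1)] cls_in_free_ula[OF st(2)] by (simp add: ula_hom_def)
      then show ?case using LStar.IH LStar.prems st by (simp add: star_free_ula)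
    }
  qed
  fix \<psi> \<psi>'
  assume a: "\<psi> \<in> ula_hom (free_ula M) L \<and> (\<forall>d. \<forall>x\<in>el M d. \<psi> d (free_ula_unit M d x) = \<phi> d x)"
    and b: "\<psi>' \<in> ula_hom (free_ula M) L \<and> (\<forall>d. \<forall>x\<in>el M d. \<psi>' d (free_ula_unit M d x) = \<phi> d x)"
  have h: "\<psi> \<in> umod_hom (free_ula M) L" "\<psi>' \<in> umod_hom (free_ula M) L" using a b by (simp_all add: ula_hom_def)
  have eq: "\<psi> d X = \<psi>' d X" for d X
  proof (cases "X \<in> el (free_ula M) d")
    case True
    then obtain s where s: "lrel M d s s" "X = Collect (lrel M d s)" by (rule el_free_ulaE)
    have w: "lwf M d s" using s(1) by (simp add: lwf_iff[OF M])
    show ?thesis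
      unfolding s(2) *[OF conjunct1[OF a] conjunct2[OF a] w] *[OF conjunct1[OF b] conjunct2[OF b] w] ..
  next
    case False then show ?thesis using umod_hom_ext[OF h(1) False] umod_hom_ext[OF h(2) False] by simp
  qed
  show "\<psi> = \<psi>'" by (rule ext, rule ext, rule eq)
qed

end

end

theory Submission
  imports "HOL-Computational_Algebra.Formal_Power_Series" Defs
begin

text \<open>
  $F(d)$ embeds into $F_2[t_1, \ldots, t_d]$ by $\iota_d \mapsto t_1 \cdots t_d$, with image the symmetric
  polynomials that are additive in each variable. Hence $J(n)$ has Miller's basis of monomials in variables $x_e$ of degree 1 and
  weight $2^e$, with total weight \<open>n\<close>; the external product multiplies monomials, and $\cdot Sq^n$ sends
  $x_e$ to $x_{e-1}$ and $x_0$ to 0. In the limit, $K(1)$ has as a basis the monomials whose variables have depths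
  $j$ with $\sum 2^{-j} = 1$, and the product of two basis elements multiplies them and increases all depths by one.
  These multisets of depths are exactly those of the leaves of binary trees, and in a level algebra the product
  of copies of one element along a tree depends only on the depths of its leaves. The free unstable level algebra
  on $F(1)$ is spanned by such products of the generator, because $Sq^1 \iota_1 = \iota_1 \star \iota_1$
  and the Cartan formula reduce all operations to products.
\<close>

text \<open>The external product is the only non-zero morphism out of J(n) \<otimes> J(m), and
  functionals are known to be representable only on unstable modules. So the Adem relations have to
  be proved for tensor products before any product can be computed, and they do not follow term by
  term from the Cartan formula. By naturality the universal case iota_a \<otimes> iota_b in F(a)
  \<otimes> F(b) is enough, and this module embeds in polynomials in a + b variables. The embedding
  of F(d) is obtained without the admissible basis: the suspension of F(d) maps onto the quotient of
  F(d + 1) by the image of Sq_0, while Sq_0 becomes the Frobenius map on polynomials. Injectivity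
  and the description of the image then follow by induction on d and on the degree. The formulas for
  Brown-Gitler modules are transposes of facts about polynomials. For the free level algebra only
  the spanning by tree products is proved directly. Their independence is read off from their images
  in K(1), so the comparison morphism starts at the free algebra and is inverted at the end.\<close>

declare add_bit_eq_xor [simp del] mult_bit_eq_and [simp del] power_bit_unfold [simp del]

lemma bit_add_self [simp]: "x + x = (0 :: bit)"
  by (cases x) simp_all

section \<open>The total square on additive polynomials\<close>

definition wt :: "nat list \<Rightarrow> nat" where
  "wt l = (\<Sum>e\<leftarrow>l. 2 ^ e)"

lemma wt_simps [simp]: "wt [] = 0" "wt (e # l) = 2 ^ e + wt l" "wt (l @ l') = wt l + wt l'"
  by (simp_all add: wt_def)

text \<open>The function \<open>f\<close> stands for the polynomial $\sum_l f(l)\, t_1^{2^{l_1}} \cdots t_d^{2^{l_d}}$, and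
  \<open>tot c\<close> is the ring homomorphism $t_i \mapsto t_i + c\,t_i^2$, so that \<open>tot c\<close> is $\sum_i c^i Sq^i$.\<close>

primrec tot :: "'r::comm_ring_1 \<Rightarrow> (nat list \<Rightarrow> 'r) \<Rightarrow> nat list \<Rightarrow> 'r" where
  "tot c f [] = f []"
| "tot c f (e # l) = tot c (\<lambda>l. f (e # l)) l +
     (case e of 0 \<Rightarrow> 0 | Suc k \<Rightarrow> c ^ 2 ^ k * tot c (\<lambda>l. f (k # l)) l)"

text \<open>Squaring is additive, so t^(2^k) goes to t^(2^k) + c^(2^k) t^(2^(k+1)); these are the
  two summands of \<open>tot\<close>. With c a formal variable, a coefficient isolates Sq^i. Power
  series leave room for the inverses of powers of 1 + X that are needed later
  (\<open>geo\<close>).\<close>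

definition psq :: "nat \<Rightarrow> (nat list \<Rightarrow> bit) \<Rightarrow> nat list \<Rightarrow> bit" where
  "psq i f l = fps_nth (tot fps_X (\<lambda>l. fps_const (f l)) l) i"

lemma tot_add: "tot c (\<lambda>l. f l + g l) l = tot c f l + tot c g l"
  by (induction l arbitrary: f g) (simp_all add: algebra_simps split: nat.split)

lemma tot_scale: "tot c (\<lambda>l. a * f l) l = a * tot c f l"
  by (induction l arbitrary: f) (simp_all add: algebra_simps split: nat.split)

lemma tot_zero: "tot c (\<lambda>l. 0) l = 0"
  by (induction l) (simp_all split: nat.split)

lemma tot_sum: "tot c (\<lambda>l. \<Sum>i\<in>A. f i l) l = (\<Sum>i\<in>A. tot c (f i) l)"
  by (induction A rule: infinite_finite_induct) (simp_all add: tot_zero tot_add)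

lemma psq_Nil: "psq i f [] = (if i = 0 then f [] else 0)"
  by (simp add: psq_def)

lemma psq_Cons: "psq i f (e # l) = psq i (\<lambda>l. f (e # l)) l +
    (case e of 0 \<Rightarrow> 0 | Suc k \<Rightarrow> if i < 2 ^ k then 0 else psq (i - 2 ^ k) (\<lambda>l. f (k # l)) l)"
  by (simp add: psq_def fps_X_power_mult_nth split: nat.split)

lemma psq_add: "psq i (\<lambda>l. f l + g l) l = psq i f l + psq i g l"
  by (simp add: psq_def tot_add flip: fps_const_add)

lemma psq_zero: "psq i (\<lambda>l. 0) l = 0"
  by (simp add: psq_def tot_zero)

lemma psq_0: "psq 0 f l = f l"
  by (induction l arbitrary: f) (simp_all add: psq_Nil psq_Cons split: nat.split)

text \<open>A contribution to the coefficient of \<open>l\<close> doubles some of the factors of a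
  monomial \<open>l'\<close>, and \<open>i\<close> is the total degree of these factors. This yields
  homogeneity and instability at once.\<close>

lemma psq_supp: "psq i f l \<noteq> 0 \<Longrightarrow> \<exists>l'. length l' = length l \<and> f l' \<noteq> 0 \<and> wt l = wt l' + i \<and> i \<le> wt l'"
proof (induction l arbitrary: f i)
  case Nil then show ?case by (auto simp: psq_Nil split: if_splits)
next
  case (Cons e l)
  consider "psq i (\<lambda>l. f (e # l)) l \<noteq> 0"
    | k where "e = Suc k" "2 ^ k \<le> i" "psq (i - 2 ^ k) (\<lambda>l. f (k # l)) l \<noteq> 0"
    using Cons.prems unfolding psq_Cons
    by (cases "psq i (\<lambda>l. f (e # l)) l = 0"; simp split: nat.splits if_splits)
  then show ?case
  proof cases
    case 1
    from Cons.IH[OF this] obtain l' where "length l' = length l" "f (e # l') \<noteq> 0" "wt l = wt l' + i" "i \<le> wt l'"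
      by blast
    then show ?thesis by (intro exI[of _ "e # l'"]) simp
  next
    case 2
    from Cons.IH[OF 2(3)] obtain l' where "length l' = length l" "f (k # l') \<noteq> 0"
      "wt l = wt l' + (i - 2 ^ k)" "i - 2 ^ k \<le> wt l'" by blast
    then show ?thesis using 2(1,2) by (intro exI[of _ "k # l'"]) simp
  qed
qed

text \<open>The substitution is polynomial in c, so \<open>psq\<close>, defined through c = X,
  computes it for every power series c. The sum may stop at \<open>W\<close> because a non-zero
  \<open>psq i f l\<close> forces i \<le> wt l.\<close>

lemma tot_psq:
  assumes "wt l \<le> W"
  shows "tot c (\<lambda>l. fps_const (f l)) l = (\<Sum>i\<le>W. c ^ i * fps_const (psq i f l))"
  using assms
proof (induction l arbitrary: f W)
  case Nil
  have "(\<Sum>i\<le>W. c ^ i * fps_const (psq i f [])) = (\<Sum>i\<in>{0}. c ^ i * fps_const (psq i f []))"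
    by (rule sum.mono_neutral_right) (auto simp: psq_Nil)
  then show ?case by (simp add: psq_Nil)
next
  case (Cons e l)
  have shift: "c ^ 2 ^ k * tot c (\<lambda>l. fps_const (f (k # l))) l =
      (\<Sum>i\<le>W. c ^ i * fps_const (if i < 2 ^ k then 0 else psq (i - 2 ^ k) (\<lambda>l. f (k # l)) l))"
    if k: "e = Suc k" for k
  proof -
    have "2 ^ k + wt l \<le> W" using Cons.prems k by simp
    then have "tot c (\<lambda>l. fps_const (f (k # l))) l =
        (\<Sum>i\<le>W - 2 ^ k. c ^ i * fps_const (psq i (\<lambda>l. f (k # l)) l))"
      by (intro Cons.IH) simp
    then have "c ^ 2 ^ k * tot c (\<lambda>l. fps_const (f (k # l))) l =
        (\<Sum>i\<le>W - 2 ^ k. c ^ (i + 2 ^ k) * fps_const (psq i (\<lambda>l. f (k # l)) l))"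
      by (simp add: sum_distrib_left power_add mult.assoc mult.left_commute)
    also have "\<dots> = (\<Sum>i\<in>{2 ^ k..W}. c ^ i * fps_const (psq (i - 2 ^ k) (\<lambda>l. f (k # l)) l))"
      by (rule sum.reindex_bij_witness[of _ "\<lambda>i. i - 2 ^ k" "\<lambda>i. i + 2 ^ k"])
        (use \<open>2 ^ k + wt l \<le> W\<close> in auto)
    also have "\<dots> = (\<Sum>i\<le>W. c ^ i * fps_const (if i < 2 ^ k then 0 else psq (i - 2 ^ k) (\<lambda>l. f (k # l)) l))"
      by (rule sum.mono_neutral_cong_left) auto
    finally show ?thesis .
  qed
  have "wt l \<le> W" using Cons.prems by simp
  note IH = Cons.IH[OF this]
  show ?case
  proof (cases e)
    case 0 then show ?thesis by (simp add: psq_Cons IH)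
  next
    case (Suc k)
    have "tot c (\<lambda>l. fps_const (f l)) (e # l) =
        (\<Sum>i\<le>W. c ^ i * fps_const (psq i (\<lambda>l. f (e # l)) l)) +
        (\<Sum>i\<le>W. c ^ i * fps_const (if i < 2 ^ k then 0 else psq (i - 2 ^ k) (\<lambda>l. f (k # l)) l))"
      unfolding shift[OF Suc, symmetric] IH[symmetric] by (simp add: Suc)
    also have "\<dots> = (\<Sum>i\<le>W. c ^ i * fps_const (psq i f (e # l)))"
      by (simp add: psq_Cons Suc distrib_left flip: sum.distrib fps_const_add)
    finally show ?thesis .
  qed
qed

section \<open>The Bullett--Macdonald identity and the Adem relations\<close>

lemma two_eq_zero_fps_bit: "(2 :: bit fps) = 0"
proof -
  have "(2 :: bit fps) = fps_const 2" by (simp only: numeral_fps_const)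
  then show ?thesis by simp
qed

lemma power_add_bit_fps: "(u + v :: bit fps) ^ 2 ^ k = u ^ 2 ^ k + v ^ 2 ^ k"
proof (induction k)
  case (Suc k)
  have "(u + v) ^ 2 ^ Suc k = ((u + v) ^ 2 ^ k)\<^sup>2" by (simp add: power_mult mult.commute[of 2])
  also have "\<dots> = (u ^ 2 ^ k)\<^sup>2 + (v ^ 2 ^ k)\<^sup>2"
    by (simp add: Suc.IH power2_sum two_eq_zero_fps_bit)
  finally show ?case by (simp add: power_mult mult.commute[of 2])
qed simp

text \<open>The substitution t -> t + v t^2 followed by t -> t + u t^2 sends t to t + (u + v) t^2 +
  u^2 v t^4. It depends only on u + v and u^2 v, which is the whole content of
  \<open>Bullett_Macdonald\<close>.\<close>

lemma tot_tot_Cons: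
  fixes u v :: "bit fps"
  shows "tot u (tot v f) (e # l) = tot u (tot v (\<lambda>l. f (e # l))) l +
    (case e of 0 \<Rightarrow> 0 | Suc k \<Rightarrow> (u + v) ^ 2 ^ k * tot u (tot v (\<lambda>l. f (k # l))) l +
      (case k of 0 \<Rightarrow> 0 | Suc j \<Rightarrow> (u\<^sup>2 * v) ^ 2 ^ j * tot u (tot v (\<lambda>l. f (j # l))) l))"
  by (simp add: tot_add tot_scale tot_zero power_add_bit_fps power_mult_distrib algebra_simps
      flip: power_mult split: nat.split)

lemma Bullett_Macdonald:
  fixes u v u' v' :: "bit fps"
  assumes "u + v = u' + v'" "u\<^sup>2 * v = u'\<^sup>2 * v'"
  shows "tot u (tot v f) l = tot u' (tot v' f) l"
proof (induction l arbitrary: f)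
  case (Cons e l)
  show ?case unfolding tot_tot_Cons assms Cons.IH ..
qed simp

text \<open>Between degrees \<open>n\<close> and \<open>n + N\<close> only pairs of operations of
  total degree \<open>N\<close> contribute, so the double sum collapses to a single one.\<close>

lemma tot_tot_psq:
  assumes f: "\<And>l. f l \<noteq> 0 \<Longrightarrow> wt l = n" and l: "wt l = n + N"
  shows "tot u (tot v (\<lambda>l. fps_const (f l))) l =
    (\<Sum>i\<le>N. u ^ i * v ^ (N - i) * fps_const (psq i (psq (N - i) f) l))"
proof -
  let ?W = "wt l"
  have z: "psq i (psq j f) l = 0" if "i + j \<noteq> N" for i j
  proof (rule ccontr)
    assume "psq i (psq j f) l \<noteq> 0"
    from psq_supp[OF this] obtain l' where l': "psq j f l' \<noteq> 0" "wt l = wt l' + i" by blast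
    from psq_supp[OF l'(1)] obtain l'' where "f l'' \<noteq> 0" "wt l' = wt l'' + j" by blast
    then show False using f[of l''] l l'(2) that by simp
  qed
  \<comment> \<open>\<open>tot_psq\<close> with the common bound \<open>?W\<close> applies only to
    monomials of weight at most \<open>?W\<close>; the outer \<open>tot u\<close> at
    \<open>l\<close> looks at no others.\<close>
  have loc: "tot u g l = tot u h l" if "\<And>l'. wt l' \<le> wt l \<Longrightarrow> g l' = h l'" for g h :: "nat list \<Rightarrow> bit fps"
    using that
  proof (induction l arbitrary: g h)
    case (Cons e l)
    have "tot u (\<lambda>l. g (e # l)) l = tot u (\<lambda>l. h (e # l)) l"
      by (rule Cons.IH) (simp add: Cons.prems)
    moreover have "tot u (\<lambda>l. g (k # l)) l = tot u (\<lambda>l. h (k # l)) l" if "e = Suc k" for k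
      by (rule Cons.IH) (simp add: Cons.prems that)
    ultimately show ?case by (simp split: nat.split)
  qed simp
  have "tot u (tot v (\<lambda>l. fps_const (f l))) l =
      tot u (\<lambda>l. \<Sum>j\<le>?W. v ^ j * fps_const (psq j f l)) l"
    by (rule loc) (rule tot_psq)
  also have "\<dots> = (\<Sum>j\<le>?W. v ^ j * tot u (\<lambda>l. fps_const (psq j f l)) l)"
    by (simp only: tot_sum tot_scale)
  also have "\<dots> = (\<Sum>j\<le>?W. v ^ j * (\<Sum>i\<le>?W. u ^ i * fps_const (psq i (psq j f) l)))"
    by (simp only: tot_psq[OF order.refl])
  also have "\<dots> = (\<Sum>j\<le>?W. \<Sum>i\<le>?W. u ^ i * v ^ j * fps_const (psq i (psq j f) l))"
    by (simp add: sum_distrib_left algebra_simps)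
  also have "\<dots> = (\<Sum>i\<le>?W. \<Sum>j\<le>?W. u ^ i * v ^ j * fps_const (psq i (psq j f) l))"
    by (rule sum.swap)
  also have "\<dots> = (\<Sum>i\<le>?W. if i \<le> N then u ^ i * v ^ (N - i) * fps_const (psq i (psq (N - i) f) l) else 0)"
  proof (rule sum.cong[OF refl])
    fix i
    have "(\<Sum>j\<le>?W. u ^ i * v ^ j * fps_const (psq i (psq j f) l)) =
        (\<Sum>j\<in>(if i \<le> N then {N - i} else {}). u ^ i * v ^ j * fps_const (psq i (psq j f) l))"
      by (rule sum.mono_neutral_right) (auto simp: l intro!: disjI2 z)
    then show "(\<Sum>j\<le>?W. u ^ i * v ^ j * fps_const (psq i (psq j f) l)) =
        (if i \<le> N then u ^ i * v ^ (N - i) * fps_const (psq i (psq (N - i) f) l) else 0)" by simp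
  qed
  also have "\<dots> = (\<Sum>i\<le>N. u ^ i * v ^ (N - i) * fps_const (psq i (psq (N - i) f) l))"
    by (rule sum.mono_neutral_cong_right) (auto simp: l)
  finally show ?thesis .
qed

text \<open>The inverse of (1 + X)^(j + 1), by the binomial series for negative exponents, whose
  signs vanish in characteristic 2.\<close>

definition geo :: "nat \<Rightarrow> bit fps" where
  "geo j = Abs_fps (\<lambda>m. of_nat ((m + j) choose j))"

lemma of_nat_bit: "(of_nat n :: bit) = (if odd n then 1 else 0)"
  by (induction n) simp_all

lemma geo_power: "(1 + fps_X) ^ Suc j * geo j = 1"
proof (induction j)
  case 0
  show ?case
  proof (rule fps_ext)
    fix n show "fps_nth ((1 + fps_X) ^ Suc 0 * geo 0) n = fps_nth 1 n"
      by (cases n) (simp_all add: geo_def distrib_right)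
  qed
next
  case (Suc j)
  have "(1 + fps_X) * geo (Suc j) = geo j"
  proof (rule fps_ext)
    fix n show "fps_nth ((1 + fps_X) * geo (Suc j)) n = fps_nth (geo j) n"
      by (cases n) (simp_all add: geo_def distrib_right of_nat_bit binomial_eq_0)
  qed
  then have "(1 + fps_X) ^ Suc (Suc j) * geo (Suc j) = (1 + fps_X) ^ Suc j * geo j"
    by (simp add: ac_simps)
  with Suc.IH show ?case by simp
qed

lemma geo_unique:
  assumes "(1 + fps_X) ^ Suc j * g = 1"
  shows "g = geo j"
proof -
  have "g = (1 + fps_X) ^ Suc j * geo j * g" by (simp only: geo_power mult_1_left)
  also have "\<dots> = (1 + fps_X) ^ Suc j * g * geo j" by (simp only: ac_simps)
  finally show ?thesis by (simp only: assms mult_1_left)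
qed

lemma geo_diag: "0 < m \<Longrightarrow> fps_nth (geo m) m = 0"
proof -
  assume m: "0 < m"
  have "(2 * m) choose m = 2 * ((2 * m - 1) choose (m - 1))"
  proof -
    have "m * ((2 * m) choose m) = 2 * m * ((2 * m - 1) choose (m - 1))"
      using times_binomial_minus1_eq[OF m, of "2 * m"] by simp
    then show ?thesis using m by simp
  qed
  then have "even ((m + m) choose m)" by (simp flip: mult_2)
  then show ?thesis by (simp add: geo_def of_nat_bit)
qed

lemma one_plus_X_power_nth: "fps_nth ((1 + fps_X) ^ n :: bit fps) k = of_nat (n choose k)"
proof (induction n arbitrary: k)
  case 0 then show ?case by (cases k) simp_all
next
  case (Suc n) then show ?case by (cases k) (simp_all add: distrib_right)
qed

text \<open>With u = X + X^2 this coefficient is the residue of u^(i - a - 1) du, since du = dX in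
  characteristic 2, and only the exponent -1 has a residue. The proof checks this through the
  evenness of the central binomial coefficients (\<open>geo_diag\<close>).\<close>

lemma Adem_coeff_left:
  assumes "i \<noteq> a"
  shows "fps_nth ((fps_X\<^sup>2 + fps_X) ^ i * geo a) a = 0"
proof -
  have "(fps_X\<^sup>2 + fps_X :: bit fps) ^ i = fps_X ^ i * (1 + fps_X) ^ i"
    by (simp add: power2_eq_square algebra_simps flip: power_mult_distrib)
  then have *: "fps_nth ((fps_X\<^sup>2 + fps_X) ^ i * geo a) a =
      (if a < i then 0 else fps_nth ((1 + fps_X) ^ i * geo a) (a - i))"
    by (simp add: mult.assoc fps_X_power_mult_nth)
  show ?thesis
  proof (cases "a < i")
    case False
    with assms have i: "i < a" by simp
    have "Suc a = Suc (a - i) + i" using i by simp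
    then have "(1 + fps_X) ^ Suc (a - i) * ((1 + fps_X) ^ i * geo a) = (1 + fps_X) ^ Suc a * geo a"
      by (simp only: power_add mult.assoc)
    then have "(1 + fps_X) ^ Suc (a - i) * ((1 + fps_X) ^ i * geo a) = 1" by (simp only: geo_power)
    then have "(1 + fps_X) ^ i * geo a = geo (a - i)"
      by (rule geo_unique)
    then show ?thesis using * i geo_diag[of "a - i"] by simp
  qed (simp add: *)
qed

lemma fps_nth_sum_const_mult:
  fixes g :: "'a::comm_ring_1 fps"
  shows "fps_nth ((\<Sum>i\<in>A. w i * fps_const (z i)) * g) a = (\<Sum>i\<in>A. fps_nth (w i * g) a * z i)"
proof -
  have "(\<Sum>i\<in>A. w i * fps_const (z i)) * g = (\<Sum>i\<in>A. w i * g * fps_const (z i))"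
    by (simp only: sum_distrib_right mult.assoc mult.commute[of g] )
  then show ?thesis by (simp add: fps_sum_nth)
qed

lemma psq_Adem:
  assumes ab: "0 < a" "a < 2 * b" and f: "\<And>l. f l \<noteq> 0 \<Longrightarrow> wt l = n" and l: "wt l = n + (a + b)"
  shows "psq a (psq b f) l =
    (\<Sum>k\<in>{k. k \<le> a div 2 \<and> odd ((b - k - 1) choose (a - 2 * k))}. psq (a + b - k) (psq k f) l)"
proof -
  \<comment> \<open>In the Bullett--Macdonald identity for $(u, v) = (X^2 + X, 1)$ and $(u', v') = (1 + X, X^2)$,
    the residue functional $g \mapsto [X^a]\, g\,(1 + X)^{-(a+1)}$ sends $u^i$ to $\delta_{ia}$.\<close>
  define N where "N = a + b"
  define Z where "Z i = psq i (psq (N - i) f) l" for i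
  define A where "A = {k. k \<le> a div 2 \<and> odd ((b - k - 1) choose (a - 2 * k))}"
  let ?X = "fps_X :: bit fps"
  have tt: "(\<Sum>i\<le>N. u ^ i * v ^ (N - i) * fps_const (Z i)) = tot u (tot v (\<lambda>l. fps_const (f l))) l" for u v
    unfolding Z_def by (rule tot_tot_psq[symmetric]) (use f l in \<open>auto simp: N_def\<close>)
  have "(?X\<^sup>2 + ?X)\<^sup>2 * 1 = (1 + ?X)\<^sup>2 * ?X\<^sup>2"
    by (simp add: power2_sum two_eq_zero_fps_bit power2_eq_square algebra_simps)
  then have "(\<Sum>i\<le>N. (?X\<^sup>2 + ?X) ^ i * 1 ^ (N - i) * fps_const (Z i)) =
      (\<Sum>i\<le>N. (1 + ?X) ^ i * (?X\<^sup>2) ^ (N - i) * fps_const (Z i))"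
    unfolding tt
    by (intro Bullett_Macdonald) (simp_all add: power2_eq_square algebra_simps two_eq_zero_fps_bit)
  then have "fps_nth ((\<Sum>i\<le>N. (?X\<^sup>2 + ?X) ^ i * 1 ^ (N - i) * fps_const (Z i)) * geo a) a =
      fps_nth ((\<Sum>i\<le>N. (1 + ?X) ^ i * (?X\<^sup>2) ^ (N - i) * fps_const (Z i)) * geo a) a"
    by simp
  moreover have "fps_nth ((\<Sum>i\<le>N. (?X\<^sup>2 + ?X) ^ i * 1 ^ (N - i) * fps_const (Z i)) * geo a) a = Z a"
  proof -
    have "fps_nth ((\<Sum>i\<le>N. (?X\<^sup>2 + ?X) ^ i * 1 ^ (N - i) * fps_const (Z i)) * geo a) a =
        (\<Sum>i\<le>N. fps_nth ((?X\<^sup>2 + ?X) ^ i * geo a) a * Z i)"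
      by (simp only: fps_nth_sum_const_mult power_one mult_1_right)
    also have "\<dots> = (\<Sum>i\<in>{a}. fps_nth ((?X\<^sup>2 + ?X) ^ i * geo a) a * Z i)"
      by (rule sum.mono_neutral_right) (auto simp: N_def Adem_coeff_left)
    also have "\<dots> = Z a"
    proof -
      have "(?X\<^sup>2 + ?X) ^ a = ?X ^ a * (1 + ?X) ^ a"
        by (simp add: power2_eq_square algebra_simps flip: power_mult_distrib)
      then show ?thesis by (simp add: mult.assoc fps_X_power_mult_nth geo_def one_plus_X_power_nth)
    qed
    finally show ?thesis .
  qed
  moreover have "fps_nth ((\<Sum>i\<le>N. (1 + ?X) ^ i * (?X\<^sup>2) ^ (N - i) * fps_const (Z i)) * geo a) a =
      (\<Sum>k\<in>A. Z (N - k))"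
  proof -
    have c: "fps_nth ((1 + ?X) ^ (N - k) * (?X\<^sup>2) ^ k * geo a) a = (if k \<in> A then 1 else 0)" if "k \<le> N" for k
    proof -
      have "fps_nth ((1 + ?X) ^ (N - k) * (?X\<^sup>2) ^ k * geo a) a =
          (if a < 2 * k then 0 else fps_nth ((1 + ?X) ^ (N - k) * geo a) (a - 2 * k))"
        by (simp add: mult.assoc mult.left_commute[of _ "fps_X ^ _"] fps_X_power_mult_nth flip: power_mult)
      also have "\<dots> = (if k \<in> A then 1 else 0)"
      proof (cases "a < 2 * k")
        case False
        \<comment> \<open>From 2k \<le> a < 2b follows k < b, so b - k - 1 is not truncated. The
          surviving factor (1 + X)^(b - k - 1) is the origin of the Adem binomial
          coefficient.\<close>
        have "N - k = (b - k - 1) + Suc a" using ab False by (simp add: N_def)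
        then have "(1 + ?X) ^ (N - k) * geo a = (1 + ?X) ^ (b - k - 1) * ((1 + ?X) ^ Suc a * geo a)"
          by (simp only: power_add mult.assoc)
        then have "(1 + ?X) ^ (N - k) * geo a = (1 + ?X) ^ (b - k - 1)"
          by (simp only: geo_power mult_1_right)
        then show ?thesis using False by (auto simp: one_plus_X_power_nth of_nat_bit A_def)
      qed (auto simp: A_def)
      finally show ?thesis .
    qed
    have "(\<Sum>i\<le>N. (1 + ?X) ^ i * (?X\<^sup>2) ^ (N - i) * fps_const (Z i)) =
        (\<Sum>k\<le>N. (1 + ?X) ^ (N - k) * (?X\<^sup>2) ^ k * fps_const (Z (N - k)))"
      by (rule sum.reindex_bij_witness[of _ "\<lambda>i. N - i" "\<lambda>i. N - i"]) auto
    then have "fps_nth ((\<Sum>i\<le>N. (1 + ?X) ^ i * (?X\<^sup>2) ^ (N - i) * fps_const (Z i)) * geo a) a =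
        (\<Sum>k\<le>N. fps_nth ((1 + ?X) ^ (N - k) * (?X\<^sup>2) ^ k * geo a) a * Z (N - k))"
      by (simp only: fps_nth_sum_const_mult)
    also have "\<dots> = (\<Sum>k\<le>N. if k \<in> A then Z (N - k) else 0)"
      by (rule sum.cong[OF refl]) (simp add: c)
    also have "\<dots> = (\<Sum>k\<in>A. Z (N - k))"
      by (rule sum.mono_neutral_cong_right) (auto simp: A_def N_def)
    finally show ?thesis .
  qed
  ultimately have "Z a = (\<Sum>k\<in>A. Z (N - k))" by simp
  also have "\<dots> = (\<Sum>k\<in>A. psq (N - k) (psq k f) l)"
    by (rule sum.cong[OF refl]) (auto simp: Z_def A_def N_def)
  finally show ?thesis by (simp add: Z_def N_def A_def)
qed


section \<open>The unstable module of additive polynomials\<close>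

text \<open>Symmetry is not imposed: products of symmetric polynomials in disjoint variables, which
  represent tensor products, are in general not symmetric in all variables together.\<close>

definition pol :: "nat \<Rightarrow> (nat list \<Rightarrow> bit) umod" where
  "pol d = \<lparr>comp = (\<lambda>n. \<lparr>carrier = {f. \<forall>l. f l \<noteq> 0 \<longrightarrow> length l = d \<and> wt l = n},
       mult = undefined, one = undefined,
       zero = (\<lambda>l. 0), add = (\<lambda>f g l. f l + g l), smult = (\<lambda>c f l. c * f l)\<rparr>),
     sq = (\<lambda>i n. psq i)\<rparr>"

lemma el_pol: "f \<in> el (pol d) n \<longleftrightarrow> (\<forall>l. f l \<noteq> 0 \<longrightarrow> length l = d \<and> wt l = n)"
  by (simp add: pol_def)

lemma el_polD: "f \<in> el (pol d) n \<Longrightarrow> f l \<noteq> 0 \<Longrightarrow> length l = d \<and> wt l = n"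
  unfolding el_pol by blast

lemma add_pol: "f \<oplus>\<^bsub>comp (pol d) n\<^esub> g = (\<lambda>l. f l + g l)"
  and zero_pol: "\<zero>\<^bsub>comp (pol d) n\<^esub> = (\<lambda>l. 0)"
  and sq_pol: "sq (pol d) i n f = psq i f"
  by (simp_all add: pol_def)

lemma pol_vector_space: "module F2 (comp (pol d) n)"
proof (rule F2_moduleI)
  fix f g assume f: "f \<in> el (pol d) n" and g: "g \<in> el (pol d) n"
  show "f \<oplus>\<^bsub>comp (pol d) n\<^esub> g \<in> el (pol d) n"
    unfolding el_pol add_pol
  proof (intro allI impI)
    fix l assume "f l + g l \<noteq> 0"
    then have "f l \<noteq> 0 \<or> g l \<noteq> 0" by auto
    then show "length l = d \<and> wt l = n" using f g el_polD by blast
  qed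
qed (simp_all add: el_pol add_pol zero_pol pol_def fun_eq_iff ac_simps)

lemma lin_eval_pol: "(\<lambda>f. f l) \<in> lin (comp (pol d) n) F2"
  by (rule linI[OF pol_vector_space F2_module]) (simp_all add: add_pol)

lemma finsum_F2: "finite A \<Longrightarrow> (\<Oplus>\<^bsub>F2\<^esub>k\<in>A. g k) = (\<Sum>k\<in>A. g k)"
proof (induction A rule: finite_induct)
  interpret Module.module F2 F2 by (rule F2_module)
  case empty show ?case by simp
next
  interpret Module.module F2 F2 by (rule F2_module)
  case (insert a A) then show ?case by simp
qed

lemma finsum_pol:
  assumes "finite A" "g \<in> A \<rightarrow> el (pol d) n"
  shows "(\<Oplus>\<^bsub>comp (pol d) n\<^esub>k\<in>A. g k) = (\<lambda>l. \<Sum>k\<in>A. g k l)"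
  using lin_finsum[OF pol_vector_space F2_module lin_eval_pol assms] finsum_F2[OF assms(1)]
  by (simp add: fun_eq_iff)

lemma psq_closed: "f \<in> el (pol d) n \<Longrightarrow> psq i f \<in> el (pol d) (n + i)"
  unfolding el_pol using psq_supp by metis

theorem pol_unstable: "unstable_module (pol d)"
proof (rule unstable_module.intro)
  show "module F2 (comp (pol d) n)" for n by (rule pol_vector_space)
  show "sq (pol d) i n \<in> lin (comp (pol d) n) (comp (pol d) (n + i))" for i n
    by (rule linI[OF pol_vector_space pol_vector_space]) (simp_all add: sq_pol psq_closed add_pol psq_add fun_eq_iff)
  fix i n f assume f: "f \<in> el (pol d) n"
  show "sq (pol d) 0 n f = f" by (simp add: sq_pol psq_0 fun_eq_iff)
  show "sq (pol d) i n f = \<zero>\<^bsub>comp (pol d) (n + i)\<^esub>" if "n < i"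
  proof (rule ext, rule ccontr)
    fix l assume "sq (pol d) i n f l \<noteq> \<zero>\<^bsub>comp (pol d) (n + i)\<^esub> l"
    then have "psq i f l \<noteq> 0" by (simp add: sq_pol zero_pol)
    from psq_supp[OF this] obtain l' where "f l' \<noteq> 0" "i \<le> wt l'" by blast
    then show False using el_polD[OF f] that by fastforce
  qed
  fix j assume ij: "0 < i" "i < 2 * j"
  let ?A = "{k. k \<le> i div 2 \<and> odd ((j - k - 1) choose (i - 2 * k))}"
  have c: "psq (i + j - k) (psq k f) \<in> el (pol d) (n + j + i)" if "k \<in> ?A" for k
  proof -
    have "n + j + i = n + k + (i + j - k)" using that ij by auto
    then show ?thesis using psq_closed[OF psq_closed[OF f]] by metis
  qed
  have "psq i (psq j f) l = (\<Sum>k\<in>?A. psq (i + j - k) (psq k f) l)" for l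
  proof (cases "length l = d \<and> wt l = n + j + i")
    case True
    show ?thesis
      by (rule psq_Adem[OF ij, of f n]) (use True el_polD[OF f] in \<open>auto simp: algebra_simps\<close>)
  next
    case False
    have "psq (i + j - k) (psq k f) l = 0" if "k \<in> ?A" for k
      using False el_polD[OF c[OF that], of l] by (rule_tac ccontr) blast
    moreover have "psq i (psq j f) l = 0"
      using False el_polD[OF psq_closed[OF psq_closed[OF f]], of i j l] by (rule_tac ccontr) blast
    ultimately show ?thesis by (simp add: sum.neutral)
  qed
  moreover have "(\<lambda>k. psq (i + j - k) (psq k f)) \<in> ?A \<rightarrow> el (pol d) (n + j + i)"
    using c by blast
  ultimately show "sq (pol d) i (n + j) (sq (pol d) j n f) =
      (\<Oplus>\<^bsub>comp (pol d) (n + j + i)\<^esub>k\<in>?A. sq (pol d) (i + j - k) (n + k) (sq (pol d) k n f))"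
    by (simp add: sq_pol finsum_pol fun_eq_iff)
qed

interpretation Pol: unstable_module "pol d" for d by (rule pol_unstable)

section \<open>Symmetric polynomials\<close>

definition symm :: "(nat list \<Rightarrow> 'b) \<Rightarrow> bool" where
  "symm f \<longleftrightarrow> (\<forall>p x y q. f (p @ x # y # q) = f (p @ y # x # q))"

lemma symm_move: "symm f \<Longrightarrow> f (p @ x # q) = f (x # p @ q)"
proof (induction p arbitrary: x q rule: rev_induct)
  case (snoc z p)
  have "f ((p @ [z]) @ x # q) = f (p @ x # z # q)" using snoc.prems by (simp add: symm_def)
  then show ?case using snoc.IH[OF snoc.prems] by simp
qed simp

lemma symm_Cons: "symm f \<Longrightarrow> symm (\<lambda>l. f (x # l))"
  unfolding symm_def by (metis append_Cons)

lemma symm_mset: "symm f \<Longrightarrow> mset l = mset l' \<Longrightarrow> f l = f l'"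
proof (induction l arbitrary: f l')
  case (Cons x l)
  then have "x \<in> set l'" using mset_eq_setD by fastforce
  then obtain p q where l': "l' = p @ x # q" by (auto dest: split_list)
  have "mset l = mset (p @ q)" using Cons.prems(2) l' by simp
  from Cons.IH[OF symm_Cons[OF Cons.prems(1)] this] show ?case
    by (simp add: l' symm_move[OF Cons.prems(1)])
qed simp

lemma symm_add: "symm f \<Longrightarrow> symm g \<Longrightarrow> symm (\<lambda>l. f l + g l)"
  by (simp add: symm_def)

lemma symm_psq: "symm f \<Longrightarrow> symm (psq i f)"
proof -
  have "psq i f (p @ x # y # q) = psq i f (p @ y # x # q)" if "symm f" for p x y q
    using that
  proof (induction p arbitrary: f i)
    case Nil
    have c: "psq j (\<lambda>l. f (a # b # l)) q = psq j (\<lambda>l. f (b # a # l)) q" for a b j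
      using Nil[unfolded symm_def, rule_format, of "[]"] by simp
    show ?case
      by (cases x; cases y; simp add: psq_Cons)
        (use c in \<open>auto simp: diff_commute add_ac intro!: arg_cong2[where f = "(+)"]\<close>)
  next
    case (Cons z p)
    from Cons.IH[OF symm_Cons[OF Cons.prems]] show ?case by (simp add: psq_Cons split: nat.split)
  qed
  then show "symm f \<Longrightarrow> symm (psq i f)" unfolding symm_def[of "psq i f"] by blast
qed

section \<open>Coordinates of elements of a span\<close>

text \<open>Over the field with two elements a linear combination is given by the finite set of
  indices with coefficient 1.\<close>

definition f2_span :: "(bit, 'v) module \<Rightarrow> ('i \<Rightarrow> 'v) \<Rightarrow> 'i set \<Rightarrow> 'v set" where
  "f2_span V b I = {\<Oplus>\<^bsub>V\<^esub>i\<in>P. b i | P. finite P \<and> P \<subseteq> I}"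

context
  fixes V :: "(bit, 'v) module" and b :: "'i \<Rightarrow> 'v" and I :: "'i set"
  assumes V: "module F2 V" and bI: "b \<in> I \<rightarrow> carrier V"
begin

lemma f2_span_generator: "i \<in> I \<Longrightarrow> b i \<in> carrier V"
  using bI by blast

interpretation Module.module F2 V by (fact V)

lemma f2_span_zero: "\<zero>\<^bsub>V\<^esub> \<in> f2_span V b I"
  unfolding f2_span_def by (intro CollectI exI[of _ "{}"]) simp

lemma f2_span_closed: "z \<in> f2_span V b I \<Longrightarrow> z \<in> carrier V"
  unfolding f2_span_def using f2_span_generator by (auto intro!: finsum_closed)

lemma f2_span_add_base:
  assumes "z \<in> f2_span V b I" and i: "i \<in> I"
  shows "z \<oplus>\<^bsub>V\<^esub> b i \<in> f2_span V b I"
proof -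
  obtain P where P: "finite P" "P \<subseteq> I" and z: "z = (\<Oplus>\<^bsub>V\<^esub>i\<in>P. b i)"
    using assms by (auto simp: f2_span_def)
  show ?thesis
  proof (cases "i \<in> P")
    case True
    let ?y = "\<Oplus>\<^bsub>V\<^esub>j\<in>P - {i}. b j"
    have y: "?y \<in> carrier V" using P f2_span_generator by (auto intro!: finsum_closed)
    have "z = (\<Oplus>\<^bsub>V\<^esub>j\<in>insert i (P - {i}). b j)" using True by (simp add: z insert_absorb)
    also have "\<dots> = b i \<oplus>\<^bsub>V\<^esub> ?y" using P f2_span_generator i by (subst finsum_insert) auto
    finally have "z \<oplus>\<^bsub>V\<^esub> b i = ?y \<oplus>\<^bsub>V\<^esub> (b i \<oplus>\<^bsub>V\<^esub> b i)" using y f2_span_generator[OF i] by (simp add: a_ac)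
    also have "\<dots> = ?y" using y by (simp add: F2_add_self[OF V f2_span_generator[OF i]])
    finally show ?thesis using P unfolding f2_span_def by (intro CollectI exI[of _ "P - {i}"]) auto
  next
    case False
    have "(\<Oplus>\<^bsub>V\<^esub>j\<in>insert i P. b j) = b i \<oplus>\<^bsub>V\<^esub> z" using P f2_span_generator i False by (subst finsum_insert) (auto simp: z)
    also have "\<dots> = z \<oplus>\<^bsub>V\<^esub> b i" using f2_span_generator[OF i] f2_span_closed[OF assms(1)] by (simp add: a_comm)
    finally show ?thesis using P i unfolding f2_span_def by (intro CollectI exI[of _ "insert i P"]) auto
  qed
qed

lemma f2_span_induct [consumes 1, case_names zero add]:
  assumes "z \<in> f2_span V b I" and z: "P \<zero>\<^bsub>V\<^esub>"
    and a: "\<And>y i. y \<in> f2_span V b I \<Longrightarrow> P y \<Longrightarrow> i \<in> I \<Longrightarrow> P (y \<oplus>\<^bsub>V\<^esub> b i)"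
  shows "P z"
proof -
  obtain A where A: "finite A" "A \<subseteq> I" and z': "z = (\<Oplus>\<^bsub>V\<^esub>i\<in>A. b i)"
    using assms by (auto simp: f2_span_def)
  have "P (\<Oplus>\<^bsub>V\<^esub>i\<in>A. b i)" using A
  proof (induction A rule: finite_induct)
    case (insert i A)
    have s: "(\<Oplus>\<^bsub>V\<^esub>i\<in>A. b i) \<in> f2_span V b I" using insert by (auto simp: f2_span_def)
    have "(\<Oplus>\<^bsub>V\<^esub>j\<in>insert i A. b j) = (\<Oplus>\<^bsub>V\<^esub>i\<in>A. b i) \<oplus>\<^bsub>V\<^esub> b i"
      using insert f2_span_generator f2_span_closed[OF s] by (subst finsum_insert) (auto simp: a_comm)
    then show ?case using a[OF s] insert by auto
  qed (use z in simp)
  then show ?thesis by (simp add: z')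
qed

lemma f2_span_add:
  assumes x: "x \<in> f2_span V b I" and "y \<in> f2_span V b I"
  shows "x \<oplus>\<^bsub>V\<^esub> y \<in> f2_span V b I"
  using assms(2)
proof (induction rule: f2_span_induct)
  case zero then show ?case using x f2_span_closed[OF x] by simp
next
  case (add y i)
  have "x \<oplus>\<^bsub>V\<^esub> (y \<oplus>\<^bsub>V\<^esub> b i) = x \<oplus>\<^bsub>V\<^esub> y \<oplus>\<^bsub>V\<^esub> b i"
    using add f2_span_closed x f2_span_generator by (simp add: a_assoc)
  then show ?case using f2_span_add_base[OF add.IH add.hyps(2)] by simp
qed

lemma f2_span_base: "i \<in> I \<Longrightarrow> b i \<in> f2_span V b I"
  using f2_span_add_base[OF f2_span_zero, of i] f2_span_generator[of i] by simp

lemma f2_span_finsum: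
  "finite A \<Longrightarrow> (\<And>k. k \<in> A \<Longrightarrow> g k \<in> f2_span V b I) \<Longrightarrow> (\<Oplus>\<^bsub>V\<^esub>k\<in>A. g k) \<in> f2_span V b I"
proof (induction A rule: finite_induct)
  case empty show ?case using f2_span_zero by simp
next
  case (insert k A)
  then have "g \<in> A \<rightarrow> carrier V" "g k \<in> carrier V" using f2_span_closed by auto
  then show ?case using insert by (simp add: f2_span_add)
qed

text \<open>Adding \<open>b i\<close> to \<open>z\<close> changes the coordinate
  \<open>\<kappa> i\<close> and no other, so a non-zero coordinate can be removed; induction on the
  number of non-zero coordinates ends at an element that \<open>sep\<close> makes zero.\<close>

lemma f2_span_separating:
  assumes I: "finite I"
    and \<kappa>: "\<And>i. i \<in> I \<Longrightarrow> \<kappa> i \<in> lin V F2" "\<And>i j. i \<in> I \<Longrightarrow> j \<in> I \<Longrightarrow> \<kappa> i (b j) = (if i = j then 1 else 0)"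
    and sep: "\<And>z. z \<in> carrier V \<Longrightarrow> (\<And>i. i \<in> I \<Longrightarrow> \<kappa> i z = 0) \<Longrightarrow> z = \<zero>\<^bsub>V\<^esub>"
    and z: "z \<in> carrier V"
  shows "z \<in> f2_span V b I"
  using z
proof (induction "card {i \<in> I. \<kappa> i z \<noteq> 0}" arbitrary: z rule: less_induct)
  case less
  show ?case
  proof (cases "\<exists>i\<in>I. \<kappa> i z \<noteq> 0")
    case False
    then have "z = \<zero>\<^bsub>V\<^esub>" by (intro sep less.prems) blast
    then show ?thesis using f2_span_zero by simp
  next
    case True
    then obtain i where i: "i \<in> I" "\<kappa> i z = 1" by auto
    let ?y = "z \<oplus>\<^bsub>V\<^esub> b i"
    have c: "\<kappa> j ?y = \<kappa> j z + (if j = i then 1 else 0)" if "j \<in> I" for j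
      using lin_add[OF \<kappa>(1)[OF that] less.prems f2_span_generator[OF i(1)]] \<kappa>(2)[OF that i(1)] by simp
    have "{j \<in> I. \<kappa> j ?y \<noteq> 0} \<subset> {j \<in> I. \<kappa> j z \<noteq> 0}"
    proof (rule psubsetI)
      show "{j \<in> I. \<kappa> j ?y \<noteq> 0} \<subseteq> {j \<in> I. \<kappa> j z \<noteq> 0}"
        using c i by (auto split: if_splits)
      have "\<kappa> i ?y = 0" using c[OF i(1)] i(2) by simp
      then show "{j \<in> I. \<kappa> j ?y \<noteq> 0} \<noteq> {j \<in> I. \<kappa> j z \<noteq> 0}"
        using i by (metis (mono_tags, lifting) mem_Collect_eq zero_neq_one)
    qed
    then have "card {j \<in> I. \<kappa> j ?y \<noteq> 0} < card {j \<in> I. \<kappa> j z \<noteq> 0}"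
      by (intro psubset_card_mono) (use I in auto)
    from less.hyps[OF this] have "?y \<in> f2_span V b I" using less.prems f2_span_generator[OF i(1)] by simp
    from f2_span_add_base[OF this i(1)] have "z \<oplus>\<^bsub>V\<^esub> (b i \<oplus>\<^bsub>V\<^esub> b i) \<in> f2_span V b I"
      using less.prems f2_span_generator[OF i(1)] by (simp add: a_assoc)
    then show ?thesis using less.prems by (simp add: F2_add_self[OF V f2_span_generator[OF i(1)]])
  qed
qed

text \<open>The coordinate \<open>\<kappa> i\<close> of a sum over \<open>A\<close> is 1 for every
  \<open>i\<close> in \<open>A\<close>, so only the empty sum is annihilated by all coordinates.
  This is how kernels are shown to vanish in \<open>hat2_inject\<close> and in the final
  theorem.\<close>

lemma f2_span_coordinates:
  assumes z: "z \<in> f2_span V b I"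
    and \<kappa>: "\<And>i. i \<in> I \<Longrightarrow> \<kappa> i \<in> lin V F2" "\<And>i j. i \<in> I \<Longrightarrow> j \<in> I \<Longrightarrow> \<kappa> i (b j) = (if i = j then 1 else 0)"
    and zero: "\<And>i. i \<in> I \<Longrightarrow> \<kappa> i z = 0"
  shows "z = \<zero>\<^bsub>V\<^esub>"
proof -
  obtain A where A: "finite A" "A \<subseteq> I" and z': "z = (\<Oplus>\<^bsub>V\<^esub>i\<in>A. b i)"
    using z by (auto simp: f2_span_def)
  have "i \<notin> A" for i
  proof
    assume i: "i \<in> A"
    then have iI: "i \<in> I" using A by blast
    have "\<kappa> i z = (\<Oplus>\<^bsub>F2\<^esub>j\<in>A. \<kappa> i (b j))"
      unfolding z' by (rule lin_finsum[OF V F2_module \<kappa>(1)[OF iI] A(1)]) (use A f2_span_generator in auto)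
    also have "\<dots> = (\<Sum>j\<in>A. \<kappa> i (b j))" by (rule finsum_F2[OF A(1)])
    also have "\<dots> = (\<Sum>j\<in>A. if i = j then 1 else 0)"
      by (rule sum.cong[OF refl]) (use \<kappa>(2)[OF iI] A in auto)
    also have "\<dots> = 1" using A i by simp
    finally show False using zero[OF iI] by simp
  qed
  then have "A = {}" by blast
  then show ?thesis by (simp add: z')
qed

end

section \<open>Free unstable modules as symmetric polynomials\<close>

interpretation PV: Module.module F2 "comp (pol d) n" for n d by (rule pol_vector_space)
interpretation FV: Module.module F2 "comp (F n) d" for n d by (rule F_vector_space)

abbreviation fcls :: "nat \<Rightarrow> nat \<Rightarrow> fterm \<Rightarrow> fterm set" where
  "fcls n d t \<equiv> Collect (frel n d t)"

lemma fcls_in: "frel n d t t \<Longrightarrow> fcls n d t \<in> el (F n) d"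
  by (simp add: comp_F frel.cls_in)

lemma el_FE:
  assumes "\<theta> \<in> el (F n) d"
  obtains t where "frel n d t t" "\<theta> = fcls n d t"
  using assms by (auto simp: comp_F frel.carrier_quot)

lemma fcls_add: "frel n d s s \<Longrightarrow> frel n d t t \<Longrightarrow> fcls n d (FAdd s t) = fcls n d s \<oplus>\<^bsub>comp (F n) d\<^esub> fcls n d t"
  by (simp add: comp_F frel.add_quot)

lemma fcls_zero: "fcls n d FZero = \<zero>\<^bsub>comp (F n) d\<^esub>"
  by (simp add: comp_F frel.zero_quot)

lemma F_induct [consumes 1, case_names iota zero add sq]:
  assumes "\<theta> \<in> el (F n) d" and "P n (iota n)" and "\<And>d. P d \<zero>\<^bsub>comp (F n) d\<^esub>"
    and add: "\<And>d \<theta> \<xi>. \<theta> \<in> el (F n) d \<Longrightarrow> \<xi> \<in> el (F n) d \<Longrightarrow> P d \<theta> \<Longrightarrow> P d \<xi> \<Longrightarrow> P d (\<theta> \<oplus>\<^bsub>comp (F n) d\<^esub> \<xi>)"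
    and sq: "\<And>d i \<theta>. \<theta> \<in> el (F n) d \<Longrightarrow> P d \<theta> \<Longrightarrow> P (d + i) (sq (F n) i d \<theta>)"
  shows "P d \<theta>"
proof -
  have "fwf n d t \<Longrightarrow> P d (fcls n d t)" for t
  proof (induction t arbitrary: d)
    case FGen then show ?case using assms(2) by (simp add: iota_def)
  next
    case FZero then show ?case using assms(3) by (simp add: fcls_zero)
  next
    case (FAdd s t)
    then have "fwf n d s" "fwf n d t" by simp_all
    then show ?case using add[OF fcls_in fcls_in] FAdd.IH by (simp add: fcls_add fwf_iff)
  next
    case (FSq i t)
    then have w: "i \<le> d" "fwf n (d - i) t" by simp_all
    have "frel n (d - i) t t" "P (d - i) (fcls n (d - i) t)"
      using w(2) FSq.IH[OF w(2)] by (simp_all only: fwf_iff)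
    with w(1) show ?case using sq[OF fcls_in, of "d - i" t i] by (simp add: sq_F)
  qed
  then show ?thesis using assms(1) by (auto elim!: el_FE simp: fwf_iff)
qed

text \<open>The monomial t_1 ... t_d: list entries are binary logarithms of exponents, hence the
  zeros.\<close>

definition ones :: "nat \<Rightarrow> nat list \<Rightarrow> bit" where
  "ones d l = (if l = replicate d 0 then 1 else 0)"

definition hat :: "nat \<Rightarrow> nat \<Rightarrow> fterm set \<Rightarrow> nat list \<Rightarrow> bit" where
  "hat d = classify (pol d) d (ones d)"

lemma ones_in: "ones d \<in> el (pol d) d"
proof -
  have "wt (replicate d 0) = d" by (induction d) simp_all
  then show ?thesis by (auto simp: el_pol ones_def)
qed

lemma hat_hom: "hat d \<in> umod_hom (F d) (pol d)"
  unfolding hat_def by (rule Pol.classify_hom[OF ones_in])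

lemma hat_iota: "hat d d (iota d) = ones d"
  unfolding hat_def by (rule Pol.classify_iota[OF ones_in])

lemma hat_in: "\<theta> \<in> el (F d) n \<Longrightarrow> hat d n \<theta> \<in> el (pol d) n"
  by (rule umod_hom_closed[OF hat_hom])

lemma hat_add: "\<theta> \<in> el (F d) n \<Longrightarrow> \<xi> \<in> el (F d) n \<Longrightarrow>
    hat d n (\<theta> \<oplus>\<^bsub>comp (F d) n\<^esub> \<xi>) = (\<lambda>l. hat d n \<theta> l + hat d n \<xi> l)"
  by (simp add: umod_hom_add[OF hat_hom] add_pol)

lemma hat_zero: "hat d n \<zero>\<^bsub>comp (F d) n\<^esub> = (\<lambda>l. 0)"
  using lin_zero[OF F_vector_space pol_vector_space umod_hom_lin[OF hat_hom]] by (simp add: zero_pol)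

lemma hat_sq: "\<theta> \<in> el (F d) n \<Longrightarrow> hat d (n + i) (sq (F d) i n \<theta>) = psq i (hat d n \<theta>)"
  by (simp add: umod_hom_sq[OF hat_hom] sq_pol)

lemma lin_hat: "(\<lambda>\<theta>. hat d n \<theta> l) \<in> lin (comp (F d) n) F2"
  by (rule linI[OF F_vector_space F2_module]) (simp_all add: hat_add)

lemma symm_ones: "symm (ones d)"
proof -
  have "l = replicate d 0 \<longleftrightarrow> length l = d \<and> (\<forall>x\<in>set l. x = 0)" for l :: "nat list"
    by (metis length_replicate replicate_eqI set_replicate_conv_if singletonD empty_iff)
  then show ?thesis unfolding symm_def ones_def by auto
qed

lemma symm_hat: "\<theta> \<in> el (F d) n \<Longrightarrow> symm (hat d n \<theta>)"
proof (induction rule: F_induct)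
  case iota show ?case by (simp add: hat_iota symm_ones)
next
  case (zero n) show ?case by (simp add: hat_zero symm_def)
next
  case (add n \<theta> \<xi>) then show ?case by (simp add: hat_add symm_add)
next
  case (sq n i \<theta>) then show ?case by (simp add: hat_sq symm_psq)
qed

text \<open>On degree n the operation Sq^n has to double every factor, so it is the Frobenius map:
  all entries of a list rise by one, and monomials with an entry 0 are not hit.\<close>

lemma psq_top: "f \<in> el (pol d) n \<Longrightarrow> psq n f l = (if 0 \<in> set l then 0 else f (map (\<lambda>e. e - 1) l))"
proof (induction l arbitrary: f d n)
  case Nil
  show ?case using el_polD[OF Nil, of "[]"] by (cases "f [] = 0") (simp_all add: psq_Nil)
next
  case (Cons e l)
  have sub: "(\<lambda>l. f (x # l)) \<in> el (pol (d - 1)) (n - 2 ^ x)" for x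
    unfolding el_pol
  proof (intro allI impI)
    fix l assume "f (x # l) \<noteq> 0"
    from el_polD[OF Cons.prems this] show "length l = d - 1 \<and> wt l = n - 2 ^ x" by auto
  qed
  \<comment> \<open>If the first factor stays as it is, Sq^n acts on the other factors, whose total
    degree is less than n; instability gives 0.\<close>
  have a: "psq n (\<lambda>l. f (x # l)) l = 0" for x
  proof (cases "\<exists>l. f (x # l) \<noteq> 0")
    case True
    then have "2 ^ x \<le> n" using el_polD[OF Cons.prems] by fastforce
    show ?thesis
    proof (rule ccontr)
      assume "psq n (\<lambda>l. f (x # l)) l \<noteq> 0"
      from psq_supp[OF this] obtain l' where l': "f (x # l') \<noteq> 0" "n \<le> wt l'" by blast
      moreover have "(0::nat) < 2 ^ x" by simp
      moreover have "2 ^ x + wt l' = n" using el_polD[OF Cons.prems l'(1)] by simp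
      ultimately show False by linarith
    qed
  qed (simp add: psq_zero)
  show ?case
  proof (cases e)
    case 0 then show ?thesis by (simp add: psq_Cons a)
  next
    case (Suc k)
    have "n < 2 ^ k \<Longrightarrow> f (k # l') = 0" for l'
      using el_polD[OF Cons.prems, of "k # l'"] by (rule_tac ccontr) auto
    then show ?thesis using Cons.IH[OF sub, of k] by (simp add: Suc psq_Cons a)
  qed
qed

section \<open>Comparison of F(d + 1), modulo the image of Sq_0, with F(d)\<close>

lemma F_low_degree: "\<theta> \<in> el (F d) n \<Longrightarrow> n < d \<Longrightarrow> \<theta> = \<zero>\<^bsub>comp (F d) n\<^esub>"
proof (induction rule: F_induct)
  case (sq n i \<theta>)
  then show ?case using lin_zero[OF F_vector_space F_vector_space Fn.sq_linear] by simp
qed simp_all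

lemma F_zero_generator: "\<theta> \<in> el (F 0) n \<Longrightarrow> \<theta> = \<zero>\<^bsub>comp (F 0) n\<^esub> \<or> n = 0 \<and> \<theta> = iota 0"
proof (induction rule: F_induct)
  case (add n \<theta> \<xi>)
  show ?case using add.hyps add.IH F2_add_self[OF F_vector_space iota_in, of 0] by (elim disjE conjE) simp_all
next
  case (sq n i \<theta>)
  then show ?case using lin_zero[OF F_vector_space F_vector_space Fn.sq_linear, of 0 i n]
      Fn.sq_zero'[OF iota_in, of 0] Fn.unstable'[of 0 i "iota 0" 0] iota_in[of 0]
    by (cases "i = 0") auto
qed simp_all

text \<open>\<open>F d\<close> and \<open>F (Suc d)\<close> have the same terms, with degrees shifted by one, and passing to
  \<open>F d\<close> amounts to killing the image of $Sq_0$.\<close>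

definition Sq0_image :: "nat \<Rightarrow> nat \<Rightarrow> fterm set \<Rightarrow> bool" where
  "Sq0_image d n \<theta> \<longleftrightarrow> \<theta> = \<zero>\<^bsub>comp (F d) n\<^esub> \<or> (\<exists>k. n = k + k \<and> (\<exists>\<xi>\<in>el (F d) k. \<theta> = sq (F d) k k \<xi>))"

lemma Sq0_image_in: "Sq0_image d n \<theta> \<Longrightarrow> \<theta> \<in> el (F d) n"
  by (auto simp: Sq0_image_def Fn.sq_closed)

lemma Sq0_image_zero: "Sq0_image d n \<zero>\<^bsub>comp (F d) n\<^esub>"
  by (simp add: Sq0_image_def)

lemma Sq0_image_add: "Sq0_image d n \<theta> \<Longrightarrow> Sq0_image d n \<xi> \<Longrightarrow> Sq0_image d n (\<theta> \<oplus>\<^bsub>comp (F d) n\<^esub> \<xi>)"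
proof -
  assume t: "Sq0_image d n \<theta>" and x: "Sq0_image d n \<xi>"
  show ?thesis
  proof (cases "\<theta> = \<zero>\<^bsub>comp (F d) n\<^esub> \<or> \<xi> = \<zero>\<^bsub>comp (F d) n\<^esub>")
    case True then show ?thesis using t x Sq0_image_in[OF t] Sq0_image_in[OF x] by auto
  next
    case False
    then obtain k \<alpha> where k: "n = k + k" "\<alpha> \<in> el (F d) k" "\<theta> = sq (F d) k k \<alpha>"
      using t unfolding Sq0_image_def by blast
    from False obtain k' \<beta> where k': "n = k' + k'" "\<beta> \<in> el (F d) k'" "\<xi> = sq (F d) k' k' \<beta>"
      using x unfolding Sq0_image_def by blast
    have "k' = k" using k(1) k'(1) by simp
    note k = k k'[unfolded this]
    show ?thesis unfolding Sq0_image_def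
      by (intro disjI2 exI[of _ k] conjI bexI[of _ "\<alpha> \<oplus>\<^bsub>comp (F d) k\<^esub> \<beta>"]) (use k in \<open>simp_all add: Fn.sq_plus\<close>)
  qed
qed

text \<open>The relation behind this is Sq^(2j) Sq_0 = Sq_0 Sq^j. In the Adem expansion of Sq^i Sq^k
  on degree k, the term Sq^(i+k-j) Sq^j acts on degree k + j in its outer operation: for i > 2j it
  vanishes by instability, and for i = 2j it is Sq_0 Sq^j. The boundary case i = 2k is Sq_0 applied
  once more.\<close>

lemma Sq0_image_sq:
  assumes "Sq0_image d n \<theta>"
  shows "Sq0_image d (n + i) (sq (F d) i n \<theta>)"
proof -
  consider "\<theta> = \<zero>\<^bsub>comp (F d) n\<^esub>" | k \<xi> where "n = k + k" "\<xi> \<in> el (F d) k" "\<theta> = sq (F d) k k \<xi>"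
    using assms by (auto simp: Sq0_image_def)
  then show ?thesis
  proof cases
    case 1
    then show ?thesis using lin_zero[OF F_vector_space F_vector_space Fn.sq_linear] by (simp add: Sq0_image_zero)
  next
    case (2 k \<xi>)
    note in2 = Fn.sq_closed[OF 2(2), of k]
    consider "i = 0" | "0 < i" "i < 2 * k" | "i = 2 * k" | "2 * k < i" by linarith
    then show ?thesis
    proof cases
      case 1 then show ?thesis using assms Sq0_image_in[OF assms] by (simp add: Fn.sq_zero')
    next
      case i: 2
      let ?A = "{j. j \<le> i div 2 \<and> odd ((k - j - 1) choose (i - 2 * j))}"
      let ?D = "k + k + i"
      have c: "sq (F d) (i + k - j) (k + j) (sq (F d) j k \<xi>) \<in> el (F d) ?D" if "j \<in> ?A" for j
      proof -
        have "?D = k + j + (i + k - j)" using that i by auto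
        then show ?thesis using Fn.sq_closed[OF Fn.sq_closed[OF 2(2)]] by metis
      qed
      have im: "Sq0_image d ?D (sq (F d) (i + k - j) (k + j) (sq (F d) j k \<xi>))" if j: "j \<in> ?A" for j
      proof (cases "i = 2 * j")
        case True
        then show ?thesis unfolding Sq0_image_def
          by (intro disjI2 exI[of _ "k + j"] conjI bexI[of _ "sq (F d) j k \<xi>"])
            (use 2(2) in \<open>simp_all add: Fn.sq_closed mult_2 add.commute[of j k]\<close>)
      next
        case False
        then have "k + j < i + k - j" using j by auto
        moreover have "?D = k + j + (i + k - j)" using j i by auto
        ultimately show ?thesis using Fn.unstable'[OF _ Fn.sq_closed[OF 2(2), of j], of "i + k - j"]
          by (metis Sq0_image_zero)
      qed
      have "finite B \<Longrightarrow> B \<subseteq> ?A \<Longrightarrow>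
          Sq0_image d ?D (\<Oplus>\<^bsub>comp (F d) ?D\<^esub>j\<in>B. sq (F d) (i + k - j) (k + j) (sq (F d) j k \<xi>))" for B
      proof (induction B rule: finite_induct)
        case (insert j B)
        then show ?case using c im by (subst FV.finsum_insert) (auto intro!: Sq0_image_add)
      qed (simp add: Sq0_image_zero)
      from this[of ?A] show ?thesis
        unfolding 2(1,3) Fn.adem'[OF i 2(2)] by simp
    next
      case 3
      then show ?thesis unfolding Sq0_image_def using 2 in2
        by (intro disjI2 exI[of _ "k + k"]) (auto simp: mult_2)
    next
      case 4
      then show ?thesis using Fn.unstable'[OF _ in2, of i] 2 by (simp add: Sq0_image_zero mult_2)
    qed
  qed
qed


lemma F_add_cancel:
  assumes "x \<in> el (F n) d" "y \<in> el (F n) d"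
  shows "x \<oplus>\<^bsub>comp (F n) d\<^esub> y \<oplus>\<^bsub>comp (F n) d\<^esub> y = x"
  using assms F2_add_self[OF F_vector_space assms(2)] by (simp add: FV.a_assoc)

lemma F_add_eq_zero:
  assumes "x \<in> el (F n) d" "y \<in> el (F n) d" "x \<oplus>\<^bsub>comp (F n) d\<^esub> y = \<zero>\<^bsub>comp (F n) d\<^esub>"
  shows "x = y"
  using F_add_cancel[OF assms(1,2)] assms by simp

text \<open>Congruence modulo the image of Sq_0, put as a relation between terms so that a
  derivation in \<open>frel\<close> for a generator of another degree can be followed rule by
  rule.\<close>

definition frel_mod :: "nat \<Rightarrow> nat \<Rightarrow> fterm \<Rightarrow> fterm \<Rightarrow> bool" where
  "frel_mod d n s t \<longleftrightarrow> frel d n s s \<and> frel d n t t \<and>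
     Sq0_image d n (fcls d n s \<oplus>\<^bsub>comp (F d) n\<^esub> fcls d n t)"

lemma frel_modI: "frel d n s t \<Longrightarrow> frel_mod d n s t"
  unfolding frel_mod_def using frel.refl1[of d n s t] frel.refl2[of d n s t] frel.cls_eq[of d n s t]
  by (simp add: F2_add_self[OF F_vector_space fcls_in] Sq0_image_zero)

lemma frel_mod_sym: "frel_mod d n s t \<Longrightarrow> frel_mod d n t s"
  unfolding frel_mod_def by (simp add: FV.a_comm fcls_in)

lemma frel_mod_trans:
  assumes "frel_mod d n s t" "frel_mod d n t u" shows "frel_mod d n s u"
proof -
  have w: "frel d n s s" "frel d n t t" "frel d n u u" using assms by (auto simp: frel_mod_def)
  note c = w[THEN fcls_in]
  have "Sq0_image d n ((fcls d n s \<oplus>\<^bsub>comp (F d) n\<^esub> fcls d n t) \<oplus>\<^bsub>comp (F d) n\<^esub>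
      (fcls d n t \<oplus>\<^bsub>comp (F d) n\<^esub> fcls d n u))"
    using assms unfolding frel_mod_def by (elim conjE) (rule Sq0_image_add)
  also have "(fcls d n s \<oplus>\<^bsub>comp (F d) n\<^esub> fcls d n t) \<oplus>\<^bsub>comp (F d) n\<^esub>
      (fcls d n t \<oplus>\<^bsub>comp (F d) n\<^esub> fcls d n u) = fcls d n s \<oplus>\<^bsub>comp (F d) n\<^esub> fcls d n u"
    using F_add_cancel[OF c(1,2)] c by (simp flip: FV.a_assoc)
  finally show ?thesis using w by (simp add: frel_mod_def)
qed

lemma frel_mod_add:
  assumes "frel_mod d n s s'" "frel_mod d n t t'" shows "frel_mod d n (FAdd s t) (FAdd s' t')"
proof -
  have w: "frel d n s s" "frel d n t t" "frel d n s' s'" "frel d n t' t'" using assms by (auto simp: frel_mod_def)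
  have "Sq0_image d n ((fcls d n s \<oplus>\<^bsub>comp (F d) n\<^esub> fcls d n s') \<oplus>\<^bsub>comp (F d) n\<^esub>
      (fcls d n t \<oplus>\<^bsub>comp (F d) n\<^esub> fcls d n t'))"
    using assms unfolding frel_mod_def by (elim conjE) (rule Sq0_image_add)
  with w show ?thesis by (simp add: frel_mod_def fcls_add fcls_in frel.add FV.a_ac)
qed

lemma frel_mod_sq:
  assumes "frel_mod d n s t" shows "frel_mod d (n + i) (FSq i s) (FSq i t)"
proof -
  have w: "frel d n s s" "frel d n t t" using assms by (auto simp: frel_mod_def)
  have "Sq0_image d (n + i) (sq (F d) i n (fcls d n s \<oplus>\<^bsub>comp (F d) n\<^esub> fcls d n t))"
    using assms by (intro Sq0_image_sq) (simp add: frel_mod_def)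
  with w show ?thesis by (simp add: frel_mod_def Fn.sq_plus fcls_in sq_F frel.sq)
qed

lemma frel_mod_top:
  assumes t: "frel d n t t" shows "frel_mod d (n + n) (FSq n t) FZero"
proof -
  have "fcls d (n + n) (FSq n t) = sq (F d) n n (fcls d n t)" using t by (simp add: sq_F)
  moreover have "Sq0_image d (n + n) (sq (F d) n n (fcls d n t))"
    unfolding Sq0_image_def using fcls_in[OF t] by blast
  ultimately show ?thesis using t by (simp add: frel_mod_def fcls_zero frel.sq frel.zero fcls_in Fn.sq_closed)
qed

text \<open>All axioms but one are insensitive to the shift of degrees. The exception is
  instability: Sq^(n+1) kills degree n in F(d), while in F(d + 1) it acts on degree n + 1, where it
  is Sq_0.\<close>

lemma frel_desuspend: "frel d n s t \<Longrightarrow> frel_mod (Suc d) (Suc n) s t"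
proof (induction rule: frel.induct)
  case gen show ?case by (rule frel_modI[OF frel.gen])
next
  case (zero n) show ?case by (rule frel_modI[OF frel.zero])
next
  case (add n s s' t t') then show ?case by (intro frel_mod_add)
next
  case (sq n t t' i) then show ?case using frel_mod_sq[of "Suc d" "Suc n" t t' i] by simp
next
  case (sym n s t) show ?case by (rule frel_mod_sym[OF sym.IH])
next
  case (trans n s t u) show ?case by (rule frel_mod_trans[OF trans.IH])
next
  case (add_assoc n s t u) then show ?case by (intro frel_modI frel.add_assoc) (simp_all add: frel_mod_def)
next
  case (add_comm n s t) then show ?case by (intro frel_modI frel.add_comm) (simp_all add: frel_mod_def)
next
  case (add_zero n t) then show ?case by (intro frel_modI frel.add_zero) (simp_all add: frel_mod_def)
next
  case (add_self n t) then show ?case by (intro frel_modI frel.add_self) (simp_all add: frel_mod_def)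
next
  case (sq_add n s t i)
  then show ?case using frel.sq_add[of "Suc d" "Suc n" s t i] by (intro frel_modI) (simp add: frel_mod_def)
next
  case (sq_zero n t) then show ?case by (intro frel_modI frel.sq_zero) (simp add: frel_mod_def)
next
  case (adem i j n t)
  then show ?case using frel.adem[of i j "Suc d" "Suc n" t] by (intro frel_modI) (simp add: frel_mod_def)
next
  case (unstable n i t)
  then have t: "frel (Suc d) (Suc n) t t" by (simp add: frel_mod_def)
  show ?case
  proof (cases "i = Suc n")
    case True then show ?thesis using frel_mod_top[OF t] by simp
  next
    case False
    then show ?thesis using frel.unstable[OF _ t, of i] unstable by (intro frel_modI) simp
  qed
qed

lemma frel_suspend: "frel d n t t \<Longrightarrow> frel (Suc d) (Suc n) t t"
  using frel_desuspend by (simp add: frel_mod_def)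

lemma F_suspend_onto:
  assumes "\<theta> \<in> el (F (Suc d)) (Suc n)"
  shows "\<exists>t. frel d n t t \<and> Sq0_image (Suc d) (Suc n) (\<theta> \<oplus>\<^bsub>comp (F (Suc d)) (Suc n)\<^esub> fcls (Suc d) (Suc n) t)"
proof -
  have "\<exists>t. frel d n t t \<and> Sq0_image (Suc d) m (\<theta> \<oplus>\<^bsub>comp (F (Suc d)) m\<^esub> fcls (Suc d) m t)"
    if "m = Suc n" "\<theta> \<in> el (F (Suc d)) m" for m
    using that(2,1)
  proof (induction arbitrary: n rule: F_induct)
    case iota
    then show ?case
      by (intro exI[of _ FGen]) (simp add: frel.gen F2_add_self[OF F_vector_space iota_in] Sq0_image_zero flip: iota_def)
  next
    case (zero m) then show ?case by (intro exI[of _ FZero]) (simp add: frel.zero fcls_zero Sq0_image_zero)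
  next
    case (add m \<theta> \<xi>)
    obtain s t where st: "frel d n s s" "Sq0_image (Suc d) m (\<theta> \<oplus>\<^bsub>comp (F (Suc d)) m\<^esub> fcls (Suc d) m s)"
      "frel d n t t" "Sq0_image (Suc d) m (\<xi> \<oplus>\<^bsub>comp (F (Suc d)) m\<^esub> fcls (Suc d) m t)"
      using add.IH add.prems by blast
    note c = st(1,3)[THEN frel_suspend, folded add.prems]
    show ?case
      using Sq0_image_add[OF st(2,4)] add.hyps c st
      by (intro exI[of _ "FAdd s t"]) (simp add: fcls_add fcls_in FV.a_ac frel.add)
  next
    case (sq m i \<theta>)
    show ?case
    proof (cases m)
      case 0
      \<comment> \<open>Degree 0 is not the shift of any degree, but F(d + 1) vanishes
        there.\<close>
      have "\<theta> = \<zero>\<^bsub>comp (F (Suc d)) m\<^esub>" using F_low_degree[OF sq.hyps] 0 by simp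
      then show ?thesis using lin_zero[OF F_vector_space F_vector_space Fn.sq_linear]
        by (intro exI[of _ FZero]) (simp add: frel.zero fcls_zero Sq0_image_zero)
    next
      case (Suc n')
      then obtain t where t: "frel d n' t t" "Sq0_image (Suc d) m (\<theta> \<oplus>\<^bsub>comp (F (Suc d)) m\<^esub> fcls (Suc d) m t)"
        using sq.IH by blast
      note c = frel_suspend[OF t(1), folded Suc]
      have "n = n' + i" using sq.prems Suc by simp
      then show ?thesis using Sq0_image_sq[OF t(2), of i] sq.hyps c frel.sq[OF t(1), of i]
        by (intro exI[of _ "FSq i t"]) (simp add: Fn.sq_plus fcls_in sq_F)
    qed
  qed
  then show ?thesis using assms by blast
qed

text \<open>A variable with exponent 1 in the result of an operation was left alone by it, so taking
  the coefficient of t_1 commutes with all operations; it sends t_1 ... t_(d+1) to the product of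
  the remaining variables, the image of the generator of F(d).\<close>

lemma hat_suspend:
  "frel d n t t \<Longrightarrow> hat (Suc d) (Suc n) (fcls (Suc d) (Suc n) t) (0 # l) = hat d n (fcls d n t) l"
proof (induction t arbitrary: n l)
  case FGen
  then have "n = d" by (simp flip: fwf_iff)
  then show ?case using hat_iota[of d] hat_iota[of "Suc d"] by (simp add: iota_def ones_def)
next
  case FZero then show ?case by (simp add: fcls_zero hat_zero)
next
  case (FAdd s t)
  then have "frel d n s s" "frel d n t t" by (simp_all flip: fwf_iff)
  then show ?case using FAdd.IH by (simp add: fcls_add hat_add fcls_in frel_suspend)
next
  case (FSq i t)
  then have t: "i \<le> n" "frel d (n - i) t t" by (simp_all flip: fwf_iff)
  note t' = frel_suspend[OF t(2)]
  have "hat d n (fcls d n (FSq i t)) = psq i (hat d (n - i) (fcls d (n - i) t))"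
    using hat_sq[OF fcls_in[OF t(2)], of i] t(1) by (simp add: sq_F[OF t(2)])
  moreover have "hat (Suc d) (Suc n) (fcls (Suc d) (Suc n) (FSq i t)) =
      psq i (hat (Suc d) (Suc (n - i)) (fcls (Suc d) (Suc (n - i)) t))"
    using hat_sq[OF fcls_in[OF t'], of i] t(1) by (simp add: sq_F[OF t'])
  ultimately show ?case using FSq.IH[OF t(2)] by (simp add: psq_Cons)
qed

lemma hat_Sq0_image: "Sq0_image d n \<theta> \<Longrightarrow> 0 \<in> set l \<Longrightarrow> hat d n \<theta> l = 0"
proof -
  assume "Sq0_image d n \<theta>" and l: "0 \<in> set l"
  then consider "\<theta> = \<zero>\<^bsub>comp (F d) n\<^esub>" | k \<xi> where "n = k + k" "\<xi> \<in> el (F d) k" "\<theta> = sq (F d) k k \<xi>"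
    by (auto simp: Sq0_image_def)
  then show ?thesis
  proof cases
    case 1 then show ?thesis by (simp add: hat_zero)
  next
    case 2 then show ?thesis using l by (simp add: hat_sq psq_top[OF hat_in])
  qed
qed

text \<open>If the polynomial of \<theta> is zero, so is its coefficient of t_1, and the hypothesis
  for \<open>d\<close> puts \<theta> into the image of Sq_0. Then \<theta> is zero or Sq_0 \<xi>
  with \<xi> of half the degree; as Frobenius is injective, the induction on the degree applies to
  \<xi>.\<close>

theorem hat_inject: "\<theta> \<in> el (F d) n \<Longrightarrow> hat d n \<theta> = (\<lambda>l. 0) \<Longrightarrow> \<theta> = \<zero>\<^bsub>comp (F d) n\<^esub>"
proof (induction d arbitrary: n \<theta>)
  case 0
  from F_zero_generator[OF 0(1)] show ?case
  proof
    assume "n = 0 \<and> \<theta> = iota 0"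
    then have "ones 0 = (\<lambda>l. 0)" using 0(2) hat_iota[of 0] by simp
    then have False by (metis ones_def replicate_0 zero_neq_one)
    then show ?thesis ..
  qed
next
  case (Suc d)
  note outer = Suc.IH
  show ?case using Suc.prems
  proof (induction n arbitrary: \<theta> rule: less_induct)
    case (less m)
    show ?case
    proof (cases m)
      case 0 then show ?thesis using F_low_degree[OF less.prems(1)] by simp
    next
      case (Suc n)
      let ?c = "fcls (Suc d) m"
      from F_suspend_onto[OF less.prems(1)[unfolded Suc]]
      obtain t where t: "frel d n t t" "Sq0_image (Suc d) m (\<theta> \<oplus>\<^bsub>comp (F (Suc d)) m\<^esub> ?c t)"
        unfolding Suc by blast
      note t' = frel_suspend[OF t(1), folded Suc]
      have "hat d n (fcls d n t) l = 0" for l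
        using hat_Sq0_image[OF t(2), of "0 # l"] less.prems fcls_in[OF t']
        by (simp add: hat_add flip: hat_suspend[OF t(1)] Suc)
      then have "hat d n (fcls d n t) = (\<lambda>l. 0)" by (rule ext)
      from outer[OF fcls_in[OF t(1)] this] have "frel d n t FZero"
        using frel.cls_eqD[of d n t FZero] frel.zero by (simp add: fcls_zero)
      from frel_desuspend[OF this] have "Sq0_image (Suc d) m (?c t \<oplus>\<^bsub>comp (F (Suc d)) m\<^esub> \<zero>\<^bsub>comp (F (Suc d)) m\<^esub>)"
        by (simp add: frel_mod_def fcls_zero Suc)
      then have "Sq0_image (Suc d) m (?c t)" using fcls_in[OF t'] by simp
      from Sq0_image_add[OF t(2) this] have "Sq0_image (Suc d) m \<theta>"
        using F_add_cancel[OF less.prems(1) fcls_in[OF t']] by simp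
      then consider "\<theta> = \<zero>\<^bsub>comp (F (Suc d)) m\<^esub>"
        | k \<xi> where "m = k + k" "\<xi> \<in> el (F (Suc d)) k" "\<theta> = sq (F (Suc d)) k k \<xi>"
        by (auto simp: Sq0_image_def)
      then show ?thesis
      proof cases
        case (2 k \<xi>)
        have "hat (Suc d) k \<xi> l = 0" for l
        proof -
          have "psq k (hat (Suc d) k \<xi>) (map Suc l) = 0" using less.prems(2) 2 by (simp add: hat_sq)
          then show ?thesis by (simp add: psq_top[OF hat_in[OF 2(2)]] o_def)
        qed
        then have "hat (Suc d) k \<xi> = (\<lambda>l. 0)" by (rule ext)
        with less.IH[of k \<xi>] 2 Suc have "\<xi> = \<zero>\<^bsub>comp (F (Suc d)) k\<^esub>" by simp
        then show ?thesis using 2 lin_zero[OF F_vector_space F_vector_space Fn.sq_linear] by simp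
      qed
    qed
  qed
qed

text \<open>The coefficient of t_1 lifts to a term over F(d); reading that term over F(d + 1) and
  subtracting its polynomial leaves, by symmetry, a remainder \<open>z\<close> without exponents 1.
  Such a remainder is the square of a symmetric polynomial of half the degree.\<close>

theorem hat_surj: "y \<in> el (pol d) n \<Longrightarrow> symm y \<Longrightarrow> \<exists>\<theta>\<in>el (F d) n. hat d n \<theta> = y"
proof (induction d arbitrary: n y)
  case 0
  have y: "y l = 0" if "l \<noteq> [] \<or> n \<noteq> 0" for l
    using el_polD[OF 0(1), of l] that by (rule_tac ccontr) auto
  show ?case
  proof (cases "y [] = 0")
    case True
    then have "y = (\<lambda>l. 0)" using y by (metis)
    then show ?thesis by (intro bexI[of _ "\<zero>\<^bsub>comp (F 0) n\<^esub>"]) (simp_all add: hat_zero)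
  next
    case False
    then have "n = 0" using y by blast
    moreover have "y = ones 0" using False y by (auto simp: ones_def)
    ultimately show ?thesis using hat_iota[of 0] iota_in[of 0] by blast
  qed
next
  case (Suc d)
  note outer = Suc.IH
  show ?case using Suc.prems
  proof (induction n arbitrary: y rule: less_induct)
    case (less m)
    show ?case
    proof (cases "m = 0")
      case True
      have "y l = 0" for l
        using el_polD[OF less.prems(1), of l] True by (cases l; rule_tac ccontr) auto
      then have "y = (\<lambda>l. 0)" by (rule ext)
      then show ?thesis by (intro bexI[of _ "\<zero>\<^bsub>comp (F (Suc d)) m\<^esub>"]) (simp_all add: hat_zero)
    next
      case False
      then obtain n where m: "m = Suc n" by (cases m) auto
      have "(\<lambda>l. y (0 # l)) \<in> el (pol d) n"
        unfolding el_pol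
      proof (intro allI impI)
        fix l assume "y (0 # l) \<noteq> 0"
        from el_polD[OF less.prems(1) this] m show "length l = d \<and> wt l = n" by simp
      qed
      from outer[OF this symm_Cons[OF less.prems(2)]] obtain t
        where t: "frel d n t t" "hat d n (fcls d n t) = (\<lambda>l. y (0 # l))" by (metis el_FE)
      note t' = frel_suspend[OF t(1), folded m]
      let ?\<theta> = "fcls (Suc d) m t"
      define z where "z l = y l + hat (Suc d) m ?\<theta> l" for l
      have z: "z \<in> el (pol (Suc d)) m"
        unfolding z_def[abs_def] add_pol[where d = "Suc d" and n = m, symmetric]
        by (rule PV.a_closed[OF less.prems(1) hat_in[OF fcls_in[OF t']]])
      have sz: "symm z" unfolding z_def by (intro symm_add less.prems symm_hat fcls_in t')
      have z0: "z l = 0" if "0 \<in> set l" for l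
      proof -
        obtain p q where "l = p @ 0 # q" using \<open>0 \<in> set l\<close> by (auto dest: split_list)
        then show ?thesis using symm_move[OF sz, of p 0 q] t(2) hat_suspend[OF t(1), of "p @ q"]
          by (simp add: z_def m)
      qed
      show ?thesis
      proof (cases "z = (\<lambda>l. 0)")
        case True
        then have "hat (Suc d) m ?\<theta> = y"
          by (auto simp: z_def fun_eq_iff) (metis add_left_cancel bit_add_self)
        then show ?thesis using fcls_in[OF t'] by blast
      next
        case nz: False
        then obtain l0 where l0: "z l0 \<noteq> 0" by blast
        define w where "w l = z (map Suc l)" for l
        have wt: "wt (map Suc l) = 2 * wt l" for l by (induction l) auto
        have "map Suc (map (\<lambda>e. e - 1) l) = l" if "0 \<notin> set l" for l
          using that by (induction l) auto
        then have zw: "z l = w (map (\<lambda>e. e - 1) l)" if "0 \<notin> set l" for l using that by (simp add: w_def)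
        \<comment> \<open>Any monomial of \<open>z\<close> determines the degree of the square root;
          that \<open>m\<close> is even comes out as a consequence.\<close>
        define k where "k = wt (map (\<lambda>e. e - 1) l0)"
        have k: "m = k + k"
        proof -
          have "0 \<notin> set l0" using z0 l0 by blast
          then have "wt l0 = 2 * k" using wt[of "map (\<lambda>e. e - 1) l0"] \<open>0 \<notin> set l0 \<Longrightarrow> map Suc _ = l0\<close> by (simp add: k_def)
          then show ?thesis using el_polD[OF z l0] by simp
        qed
        have w: "w \<in> el (pol (Suc d)) k"
          unfolding el_pol
        proof (intro allI impI)
          fix l assume "w l \<noteq> 0"
          from el_polD[OF z this[unfolded w_def]] show "length l = Suc d \<and> wt l = k" by (simp add: wt k)
        qed
        have "symm w" using sz by (simp add: w_def symm_def)
        with less.IH[OF _ w] k m obtain \<xi> where xi: "\<xi> \<in> el (F (Suc d)) k" "hat (Suc d) k \<xi> = w" by auto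
        let ?q = "sq (F (Suc d)) k k \<xi>"
        have q: "?q \<in> el (F (Suc d)) m" using Fn.sq_closed[OF xi(1)] k by simp
        have "hat (Suc d) m ?q = z"
          using z0 zw by (auto simp: k hat_sq[OF xi(1)] xi(2) psq_top[OF w])
        then have "hat (Suc d) m (?q \<oplus>\<^bsub>comp (F (Suc d)) m\<^esub> ?\<theta>) = y"
          using q fcls_in[OF t'] by (simp add: hat_add z_def add.assoc)
        then show ?thesis using q fcls_in[OF t'] by blast
      qed
    qed
  qed
qed

section \<open>The basis of orbit sums\<close>

definition wtm :: "nat multiset \<Rightarrow> nat" where
  "wtm E = (\<Sum>e\<in>#E. 2 ^ e)"

lemma wtm_mset [simp]: "wtm (mset l) = wt l"
  by (induction l) (simp_all add: wtm_def)

lemma wtm_simps [simp]: "wtm {#} = 0" "wtm (add_mset e E) = 2 ^ e + wtm E" "wtm (E + E') = wtm E + wtm E'"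
  by (simp_all add: wtm_def)

abbreviation sorted_list :: "nat multiset \<Rightarrow> nat list" where
  "sorted_list \<equiv> sorted_list_of_multiset"

lemma wt_sorted_list [simp]: "wt (sorted_list E) = wtm E"
  by (metis mset_sorted_list_of_multiset wtm_mset)

lemma length_sorted_list [simp]: "length (sorted_list E) = size E"
  by (metis mset_sorted_list_of_multiset size_mset)

lemma member_less_wtm: "e \<in># E \<Longrightarrow> e < wtm E"
proof -
  assume "e \<in># E"
  then obtain E' where "E = add_mset e E'" by (metis mset_add)
  moreover have "e < 2 ^ e" by (rule less_exp)
  ultimately show ?thesis by (simp add: trans_less_add1)
qed

text \<open>Indexes the orbits of monomials of degree \<open>n\<close> in \<open>d\<close> variables
  under permutation, hence a basis of F(d)^n.\<close>

definition orbits :: "nat \<Rightarrow> nat \<Rightarrow> nat multiset set" where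
  "orbits d n = {E. size E = d \<and> wtm E = n}"

lemma finite_multisets: "finite {E :: nat multiset. size E = d \<and> (\<forall>e\<in>#E. e < n)}"
proof (rule finite_subset)
  show "{E :: nat multiset. size E = d \<and> (\<forall>e\<in>#E. e < n)} \<subseteq> mset ` {l. set l \<subseteq> {..<n} \<and> length l = d}"
  proof
    fix E :: "nat multiset" assume E: "E \<in> {E. size E = d \<and> (\<forall>e\<in>#E. e < n)}"
    then have "sorted_list E \<in> {l. set l \<subseteq> {..<n} \<and> length l = d}" by auto
    then show "E \<in> mset ` {l. set l \<subseteq> {..<n} \<and> length l = d}"
      by (rule image_eqI[rotated]) simp
  qed
qed (simp add: finite_lists_length_eq)

lemma finite_orbits: "finite (orbits d n)"
  by (rule finite_subset[OF _ finite_multisets[of d n]]) (auto simp: orbits_def member_less_wtm)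

definition coef :: "nat multiset \<Rightarrow> fterm set \<Rightarrow> bit" where
  "coef E \<theta> = hat (size E) (wtm E) \<theta> (sorted_list E)"

lemma hat_eq_coef: "\<theta> \<in> el (F (size E)) (wtm E) \<Longrightarrow> mset l = E \<Longrightarrow> hat (size E) (wtm E) \<theta> l = coef E \<theta>"
  unfolding coef_def by (rule symm_mset[OF symm_hat]) simp_all

lemma lin_coef: "E \<in> orbits d n \<Longrightarrow> coef E \<in> lin (comp (F d) n) F2"
  using lin_hat[of d n "sorted_list E"] by (simp add: coef_def[abs_def] orbits_def)

lemma orbit_sum_exists: "\<exists>\<theta>\<in>el (F (size E)) (wtm E). hat (size E) (wtm E) \<theta> = (\<lambda>l. if mset l = E then 1 else 0)"
  by (rule hat_surj) (auto simp: el_pol symm_def)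

text \<open>The preimage of a monomial symmetric polynomial; \<open>hat_inject\<close> makes it
  unique, so the choice is harmless.\<close>

definition orb :: "nat multiset \<Rightarrow> fterm set" where
  "orb E = (SOME \<theta>. \<theta> \<in> el (F (size E)) (wtm E) \<and> hat (size E) (wtm E) \<theta> = (\<lambda>l. if mset l = E then 1 else 0))"

lemma orb: "orb E \<in> el (F (size E)) (wtm E)" "hat (size E) (wtm E) (orb E) = (\<lambda>l. if mset l = E then 1 else 0)"
proof -
  have "orb E \<in> el (F (size E)) (wtm E) \<and> hat (size E) (wtm E) (orb E) = (\<lambda>l. if mset l = E then 1 else 0)"
    unfolding orb_def by (rule someI_ex) (use orbit_sum_exists[of E] in blast)
  then show "orb E \<in> el (F (size E)) (wtm E)" "hat (size E) (wtm E) (orb E) = (\<lambda>l. if mset l = E then 1 else 0)"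
    by blast+
qed

lemma orb_in: "E \<in> orbits d n \<Longrightarrow> orb E \<in> el (F d) n"
  using orb(1)[of E] by (simp add: orbits_def)

lemma orb_Pi: "orb \<in> orbits d n \<rightarrow> el (F d) n"
  using orb_in by blast

lemma coef_orb: "E \<in> orbits d n \<Longrightarrow> E' \<in> orbits d n \<Longrightarrow> coef E (orb E') = (if E = E' then 1 else 0)"
  using orb(2)[of E'] by (simp add: coef_def orbits_def)

lemma coef_inject:
  assumes \<theta>: "\<theta> \<in> el (F d) n" and z: "\<And>E. E \<in> orbits d n \<Longrightarrow> coef E \<theta> = 0"
  shows "\<theta> = \<zero>\<^bsub>comp (F d) n\<^esub>"
proof (rule hat_inject[OF \<theta>], rule ext)
  fix l
  show "hat d n \<theta> l = 0"
  proof (cases "length l = d \<and> wt l = n")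
    case True
    then have "mset l \<in> orbits d n" by (simp add: orbits_def)
    then show ?thesis using z hat_eq_coef[of \<theta> "mset l" l] \<theta> True by simp
  next
    case False then show ?thesis using el_polD[OF hat_in[OF \<theta>], of l] by (rule_tac ccontr) blast
  qed
qed

theorem F_span: "\<theta> \<in> el (F d) n \<Longrightarrow> \<theta> \<in> f2_span (comp (F d) n) orb (orbits d n)"
  by (rule f2_span_separating[OF F_vector_space orb_Pi finite_orbits lin_coef coef_orb coef_inject])

section \<open>Tensor products are unstable modules\<close>

interpretation trel: f2_quot "trel M N d" TZero TAdd
  by unfold_locales (fact trel.sym trel.trans trel.zero trel.add trel.add_assoc trel.add_comm trel.add_zero trel.add_self)+

lemma comp_tensor: "comp (tensor M N) d = quot (trel M N d) TZero TAdd"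
  by (simp add: tensor_def)

lemma tensor_vector_space: "module F2 (comp (tensor M N) d)"
  by (simp add: comp_tensor trel.module_quot)

interpretation TV: Module.module F2 "comp (tensor M N) d" for M N d by (rule tensor_vector_space)

abbreviation tcls :: "('a, 'm) umod_scheme \<Rightarrow> ('b, 'n) umod_scheme \<Rightarrow> nat \<Rightarrow> ('a, 'b) tterm \<Rightarrow> ('a, 'b) tterm set" where
  "tcls M N d t \<equiv> Collect (trel M N d t)"

lemma tcls_in: "trel M N d t t \<Longrightarrow> tcls M N d t \<in> el (tensor M N) d"
  by (simp add: comp_tensor trel.cls_in)

lemma tcls_add: "trel M N d s s \<Longrightarrow> trel M N d t t \<Longrightarrow>
    tcls M N d (TAdd s t) = tcls M N d s \<oplus>\<^bsub>comp (tensor M N) d\<^esub> tcls M N d t"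
  by (simp add: comp_tensor trel.add_quot)

lemma tcls_zero: "tcls M N d TZero = \<zero>\<^bsub>comp (tensor M N) d\<^esub>"
  by (simp add: comp_tensor trel.zero_quot)

lemma el_tensorE:
  assumes "X \<in> el (tensor M N) d"
  obtains t where "trel M N d t t" "X = tcls M N d t"
  using assms by (auto simp: comp_tensor trel.carrier_quot)

lemma trel_tsum: "(\<And>k. k \<in> set ks \<Longrightarrow> trel M N d (f k) (g k)) \<Longrightarrow> trel M N d (tsum (map f ks)) (tsum (map g ks))"
  unfolding tsum_def by (induction ks) (simp_all add: trel.zero trel.add)

lemma tcls_tsum:
  assumes "distinct ks" "\<And>k. k \<in> set ks \<Longrightarrow> trel M N d (f k) (f k)"
  shows "tcls M N d (tsum (map f ks)) = (\<Oplus>\<^bsub>comp (tensor M N) d\<^esub>k\<in>set ks. tcls M N d (f k))"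
  unfolding tsum_def comp_tensor by (rule trel.sum_quot[THEN conjunct2, OF assms])

lemma trel_tsum_add:
  assumes "\<And>k. k \<in> set ks \<Longrightarrow> trel M N d (f k) (TAdd (g k) (h k))"
    and "\<And>k. k \<in> set ks \<Longrightarrow> trel M N d (g k) (g k) \<and> trel M N d (h k) (h k)"
  shows "trel M N d (tsum (map f ks)) (TAdd (tsum (map g ks)) (tsum (map h ks)))"
  using assms
proof (induction ks)
  case Nil
  have "trel M N d (TAdd TZero TZero) TZero" by (intro trel.add_zero trel.zero)
  then show ?case by (simp add: tsum_def trel.sym)
next
  case (Cons k ks)
  let ?G = "tsum (map g ks)" and ?H = "tsum (map h ks)"
  have w: "trel M N d (g k) (g k)" "trel M N d (h k) (h k)" "trel M N d ?G ?G" "trel M N d ?H ?H"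
    using Cons.prems(2) by (auto intro: trel_tsum)
  have "trel M N d (TAdd (f k) (tsum (map f ks))) (TAdd (TAdd (g k) (h k)) (TAdd ?G ?H))"
    by (rule trel.add) (use Cons in auto)
  moreover have "tcls M N d (TAdd (TAdd (g k) (h k)) (TAdd ?G ?H)) = tcls M N d (TAdd (TAdd (g k) ?G) (TAdd (h k) ?H))"
    using w[THEN tcls_in] by (simp add: tcls_add w trel.add TV.a_ac)
  then have "trel M N d (TAdd (TAdd (g k) (h k)) (TAdd ?G ?H)) (TAdd (TAdd (g k) ?G) (TAdd (h k) ?H))"
    by (rule trel.cls_eqD) (intro trel.add w)
  ultimately show ?case by (auto simp: tsum_def intro: trel.trans)
qed

primrec twf :: "('a, 'm) umod_scheme \<Rightarrow> ('b, 'n) umod_scheme \<Rightarrow> nat \<Rightarrow> ('a, 'b) tterm \<Rightarrow> bool" where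
  "twf M N d (TPure a x b y) \<longleftrightarrow> d = a + b \<and> x \<in> el M a \<and> y \<in> el N b"
| "twf M N d TZero \<longleftrightarrow> True"
| "twf M N d (TAdd s t) \<longleftrightarrow> twf M N d s \<and> twf M N d t"

primrec teval :: "(bit, 'c) module \<Rightarrow> (nat \<Rightarrow> nat \<Rightarrow> 'a \<Rightarrow> 'b \<Rightarrow> 'c) \<Rightarrow> ('a, 'b) tterm \<Rightarrow> 'c" where
  "teval V B (TPure a x b y) = B a b x y"
| "teval V B TZero = \<zero>\<^bsub>V\<^esub>"
| "teval V B (TAdd s t) = teval V B s \<oplus>\<^bsub>V\<^esub> teval V B t"

locale tensor_factors = M: unstable_module M + N: unstable_module N
  for M :: "('a, 'm) umod_scheme" and N :: "('b, 'n) umod_scheme"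
begin

interpretation MV: Module.module F2 "comp M d" for d by (rule M.vector_space)
interpretation NV: Module.module F2 "comp N d" for d by (rule N.vector_space)

abbreviation "T \<equiv> tensor M N"
abbreviation "pure \<equiv> pure_tensor M N"

lemma twf_trel: "trel M N d s t \<Longrightarrow> twf M N d s \<and> twf M N d t"
  by (induction rule: trel.induct) auto

lemma pure_in: "x \<in> el M a \<Longrightarrow> y \<in> el N b \<Longrightarrow> pure a b x y \<in> el T (a + b)"
  unfolding pure_tensor_def by (intro tcls_in trel.pure)

lemma pure_add_left: "x \<in> el M a \<Longrightarrow> x' \<in> el M a \<Longrightarrow> y \<in> el N b \<Longrightarrow>
    pure a b (x \<oplus>\<^bsub>comp M a\<^esub> x') y = pure a b x y \<oplus>\<^bsub>comp T (a + b)\<^esub> pure a b x' y"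
  unfolding pure_tensor_def by (simp add: trel.cls_eq[OF trel.pure_add1] tcls_add trel.pure)

lemma pure_add_right: "x \<in> el M a \<Longrightarrow> y \<in> el N b \<Longrightarrow> y' \<in> el N b \<Longrightarrow>
    pure a b x (y \<oplus>\<^bsub>comp N b\<^esub> y') = pure a b x y \<oplus>\<^bsub>comp T (a + b)\<^esub> pure a b x y'"
  unfolding pure_tensor_def by (simp add: trel.cls_eq[OF trel.pure_add2] tcls_add trel.pure)

lemma lin_pure_left: "y \<in> el N b \<Longrightarrow> (\<lambda>x. pure a b x y) \<in> lin (comp M a) (comp T (a + b))"
  by (rule linI[OF M.vector_space tensor_vector_space pure_in pure_add_left])

lemma lin_pure_right: "x \<in> el M a \<Longrightarrow> pure a b x \<in> lin (comp N b) (comp T (a + b))"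
  by (rule linI[OF N.vector_space tensor_vector_space pure_in pure_add_right])

lemma pure_zero_left: "y \<in> el N b \<Longrightarrow> pure a b \<zero>\<^bsub>comp M a\<^esub> y = \<zero>\<^bsub>comp T (a + b)\<^esub>"
  using lin_zero[OF M.vector_space tensor_vector_space lin_pure_left] by blast

lemma pure_zero_right: "x \<in> el M a \<Longrightarrow> pure a b x \<zero>\<^bsub>comp N b\<^esub> = \<zero>\<^bsub>comp T (a + b)\<^esub>"
  using lin_zero[OF N.vector_space tensor_vector_space lin_pure_right] by blast

lemma tensor_induct [consumes 1, case_names zero pure add]:
  assumes "X \<in> el T d" and z: "P \<zero>\<^bsub>comp T d\<^esub>"
    and p: "\<And>a b x y. d = a + b \<Longrightarrow> x \<in> el M a \<Longrightarrow> y \<in> el N b \<Longrightarrow> P (pure a b x y)"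
    and a: "\<And>X Y. X \<in> el T d \<Longrightarrow> Y \<in> el T d \<Longrightarrow> P X \<Longrightarrow> P Y \<Longrightarrow> P (X \<oplus>\<^bsub>comp T d\<^esub> Y)"
  shows "P X"
proof -
  have "twf M N d t \<Longrightarrow> trel M N d t t \<and> P (tcls M N d t)" for t
  proof (induction t)
    case (TPure a x b y) then show ?case using p trel.pure by (auto simp: pure_tensor_def)
  next
    case TZero then show ?case using z by (simp add: tcls_zero trel.zero)
  next
    case (TAdd s t) then show ?case using a[OF tcls_in tcls_in, of s t] by (simp add: tcls_add trel.add)
  qed
  then show ?thesis using assms(1) twf_trel by (metis el_tensorE)
qed

text \<open>The universal property within one total degree. The maps \<open>B a b\<close> for
  different splittings of \<open>d\<close> are independent of each other, so a functional can be
  prescribed on one summand and be zero on the others, as in \<open>ext_form\<close>.\<close>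

lemma tensor_lift:
  assumes V: "module F2 V"
    and B: "\<And>a b x y. d = a + b \<Longrightarrow> x \<in> el M a \<Longrightarrow> y \<in> el N b \<Longrightarrow> B a b x y \<in> carrier V"
      "\<And>a b x x' y. d = a + b \<Longrightarrow> x \<in> el M a \<Longrightarrow> x' \<in> el M a \<Longrightarrow> y \<in> el N b \<Longrightarrow>
        B a b (x \<oplus>\<^bsub>comp M a\<^esub> x') y = B a b x y \<oplus>\<^bsub>V\<^esub> B a b x' y"
      "\<And>a b x y y'. d = a + b \<Longrightarrow> x \<in> el M a \<Longrightarrow> y \<in> el N b \<Longrightarrow> y' \<in> el N b \<Longrightarrow>
        B a b x (y \<oplus>\<^bsub>comp N b\<^esub> y') = B a b x y \<oplus>\<^bsub>V\<^esub> B a b x y'"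
  shows "\<exists>\<phi>\<in>lin (comp T d) V. \<forall>a b. \<forall>x\<in>el M a. \<forall>y\<in>el N b. d = a + b \<longrightarrow> \<phi> (pure a b x y) = B a b x y"
proof -
  interpret V: Module.module F2 V by (rule V)
  have s: "trel M N e s t \<Longrightarrow> e = d \<Longrightarrow> teval V B s = teval V B t \<and> teval V B s \<in> carrier V" for e s t
  proof (induction rule: trel.induct)
    case (add_self e t) then show ?case by (simp add: F2_add_self[OF V])
  next
    case (add e s s' t t')
    then have "teval V B s = teval V B s' \<and> teval V B s \<in> carrier V"
      "teval V B t = teval V B t' \<and> teval V B t \<in> carrier V" by blast+
    then show ?case by (metis V.a_closed teval.simps(3))
  next
    case (sym e s t) then show ?case by metis
  next
    case (trans e s t u) then show ?case by metis
  next
    case (add_comm e s t) then show ?case by (simp add: V.a_comm)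
  qed (simp_all add: B V.a_assoc)
  define \<phi> where "\<phi> X = teval V B (SOME t. t \<in> X)" for X
  have \<phi>: "\<phi> (tcls M N d t) = teval V B t" if t: "trel M N d t t" for t
  proof -
    have "trel M N d t (SOME u. trel M N d t u)" using t by (rule someI)
    then show ?thesis using s[of d t "SOME u. trel M N d t u"] by (simp add: \<phi>_def)
  qed
  have "\<phi> \<in> lin (comp T d) V"
  proof (rule linI[OF tensor_vector_space V])
    fix X assume "X \<in> el T d"
    then obtain t where t: "trel M N d t t" "X = tcls M N d t" by (rule el_tensorE)
    then show "\<phi> X \<in> carrier V" using s[OF t(1)] by (simp add: \<phi>)
    fix Y assume "Y \<in> el T d"
    then obtain u where u: "trel M N d u u" "Y = tcls M N d u" by (rule el_tensorE)
    show "\<phi> (X \<oplus>\<^bsub>comp T d\<^esub> Y) = \<phi> X \<oplus>\<^bsub>V\<^esub> \<phi> Y"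
      using t u by (simp add: \<phi> trel.add flip: tcls_add)
  qed
  moreover have "\<phi> (pure a b x y) = B a b x y" if "x \<in> el M a" "y \<in> el N b" "d = a + b" for a b x y
    using that \<phi>[of "TPure a x b y"] by (simp add: pure_tensor_def trel.pure)
  ultimately show ?thesis by blast
qed

lemma trel_tsq: "trel M N d s t \<Longrightarrow> trel M N (d + i) (tsq M N i s) (tsq M N i t)"
proof (induction rule: trel.induct)
  case (pure x a y b)
  have "trel M N (a + b + i) (TPure (a + k) (sq M k a x) (b + (i - k)) (sq N (i - k) b y))
      (TPure (a + k) (sq M k a x) (b + (i - k)) (sq N (i - k) b y))" if "k \<le> i" for k
    using trel.pure[OF M.sq_closed[OF pure(1), of k] N.sq_closed[OF pure(2), of "i - k"]] that
    by (simp add: algebra_simps)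
  then show ?case unfolding tsq.simps by (intro trel_tsum) (auto simp del: upt_Suc)
next
  case (add_self d t) then show ?case by (simp add: trel.add_self)
next
  case (pure_add1 x a x' y b)
  have w: "trel M N (a + b + i) (TPure (a + k) (sq M k a x) (b + (i - k)) (sq N (i - k) b y))
      (TPure (a + k) (sq M k a x) (b + (i - k)) (sq N (i - k) b y))" if "k \<le> i" "x \<in> el M a" for k x
    using trel.pure[OF M.sq_closed[OF that(2), of k] N.sq_closed[OF pure_add1(3), of "i - k"]] that
    by (simp add: algebra_simps)
  have "trel M N (a + b + i) (TPure (a + k) (sq M k a (x \<oplus>\<^bsub>comp M a\<^esub> x')) (b + (i - k)) (sq N (i - k) b y))
      (TAdd (TPure (a + k) (sq M k a x) (b + (i - k)) (sq N (i - k) b y))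
        (TPure (a + k) (sq M k a x') (b + (i - k)) (sq N (i - k) b y)))" if "k \<le> i" for k
    using trel.pure_add1[OF M.sq_closed[OF pure_add1(1), of k] M.sq_closed[OF pure_add1(2), of k]
        N.sq_closed[OF pure_add1(3), of "i - k"]] that pure_add1
    by (simp add: algebra_simps M.sq_plus)
  then show ?case unfolding tsq.simps
    by (intro trel_tsum_add) (use w pure_add1 in \<open>auto simp del: upt_Suc\<close>)
next
  case (pure_add2 x a y b y')
  have w: "trel M N (a + b + i) (TPure (a + k) (sq M k a x) (b + (i - k)) (sq N (i - k) b y))
      (TPure (a + k) (sq M k a x) (b + (i - k)) (sq N (i - k) b y))" if "k \<le> i" "y \<in> el N b" for k y
    using trel.pure[OF M.sq_closed[OF pure_add2(1), of k] N.sq_closed[OF that(2), of "i - k"]] that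
    by (simp add: algebra_simps)
  have "trel M N (a + b + i) (TPure (a + k) (sq M k a x) (b + (i - k)) (sq N (i - k) b (y \<oplus>\<^bsub>comp N b\<^esub> y')))
      (TAdd (TPure (a + k) (sq M k a x) (b + (i - k)) (sq N (i - k) b y))
        (TPure (a + k) (sq M k a x) (b + (i - k)) (sq N (i - k) b y')))" if "k \<le> i" for k
    using trel.pure_add2[OF M.sq_closed[OF pure_add2(1), of k] N.sq_closed[OF pure_add2(2), of "i - k"]
        N.sq_closed[OF pure_add2(3), of "i - k"]] that pure_add2
    by (simp add: algebra_simps N.sq_plus)
  then show ?case unfolding tsq.simps
    by (intro trel_tsum_add) (use w pure_add2 in \<open>auto simp del: upt_Suc\<close>)
next
  case (trans d s t u) then show ?case by (blast intro: trel.trans)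
next
  case (sym d s t) show ?case by (rule trel.sym[OF sym.IH])
qed (simp_all add: trel.zero trel.add trel.add_assoc trel.add_comm trel.add_zero)

lemma sq_tcls: "trel M N d t t \<Longrightarrow> sq T i d (tcls M N d t) = tcls M N (d + i) (tsq M N i t)"
proof -
  assume t: "trel M N d t t"
  have "(\<Union>u\<in>tcls M N d t. tcls M N (d + i) (tsq M N i u)) = tcls M N (d + i) (tsq M N i t)"
    by (rule trel.lift1[OF t, where f = "\<lambda>u. tcls M N (d + i) (tsq M N i u)"])
      (rule trel.cls_eq, rule trel_tsq, erule trel.sym)
  then show ?thesis by (simp only: tensor_def umod.simps)
qed

lemma lin_sq_tensor: "sq T i d \<in> lin (comp T d) (comp T (d + i))"
proof (rule linI[OF tensor_vector_space tensor_vector_space])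
  fix X assume "X \<in> el T d"
  then obtain s where s: "trel M N d s s" "X = tcls M N d s" by (rule el_tensorE)
  then show "sq T i d X \<in> el T (d + i)" by (simp add: sq_tcls tcls_in trel_tsq)
  fix Y assume "Y \<in> el T d"
  then obtain t where t: "trel M N d t t" "Y = tcls M N d t" by (rule el_tensorE)
  have "sq T i d (tcls M N d (TAdd s t)) = sq T i d X \<oplus>\<^bsub>comp T (d + i)\<^esub> sq T i d Y"
    unfolding sq_tcls[OF trel.add[OF s(1) t(1)]] s(2) t(2) sq_tcls[OF s(1)] sq_tcls[OF t(1)] tsq.simps
    by (rule tcls_add[OF trel_tsq[OF s(1)] trel_tsq[OF t(1)]])
  then show "sq T i d (X \<oplus>\<^bsub>comp T d\<^esub> Y) = sq T i d X \<oplus>\<^bsub>comp T (d + i)\<^esub> sq T i d Y"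
    using s t by (simp only: tcls_add)
qed

lemma sq_pure:
  assumes x: "x \<in> el M a" and y: "y \<in> el N b"
  shows "sq T i (a + b) (pure a b x y) =
    (\<Oplus>\<^bsub>comp T (a + b + i)\<^esub>k\<in>{..i}. pure (a + k) (b + (i - k)) (sq M k a x) (sq N (i - k) b y))"
proof -
  let ?f = "\<lambda>k. TPure (a + k) (sq M k a x) (b + (i - k)) (sq N (i - k) b y)"
  have ks: "{..i} = set [0..<Suc i]" by (auto simp del: upt_Suc)
  have d: "a + k + (b + (i - k)) = a + b + i" if "k \<le> i" for k using that by simp
  have w: "trel M N (a + b + i) (?f k) (?f k)" if "k \<le> i" for k
    using trel.pure[OF M.sq_closed[OF x, of k] N.sq_closed[OF y, of "i - k"]] unfolding d[OF that] .
  have "sq T i (a + b) (pure a b x y) = tcls M N (a + b + i) (tsum (map ?f [0..<Suc i]))"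
    unfolding pure_tensor_def by (simp only: sq_tcls[OF trel.pure[OF x y]] tsq.simps)
  also have "\<dots> = (\<Oplus>\<^bsub>comp T (a + b + i)\<^esub>k\<in>set [0..<Suc i]. tcls M N (a + b + i) (?f k))"
    by (rule tcls_tsum) (use w in \<open>auto simp del: upt_Suc\<close>)
  also have "\<dots> = (\<Oplus>\<^bsub>comp T (a + b + i)\<^esub>k\<in>{..i}. pure (a + k) (b + (i - k)) (sq M k a x) (sq N (i - k) b y))"
    unfolding ks[symmetric]
  proof (rule TV.finsum_cong'[OF refl])
    fix k assume "k \<in> {..i}"
    then have k: "k \<le> i" by simp
    show "tcls M N (a + b + i) (?f k) = pure (a + k) (b + (i - k)) (sq M k a x) (sq N (i - k) b y)"
      unfolding pure_tensor_def d[OF k] ..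
  next
    show "(\<lambda>k. pure (a + k) (b + (i - k)) (sq M k a x) (sq N (i - k) b y)) \<in> {..i} \<rightarrow> el T (a + b + i)"
    proof
      fix k assume "k \<in> {..i}"
      then show "pure (a + k) (b + (i - k)) (sq M k a x) (sq N (i - k) b y) \<in> el T (a + b + i)"
        using pure_in[OF M.sq_closed[OF x, of k] N.sq_closed[OF y, of "i - k"]] by (simp only: d atMost_iff)
    qed
  qed
  finally show ?thesis .
qed

lemma pure_sq_in: "x \<in> el M a \<Longrightarrow> y \<in> el N b \<Longrightarrow> k \<le> i \<Longrightarrow>
    pure (a + k) (b + (i - k)) (sq M k a x) (sq N (i - k) b y) \<in> el T (a + b + i)"
proof -
  assume h: "x \<in> el M a" "y \<in> el N b" "k \<le> i"
  have "a + k + (b + (i - k)) = a + b + i" using h(3) by simp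
  then show ?thesis using pure_in[OF M.sq_closed[OF h(1), of k] N.sq_closed[OF h(2), of "i - k"]] by (simp only:)
qed

text \<open>A bilinear family extends to a morphism exactly when it obeys the Cartan formula. The
  target is asked only for linear operations because \<open>tensor_map\<close> takes a tensor
  product as target before its Adem relations are known.\<close>

lemma tensor_hom:
  assumes P: "\<And>d. module F2 (comp P d)" "\<And>i d. sq P i d \<in> lin (comp P d) (comp P (d + i))"
    and B: "\<And>a b x y. x \<in> el M a \<Longrightarrow> y \<in> el N b \<Longrightarrow> B a b x y \<in> el P (a + b)"
      "\<And>a b x x' y. x \<in> el M a \<Longrightarrow> x' \<in> el M a \<Longrightarrow> y \<in> el N b \<Longrightarrow>
        B a b (x \<oplus>\<^bsub>comp M a\<^esub> x') y = B a b x y \<oplus>\<^bsub>comp P (a + b)\<^esub> B a b x' y"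
      "\<And>a b x y y'. x \<in> el M a \<Longrightarrow> y \<in> el N b \<Longrightarrow> y' \<in> el N b \<Longrightarrow>
        B a b x (y \<oplus>\<^bsub>comp N b\<^esub> y') = B a b x y \<oplus>\<^bsub>comp P (a + b)\<^esub> B a b x y'"
    and cartan: "\<And>a b x y i. x \<in> el M a \<Longrightarrow> y \<in> el N b \<Longrightarrow> sq P i (a + b) (B a b x y) =
        (\<Oplus>\<^bsub>comp P (a + b + i)\<^esub>k\<in>{..i}. B (a + k) (b + (i - k)) (sq M k a x) (sq N (i - k) b y))"
  shows "\<exists>\<phi>\<in>umod_hom T P. \<forall>a b. \<forall>x\<in>el M a. \<forall>y\<in>el N b. \<phi> (a + b) (pure a b x y) = B a b x y"
proof -
  have "\<exists>\<phi>\<in>lin (comp T d) (comp P d). \<forall>a b. \<forall>x\<in>el M a. \<forall>y\<in>el N b. d = a + b \<longrightarrow> \<phi> (pure a b x y) = B a b x y" for d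
    by (rule tensor_lift[OF P(1)]) (simp_all only: B)
  then obtain \<phi> where \<phi>: "\<And>d. \<phi> d \<in> lin (comp T d) (comp P d)"
    "\<And>a b x y. x \<in> el M a \<Longrightarrow> y \<in> el N b \<Longrightarrow> \<phi> (a + b) (pure a b x y) = B a b x y" by metis
  define \<psi> where "\<psi> d = restrict (\<phi> d) (el T d)" for d
  have \<psi>: "\<psi> (a + b) (pure a b x y) = B a b x y" if "x \<in> el M a" "y \<in> el N b" for a b x y
    using that by (simp add: \<psi>_def pure_in \<phi>)
  have "\<psi> \<in> umod_hom T P"
  proof (rule umod_homI[OF tensor_vector_space P(1)])
    fix d i X assume X: "X \<in> el T d"
    show "\<psi> d X \<in> el P d" using X lin_closed[OF \<phi>(1)] by (simp add: \<psi>_def)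
    show "\<psi> d (X \<oplus>\<^bsub>comp T d\<^esub> Y) = \<psi> d X \<oplus>\<^bsub>comp P d\<^esub> \<psi> d Y" if "Y \<in> el T d" for Y
      using X that lin_add[OF \<phi>(1)] by (simp add: \<psi>_def)
    have "\<phi> (d + i) (sq T i d X) = sq P i d (\<phi> d X)" using X
    proof (induction rule: tensor_induct)
      case zero
      show ?case
        by (simp add: lin_zero[OF tensor_vector_space tensor_vector_space lin_sq_tensor]
            lin_zero[OF P(1) P(1) P(2)] lin_zero[OF tensor_vector_space P(1) \<phi>(1)])
    next
      case (add X Y)
      then show ?case
        by (simp add: lin_add[OF lin_sq_tensor] lin_add[OF P(2)] lin_add[OF \<phi>(1)]
            lin_closed[OF lin_sq_tensor] lin_closed[OF \<phi>(1)])
    next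
      case (pure a b x y)
      interpret PV: Module.module F2 "comp P d" for d by (rule P(1))
      let ?f = "\<lambda>k. pure (a + k) (b + (i - k)) (sq M k a x) (sq N (i - k) b y)"
      have "\<phi> (a + b + i) (sq T i (a + b) (pure a b x y)) = \<phi> (a + b + i) (\<Oplus>\<^bsub>comp T (a + b + i)\<^esub>k\<in>{..i}. ?f k)"
        by (simp only: sq_pure[OF pure(2,3)])
      also have "\<dots> = (\<Oplus>\<^bsub>comp P (a + b + i)\<^esub>k\<in>{..i}. \<phi> (a + b + i) (?f k))"
        by (rule lin_finsum[OF tensor_vector_space P(1) \<phi>(1)]) (use pure_sq_in[OF pure(2,3)] in auto)
      also have "\<dots> = (\<Oplus>\<^bsub>comp P (a + b + i)\<^esub>k\<in>{..i}. B (a + k) (b + (i - k)) (sq M k a x) (sq N (i - k) b y))"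
      proof (rule PV.finsum_cong'[OF refl])
        have e: "\<phi> (a + b + i) (?f k) = B (a + k) (b + (i - k)) (sq M k a x) (sq N (i - k) b y)" if "k \<le> i" for k
        proof -
          have "a + k + (b + (i - k)) = a + b + i" using that by simp
          then show ?thesis using \<phi>(2)[OF M.sq_closed[OF pure(2), of k] N.sq_closed[OF pure(3), of "i - k"]] by (simp only:)
        qed
        then show "\<phi> (a + b + i) (?f k) = B (a + k) (b + (i - k)) (sq M k a x) (sq N (i - k) b y)" if "k \<in> {..i}" for k
          using that by simp
        show "(\<lambda>k. B (a + k) (b + (i - k)) (sq M k a x) (sq N (i - k) b y)) \<in> {..i} \<rightarrow> el P (a + b + i)"
          by (rule Pi_I) (simp only: atMost_iff e[symmetric] lin_closed[OF \<phi>(1) pure_sq_in[OF pure(2,3)]])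
      qed
      also have "\<dots> = sq P i (a + b) (B a b x y)" by (rule cartan[OF pure(2,3), symmetric])
      also have "\<dots> = sq P i (a + b) (\<phi> (a + b) (pure a b x y))" by (simp only: \<phi>(2)[OF pure(2,3)])
      finally show ?case unfolding pure(1) .
    qed
    then show "\<psi> (d + i) (sq T i d X) = sq P i d (\<psi> d X)"
      using X lin_closed[OF lin_sq_tensor] by (simp add: \<psi>_def)
  qed (simp add: \<psi>_def)
  then show ?thesis using \<psi> by blast
qed

end

section \<open>Polynomials in disjoint variables and the embedding of F(a) \<otimes> F(b)\<close>

lemma tot_mult: "a \<le> length l \<Longrightarrow>
    tot c (\<lambda>l. f (take a l) * g (drop a l)) l = tot c f (take a l) * tot c g (drop a l)"
proof (induction a arbitrary: f l)
  case 0 show ?case by (simp add: tot_scale)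
next
  case (Suc a)
  then obtain e l' where l: "l = e # l'" "a \<le> length l'" by (cases l) auto
  have "tot c (\<lambda>l. f (x # take a l) * g (drop a l)) l' = tot c (\<lambda>l. f (x # l)) (take a l') * tot c g (drop a l')" for x
    by (rule Suc.IH[OF l(2)])
  then show ?case by (simp add: l algebra_simps split: nat.split)
qed

text \<open>The Cartan formula: the total square is multiplicative, and the coefficients of X^i are
  compared.\<close>

lemma psq_mult:
  assumes "a \<le> length l"
  shows "psq i (\<lambda>l. f (take a l) * g (drop a l)) l = (\<Sum>k\<le>i. psq k f (take a l) * psq (i - k) g (drop a l))"
proof -
  have "psq i (\<lambda>l. f (take a l) * g (drop a l)) l =
      fps_nth (tot fps_X (\<lambda>l. fps_const (f (take a l)) * fps_const (g (drop a l))) l) i"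
    by (simp add: psq_def)
  also have "\<dots> = (\<Sum>k\<le>i. psq k f (take a l) * psq (i - k) g (drop a l))"
    unfolding tot_mult[OF assms, where f = "\<lambda>l. fps_const (f l)" and g = "\<lambda>l. fps_const (g l)"]
    by (simp add: fps_mult_nth psq_def atLeast0AtMost)
  finally show ?thesis .
qed

definition pmul :: "nat \<Rightarrow> (nat list \<Rightarrow> bit) \<Rightarrow> (nat list \<Rightarrow> bit) \<Rightarrow> nat list \<Rightarrow> bit" where
  "pmul a f g l = f (take a l) * g (drop a l)"

lemma pmul_in: "f \<in> el (pol a) p \<Longrightarrow> g \<in> el (pol b) q \<Longrightarrow> pmul a f g \<in> el (pol (a + b)) (p + q)"
proof -
  assume f: "f \<in> el (pol a) p" and g: "g \<in> el (pol b) q"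
  show ?thesis unfolding el_pol
  proof (intro allI impI)
    fix l assume "pmul a f g l \<noteq> 0"
    then have "f (take a l) \<noteq> 0" "g (drop a l) \<noteq> 0" by (auto simp: pmul_def)
    then have "length (take a l) = a" "wt (take a l) = p" "length (drop a l) = b" "wt (drop a l) = q"
      using el_polD[OF f] el_polD[OF g] by blast+
    moreover have "wt l = wt (take a l) + wt (drop a l)" by (metis append_take_drop_id wt_simps(3))
    moreover have "length l = length (take a l) + length (drop a l)" by simp
    ultimately show "length l = a + b \<and> wt l = p + q" by linarith
  qed
qed

lemma pmul_append: "length l = a \<Longrightarrow> pmul a f g (l @ l') = f l * g l'"
  by (simp add: pmul_def)

text \<open>Both iota_a \<otimes> iota_b and iota_(a+b) have the polynomial t_1 ... t_(a+b); the
  computation of external products rests on this coincidence.\<close>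

lemma pmul_ones: "pmul a (ones a) (ones b) = ones (a + b)"
proof
  fix l :: "nat list"
  have "take a l = replicate a 0 \<and> drop a l = replicate b 0 \<longleftrightarrow> l = replicate (a + b) 0"
    by (metis append_take_drop_id replicate_add take_replicate drop_replicate diff_add_inverse min.absorb1 le_add1)
  then show "pmul a (ones a) (ones b) l = ones (a + b) l" by (auto simp: pmul_def ones_def)
qed

lemma psq_pmul:
  assumes f: "f \<in> el (pol a) p" and g: "g \<in> el (pol b) q"
  shows "psq i (pmul a f g) l = (\<Sum>k\<le>i. pmul a (psq k f) (psq (i - k) g) l)"
proof (cases "a \<le> length l")
  case True then show ?thesis using psq_mult[OF True] by (simp add: pmul_def[abs_def])
next
  case False
  have "pmul a (psq k f) (psq (i - k) g) l = 0" for k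
    using el_polD[OF pmul_in[OF psq_closed[OF f, of k] psq_closed[OF g, of "i - k"]], of l] False
    by (rule_tac ccontr) auto
  moreover have "psq i (pmul a f g) l = 0"
    using el_polD[OF psq_closed[OF pmul_in[OF f g]], of i l] False by (rule_tac ccontr) auto
  ultimately show ?thesis by simp
qed

lemma tensor_factors_F: "tensor_factors (F a) (F b)"
  by (intro tensor_factors.intro F_unstable)

interpretation TF: tensor_factors "F a" "F b" for a b by (rule tensor_factors_F)

definition hat2 :: "nat \<Rightarrow> nat \<Rightarrow> nat \<Rightarrow> (fterm set, fterm set) tterm set \<Rightarrow> nat list \<Rightarrow> bit" where
  "hat2 a b = (SOME \<phi>. \<phi> \<in> umod_hom (tensor (F a) (F b)) (pol (a + b)) \<and>
     (\<forall>p q. \<forall>\<alpha>\<in>el (F a) p. \<forall>\<beta>\<in>el (F b) q.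
       \<phi> (p + q) (pure_tensor (F a) (F b) p q \<alpha> \<beta>) = pmul a (hat a p \<alpha>) (hat b q \<beta>)))"

lemma hat2: "hat2 a b \<in> umod_hom (tensor (F a) (F b)) (pol (a + b))"
  "\<alpha> \<in> el (F a) p \<Longrightarrow> \<beta> \<in> el (F b) q \<Longrightarrow>
    hat2 a b (p + q) (pure_tensor (F a) (F b) p q \<alpha> \<beta>) = pmul a (hat a p \<alpha>) (hat b q \<beta>)"
proof -
  have "\<exists>\<phi>\<in>umod_hom (tensor (F a) (F b)) (pol (a + b)). \<forall>p q. \<forall>\<alpha>\<in>el (F a) p. \<forall>\<beta>\<in>el (F b) q.
      \<phi> (p + q) (pure_tensor (F a) (F b) p q \<alpha> \<beta>) = pmul a (hat a p \<alpha>) (hat b q \<beta>)"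
  proof (rule TF.tensor_hom[OF pol_vector_space Pol.sq_linear])
    fix p q i \<alpha> \<beta> assume \<alpha>: "\<alpha> \<in> el (F a) p" and \<beta>: "\<beta> \<in> el (F b) q"
    show "pmul a (hat a p \<alpha>) (hat b q \<beta>) \<in> el (pol (a + b)) (p + q)"
      by (intro pmul_in hat_in \<alpha> \<beta>)
    show "pmul a (hat a p (\<alpha> \<oplus>\<^bsub>comp (F a) p\<^esub> \<alpha>')) (hat b q \<beta>) =
        pmul a (hat a p \<alpha>) (hat b q \<beta>) \<oplus>\<^bsub>comp (pol (a + b)) (p + q)\<^esub> pmul a (hat a p \<alpha>') (hat b q \<beta>)"
      if "\<alpha>' \<in> el (F a) p" for \<alpha>'
      using that \<alpha> by (simp add: hat_add add_pol pmul_def distrib_right fun_eq_iff)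
    show "pmul a (hat a p \<alpha>) (hat b q (\<beta> \<oplus>\<^bsub>comp (F b) q\<^esub> \<beta>')) =
        pmul a (hat a p \<alpha>) (hat b q \<beta>) \<oplus>\<^bsub>comp (pol (a + b)) (p + q)\<^esub> pmul a (hat a p \<alpha>) (hat b q \<beta>')"
      if "\<beta>' \<in> el (F b) q" for \<beta>'
      using that \<beta> by (simp add: hat_add add_pol pmul_def distrib_left fun_eq_iff)
    have "pmul a (psq k (hat a p \<alpha>)) (psq (i - k) (hat b q \<beta>)) \<in> el (pol (a + b)) (p + q + i)" if "k \<le> i" for k
    proof -
      have "p + k + (q + (i - k)) = p + q + i" using that by simp
      then show ?thesis
        using pmul_in[OF psq_closed[OF hat_in[OF \<alpha>], of k] psq_closed[OF hat_in[OF \<beta>], of "i - k"]] by (simp only:)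
    qed
    then show "sq (pol (a + b)) i (p + q) (pmul a (hat a p \<alpha>) (hat b q \<beta>)) =
        (\<Oplus>\<^bsub>comp (pol (a + b)) (p + q + i)\<^esub>k\<in>{..i}.
          pmul a (hat a (p + k) (sq (F a) k p \<alpha>)) (hat b (q + (i - k)) (sq (F b) (i - k) q \<beta>)))"
      unfolding hat_sq[OF \<alpha>] hat_sq[OF \<beta>]
      by (subst finsum_pol) (auto simp: sq_pol psq_pmul[OF hat_in[OF \<alpha>] hat_in[OF \<beta>]])
  qed
  then have "\<exists>\<phi>. \<phi> \<in> umod_hom (tensor (F a) (F b)) (pol (a + b)) \<and>
     (\<forall>p q. \<forall>\<alpha>\<in>el (F a) p. \<forall>\<beta>\<in>el (F b) q.
       \<phi> (p + q) (pure_tensor (F a) (F b) p q \<alpha> \<beta>) = pmul a (hat a p \<alpha>) (hat b q \<beta>))" by blast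
  from someI_ex[OF this, folded hat2_def]
  show "hat2 a b \<in> umod_hom (tensor (F a) (F b)) (pol (a + b))"
    "\<alpha> \<in> el (F a) p \<Longrightarrow> \<beta> \<in> el (F b) q \<Longrightarrow>
      hat2 a b (p + q) (pure_tensor (F a) (F b) p q \<alpha> \<beta>) = pmul a (hat a p \<alpha>) (hat b q \<beta>)"
    by blast+
qed

definition bi_orbits :: "nat \<Rightarrow> nat \<Rightarrow> nat \<Rightarrow> (nat multiset \<times> nat multiset) set" where
  "bi_orbits a b n = {(E, E'). size E = a \<and> size E' = b \<and> wtm E + wtm E' = n}"

definition bi_orb :: "nat multiset \<times> nat multiset \<Rightarrow> (fterm set, fterm set) tterm set" where
  "bi_orb = (\<lambda>(E, E'). pure_tensor (F (size E)) (F (size E')) (wtm E) (wtm E') (orb E) (orb E'))"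

lemma bi_orb_in: "i \<in> bi_orbits a b n \<Longrightarrow> bi_orb i \<in> el (tensor (F a) (F b)) n"
  using TF.pure_in[OF orb(1) orb(1)] by (auto simp: bi_orbits_def bi_orb_def)

lemma bi_orb_Pi: "bi_orb \<in> bi_orbits a b n \<rightarrow> el (tensor (F a) (F b)) n"
  using bi_orb_in by blast

lemma tensor_F_span: "X \<in> el (tensor (F a) (F b)) n \<Longrightarrow> X \<in> f2_span (comp (tensor (F a) (F b)) n) bi_orb (bi_orbits a b n)"
proof (induction rule: TF.tensor_induct)
  note sp = tensor_vector_space[of "F a" "F b" n] bi_orb_Pi[of a b n]
  {
    case zero show ?case by (rule f2_span_zero[OF sp])
  next
    case (add X Y) show ?case by (rule f2_span_add[OF sp add.IH])
  next
    case (pure p q x y)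
    note spa = F_vector_space[of a p] orb_Pi[of a p] and spb = F_vector_space[of b q] orb_Pi[of b q]
    have *: "pure_tensor (F a) (F b) p q (orb E) y \<in> f2_span (comp (tensor (F a) (F b)) n) bi_orb (bi_orbits a b n)"
      if E: "E \<in> orbits a p" for E
      using F_span[OF pure(3)]
    proof (induction rule: f2_span_induct[OF spb, consumes 1, case_names z s])
      case z show ?case
        using TF.pure_zero_right[OF orb_in[OF E]] f2_span_zero[OF sp] by (simp add: pure(1))
    next
      case (s y E')
      have y: "y \<in> el (F b) q" by (rule f2_span_closed[OF spb s.hyps(1)])
      have "(E, E') \<in> bi_orbits a b n" using E s.hyps(2) by (simp add: orbits_def bi_orbits_def pure(1))
      from f2_span_add_base[OF sp s.IH this] show ?case
        using TF.pure_add_right[OF orb_in[OF E] y orb_in[OF s.hyps(2)]] E s.hyps(2)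
        by (simp add: bi_orb_def orbits_def pure(1))
    qed
    show ?case using F_span[OF pure(2)]
    proof (induction rule: f2_span_induct[OF spa, consumes 1, case_names z s])
      case z show ?case
        using TF.pure_zero_left[OF pure(3)] f2_span_zero[OF sp] by (simp add: pure(1))
    next
      case (s x E)
      have x: "x \<in> el (F a) p" by (rule f2_span_closed[OF spa s.hyps(1)])
      from f2_span_add[OF sp s.IH *[OF s.hyps(2)]] show ?case
        using TF.pure_add_left[OF x orb_in[OF s.hyps(2)] pure(3)] by (simp add: pure(1))
    qed
  }
qed

text \<open>Pure tensors of orbit sums span by bilinearity. The coefficient at a concatenation of
  two sorted lists is 1 on exactly one of them, so no non-trivial sum is sent to zero.\<close>

lemma hat2_inject:
  assumes X: "X \<in> el (tensor (F a) (F b)) n" and z: "hat2 a b n X = (\<lambda>l. 0)"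
  shows "X = \<zero>\<^bsub>comp (tensor (F a) (F b)) n\<^esub>"
proof (rule f2_span_coordinates[OF tensor_vector_space bi_orb_Pi tensor_F_span[OF X]])
  let ?\<kappa> = "\<lambda>(E, E') X. hat2 a b n X (sorted_list E @ sorted_list E')"
  fix i assume i: "i \<in> bi_orbits a b n"
  obtain E E' where E: "i = (E, E')" "size E = a" "size E' = b" "n = wtm E + wtm E'"
    using i by (auto simp: bi_orbits_def)
  show "?\<kappa> i \<in> lin (comp (tensor (F a) (F b)) n) F2"
    unfolding E(1) prod.case by (rule lin_comp[OF umod_hom_lin[OF hat2(1)] lin_eval_pol])
  show "?\<kappa> i X = 0" using z by (simp add: E(1))
  fix j assume j: "j \<in> bi_orbits a b n"
  obtain D D' where D: "j = (D, D')" "size D = a" "size D' = b" "n = wtm D + wtm D'"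
    using j by (auto simp: bi_orbits_def)
  have "hat2 a b n (bi_orb j) = pmul a (hat a (wtm D) (orb D)) (hat b (wtm D') (orb D'))"
    using hat2(2)[OF orb(1)[of D] orb(1)[of D']] D by (simp add: bi_orb_def)
  then show "?\<kappa> i (bi_orb j) = (if i = j then 1 else 0)"
    using orb(2)[of D] orb(2)[of D'] D E by (simp add: pmul_append)
qed

text \<open>With a name for the right-hand side, its linearity and naturality can be proved for
  modules in which the Adem relation itself is still unknown.\<close>

definition adem_rhs :: "('a, 'm) umod_scheme \<Rightarrow> nat \<Rightarrow> nat \<Rightarrow> nat \<Rightarrow> 'a \<Rightarrow> 'a" where
  "adem_rhs M i j d x = (\<Oplus>\<^bsub>comp M (d + j + i)\<^esub> k \<in> {k. k \<le> i div 2 \<and> odd ((j - k - 1) choose (i - 2 * k))}.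
     sq M (i + j - k) (d + k) (sq M k d x))"

lemma adem_rhs:
  assumes M: "\<And>d. module F2 (comp M d)" "\<And>i d. sq M i d \<in> lin (comp M d) (comp M (d + i))"
    and ij: "0 < i" "i < 2 * j"
  shows lin_adem_rhs: "adem_rhs M i j d \<in> lin (comp M d) (comp M (d + j + i))"
    and hom_adem_rhs: "\<phi> \<in> umod_hom M N \<Longrightarrow> (\<And>d. module F2 (comp N d)) \<Longrightarrow> x \<in> el M d \<Longrightarrow>
      \<phi> (d + j + i) (adem_rhs M i j d x) = adem_rhs N i j d (\<phi> d x)"
proof -
  let ?A = "{k. k \<le> i div 2 \<and> odd ((j - k - 1) choose (i - 2 * k))}"
  let ?g = "\<lambda>x k. sq M (i + j - k) (d + k) (sq M k d x)"
  interpret V: Module.module F2 "comp M e" for e by (rule M(1))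
  have deg: "d + k + (i + j - k) = d + j + i" if "k \<in> ?A" for k using that ij by auto
  have c: "?g x k \<in> el M (d + j + i)" if "k \<in> ?A" "x \<in> el M d" for k x
    using lin_closed[OF M(2) lin_closed[OF M(2) that(2)], of "i + j - k" k] by (simp only: deg[OF that(1)])
  show "adem_rhs M i j d \<in> lin (comp M d) (comp M (d + j + i))"
  proof (rule linI[OF M(1) M(1)])
    fix x assume x: "x \<in> el M d"
    show "adem_rhs M i j d x \<in> el M (d + j + i)" unfolding adem_rhs_def
      by (rule V.finsum_closed) (use c[OF _ x] in auto)
    fix y assume y: "y \<in> el M d"
    have "adem_rhs M i j d (x \<oplus>\<^bsub>comp M d\<^esub> y) = (\<Oplus>\<^bsub>comp M (d + j + i)\<^esub>k\<in>?A. ?g x k \<oplus>\<^bsub>comp M (d + j + i)\<^esub> ?g y k)"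
      unfolding adem_rhs_def
    proof (rule V.finsum_cong'[OF refl])
      show "(\<lambda>k. ?g x k \<oplus>\<^bsub>comp M (d + j + i)\<^esub> ?g y k) \<in> ?A \<rightarrow> el M (d + j + i)"
        using c[OF _ x] c[OF _ y] by (intro Pi_I V.a_closed)
      fix k assume k: "k \<in> ?A"
      show "?g (x \<oplus>\<^bsub>comp M d\<^esub> y) k = ?g x k \<oplus>\<^bsub>comp M (d + j + i)\<^esub> ?g y k"
        using lin_add[OF M(2) lin_closed[OF M(2) x] lin_closed[OF M(2) y], of "i + j - k" k]
        unfolding deg[OF k] lin_add[OF M(2) x y] .
    qed
    also have "\<dots> = adem_rhs M i j d x \<oplus>\<^bsub>comp M (d + j + i)\<^esub> adem_rhs M i j d y"
      unfolding adem_rhs_def by (rule V.finsum_addf) (use c[OF _ x] c[OF _ y] in auto)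
    finally show "adem_rhs M i j d (x \<oplus>\<^bsub>comp M d\<^esub> y) = adem_rhs M i j d x \<oplus>\<^bsub>comp M (d + j + i)\<^esub> adem_rhs M i j d y" .
  qed
  assume \<phi>: "\<phi> \<in> umod_hom M N" and N: "\<And>d. module F2 (comp N d)" and x: "x \<in> el M d"
  interpret W: Module.module F2 "comp N e" for e by (rule N)
  have e: "\<phi> (d + j + i) (?g x k) = sq N (i + j - k) (d + k) (sq N k d (\<phi> d x))" if "k \<in> ?A" for k
    using umod_hom_sq[OF \<phi> lin_closed[OF M(2) x], of k "i + j - k"] umod_hom_sq[OF \<phi> x, of k]
    unfolding deg[OF that] by simp
  have "\<phi> (d + j + i) (adem_rhs M i j d x) = (\<Oplus>\<^bsub>comp N (d + j + i)\<^esub>k\<in>?A. \<phi> (d + j + i) (?g x k))"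
    unfolding adem_rhs_def by (rule lin_finsum[OF M(1) N umod_hom_lin[OF \<phi>]]) (use c[OF _ x] in auto)
  also have "\<dots> = adem_rhs N i j d (\<phi> d x)" unfolding adem_rhs_def
  proof (rule W.finsum_cong'[OF refl _ e])
    show "(\<lambda>k. sq N (i + j - k) (d + k) (sq N k d (\<phi> d x))) \<in> ?A \<rightarrow> el N (d + j + i)"
      using umod_hom_closed[OF \<phi> c[OF _ x]] by (intro Pi_I) (simp only: flip: e)
  qed
  finally show "\<phi> (d + j + i) (adem_rhs M i j d x) = adem_rhs N i j d (\<phi> d x)" .
qed

lemma tensor_F_adem:
  assumes ij: "0 < i" "i < 2 * j" and x: "X \<in> el (tensor (F a) (F b)) d"
  shows "sq (tensor (F a) (F b)) i (d + j) (sq (tensor (F a) (F b)) j d X) = adem_rhs (tensor (F a) (F b)) i j d X"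
proof -
  let ?T = "tensor (F a) (F b)"
  let ?L = "sq ?T i (d + j) (sq ?T j d X)" and ?R = "adem_rhs ?T i j d X"
  let ?n = "d + j + i"
  have L: "?L \<in> el ?T ?n" by (intro lin_closed[OF TF.lin_sq_tensor] x)
  have R: "?R \<in> el ?T ?n" by (rule lin_closed[OF lin_adem_rhs[OF tensor_vector_space TF.lin_sq_tensor ij] x])
  have h: "hat2 a b d X \<in> el (pol (a + b)) d" by (rule umod_hom_closed[OF hat2(1) x])
  have "hat2 a b ?n ?L = sq (pol (a + b)) i (d + j) (sq (pol (a + b)) j d (hat2 a b d X))"
    by (simp only: umod_hom_sq[OF hat2(1) x] umod_hom_sq[OF hat2(1) lin_closed[OF TF.lin_sq_tensor x]])
  also have "\<dots> = adem_rhs (pol (a + b)) i j d (hat2 a b d X)"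
    unfolding adem_rhs_def by (rule Pol.adem'[OF ij h])
  also have "\<dots> = hat2 a b ?n ?R"
    by (rule hom_adem_rhs[OF tensor_vector_space TF.lin_sq_tensor ij hat2(1) pol_vector_space x, symmetric])
  finally have e: "hat2 a b ?n ?L = hat2 a b ?n ?R" .
  have "hat2 a b ?n (?L \<oplus>\<^bsub>comp ?T ?n\<^esub> ?R) = (\<lambda>l. 0)"
    by (simp only: umod_hom_add[OF hat2(1) L R] e add_pol bit_add_self)
  from hat2_inject[OF _ this] L R have "?L \<oplus>\<^bsub>comp ?T ?n\<^esub> ?R = \<zero>\<^bsub>comp ?T ?n\<^esub>" by simp
  moreover have "?L \<oplus>\<^bsub>comp ?T ?n\<^esub> ?R \<oplus>\<^bsub>comp ?T ?n\<^esub> ?R = ?L"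
    using L R F2_add_self[OF tensor_vector_space R] by (simp add: TV.a_assoc)
  ultimately show ?thesis using R by simp
qed

context tensor_factors
begin

lemma tensor_map:
  assumes M': "tensor_factors M' N'" and \<phi>: "\<phi> \<in> umod_hom M M'" and \<psi>: "\<psi> \<in> umod_hom N N'"
  shows "\<exists>\<chi>\<in>umod_hom T (tensor M' N'). \<forall>a b. \<forall>x\<in>el M a. \<forall>y\<in>el N b.
    \<chi> (a + b) (pure a b x y) = pure_tensor M' N' a b (\<phi> a x) (\<psi> b y)"
proof -
  interpret T': tensor_factors M' N' by fact
  note [simp] = umod_hom_closed[OF \<phi>] umod_hom_closed[OF \<psi>] umod_hom_add[OF \<phi>] umod_hom_add[OF \<psi>]
    umod_hom_sq[OF \<phi>] umod_hom_sq[OF \<psi>]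
  show ?thesis
    by (rule tensor_hom[OF tensor_vector_space T'.lin_sq_tensor])
      (simp_all add: T'.pure_in T'.pure_add_left T'.pure_add_right T'.sq_pure)
qed

text \<open>Both sides of the Adem relation are additive and natural, so pure tensors suffice, and x
  \<otimes> y is the image of iota_a \<otimes> iota_b under the tensor product of two classifying
  morphisms. In F(a) \<otimes> F(b) the relation holds because it holds for polynomials and
  \<open>hat2\<close> is injective.\<close>

theorem tensor_unstable: "unstable_module T"
proof (rule unstable_module.intro)
  show "module F2 (comp T d)" for d by (rule tensor_vector_space)
  show "sq T i d \<in> lin (comp T d) (comp T (d + i))" for i d by (rule lin_sq_tensor)
  note [simp] = lin_zero[OF tensor_vector_space tensor_vector_space lin_sq_tensor]
  fix i d X assume X: "X \<in> el T d"
  show "sq T 0 d X = X" using X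
  proof (induction rule: tensor_induct)
    case (pure a b x y)
    then show ?case using sq_pure[OF pure(2,3), of 0] pure_in[OF pure(2,3)] by (simp add: M.sq_zero' N.sq_zero')
  next
    case (add X Y) then show ?case using lin_add[OF lin_sq_tensor[of 0 d]] by simp
  next
    case zero show ?case using lin_zero[OF tensor_vector_space tensor_vector_space lin_sq_tensor[of 0 d]] by simp
  qed
  show "sq T i d X = \<zero>\<^bsub>comp T (d + i)\<^esub>" if i: "d < i" using X
  proof (induction rule: tensor_induct)
    case (pure a b x y)
    have "pure (a + k) (b + (i - k)) (sq M k a x) (sq N (i - k) b y) = \<zero>\<^bsub>comp T (a + b + i)\<^esub>" if k: "k \<le> i" for k
    proof -
      have d: "a + k + (b + (i - k)) = a + b + i" using k by simp
      \<comment> \<open>Since a + b < i, in each Cartan term one of the two operations exceeds the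
        degree of its argument.\<close>
      consider "a < k" | "b < i - k" using i pure(1) k by linarith
      then show ?thesis
      proof cases
        case 1
        show ?thesis using pure_zero_left[OF N.sq_closed[OF pure(3), of "i - k"], of "a + k"]
          unfolding d M.unstable'[OF 1 pure(2)] .
      next
        case 2
        show ?thesis using pure_zero_right[OF M.sq_closed[OF pure(2), of k], of "b + (i - k)"]
          unfolding d N.unstable'[OF 2 pure(3)] .
      qed
    qed
    then have "(\<Oplus>\<^bsub>comp T (a + b + i)\<^esub>k\<in>{..i}. pure (a + k) (b + (i - k)) (sq M k a x) (sq N (i - k) b y)) =
        (\<Oplus>\<^bsub>comp T (a + b + i)\<^esub>k\<in>{..i}. \<zero>\<^bsub>comp T (a + b + i)\<^esub>)"
      by (intro TV.finsum_cong') auto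
    then show ?case unfolding pure(1) sq_pure[OF pure(2,3)] by simp
  qed (simp_all add: lin_add[OF lin_sq_tensor])
  fix j assume ij: "0 < i" "i < 2 * j"
  note lin = lin_adem_rhs[OF tensor_vector_space lin_sq_tensor ij]
  have "sq T i (d + j) (sq T j d X) = adem_rhs T i j d X" using X
  proof (induction rule: tensor_induct)
    case zero show ?case by (simp add: lin_zero[OF tensor_vector_space tensor_vector_space lin])
  next
    case (add X Y)
    then show ?case by (simp add: lin_add[OF lin_sq_tensor] lin_closed[OF lin_sq_tensor] lin_add[OF lin])
  next
    case (pure a b x y)
    let ?F = "tensor (F a) (F b)"
    let ?\<iota> = "pure_tensor (F a) (F b) a b (iota a) (iota b)"
    obtain \<chi> where \<chi>: "\<chi> \<in> umod_hom ?F T"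
      "\<And>p q \<alpha> \<beta>. \<alpha> \<in> el (F a) p \<Longrightarrow> \<beta> \<in> el (F b) q \<Longrightarrow> \<chi> (p + q) (pure_tensor (F a) (F b) p q \<alpha> \<beta>) =
        pure p q (classify M a x p \<alpha>) (classify N b y q \<beta>)"
      using TF.tensor_map[OF tensor_factors_axioms M.classify_hom[OF pure(2)] N.classify_hom[OF pure(3)]] by blast
    have \<iota>: "\<chi> d ?\<iota> = pure a b x y"
      using \<chi>(2)[OF iota_in iota_in] by (simp add: pure(1) M.classify_iota[OF pure(2)] N.classify_iota[OF pure(3)])
    have i: "?\<iota> \<in> el ?F d" unfolding pure(1) by (rule TF.pure_in[OF iota_in iota_in])
    have "sq T i (d + j) (sq T j d (\<chi> d ?\<iota>)) = \<chi> (d + j + i) (sq ?F i (d + j) (sq ?F j d ?\<iota>))"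
      by (simp only: umod_hom_sq[OF \<chi>(1) i] umod_hom_sq[OF \<chi>(1) lin_closed[OF TF.lin_sq_tensor i]])
    also have "\<dots> = \<chi> (d + j + i) (adem_rhs ?F i j d ?\<iota>)" by (simp only: tensor_F_adem[OF ij i])
    also have "\<dots> = adem_rhs T i j d (\<chi> d ?\<iota>)"
      by (rule hom_adem_rhs[OF tensor_vector_space TF.lin_sq_tensor ij \<chi>(1) tensor_vector_space i])
    finally show ?case unfolding \<iota> .
  qed
  then show "sq T i (d + j) (sq T j d X) =
      (\<Oplus>\<^bsub>comp T (d + j + i)\<^esub>k\<in>{k. k \<le> i div 2 \<and> odd ((j - k - 1) choose (i - 2 * k))}.
        sq T (i + j - k) (d + k) (sq T k d X))"
    unfolding adem_rhs_def .
qed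

end

section \<open>Products of Brown--Gitler modules\<close>

interpretation JV: Module.module F2 "comp (J n) d" for n d by (rule J_vector_space)
interpretation Jn: unstable_module "J n" for n by (rule J_unstable)

text \<open>\<open>represent_apply\<close> is the Yoneda description: \<theta> acts on
  \<open>x\<close> as an operation from degree \<open>m\<close> to degree \<open>n\<close>, and
  \<omega> is applied to the result.\<close>

lemma (in unstable_module) represent:
  assumes \<omega>: "\<omega> \<in> lin (comp M n) F2"
  shows represent_hom: "represent n M \<omega> \<in> umod_hom M (J n)"
    and represent_iota: "x \<in> el M n \<Longrightarrow> represent n M \<omega> n x (iota n) = \<omega> x"
    and represent_apply: "x \<in> el M m \<Longrightarrow> \<theta> \<in> el (F m) n \<Longrightarrow>
      represent n M \<omega> m x \<theta> = \<omega> (classify M m x n \<theta>)"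
    and represent_unique: "\<phi> \<in> umod_hom M (J n) \<Longrightarrow> (\<And>x. x \<in> el M n \<Longrightarrow> \<phi> n x (iota n) = \<omega> x) \<Longrightarrow>
      \<phi> = represent n M \<omega>"
proof -
  let ?\<phi> = "represent n M \<omega>"
  have *: "?\<phi> \<in> umod_hom M (J n) \<and> (\<forall>x\<in>el M n. ?\<phi> n x (iota n) = \<omega> x)"
    unfolding represent_def by (rule theI'[OF J_represents[OF \<omega>]])
  then show hom: "?\<phi> \<in> umod_hom M (J n)" and iota: "x \<in> el M n \<Longrightarrow> ?\<phi> n x (iota n) = \<omega> x" for x
    by blast+
  show "\<phi> \<in> umod_hom M (J n) \<Longrightarrow> (\<And>x. x \<in> el M n \<Longrightarrow> \<phi> n x (iota n) = \<omega> x) \<Longrightarrow> \<phi> = ?\<phi>"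
    using J_represents[OF \<omega>] * by blast
  assume x: "x \<in> el M m" and \<theta>: "\<theta> \<in> el (F m) n"
  note f = umod_hom_closed[OF hom x]
  have "?\<phi> m x \<theta> = J_act n m n \<theta> (?\<phi> m x) (iota n)"
    by (simp only: J_act_def iota_in if_True Fn.classify_iota[OF \<theta>])
  also have "\<dots> = classify (J n) m (?\<phi> m x) n \<theta> (iota n)" by (simp only: classify_J[OF f \<theta>])
  also have "\<dots> = ?\<phi> n (classify M m x n \<theta>) (iota n)" by (simp only: classify_comp[OF x hom J_unstable \<theta>])
  also have "\<dots> = \<omega> (classify M m x n \<theta>)" by (rule iota[OF classify_closed[OF x \<theta>]])
  finally show "?\<phi> m x \<theta> = \<omega> (classify M m x n \<theta>)" .
qed

lemma J_off: "f \<in> el (J n) m \<Longrightarrow> \<theta> \<notin> el (F m) n \<Longrightarrow> f \<theta> = 0"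
  by (simp add: el_J)

lemma J_eqI:
  assumes "f \<in> el (J n) m" "g \<in> el (J n) m" "\<And>\<theta>. \<theta> \<in> el (F m) n \<Longrightarrow> f \<theta> = g \<theta>"
  shows "f = g"
proof
  fix \<theta> show "f \<theta> = g \<theta>" using assms by (cases "\<theta> \<in> el (F m) n") (simp_all add: J_off)
qed

lemma lin_eval_J: "(\<lambda>f. f \<theta>) \<in> lin (comp (J n) m) F2"
  by (rule linI[OF J_vector_space F2_module]) (simp_all add: add_J)

lemma J_zero: "f \<in> el (J n) m \<Longrightarrow> f \<zero>\<^bsub>comp (F m) n\<^esub> = 0"
proof -
  assume "f \<in> el (J n) m"
  then have "f (\<zero>\<^bsub>comp (F m) n\<^esub> \<oplus>\<^bsub>comp (F m) n\<^esub> \<zero>\<^bsub>comp (F m) n\<^esub>) = f \<zero>\<^bsub>comp (F m) n\<^esub> + f \<zero>\<^bsub>comp (F m) n\<^esub>"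
    unfolding el_J using FV.zero_closed by blast
  then show ?thesis by simp
qed

text \<open>The monomial $x_{e_1} \cdots x_{e_d}$ of Miller's description of the Brown--Gitler modules.\<close>

definition jmono :: "nat multiset \<Rightarrow> fterm set \<Rightarrow> bit" where
  "jmono E \<theta> = (if \<theta> \<in> el (F (size E)) (wtm E) then coef E \<theta> else 0)"

lemma jmono_in: "jmono E \<in> el (J (wtm E)) (size E)"
  unfolding el_J jmono_def using lin_add[OF lin_coef[of E "size E" "wtm E"]] by (simp add: orbits_def)

text \<open>Viewed as a morphism F(n) -> F(d), \<theta> carries Sq_0 iota_n to Sq_0 \<theta>; hence
  the map is the transpose of Sq_0 on F(d).\<close>

lemma dot_Sq:
  shows dot_Sq_hom: "dot_Sq n \<in> umod_hom (J (2 * n)) (J n)"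
    and dot_Sq_apply: "f \<in> el (J (2 * n)) d \<Longrightarrow> \<theta> \<in> el (F d) n \<Longrightarrow> dot_Sq n d f \<theta> = f (sq (F d) n n \<theta>)"
proof -
  let ?s = "sq (F n) n n (iota n)"
  have l: "(\<lambda>f. f (Sq0 (F n) n (iota n))) \<in> lin (comp (J (2 * n)) n) F2" by (rule lin_eval_J)
  show "dot_Sq n \<in> umod_hom (J (2 * n)) (J n)" unfolding dot_Sq_def by (rule Jn.represent_hom[OF l])
  assume f: "f \<in> el (J (2 * n)) d" and \<theta>: "\<theta> \<in> el (F d) n"
  have s: "?s \<in> el (F n) (2 * n)" using Fn.sq_closed[OF iota_in, of n n] by (simp add: mult_2)
  have "dot_Sq n d f \<theta> = classify (J (2 * n)) d f n \<theta> ?s"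
    unfolding dot_Sq_def Jn.represent_apply[OF l f \<theta>] by (simp add: Sq0_def)
  also have "\<dots> = f (classify (F d) n \<theta> (2 * n) ?s)" using s by (simp add: classify_J[OF f \<theta>] J_act_def)
  also have "classify (F d) n \<theta> (2 * n) ?s = sq (F d) n n \<theta>"
    using umod_hom_sq[OF Fn.classify_hom[OF \<theta>] iota_in, of n] by (simp add: mult_2 Fn.classify_iota[OF \<theta>])
  finally show "dot_Sq n d f \<theta> = f (sq (F d) n n \<theta>)" .
qed

text \<open>The transpose of \<open>psq_top\<close>: a monomial occurs in a square with the
  coefficient of its square root, or not at all if some entry is 0.\<close>

lemma dot_Sq_jmono:
  assumes "wtm E = 2 * n"
  shows "dot_Sq n (size E) (jmono E) = (if 0 \<in># E then (\<lambda>\<theta>. 0) else jmono (image_mset (\<lambda>e. e - 1) E))"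
proof (rule J_eqI)
  have E: "jmono E \<in> el (J (2 * n)) (size E)" using jmono_in[of E] assms by simp
  show "dot_Sq n (size E) (jmono E) \<in> el (J n) (size E)" by (rule umod_hom_closed[OF dot_Sq_hom E])
  let ?E = "image_mset (\<lambda>e. e - 1) E"
  have w: "wtm ?E = n" if "0 \<notin># E"
  proof -
    have "2 * wtm ?E = wtm E" using that
    proof (induction E)
      case (add e E)
      then have "0 < e" "2 * wtm (image_mset (\<lambda>e. e - 1) E) = wtm E" by auto
      then show ?case by (cases e) auto
    qed simp
    then show ?thesis using assms by simp
  qed
  show "(if 0 \<in># E then (\<lambda>\<theta>. 0) else jmono ?E) \<in> el (J n) (size E)"
    using jmono_in[of ?E] w JV.zero_closed[of n "size E"] by (auto simp: zero_J)
  fix \<theta> assume \<theta>: "\<theta> \<in> el (F (size E)) n"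
  have "dot_Sq n (size E) (jmono E) \<theta> = coef E (sq (F (size E)) n n \<theta>)"
    using dot_Sq_apply[OF E \<theta>] Fn.sq_closed[OF \<theta>, of n] assms by (simp add: jmono_def mult_2)
  also have "\<dots> = psq n (hat (size E) n \<theta>) (sorted_list E)"
    using hat_sq[OF \<theta>, of n] assms by (simp add: coef_def mult_2)
  also have "\<dots> = (if 0 \<in># E then 0 else hat (size E) n \<theta> (map (\<lambda>e. e - 1) (sorted_list E)))"
    using psq_top[OF hat_in[OF \<theta>]] by simp
  also have "\<dots> = (if 0 \<in># E then (\<lambda>\<theta>. 0) else jmono ?E) \<theta>"
  proof (cases "0 \<in># E")
    case False
    then show ?thesis
      using w[OF False] \<theta> hat_eq_coef[of \<theta> ?E "map (\<lambda>e. e - 1) (sorted_list E)"] by (simp add: jmono_def)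
  qed simp
  finally show "dot_Sq n (size E) (jmono E) \<theta> = (if 0 \<in># E then (\<lambda>\<theta>. 0) else jmono ?E) \<theta>" .
qed

lemma tensor_factors_J: "tensor_factors (J n) (J m)"
  by (intro tensor_factors.intro J_unstable)

interpretation TJ: tensor_factors "J n" "J m" for n m by (rule tensor_factors_J)

section \<open>The external product as the representative of an explicit functional\<close>

lemma J_high_degree: "f \<in> el (J n) m \<Longrightarrow> n < m \<Longrightarrow> f = \<zero>\<^bsub>comp (J n) m\<^esub>"
  by (rule J_eqI, assumption, simp) (metis F_low_degree J_zero zero_J)

lemma F_bottom: "\<theta> \<in> el (F n) n \<Longrightarrow> \<theta> = \<zero>\<^bsub>comp (F n) n\<^esub> \<or> \<theta> = iota n"
proof -
  have "\<theta> \<in> el (F n) d \<Longrightarrow> d = n \<longrightarrow> \<theta> = \<zero>\<^bsub>comp (F n) n\<^esub> \<or> \<theta> = iota n" for d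
  proof (induction rule: F_induct)
    case (add d \<theta> \<xi>)
    show ?case
    proof
      assume "d = n"
      then show "\<theta> \<oplus>\<^bsub>comp (F n) d\<^esub> \<xi> = \<zero>\<^bsub>comp (F n) n\<^esub> \<or> \<theta> \<oplus>\<^bsub>comp (F n) d\<^esub> \<xi> = iota n"
        using add F2_add_self[OF F_vector_space iota_in, of n] iota_in[of n] by (elim impE disjE) simp_all
    qed
  next
    case (sq d i \<theta>)
    show ?case
    proof
      assume n: "d + i = n"
      show "sq (F n) i d \<theta> = \<zero>\<^bsub>comp (F n) n\<^esub> \<or> sq (F n) i d \<theta> = iota n"
      proof (cases "d < n")
        case True
        from F_low_degree[OF sq.hyps True] show ?thesis
          using lin_zero[OF F_vector_space F_vector_space Fn.sq_linear, of n i d] n by simp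
      next
        case False
        then have "i = 0" "d = n" using n by simp_all
        then show ?thesis using sq by (simp add: Fn.sq_zero')
      qed
    qed
  qed simp_all
  then show "\<theta> \<in> el (F n) n \<Longrightarrow> ?thesis" by blast
qed

lemma J_bottom: "f \<in> el (J n) n \<Longrightarrow> g \<in> el (J n) n \<Longrightarrow> f (iota n) = g (iota n) \<Longrightarrow> f = g"
  by (rule J_eqI, assumption+) (metis F_bottom J_zero)

text \<open>The monomial x_0^n, the non-zero element of the one-dimensional space J(n)^n.\<close>

definition bottom :: "nat \<Rightarrow> fterm set \<Rightarrow> bit" where
  "bottom n = jmono (replicate_mset n 0)"

lemma wtm_replicate: "wtm (replicate_mset n 0) = n"
  by (induction n) simp_all

lemma bottom: "bottom n \<in> el (J n) n" "bottom n (iota n) = 1"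
proof -
  show "bottom n \<in> el (J n) n" using jmono_in[of "replicate_mset n 0"] by (simp add: bottom_def wtm_replicate)
  have "mset (replicate n (0::nat)) = replicate_mset n 0" by simp
  then have "coef (replicate_mset n 0) (iota n) = hat n n (iota n) (replicate n 0)"
    using hat_eq_coef[of "iota n" "replicate_mset n 0" "replicate n 0"] iota_in[of n] by (simp add: wtm_replicate)
  then show "bottom n (iota n) = 1"
    by (simp add: bottom_def jmono_def wtm_replicate iota_in hat_iota ones_def)
qed

definition ext_form :: "nat \<Rightarrow> nat \<Rightarrow> (fterm set \<Rightarrow> bit, fterm set \<Rightarrow> bit) tterm set \<Rightarrow> bit" where
  "ext_form n m = (SOME \<omega>. \<omega> \<in> lin (comp (tensor (J n) (J m)) (n + m)) F2 \<and>
     (\<forall>a b. \<forall>f\<in>el (J n) a. \<forall>g\<in>el (J m) b. n + m = a + b \<longrightarrow>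
       \<omega> (pure_tensor (J n) (J m) a b f g) = (if a = n then f (iota n) * g (iota m) else 0)))"

lemma ext_form:
  "ext_form n m \<in> lin (comp (tensor (J n) (J m)) (n + m)) F2"
  "f \<in> el (J n) a \<Longrightarrow> g \<in> el (J m) b \<Longrightarrow> n + m = a + b \<Longrightarrow>
    ext_form n m (pure_tensor (J n) (J m) a b f g) = (if a = n then f (iota n) * g (iota m) else 0)"
proof -
  have "\<exists>\<omega>\<in>lin (comp (tensor (J n) (J m)) (n + m)) F2. \<forall>a b. \<forall>f\<in>el (J n) a. \<forall>g\<in>el (J m) b. n + m = a + b \<longrightarrow>
       \<omega> (pure_tensor (J n) (J m) a b f g) = (if a = n then f (iota n) * g (iota m) else 0)"
    by (rule TJ.tensor_lift[OF F2_module]) (simp_all add: add_J distrib_left distrib_right)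
  then have "\<exists>\<omega>. \<omega> \<in> lin (comp (tensor (J n) (J m)) (n + m)) F2 \<and>
     (\<forall>a b. \<forall>f\<in>el (J n) a. \<forall>g\<in>el (J m) b. n + m = a + b \<longrightarrow>
       \<omega> (pure_tensor (J n) (J m) a b f g) = (if a = n then f (iota n) * g (iota m) else 0))" by blast
  from someI_ex[OF this, folded ext_form_def]
  show "ext_form n m \<in> lin (comp (tensor (J n) (J m)) (n + m)) F2"
    "f \<in> el (J n) a \<Longrightarrow> g \<in> el (J m) b \<Longrightarrow> n + m = a + b \<Longrightarrow>
      ext_form n m (pure_tensor (J n) (J m) a b f g) = (if a = n then f (iota n) * g (iota m) else 0)"
    by blast+
qed

text \<open>The space of functionals on $(J(n) \otimes J(m))^{n+m}$ is one-dimensional because the only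
  non-zero summand $J(n)^a \otimes J(m)^b$ is the one-dimensional $J(n)^n \otimes J(m)^m$.\<close>

lemma ext_form_unique:
  assumes \<omega>: "\<omega> \<in> lin (comp (tensor (J n) (J m)) (n + m)) F2" and X: "X \<in> el (tensor (J n) (J m)) (n + m)"
  shows "\<omega> X = \<omega> (pure_tensor (J n) (J m) n m (bottom n) (bottom m)) * ext_form n m X"
  using X
proof (induction rule: TJ.tensor_induct)
  case zero
  then show ?case using lin_zero[OF tensor_vector_space F2_module \<omega>]
      lin_zero[OF tensor_vector_space F2_module ext_form(1)] by simp
next
  case (add X Y)
  then show ?case using lin_add[OF \<omega>] lin_add[OF ext_form(1)] by (simp add: distrib_left)
next
  case (pure a b f g)
  note z = lin_zero[OF tensor_vector_space F2_module \<omega>]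
  consider "n < a" | "m < b" | "a = n" "b = m" using pure(1) by linarith
  then show ?case
  proof cases
    case 1
    then have "f = \<zero>\<^bsub>comp (J n) a\<^esub>" using J_high_degree pure by blast
    then have "\<omega> (pure_tensor (J n) (J m) a b f g) = 0" using TJ.pure_zero_left[OF pure(3)] z pure(1) by simp
    then show ?thesis using ext_form(2)[OF pure(2,3,1)] 1 by simp
  next
    case 2
    then have "g = \<zero>\<^bsub>comp (J m) b\<^esub>" using J_high_degree pure by blast
    then have "\<omega> (pure_tensor (J n) (J m) a b f g) = 0" using TJ.pure_zero_right[OF pure(2)] z pure(1) by simp
    then show ?thesis using ext_form(2)[OF pure(2,3,1)] 2 pure(1) by simp
  next
    case 3
    note f = pure(2)[unfolded 3] and g = pure(3)[unfolded 3]
    consider "f = \<zero>\<^bsub>comp (J n) n\<^esub>" | "g = \<zero>\<^bsub>comp (J m) m\<^esub>" | "f = bottom n" "g = bottom m"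
      using J_bottom[OF f] J_bottom[OF g] bottom zero_J JV.zero_closed by (metis bit_not_zero_iff)
    then show ?thesis
    proof cases
      case 1 then show ?thesis using TJ.pure_zero_left[OF g] z lin_zero[OF tensor_vector_space F2_module ext_form(1)] 3 by simp
    next
      case 2 then show ?thesis using TJ.pure_zero_right[OF f] z lin_zero[OF tensor_vector_space F2_module ext_form(1)] 3 by simp
    next
      case b: 3
      then show ?thesis using ext_form(2)[OF f g] bottom[of n] bottom[of m] 3 by simp
    qed
  qed
qed

text \<open>Morphisms into J(n + m) correspond to functionals, and a one-dimensional space over the
  field with two elements has a single non-zero element, so the definite description has exactly one
  candidate.\<close>

lemma ext_prod_eq: "ext_prod n m = represent (n + m) (tensor (J n) (J m)) (ext_form n m)"
proof -
  let ?T = "tensor (J n) (J m)"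
  let ?\<phi> = "represent (n + m) ?T (ext_form n m)"
  let ?x = "pure_tensor (J n) (J m) n m (bottom n) (bottom m)"
  interpret T: unstable_module ?T by (rule TJ.tensor_unstable)
  note rep = T.represent_hom[OF ext_form(1)] T.represent_iota[OF ext_form(1)]
  have x: "?x \<in> el ?T (n + m)" by (rule TJ.pure_in[OF bottom(1) bottom(1)])
  have x1: "ext_form n m ?x = 1" using ext_form(2)[OF bottom(1) bottom(1)] bottom(2) by simp
  show ?thesis unfolding ext_prod_def
  proof (rule the_equality)
    have "?\<phi> (n + m) ?x (iota (n + m)) = 1" using rep(2)[OF x] x1 by simp
    then have "?\<phi> (n + m) ?x \<noteq> \<zero>\<^bsub>comp (J (n + m)) (n + m)\<^esub>" by (metis zero_J zero_neq_one)
    then show "?\<phi> \<in> umod_hom ?T (J (n + m)) \<and> (\<exists>d. \<exists>x\<in>el ?T d. ?\<phi> d x \<noteq> \<zero>\<^bsub>comp (J (n + m)) d\<^esub>)"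
      using rep(1) x by blast
    fix \<phi> assume "\<phi> \<in> umod_hom ?T (J (n + m)) \<and> (\<exists>d. \<exists>x\<in>el ?T d. \<phi> d x \<noteq> \<zero>\<^bsub>comp (J (n + m)) d\<^esub>)"
    then obtain d y where \<phi>: "\<phi> \<in> umod_hom ?T (J (n + m))" and y: "y \<in> el ?T d" "\<phi> d y \<noteq> \<zero>\<^bsub>comp (J (n + m)) d\<^esub>"
      by blast
    let ?\<omega> = "\<lambda>x. \<phi> (n + m) x (iota (n + m))"
    have \<omega>: "?\<omega> \<in> lin (comp ?T (n + m)) F2" by (rule lin_comp[OF umod_hom_lin[OF \<phi>] lin_eval_J])
    have e: "\<phi> = represent (n + m) ?T ?\<omega>" by (rule T.represent_unique[OF \<omega> \<phi>]) simp
    have "?\<omega> ?x \<noteq> 0"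
    proof
      assume z: "?\<omega> ?x = 0"
      have "\<phi> d y = \<zero>\<^bsub>comp (J (n + m)) d\<^esub>"
      proof (rule J_eqI[OF umod_hom_closed[OF \<phi> y(1)] JV.zero_closed])
        fix \<theta> assume \<theta>: "\<theta> \<in> el (F d) (n + m)"
        have "\<phi> d y \<theta> = ?\<omega> (classify ?T d y (n + m) \<theta>)"
          by (subst e) (rule T.represent_apply[OF \<omega> y(1) \<theta>])
        also have "\<dots> = 0" using ext_form_unique[OF \<omega> T.classify_closed[OF y(1) \<theta>]] z by simp
        finally show "\<phi> d y \<theta> = \<zero>\<^bsub>comp (J (n + m)) d\<^esub> \<theta>" by (simp add: zero_J)
      qed
      then show False using y(2) by blast
    qed
    then have "?\<omega> x = ext_form n m x" if "x \<in> el ?T (n + m)" for x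
      using ext_form_unique[OF \<omega> that] by simp
    then show "\<phi> = ?\<phi>" by (rule T.represent_unique[OF ext_form(1) \<phi>])
  qed
qed

lemma ext_prod_hom: "ext_prod n m \<in> umod_hom (tensor (J n) (J m)) (J (n + m))"
  unfolding ext_prod_eq by (rule unstable_module.represent_hom[OF TJ.tensor_unstable ext_form(1)])

text \<open>Evaluation at \<theta> lets \<theta> act on the tensor of the two monomials. As this
  tensor is the image of iota_a \<otimes> iota_b, the action can be computed on t_1 ... t_(a+b),
  where it gives \<open>hat\<close> of \<theta>. The functional then extracts the coefficient of the
  monomial with \<open>E\<close> on the first \<open>a\<close> variables and \<open>E'\<close> on
  the others, which by symmetry is the coefficient of the orbit \<open>E + E'\<close>.\<close>

theorem ext_prod_jmono:
  "ext_prod (wtm E) (wtm E') (size E + size E')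
    (pure_tensor (J (wtm E)) (J (wtm E')) (size E) (size E') (jmono E) (jmono E')) = jmono (E + E')"
proof -
  define n m a b where nm: "n = wtm E" "m = wtm E'" "a = size E" "b = size E'"
  let ?T = "tensor (J n) (J m)" and ?S = "tensor (F a) (F b)"
  let ?x = "pure_tensor (J n) (J m) a b (jmono E) (jmono E')"
  let ?\<iota> = "pure_tensor (F a) (F b) a b (iota a) (iota b)"
  interpret T: unstable_module ?T by (rule TJ.tensor_unstable)
  interpret S: unstable_module ?S by (rule TF.tensor_unstable)
  have f: "jmono E \<in> el (J n) a" and g: "jmono E' \<in> el (J m) b" using jmono_in nm by auto
  have x: "?x \<in> el ?T (a + b)" by (rule TJ.pure_in[OF f g])
  have \<iota>: "?\<iota> \<in> el ?S (a + b)" by (rule TF.pure_in[OF iota_in iota_in])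
  obtain \<chi> where \<chi>: "\<chi> \<in> umod_hom ?S ?T"
    "\<And>p q \<alpha> \<beta>. \<alpha> \<in> el (F a) p \<Longrightarrow> \<beta> \<in> el (F b) q \<Longrightarrow> \<chi> (p + q) (pure_tensor (F a) (F b) p q \<alpha> \<beta>) =
      pure_tensor (J n) (J m) p q (classify (J n) a (jmono E) p \<alpha>) (classify (J m) b (jmono E') q \<beta>)"
    using TF.tensor_map[OF tensor_factors_J Jn.classify_hom[OF f] Jn.classify_hom[OF g]] by blast
  have \<chi>\<iota>: "\<chi> (a + b) ?\<iota> = ?x"
    using \<chi>(2)[OF iota_in iota_in] by (simp add: Jn.classify_iota[OF f] Jn.classify_iota[OF g])
  \<comment> \<open>Pulled back to F(a) \<otimes> F(b), the functional becomes a coefficient of the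
    polynomial. This is checked on pure tensors; for p \<noteq> n both sides vanish, the right one
    because \<open>E\<close> has weight \<open>n\<close>.\<close>
  have key: "ext_form n m (\<chi> (n + m) Z) = hat2 a b (n + m) Z (sorted_list E @ sorted_list E')"
    if "Z \<in> el ?S (n + m)" for Z
    using that
  proof (induction rule: TF.tensor_induct)
    case zero
    show ?case using lin_zero[OF tensor_vector_space tensor_vector_space umod_hom_lin[OF \<chi>(1)]]
        lin_zero[OF tensor_vector_space F2_module ext_form(1)]
        lin_zero[OF tensor_vector_space pol_vector_space umod_hom_lin[OF hat2(1)]] by (simp add: zero_pol)
  next
    case (add X Y)
    then show ?case using umod_hom_add[OF \<chi>(1)] umod_hom_closed[OF \<chi>(1)] lin_add[OF ext_form(1)]
        umod_hom_add[OF hat2(1)] by (simp add: add_pol)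
  next
    case (pure p q \<alpha> \<beta>)
    have cf: "classify (J n) a (jmono E) p \<alpha> \<in> el (J n) p" by (rule Jn.classify_closed[OF f pure(2)])
    have cg: "classify (J m) b (jmono E') q \<beta> \<in> el (J m) q" by (rule Jn.classify_closed[OF g pure(3)])
    have R: "hat2 a b (n + m) (pure_tensor (F a) (F b) p q \<alpha> \<beta>) (sorted_list E @ sorted_list E') =
        hat a p \<alpha> (sorted_list E) * hat b q \<beta> (sorted_list E')"
      using hat2(2)[OF pure(2,3), folded pure(1)] by (simp add: pmul_append nm)
    have L: "ext_form n m (\<chi> (n + m) (pure_tensor (F a) (F b) p q \<alpha> \<beta>)) =
        (if p = n then classify (J n) a (jmono E) p \<alpha> (iota n) * classify (J m) b (jmono E') q \<beta> (iota m) else 0)"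
      using \<chi>(2)[OF pure(2,3)] ext_form(2)[OF cf cg pure(1)] by (simp add: pure(1))
    show ?case
    proof (cases "p = n")
      case True
      then have q: "q = m" using pure(1) by simp
      note \<alpha> = pure(2)[unfolded True] and \<beta> = pure(3)[unfolded q]
      have "classify (J n) a (jmono E) n \<alpha> (iota n) = coef E \<alpha>"
        unfolding classify_J[OF f \<alpha>] J_act_def Fn.classify_iota[OF \<alpha>]
        using \<alpha> by (simp add: iota_in jmono_def nm)
      moreover have "classify (J m) b (jmono E') m \<beta> (iota m) = coef E' \<beta>"
        unfolding classify_J[OF g \<beta>] J_act_def Fn.classify_iota[OF \<beta>]
        using \<beta> by (simp add: iota_in jmono_def nm)
      ultimately show ?thesis unfolding L R by (simp add: True q coef_def nm)
    next
      case False
      then have "hat a p \<alpha> (sorted_list E) = 0"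
        using el_polD[OF hat_in[OF pure(2)], of "sorted_list E"] nm by (rule_tac ccontr) simp
      then show ?thesis unfolding L R using False by simp
    qed
  qed
  have "ext_prod n m (a + b) ?x = jmono (E + E')"
  proof (rule J_eqI)
    show "ext_prod n m (a + b) ?x \<in> el (J (n + m)) (a + b)" by (rule umod_hom_closed[OF ext_prod_hom x])
    show "jmono (E + E') \<in> el (J (n + m)) (a + b)" using jmono_in[of "E + E'"] by (simp add: nm)
    fix \<theta> assume \<theta>: "\<theta> \<in> el (F (a + b)) (n + m)"
    have "ext_prod n m (a + b) ?x \<theta> = ext_form n m (classify ?T (a + b) (\<chi> (a + b) ?\<iota>) (n + m) \<theta>)"
      unfolding ext_prod_eq \<chi>\<iota> by (rule T.represent_apply[OF ext_form(1) x \<theta>])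
    also have "\<dots> = ext_form n m (\<chi> (n + m) (classify ?S (a + b) ?\<iota> (n + m) \<theta>))"
      by (simp only: S.classify_comp[OF \<iota> \<chi>(1) TJ.tensor_unstable \<theta>])
    also have "\<dots> = hat2 a b (n + m) (classify ?S (a + b) ?\<iota> (n + m) \<theta>) (sorted_list E @ sorted_list E')"
      by (rule key[OF S.classify_closed[OF \<iota> \<theta>]])
    also have "hat2 a b (n + m) (classify ?S (a + b) ?\<iota> (n + m) \<theta>) = classify (pol (a + b)) (a + b) (hat2 a b (a + b) ?\<iota>) (n + m) \<theta>"
      by (simp only: S.classify_comp[OF \<iota> hat2(1) pol_unstable \<theta>])
    also have "\<dots> = hat (a + b) (n + m) \<theta>"
      by (simp only: hat2(2)[OF iota_in iota_in] hat_iota pmul_ones hat_def[of "a + b"])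
    also have "\<dots> (sorted_list E @ sorted_list E') = jmono (E + E') \<theta>"
      using hat_eq_coef[of \<theta> "E + E'" "sorted_list E @ sorted_list E'"] \<theta> by (simp add: nm jmono_def)
    finally show "ext_prod n m (a + b) ?x \<theta> = jmono (E + E') \<theta>" .
  qed
  then show ?thesis by (simp only: nm)
qed

lemma int_prod_jmono:
  assumes "wtm E = n" "wtm E' = n"
  shows "int_prod n (size E) (size E') (jmono E) (jmono E') = dot_Sq n (size E + size E') (jmono (E + E'))"
  using ext_prod_jmono[of E E'] assms by (simp add: int_prod_def)

lemma int_prod_closed: "x \<in> el (J n) a \<Longrightarrow> y \<in> el (J n) b \<Longrightarrow> int_prod n a b x y \<in> el (J n) (a + b)"
proof -
  assume h: "x \<in> el (J n) a" "y \<in> el (J n) b"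
  from umod_hom_closed[OF ext_prod_hom TJ.pure_in[OF h]] show ?thesis
    unfolding int_prod_def by (intro umod_hom_closed[OF dot_Sq_hom]) (simp add: mult_2)
qed

lemma int_prod_lin:
  "X \<in> el (tensor (J n) (J n)) d \<Longrightarrow> dot_Sq n d (ext_prod n n d X) \<in> el (J n) d"
  "X \<in> el (tensor (J n) (J n)) d \<Longrightarrow> Y \<in> el (tensor (J n) (J n)) d \<Longrightarrow>
    dot_Sq n d (ext_prod n n d (X \<oplus>\<^bsub>comp (tensor (J n) (J n)) d\<^esub> Y)) =
    dot_Sq n d (ext_prod n n d X) \<oplus>\<^bsub>comp (J n) d\<^esub> dot_Sq n d (ext_prod n n d Y)"
  "X \<in> el (tensor (J n) (J n)) d \<Longrightarrow>
    dot_Sq n (d + i) (ext_prod n n (d + i) (sq (tensor (J n) (J n)) i d X)) = sq (J n) i d (dot_Sq n d (ext_prod n n d X))"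
proof -
  note e = ext_prod_hom[of n n, unfolded mult_2[symmetric]]
  note closed = umod_hom_closed[OF e]
  show "X \<in> el (tensor (J n) (J n)) d \<Longrightarrow> dot_Sq n d (ext_prod n n d X) \<in> el (J n) d"
    by (intro umod_hom_closed[OF dot_Sq_hom] closed)
  show "X \<in> el (tensor (J n) (J n)) d \<Longrightarrow> Y \<in> el (tensor (J n) (J n)) d \<Longrightarrow>
    dot_Sq n d (ext_prod n n d (X \<oplus>\<^bsub>comp (tensor (J n) (J n)) d\<^esub> Y)) =
    dot_Sq n d (ext_prod n n d X) \<oplus>\<^bsub>comp (J n) d\<^esub> dot_Sq n d (ext_prod n n d Y)"
    by (simp only: umod_hom_add[OF e] umod_hom_add[OF dot_Sq_hom] closed)
  show "X \<in> el (tensor (J n) (J n)) d \<Longrightarrow>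
    dot_Sq n (d + i) (ext_prod n n (d + i) (sq (tensor (J n) (J n)) i d X)) = sq (J n) i d (dot_Sq n d (ext_prod n n d X))"
    by (simp only: umod_hom_sq[OF e] umod_hom_sq[OF dot_Sq_hom] closed)
qed

lemma int_prod_add_left: "x \<in> el (J n) a \<Longrightarrow> x' \<in> el (J n) a \<Longrightarrow> y \<in> el (J n) b \<Longrightarrow>
    int_prod n a b (x \<oplus>\<^bsub>comp (J n) a\<^esub> x') y = int_prod n a b x y \<oplus>\<^bsub>comp (J n) (a + b)\<^esub> int_prod n a b x' y"
  unfolding int_prod_def by (simp only: TJ.pure_add_left TJ.pure_in int_prod_lin(2))

lemma int_prod_add_right: "x \<in> el (J n) a \<Longrightarrow> y \<in> el (J n) b \<Longrightarrow> y' \<in> el (J n) b \<Longrightarrow>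
    int_prod n a b x (y \<oplus>\<^bsub>comp (J n) b\<^esub> y') = int_prod n a b x y \<oplus>\<^bsub>comp (J n) (a + b)\<^esub> int_prod n a b x y'"
  unfolding int_prod_def by (simp only: TJ.pure_add_right TJ.pure_in int_prod_lin(2))

lemma int_prod_cartan:
  assumes x: "x \<in> el (J n) a" and y: "y \<in> el (J n) b"
  shows "sq (J n) i (a + b) (int_prod n a b x y) = (\<Oplus>\<^bsub>comp (J n) (a + b + i)\<^esub>k\<in>{..i}.
    int_prod n (a + k) (b + (i - k)) (sq (J n) k a x) (sq (J n) (i - k) b y))"
proof -
  let ?T = "tensor (J n) (J n)" and ?D = "a + b + i"
  let ?f = "\<lambda>k. pure_tensor (J n) (J n) (a + k) (b + (i - k)) (sq (J n) k a x) (sq (J n) (i - k) b y)"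
  have f: "?f k \<in> el ?T ?D" if "k \<le> i" for k by (rule TJ.pure_sq_in[OF x y that])
  have lin: "(\<lambda>X. dot_Sq n ?D (ext_prod n n ?D X)) \<in> lin (comp ?T ?D) (comp (J n) ?D)"
    by (rule linI[OF tensor_vector_space J_vector_space int_prod_lin(1,2)])
  have "sq (J n) i (a + b) (int_prod n a b x y) = dot_Sq n ?D (ext_prod n n ?D (sq ?T i (a + b) (pure_tensor (J n) (J n) a b x y)))"
    unfolding int_prod_def by (simp only: int_prod_lin(3) TJ.pure_in[OF x y])
  also have "\<dots> = dot_Sq n ?D (ext_prod n n ?D (\<Oplus>\<^bsub>comp ?T ?D\<^esub>k\<in>{..i}. ?f k))"
    by (simp only: TJ.sq_pure[OF x y])
  also have "\<dots> = (\<Oplus>\<^bsub>comp (J n) ?D\<^esub>k\<in>{..i}. dot_Sq n ?D (ext_prod n n ?D (?f k)))"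
    by (rule lin_finsum[OF tensor_vector_space J_vector_space lin]) (use f in auto)
  also have "\<dots> = (\<Oplus>\<^bsub>comp (J n) ?D\<^esub>k\<in>{..i}.
      int_prod n (a + k) (b + (i - k)) (sq (J n) k a x) (sq (J n) (i - k) b y))"
  proof (rule JV.finsum_cong'[OF refl])
    have e: "dot_Sq n ?D (ext_prod n n ?D (?f k)) =
        int_prod n (a + k) (b + (i - k)) (sq (J n) k a x) (sq (J n) (i - k) b y)" if "k \<in> {..i}" for k
    proof -
      have "a + k + (b + (i - k)) = ?D" using that by simp
      then show ?thesis unfolding int_prod_def by (simp only:)
    qed
    then show "\<And>k. k \<in> {..i} \<Longrightarrow> dot_Sq n ?D (ext_prod n n ?D (?f k)) =
        int_prod n (a + k) (b + (i - k)) (sq (J n) k a x) (sq (J n) (i - k) b y)" .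
    show "(\<lambda>k. int_prod n (a + k) (b + (i - k)) (sq (J n) k a x) (sq (J n) (i - k) b y)) \<in> {..i} \<rightarrow> el (J n) ?D"
      by (rule Pi_I) (simp only: e[symmetric] int_prod_lin(1) f atMost_iff)
  qed
  finally show ?thesis .
qed

section \<open>The operation Sq^1 on the variables x_e\<close>

lemma psq_diagonal:
  assumes f: "\<And>e. f [e] = (if e = 0 then 0 else g [e - 1, e - 1])" and g: "\<And>x y. g [x, y] = g [y, x]"
  shows "psq i f [e] = (if e = 0 then 0 else psq i g [e - 1, e - 1])"
proof -
  have "g [Suc k, k] = g [k, Suc k]" for k by (rule g)
  moreover have "i = 2 * 2 ^ k" if "i \<le> 2 * 2 ^ k" "\<not> i - 2 ^ k < 2 ^ k" for k :: nat using that by auto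
  ultimately show ?thesis by (cases e; cases "e - 1") (auto simp: psq_Cons psq_Nil f split: nat.splits)
qed

text \<open>The morphism F(2) -> F(1) with iota_2 -> Sq^1 iota_1 sets t_1 = t_2 = t, because t_1 t_2
  goes to t^2. In a symmetric polynomial the mixed monomials then cancel in pairs, and t_1^(2^k)
  t_2^(2^k) becomes t^(2^(k+1)), whence the shift by one. \<open>psq_diagonal\<close> says that the
  operations respect this.\<close>

lemma hat_Sq_iota:
  assumes "\<theta> \<in> el (F 2) d"
  shows "hat 1 d (classify (F 1) 2 (sq (F 1) 1 1 (iota 1)) d \<theta>) [e] = (if e = 0 then 0 else hat 2 d \<theta> [e - 1, e - 1])"
proof -
  let ?s = "sq (F 1) 1 1 (iota 1)"
  have s: "?s \<in> el (F 1) 2" using Fn.sq_closed[OF iota_in, of 1 1] by (simp add: numeral_2_eq_2)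
  note c = Fn.classify_hom[OF s]
  show ?thesis using assms
  proof (induction arbitrary: e rule: F_induct)
    case iota
    have "hat 1 2 ?s = psq 1 (ones 1)" using hat_sq[OF iota_in, of 1 1] hat_iota[of 1] by (simp add: numeral_2_eq_2)
    then show ?case unfolding Fn.classify_iota[OF s] hat_iota
      by (cases e) (auto simp: psq_Cons psq_Nil ones_def numeral_2_eq_2)
  next
    case (zero d)
    show ?case using lin_zero[OF F_vector_space F_vector_space umod_hom_lin[OF c]] by (simp add: hat_zero)
  next
    case (add d \<theta> \<xi>)
    show ?case
      unfolding umod_hom_add[OF c add.hyps] hat_add[OF add.hyps[THEN umod_hom_closed[OF c]]] hat_add[OF add.hyps] add.IH
      by simp
  next
    case (sq d i \<theta>)
    let ?g = "hat 2 d \<theta>"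
    have sym: "?g [x, y] = ?g [y, x]" for x y
      using symm_hat[OF sq.hyps, unfolded symm_def, rule_format, of "[]" x y "[]"] by simp
    have "hat 1 (d + i) (classify (F 1) 2 ?s (d + i) (sq (F 2) i d \<theta>)) = psq i (hat 1 d (classify (F 1) 2 ?s d \<theta>))"
      by (simp only: umod_hom_sq[OF c sq.hyps] hat_sq[OF umod_hom_closed[OF c sq.hyps]])
    moreover have "hat 2 (d + i) (sq (F 2) i d \<theta>) = psq i ?g" by (rule hat_sq[OF sq.hyps])
    ultimately show ?case using psq_diagonal[OF sq.IH sym] by (simp only:)
  qed
qed

lemma sq_jmono_generator:
  "sq (J (2 ^ e)) 1 1 (jmono {#e#}) = (if e = 0 then (\<lambda>\<theta>. 0) else jmono {#e - 1, e - 1#})"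
proof (rule J_eqI)
  have m: "jmono {#e#} \<in> el (J (2 ^ e)) 1" using jmono_in[of "{#e#}"] by simp
  have s: "sq (F 1) 1 1 (iota 1) \<in> el (F 1) 2" using Fn.sq_closed[OF iota_in, of 1 1] by (simp add: numeral_2_eq_2)
  show "sq (J (2 ^ e)) 1 1 (jmono {#e#}) \<in> el (J (2 ^ e)) 2"
    using Jn.sq_closed[OF m, of 1] by (simp add: numeral_2_eq_2)
  have w: "wtm {#e - 1, e - 1#} = 2 ^ e" if "e \<noteq> 0" using that by (cases e) auto
  show "(if e = 0 then (\<lambda>\<theta>. 0) else jmono {#e - 1, e - 1#}) \<in> el (J (2 ^ e)) 2"
    using jmono_in[of "{#e - 1, e - 1#}"] w JV.zero_closed[of "2 ^ e" 2] by (auto simp: zero_J numeral_2_eq_2)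
  fix \<theta> assume \<theta>: "\<theta> \<in> el (F 2) (2 ^ e)"
  let ?c = "classify (F 1) 2 (sq (F 1) 1 1 (iota 1)) (2 ^ e) \<theta>"
  have c: "?c \<in> el (F 1) (2 ^ e)" by (rule Fn.classify_closed[OF s \<theta>])
  have "sq (J (2 ^ e)) 1 1 (jmono {#e#}) \<theta> = jmono {#e#} ?c"
    using \<theta> by (simp add: sq_J J_act_def numeral_2_eq_2)
  also have "\<dots> = hat 1 (2 ^ e) ?c [e]" using c by (simp add: jmono_def coef_def)
  also have "\<dots> = (if e = 0 then 0 else hat 2 (2 ^ e) \<theta> [e - 1, e - 1])" by (rule hat_Sq_iota[OF \<theta>])
  also have "\<dots> = (if e = 0 then (\<lambda>\<theta>. 0) else jmono {#e - 1, e - 1#}) \<theta>"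
    using \<theta> w by (simp add: jmono_def coef_def numeral_2_eq_2)
  finally show "sq (J (2 ^ e)) 1 1 (jmono {#e#}) \<theta> = (if e = 0 then (\<lambda>\<theta>. 0) else jmono {#e - 1, e - 1#}) \<theta>" .
qed

section \<open>Products of one element in a level algebra\<close>

text \<open>The Kraft sum of binary prefix codes. The value 1 characterises the leaf depths of
  binary trees in which every inner node has two children (\<open>tree_kraft\<close>,
  \<open>tree_exists\<close>).\<close>

definition kraft :: "nat multiset \<Rightarrow> real" where
  "kraft D = (\<Sum>j\<in>#D. (1/2) ^ j)"

lemma kraft_simps [simp]: "kraft {#} = 0" "kraft (add_mset j D) = (1/2) ^ j + kraft D"
  "kraft (D + D') = kraft D + kraft D'"
  by (simp_all add: kraft_def)

lemma kraft_nonneg: "0 \<le> kraft D"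
  by (induction D) simp_all

lemma kraft_eq_0: "kraft D = 0 \<Longrightarrow> D = {#}"
  using kraft_nonneg by (cases D) (simp_all add: add_pos_nonneg less_imp_neq[symmetric])

lemma kraft_mono: "D \<subseteq># E \<Longrightarrow> kraft D \<le> kraft E"
  using kraft_nonneg by (auto simp: mset_subset_eq_exists_conv)

lemma kraft_Suc: "kraft (image_mset Suc D) = kraft D / 2"
  by (induction D) simp_all

lemma kraft_dyadic: "(\<forall>j\<in>#D. j \<le> h) \<Longrightarrow> \<exists>z::nat. kraft D = real z * (1/2) ^ h"
proof (induction D)
  case empty show ?case by (intro exI[of _ 0]) simp
next
  case (add j D)
  then obtain z :: nat where z: "kraft D = real z * (1/2) ^ h" by auto
  have "j \<le> h" using add.prems by simp
  then have "(1/2 :: real) ^ h = (1/2) ^ (h - j) * (1/2) ^ j" by (simp flip: power_add)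
  then have "(1/2 :: real) ^ j = 2 ^ (h - j) * (1/2) ^ h" by (simp add: power_one_over)
  then show ?case using z by (intro exI[of _ "2 ^ (h - j) + z"]) (simp add: distrib_right)
qed

text \<open>Take a smallest sub-multiset with sum at least (1/2)^m and let h be its greatest depth.
  Its sum and (1/2)^m are both multiples of (1/2)^h, so an excess would be at least (1/2)^h, and a
  leaf of depth h could be removed.\<close>

lemma kraft_submultiset:
  assumes "\<forall>j\<in>#D. m \<le> j" "(1/2) ^ m \<le> kraft D"
  shows "\<exists>E. E \<subseteq># D \<and> kraft E = (1/2) ^ m"
proof -
  let ?P = "\<lambda>E. E \<subseteq># D \<and> (1/2) ^ m \<le> kraft E"
  have "?P D" using assms by simp
  then obtain E where E: "?P E" "\<And>E'. ?P E' \<Longrightarrow> size E \<le> size E'"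
    using ex_has_least_nat[of ?P D size] by blast
  show ?thesis
  proof (cases "kraft E = (1/2) ^ m")
    case True then show ?thesis using E by blast
  next
    case False
    then have lt: "(1/2) ^ m < kraft E" using E(1) by simp
    have ne: "E \<noteq> {#}"
    proof
      assume "E = {#}"
      then have "(1/2 :: real) ^ m < 0" using lt by simp
      moreover have "0 < (1/2 :: real) ^ m" by simp
      ultimately show False by linarith
    qed
    define h where "h = Max (set_mset E)"
    have h: "h \<in># E" "\<forall>j\<in>#E. j \<le> h" using ne by (simp_all add: h_def)
    have "h \<in># D" by (rule mset_subset_eqD[OF conjunct1[OF E(1)] h(1)])
    then have "m \<le> h" using assms(1) by blast
    then have "(1/2 :: real) ^ h = (1/2) ^ (h - m) * (1/2) ^ m" by (simp flip: power_add)
    then have pm: "(1/2 :: real) ^ m = 2 ^ (h - m) * (1/2) ^ h" by (simp add: power_one_over)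
    obtain z :: nat where z: "kraft E = real z * (1/2) ^ h" using kraft_dyadic[OF h(2)] by blast
    have "real (2 ^ (h - m)) < real z" using lt unfolding pm z by simp
    then have "2 ^ (h - m) + 1 \<le> z" by linarith
    then have "real (2 ^ (h - m) + 1) \<le> real z" by (simp only: of_nat_le_iff)
    then have "real (2 ^ (h - m) + 1) * (1/2) ^ h \<le> real z * (1/2) ^ h" by (rule mult_right_mono) simp
    then have "(1/2) ^ m + (1/2) ^ h \<le> kraft E" unfolding pm z by (simp add: distrib_right)
    moreover obtain E' where E': "E = add_mset h E'" using h(1) by (metis mset_add)
    ultimately have "?P E'" using E(1) by (auto intro: subset_mset.trans[of E' E D])
    from E(2)[OF this] show ?thesis using E' by simp
  qed
qed

lemma kraft_leaf: "kraft D = 1 \<Longrightarrow> 0 \<in># D \<Longrightarrow> D = {#0#}"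
proof -
  assume D: "kraft D = 1" "0 \<in># D"
  obtain D' where "D = add_mset 0 D'" using D(2) by (metis mset_add)
  then show ?thesis using D(1) kraft_eq_0[of D'] by simp
qed

lemma kraft_half:
  assumes "0 \<notin># D" "kraft D = 1/2"
  obtains E where "D = image_mset Suc E" "kraft E = 1"
proof
  show D: "D = image_mset Suc (image_mset (\<lambda>j. j - 1) D)"
    using assms(1) by (induction D) auto
  show "kraft (image_mset (\<lambda>j. j - 1) D) = 1"
    using kraft_Suc[of "image_mset (\<lambda>j. j - 1) D"] assms(2) unfolding D[symmetric] by simp
qed

text \<open>Cutting at the root leaves two parts of sum 1/2. One of them can be chosen inside any
  \<open>N\<close> of sum at least 1/2; this freedom is what gives two different trees a common
  branch.\<close>

lemma kraft_split_sub:
  assumes N: "N \<subseteq># D" "1/2 \<le> kraft N" and D: "kraft D = 1" "0 \<notin># D"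
  obtains A B where "image_mset Suc A \<subseteq># N" "D = image_mset Suc (A + B)" "kraft A = 1" "kraft B = 1"
proof -
  have pos: "\<forall>j\<in>#N. 1 \<le> j"
  proof
    fix j assume "j \<in># N"
    then have "j \<in># D" by (rule mset_subset_eqD[OF N(1)])
    then show "1 \<le> j" using D(2) by (cases j) auto
  qed
  obtain A' where A': "A' \<subseteq># N" "kraft A' = 1/2" using kraft_submultiset[OF pos] N(2) by auto
  have sub: "A' \<subseteq># D" using A'(1) N(1) by (rule subset_mset.trans)
  then have dd: "D = A' + (D - A')" by simp
  then have k: "kraft (D - A') = 1/2" using D(1) A'(2) kraft_simps(3)[of A' "D - A'"] by simp
  have z: "0 \<notin># A'" "0 \<notin># D - A'" using D(2) mset_subset_eqD[OF sub] in_diffD[of 0 D A'] by blast+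
  obtain A where A: "A' = image_mset Suc A" "kraft A = 1" using kraft_half[OF z(1) A'(2)] .
  obtain B where B: "D - A' = image_mset Suc B" "kraft B = 1" using kraft_half[OF z(2) k] .
  have "D = image_mset Suc A + image_mset Suc B" using dd unfolding B(1) unfolding A(1) .
  then have "D = image_mset Suc (A + B)" by simp
  moreover have "image_mset Suc A \<subseteq># N" using A'(1) unfolding A(1) .
  ultimately show ?thesis using that A(2) B(2) by blast
qed

lemma kraft_split:
  assumes "kraft D = 1" "D \<noteq> {#0#}"
  obtains A B where "D = image_mset Suc (A + B)" "kraft A = 1" "kraft B = 1"
proof -
  have z: "0 \<notin># D" using assms kraft_leaf by blast
  have h: "1/2 \<le> kraft D" using assms(1) by simp
  show ?thesis by (rule kraft_split_sub[OF subset_mset.order_refl h assms(1) z]) (rule that)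
qed

lemma kraft_nonempty: "kraft D = 1 \<Longrightarrow> 0 < size D"
  by (cases D) simp_all

lemma kraft_induct [consumes 1, case_names leaf node]:
  assumes "kraft D = 1" and "P {#0#}"
    and node: "\<And>A B. kraft A = 1 \<Longrightarrow> kraft B = 1 \<Longrightarrow> P A \<Longrightarrow> P B \<Longrightarrow> P (image_mset Suc (A + B))"
  shows "P D"
  using assms(1)
proof (induction "size D" arbitrary: D rule: less_induct)
  case less
  show ?case
  proof (cases "D = {#0#}")
    case False
    obtain A B where AB: "D = image_mset Suc (A + B)" "kraft A = 1" "kraft B = 1"
      using kraft_split[OF less.prems False] .
    have "size D = size A + size B" unfolding AB(1) by simp
    then have s: "size A < size D" "size B < size D"
      using kraft_nonempty[OF AB(2)] kraft_nonempty[OF AB(3)] by linarith+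
    show ?thesis unfolding AB(1)
      by (rule node[OF AB(2,3) less.hyps[OF s(1) AB(2)] less.hyps[OF s(2) AB(3)]])
  qed (simp add: assms(2))
qed

lemma kraft_less_size: "kraft D = 1 \<Longrightarrow> j \<in># D \<Longrightarrow> j < size D"
proof (induction arbitrary: j rule: kraft_induct)
  case (node A B)
  then obtain i where i: "j = Suc i" "i \<in># A \<or> i \<in># B" by auto
  from i(2) have "i < size A \<or> i < size B" using node.IH by blast
  then show ?case using i(1) kraft_nonempty[OF node.hyps(1)] kraft_nonempty[OF node.hyps(2)] by auto
qed simp

section \<open>Products along binary trees and their independence of the bracketing\<close>

inductive tree :: "('a, 'm) ulalg_scheme \<Rightarrow> 'a \<Rightarrow> nat multiset \<Rightarrow> 'a \<Rightarrow> bool" for L x where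
  leaf: "tree L x {#0#} x"
| node: "tree L x A s \<Longrightarrow> tree L x B t \<Longrightarrow>
    tree L x (image_mset Suc (A + B)) (star L (size A) (size B) s t)"

text \<open>\<open>tree L x D y\<close>: \<open>y\<close> is a product of copies of \<open>x\<close>, bracketed as a binary tree whose leaves
  have the depths \<open>D\<close>.\<close>

lemma tree_kraft: "tree L x D y \<Longrightarrow> kraft D = 1"
  by (induction rule: tree.induct) (simp_all add: kraft_Suc)

lemma tree_exists: "kraft D = 1 \<Longrightarrow> \<exists>y. tree L x D y"
  by (induction rule: kraft_induct) (blast intro: tree.intros)+

lemma tree_leaf_unique: "tree L x {#0#} y \<Longrightarrow> y = x"
proof (erule tree.cases)
  fix A s B t assume "{#0#} = image_mset Suc (A + B)"
  then have "0 \<in># image_mset Suc (A + B)" by (metis union_single_eq_member add_mset_add_single multi_member_last)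
  then show "y = x" by auto
qed

context unstable_level_algebra
begin

lemma tree_closed:
  assumes "x \<in> el L 1" "tree L x D y" shows "y \<in> el L (size D)"
  using assms(2)
proof (induction rule: tree.induct)
  case (node A s B t) then show ?case using star_closed[of t "size B" s "size A"] by simp
qed (use assms(1) in simp)

text \<open>Let \<open>s1 \<star> s2\<close> and \<open>t1 \<star> t2\<close> have the same depths. Up to commutativity \<open>s1\<close> and \<open>t1\<close>
  share a half \<open>a\<close>, and then \<open>s2\<close> and \<open>t2\<close> share a half \<open>b\<close>; the level law moves \<open>a \<star> b\<close> into one
  branch, and the other branches agree by induction.\<close>

theorem tree_unique:
  assumes x: "x \<in> el L 1"
  shows "tree L x D s \<Longrightarrow> tree L x D t \<Longrightarrow> s = t"
proof (induction "size D" arbitrary: D s t rule: less_induct)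
  case less
  have core: "star L (size p1) (size p2) s1 s2 = star L (size q1) (size q2) t1 t2"
    if t: "tree L x p1 s1" "tree L x p2 s2" "tree L x q1 t1" "tree L x q2 t2"
      and pq: "p1 + p2 = q1 + q2" and D: "size D = size p1 + size p2" and half: "1/2 \<le> kraft (p1 \<inter># q1)"
    for p1 p2 q1 q2 s1 s2 t1 t2
  proof -
    note k = t[THEN tree_kraft]
    note pos = k[THEN kraft_nonempty]
    have sz: "size q1 + size q2 = size D" using D arg_cong[OF pq, of size] by simp
    have less4: "size p1 < size D" "size p2 < size D" "size q1 < size D" "size q2 < size D"
      using D sz pos by linarith+
    show ?thesis
    proof (cases "p1 = q1")
      case True
      then have "p2 = q2" using pq by simp
      then show ?thesis using True less.hyps[OF less4(1) t(1)] less.hyps[OF less4(2) t(2)] t by simp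
    next
      case neq: False
      define n11 where "n11 = p1 \<inter># q1"
      define n12 where "n12 = p1 - n11"
      define n21 where "n21 = q1 - n11"
      define r where "r = p2 - n21"
      have p1: "p1 = n11 + n12" and q1: "q1 = n11 + n21"
        by (rule multiset_eqI, simp add: n11_def n12_def n21_def min_def)+
      have "count p1 c + count p2 c = count q1 c + count q2 c" for c
        using arg_cong[OF pq, of "\<lambda>M. count M c"] by simp
      note c = this
      have p2: "p2 = n21 + r"
      proof (rule multiset_eqI)
        fix e show "count p2 e = count (n21 + r) e"
          using c[of e] by (simp add: r_def n21_def n11_def min_def)
      qed
      have q2: "q2 = n12 + r"
      proof -
        have "n11 + n12 + (n21 + r) = n11 + n21 + q2" using pq by (simp only: p1 p2 q1)
        then show ?thesis by (simp add: ac_simps)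
      qed
      \<comment> \<open>All rows and columns have Kraft sum 1, so the two diagonal entries agree:
        \<open>r\<close> too has sum at least 1/2 and contains a half common to \<open>p2\<close>
        and \<open>q2\<close>.\<close>
      have kr: "kraft r = kraft n11" using k(2,3) unfolding p2 q1 by simp
      \<comment> \<open>A depth 0 would make its multiset a single leaf, and the table would then
        force \<open>p1 = q1\<close>. Without depth 0 all four multisets can be cut at the
        root.\<close>
      have z1: "0 \<notin># p1"
      proof
        assume "0 \<in># p1"
        then have p: "p1 = {#0#}" by (rule kraft_leaf[OF k(1)])
        have "n11 \<noteq> {#}" using half by (auto simp: n11_def)
        then have "0 \<in># n11" using p1 p by (metis multiset_nonemptyE mset_subset_eqD mset_subset_eq_add_left set_mset_single add_mset_add_single singletonD set_mset_add_mset_insert set_mset_empty)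
        then have "0 \<in># q1" using q1 by simp
        then show False using kraft_leaf[OF k(3)] p neq by simp
      qed
      have z3: "0 \<notin># q1"
      proof
        assume "0 \<in># q1"
        then have p: "q1 = {#0#}" by (rule kraft_leaf[OF k(3)])
        have "n11 \<noteq> {#}" using half by (auto simp: n11_def)
        then have "n11 = {#0#}" using q1 p by (metis add_eq_self_zero size_eq_0_iff_empty size_single size_union add_is_1 union_is_single)
        then have "0 \<in># p1" using p1 by simp
        then show False using z1 by blast
      qed
      have z2: "0 \<notin># p2"
      proof
        assume "0 \<in># p2"
        then have p: "p2 = {#0#}" by (rule kraft_leaf[OF k(2)])
        have "r \<noteq> {#}" using half kr by (auto simp: n11_def)
        then have "n21 = {#}" using p2 p by (metis union_is_single)
        then have "kraft n11 = 1" using k(3) q1 by simp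
        then have "kraft n12 = 0" using k(1) p1 by simp
        then have "p1 = q1" using kraft_eq_0 p1 q1 \<open>n21 = {#}\<close> by simp
        then show False using neq by blast
      qed
      have z4: "0 \<notin># q2"
      proof
        assume "0 \<in># q2"
        then have "0 \<in># n12 \<or> 0 \<in># r" using q2 by simp
        then show False using z1 z2 p1 p2 by auto
      qed
      have n11: "n11 \<subseteq># p1" "1/2 \<le> kraft n11" using half by (simp_all add: n11_def)
      obtain a a' where a: "image_mset Suc a \<subseteq># n11" "p1 = image_mset Suc (a + a')" "kraft a = 1" "kraft a' = 1"
        using kraft_split_sub[OF n11 k(1) z1] .
      have r: "r \<subseteq># p2" by (simp add: r_def)
      have r: "r \<subseteq># p2" "1/2 \<le> kraft r" by (rule r) (use n11(2) kr in simp)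
      obtain b b' where b: "image_mset Suc b \<subseteq># r" "p2 = image_mset Suc (b + b')" "kraft b = 1" "kraft b' = 1"
        using kraft_split_sub[OF r k(2) z2] .
      have rest: "\<exists>e. q = image_mset Suc (d + e) \<and> kraft e = 1"
        if q: "image_mset Suc d \<subseteq># q" "kraft d = 1" "kraft q = 1" "0 \<notin># q" for q d
      proof -
        have qd: "q = image_mset Suc d + (q - image_mset Suc d)" using q(1) by simp
        then have "kraft (q - image_mset Suc d) = 1/2"
          using q(2,3) kraft_simps(3)[of "image_mset Suc d" "q - image_mset Suc d"] by (simp add: kraft_Suc)
        moreover have "0 \<notin># q - image_mset Suc d" using q(4) in_diffD by fastforce
        ultimately obtain e where e: "q - image_mset Suc d = image_mset Suc e" "kraft e = 1" using kraft_half by blast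
        have "q = image_mset Suc (d + e)" using qd unfolding e(1) by simp
        then show ?thesis using e(2) by blast
      qed
      obtain a'' where a'': "q1 = image_mset Suc (a + a'')" "kraft a'' = 1"
        using rest[OF _ a(3) k(3) z3] a(1) q1 by (metis mset_subset_eq_add_left subset_mset.trans)
      obtain b'' where b'': "q2 = image_mset Suc (b + b'')" "kraft b'' = 1"
        using rest[OF _ b(3) k(4) z4] b(1) q2 by (metis mset_subset_eq_add_right subset_mset.trans)
      have "image_mset Suc (a + a') + image_mset Suc (b + b') = image_mset Suc (a + a'') + image_mset Suc (b + b'')"
        using pq by (simp only: a(2) b(2) a''(1) b''(1))
      then have ab: "image_mset Suc (a' + b') = image_mset Suc (a'' + b'')" by (simp add: ac_simps)
      obtain ta ta' ta'' tb tb' tb'' where tr: "tree L x a ta" "tree L x a' ta'" "tree L x a'' ta''"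
        "tree L x b tb" "tree L x b' tb'" "tree L x b'' tb''"
        using a(3,4) b(3,4) a''(2) b''(2) tree_exists by meson
      note cl = tr[THEN tree_closed[OF x]]
      have s1: "s1 = star L (size a) (size a') ta ta'"
        by (rule less.hyps[OF less4(1) t(1)]) (unfold a(2), intro tree.node tr)
      have s2: "s2 = star L (size b) (size b') tb tb'"
        by (rule less.hyps[OF less4(2) t(2)]) (unfold b(2), intro tree.node tr)
      have t1: "t1 = star L (size a) (size a'') ta ta''"
        by (rule less.hyps[OF less4(3) t(3)]) (unfold a''(1), intro tree.node tr)
      have t2: "t2 = star L (size b) (size b'') tb tb''"
        by (rule less.hyps[OF less4(4) t(4)]) (unfold b''(1), intro tree.node tr)
      have m: "star L (size a') (size b') ta' tb' = star L (size a'') (size b'') ta'' tb''"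
      proof (rule less.hyps)
        show "tree L x (image_mset Suc (a' + b')) (star L (size a') (size b') ta' tb')" by (intro tree.node tr)
        show "tree L x (image_mset Suc (a' + b')) (star L (size a'') (size b'') ta'' tb'')"
          unfolding ab by (intro tree.node tr)
        show "size (image_mset Suc (a' + b')) < size D"
          using kraft_nonempty[OF a(3)] D a(2) b(2) by simp
      qed
      have szs: "size a' + size b' = size a'' + size b''" using arg_cong[OF ab, of size] by simp
      have "star L (size p1) (size p2) s1 s2 =
          star L (size a + size a') (size b + size b') (star L (size a) (size a') ta ta') (star L (size b) (size b') tb tb')"
        by (simp add: a(2) b(2) s1 s2)
      also have "\<dots> = star L (size a + size b) (size a' + size b') (star L (size a) (size b) ta tb) (star L (size a') (size b') ta' tb')"
        by (rule level'[OF cl(1,2,4,5)])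
      also have "\<dots> = star L (size a + size b) (size a'' + size b'') (star L (size a) (size b) ta tb) (star L (size a'') (size b'') ta'' tb'')"
        by (simp only: m szs)
      also have "\<dots> = star L (size a + size a'') (size b + size b'') (star L (size a) (size a'') ta ta'') (star L (size b) (size b'') tb tb'')"
        by (rule level'[OF cl(1,4,3,6)])
      also have "\<dots> = star L (size q1) (size q2) t1 t2" by (simp add: a''(1) b''(1) t1 t2)
      finally show ?thesis .
    qed
  qed
  from less.prems(1) show ?case
  proof cases
    case leaf
    then show ?thesis using less.prems(2) tree_leaf_unique by metis
  next
    case s: (node p1 s1 p2 s2)
    from less.prems(2) show ?thesis
    proof cases
      case leaf
      then show ?thesis using less.prems(1) tree_leaf_unique by metis
    next
      case t: (node q1 t1 q2 t2)
      have pq: "p1 + p2 = q1 + q2"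
      proof -
        have "image_mset Suc (p1 + p2) = image_mset Suc (q1 + q2)" using s(1) t(1) by simp
        then have "image_mset (\<lambda>j. j - 1) (image_mset Suc (p1 + p2)) = image_mset (\<lambda>j. j - 1) (image_mset Suc (q1 + q2))"
          by (simp only:)
        then show ?thesis by (simp add: image_mset.compositionality o_def)
      qed
      have D: "size D = size p1 + size p2" using s(1) by simp
      show ?thesis
      proof (cases "1/2 \<le> kraft (p1 \<inter># q1)")
        case True
        then show ?thesis using core[OF s(3,4) t(3,4) pq D] s(2) t(2) by simp
      next
        case False
        \<comment> \<open>What \<open>p1\<close> does not share with \<open>q1\<close> lies in
          \<open>q2\<close>. As \<open>p1\<close> has sum 1, one of the two intersections has sum at
          least 1/2, and commutativity exchanges \<open>q1\<close> and \<open>q2\<close>.\<close>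
        have "p1 - p1 \<inter># q1 \<subseteq># q2"
        proof (rule mset_subset_eqI)
          fix e
          have "count p1 e + count p2 e = count q1 e + count q2 e"
            using arg_cong[OF pq, of "\<lambda>M. count M e"] by simp
          then show "count (p1 - p1 \<inter># q1) e \<le> count q2 e" by (simp add: min_def)
        qed
        then have sub: "p1 - p1 \<inter># q1 \<subseteq># p1 \<inter># q2" by simp
        have "p1 = p1 \<inter># q1 + (p1 - p1 \<inter># q1)"
          by (rule multiset_eqI) (simp add: min_def)
        then have "kraft (p1 \<inter># q1) + kraft (p1 - p1 \<inter># q1) = 1"
          using tree_kraft[OF s(3)] by (metis kraft_simps(3))
        then have half: "1/2 \<le> kraft (p1 \<inter># q2)" using False kraft_mono[OF sub] by linarith
        have pq': "p1 + p2 = q2 + q1" using pq by (simp add: add.commute)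
        have "star L (size q1) (size q2) t1 t2 = star L (size q2) (size q1) t2 t1"
          by (rule star_comm'[OF tree_closed[OF x t(3)] tree_closed[OF x t(4)]])
        then show ?thesis using core[OF s(3,4) t(4,3) pq' D half] s(2) t(2) by simp
      qed
    qed
  qed
qed

end

section \<open>The Carlsson module \<open>K 1\<close>\<close>

declare One_nat_def [simp del]

lemma el_K: "x \<in> el (K 1) d \<longleftrightarrow> (\<forall>q. x q \<in> el (J (2 ^ q)) d \<and> dot_Sq (2 ^ q) d (x (Suc q)) = x q)"
  and add_K: "x \<oplus>\<^bsub>comp (K 1) d\<^esub> y = (\<lambda>q. x q \<oplus>\<^bsub>comp (J (2 ^ q)) d\<^esub> y q)"
  and zero_K: "\<zero>\<^bsub>comp (K 1) d\<^esub> = (\<lambda>q. \<zero>\<^bsub>comp (J (2 ^ q)) d\<^esub>)"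
  and sq_K: "sq (K 1) i d x = (\<lambda>q. sq (J (2 ^ q)) i d (x q))"
  and star_K: "star (K 1) a b x y = (\<lambda>q. int_prod (2 ^ q) a b (x q) (y q))"
  by (simp_all add: K_def)

lemma el_K_J: "x \<in> el (K 1) d \<Longrightarrow> x q \<in> el (J (2 ^ q)) d"
  and el_K_dot: "x \<in> el (K 1) d \<Longrightarrow> dot_Sq (2 ^ q) d (x (Suc q)) = x q"
  by (simp_all only: el_K)

lemma dot_Sq_hom_power: "dot_Sq (2 ^ q) \<in> umod_hom (J (2 ^ Suc q)) (J (2 ^ q))"
  using dot_Sq_hom[of "2 ^ q"] by simp

lemma K_vector_space: "module F2 (comp (K 1) d)"
proof (rule F2_moduleI)
  note hom = dot_Sq_hom_power
  show "\<zero>\<^bsub>comp (K 1) d\<^esub> \<in> el (K 1) d"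
    using lin_zero[OF J_vector_space J_vector_space umod_hom_lin[OF hom]] by (simp add: el_K zero_K)
  fix x y assume x: "x \<in> el (K 1) d" and y: "y \<in> el (K 1) d"
  show "x \<oplus>\<^bsub>comp (K 1) d\<^esub> y \<in> el (K 1) d"
    unfolding el_K add_K
    by (simp only: umod_hom_add[OF hom] el_K_J[OF x] el_K_J[OF y] el_K_dot[OF x] el_K_dot[OF y] JV.a_closed simp_thms)
  show "x \<oplus>\<^bsub>comp (K 1) d\<^esub> y = y \<oplus>\<^bsub>comp (K 1) d\<^esub> x"
    by (simp add: add_K add_J fun_eq_iff add.commute)
  fix z assume z: "z \<in> el (K 1) d"
  show "x \<oplus>\<^bsub>comp (K 1) d\<^esub> y \<oplus>\<^bsub>comp (K 1) d\<^esub> z = x \<oplus>\<^bsub>comp (K 1) d\<^esub> (y \<oplus>\<^bsub>comp (K 1) d\<^esub> z)"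
    by (simp add: add_K add_J fun_eq_iff add.assoc)
qed (simp_all add: add_K add_J zero_K zero_J fun_eq_iff K_def comp_J dual_def)

interpretation KV: Module.module F2 "comp (K 1) d" for d by (rule K_vector_space)

lemma lin_K_J: "(\<lambda>x. x q) \<in> lin (comp (K 1) d) (comp (J (2 ^ q)) d)"
  by (rule linI[OF K_vector_space J_vector_space]) (simp_all only: el_K_J add_K)

lemma finsum_K: "finite A \<Longrightarrow> g \<in> A \<rightarrow> el (K 1) d \<Longrightarrow>
    (\<Oplus>\<^bsub>comp (K 1) d\<^esub>k\<in>A. g k) q = (\<Oplus>\<^bsub>comp (J (2 ^ q)) d\<^esub>k\<in>A. g k q)"
  by (rule lin_finsum[OF K_vector_space J_vector_space lin_K_J])

lemma K_sq_closed:
  assumes x: "x \<in> el (K 1) d" shows "sq (K 1) i d x \<in> el (K 1) (d + i)"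
  unfolding el_K sq_K
  by (simp only: umod_hom_sq[OF dot_Sq_hom_power] el_K_J[OF x] el_K_dot[OF x] Jn.sq_closed simp_thms)

lemma K_unstable: "unstable_module (K 1)"
proof (rule unstable_module.intro)
  show "module F2 (comp (K 1) d)" for d by (rule K_vector_space)
  show "sq (K 1) i d \<in> lin (comp (K 1) d) (comp (K 1) (d + i))" for i d
    by (rule linI[OF K_vector_space K_vector_space K_sq_closed])
      (simp_all add: sq_K add_K Jn.sq_plus el_K_J)
  fix i d x assume x: "x \<in> el (K 1) d"
  note xq = el_K_J[OF x]
  show "sq (K 1) 0 d x = x" by (simp add: sq_K Jn.sq_zero'[OF xq])
  show "sq (K 1) i d x = \<zero>\<^bsub>comp (K 1) (d + i)\<^esub>" if "d < i"
    by (simp add: sq_K zero_K Jn.unstable'[OF that xq])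
  fix j assume ij: "0 < i" "i < 2 * j"
  let ?A = "{k. k \<le> i div 2 \<and> odd ((j - k - 1) choose (i - 2 * k))}"
  have c: "(\<lambda>k. sq (K 1) (i + j - k) (d + k) (sq (K 1) k d x)) \<in> ?A \<rightarrow> el (K 1) (d + j + i)"
  proof
    fix k assume "k \<in> ?A"
    then have "d + k + (i + j - k) = d + j + i" using ij by auto
    then show "sq (K 1) (i + j - k) (d + k) (sq (K 1) k d x) \<in> el (K 1) (d + j + i)"
      using K_sq_closed[OF K_sq_closed[OF x, of k], of "i + j - k"] by (simp only:)
  qed
  show "sq (K 1) i (d + j) (sq (K 1) j d x) =
      (\<Oplus>\<^bsub>comp (K 1) (d + j + i)\<^esub>k\<in>?A. sq (K 1) (i + j - k) (d + k) (sq (K 1) k d x))"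
    by (rule ext, subst finsum_K[OF _ c]) (simp_all only: sq_K Jn.adem'[OF ij xq], simp)
qed

interpretation Km: unstable_module "K 1" by (rule K_unstable)

subsection \<open>The monomial basis\<close>

text \<open>The component in $J(2^q)$ of the variable of depth \<open>j\<close> is $x_{q-j}$, or 0 if $q < j$.\<close>

definition depth_mono :: "nat multiset \<Rightarrow> nat \<Rightarrow> fterm set \<Rightarrow> bit" where
  "depth_mono D q = (if \<forall>j\<in>#D. j \<le> q then jmono (image_mset (\<lambda>j. q - j) D) else (\<lambda>\<theta>. 0))"

definition profiles :: "nat \<Rightarrow> nat multiset set" where
  "profiles d = {D. size D = d \<and> kraft D = 1}"

lemma finite_profiles: "finite (profiles d)"
  by (rule finite_subset[OF _ finite_multisets[of d d]]) (auto simp: profiles_def kraft_less_size)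

text \<open>At stage q, that is in J(2^q), the variable of depth j has weight 2^(q-j), or 2^q times
  (1/2)^j. Kraft sum 1 is therefore the condition of having the right total weight, the same for
  every stage.\<close>

lemma wtm_depths: "\<forall>j\<in>#D. j \<le> q \<Longrightarrow> real (wtm (image_mset (\<lambda>j. q - j) D)) = 2 ^ q * kraft D"
proof (induction D)
  case (add j D)
  then have "j \<le> q" by simp
  then have "(2::real) ^ (q - j) = 2 ^ q * (1/2) ^ j" by (simp add: power_diff power_one_over)
  then show ?case using add by (simp add: distrib_left)
qed simp

lemma wtm_profile: "D \<in> profiles d \<Longrightarrow> \<forall>j\<in>#D. j \<le> q \<Longrightarrow> wtm (image_mset (\<lambda>j. q - j) D) = 2 ^ q"
proof -
  assume "D \<in> profiles d" "\<forall>j\<in>#D. j \<le> q"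
  then have "real (wtm (image_mset (\<lambda>j. q - j) D)) = real (2 ^ q)"
    using wtm_depths[of D q] by (simp add: profiles_def)
  then show ?thesis by (simp only: of_nat_eq_iff)
qed

lemma depths_orbit: "D \<in> profiles d \<Longrightarrow> \<forall>j\<in>#D. j \<le> q \<Longrightarrow> image_mset (\<lambda>j. q - j) D \<in> orbits d (2 ^ q)"
  using wtm_profile[of D d q] by (simp add: orbits_def profiles_def)

lemma depth_mono_J: "D \<in> profiles d \<Longrightarrow> depth_mono D q \<in> el (J (2 ^ q)) d"
  using jmono_in[of "image_mset (\<lambda>j. q - j) D"] wtm_profile[of D d q] JV.zero_closed[of "2 ^ q" d]
  by (auto simp: depth_mono_def profiles_def zero_J)

lemma dot_Sq_zero: "dot_Sq n d (\<lambda>\<theta>. 0) = (\<lambda>\<theta>. 0)"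
  using lin_zero[OF J_vector_space J_vector_space umod_hom_lin[OF dot_Sq_hom]] by (simp add: zero_J)

lemma dot_Sq_depths:
  assumes w: "wtm (image_mset (\<lambda>j. Suc q - j) D) = 2 * 2 ^ q" and le: "\<forall>j\<in>#D. j \<le> Suc q"
  shows "dot_Sq (2 ^ q) (size D) (jmono (image_mset (\<lambda>j. Suc q - j) D)) =
    (if \<forall>j\<in>#D. j \<le> q then jmono (image_mset (\<lambda>j. q - j) D) else (\<lambda>\<theta>. 0))"
proof -
  have "0 = Suc q - j \<longleftrightarrow> \<not> j \<le> q" for j by auto
  then have z: "0 \<in># image_mset (\<lambda>j. Suc q - j) D \<longleftrightarrow> \<not> (\<forall>j\<in>#D. j \<le> q)" by (simp add: image_iff)
  have "image_mset (\<lambda>e. e - 1) (image_mset (\<lambda>j. Suc q - j) D) = image_mset (\<lambda>j. q - j) D"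
    unfolding image_mset.compositionality by (rule image_mset_cong) simp
  then show ?thesis using dot_Sq_jmono[OF w] z by simp
qed

lemma depth_mono_in: "D \<in> profiles d \<Longrightarrow> depth_mono D \<in> el (K 1) d"
  unfolding el_K
proof (intro allI conjI)
  fix q assume D: "D \<in> profiles d"
  show "depth_mono D q \<in> el (J (2 ^ q)) d" by (rule depth_mono_J[OF D])
  have d: "size D = d" using D by (simp add: profiles_def)
  show "dot_Sq (2 ^ q) d (depth_mono D (Suc q)) = depth_mono D q"
  proof (cases "\<forall>j\<in>#D. j \<le> Suc q")
    case True
    show ?thesis using dot_Sq_depths[of q D] wtm_profile[OF D True] True by (simp add: depth_mono_def d)
  next
    case False
    then have "\<not> (\<forall>j\<in>#D. j \<le> q)" by fastforce
    then show ?thesis unfolding depth_mono_def if_not_P[OF False] if_not_P[OF \<open>\<not> (\<forall>j\<in>#D. j \<le> q)\<close>]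
      by (simp only: dot_Sq_zero)
  qed
qed

text \<open>The stage \<open>size D\<close> is late enough for every variable to be present, since
  on profiles a depth is less than the number of leaves (\<open>kraft_less_size\<close>); by
  \<open>K_stable_coef\<close> any other such stage gives the same coordinate.\<close>

definition depth_coef :: "nat multiset \<Rightarrow> (nat \<Rightarrow> fterm set \<Rightarrow> bit) \<Rightarrow> bit" where
  "depth_coef D x = x (size D) (orb (image_mset (\<lambda>j. size D - j) D))"

lemma lin_depth_coef: "depth_coef D \<in> lin (comp (K 1) d) F2"
  unfolding depth_coef_def[abs_def] by (rule lin_comp[OF lin_K_J lin_eval_J])

lemma profile_le: "D \<in> profiles d \<Longrightarrow> \<forall>j\<in>#D. j \<le> d"
  using kraft_less_size[of D] by (auto simp: profiles_def intro: less_imp_le)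

lemma image_diff_diff: "\<forall>j\<in>#D. j \<le> q \<Longrightarrow> image_mset (\<lambda>e. q - e) (image_mset (\<lambda>j. q - j) D) = D"
  for q :: nat
  by (induction D) simp_all

lemma depth_coef_mono:
  assumes D: "D \<in> profiles d" and D': "D' \<in> profiles d"
  shows "depth_coef D (depth_mono D') = (if D = D' then 1 else 0)"
proof -
  note le = profile_le[OF D] profile_le[OF D']
  have d: "size D = d" "size D' = d" using D D' by (simp_all add: profiles_def)
  note o = depths_orbit[OF D le(1)] depths_orbit[OF D' le(2)]
  have "D = D' \<longleftrightarrow> image_mset (\<lambda>j. d - j) D' = image_mset (\<lambda>j. d - j) D"
    using image_diff_diff[OF le(1)] image_diff_diff[OF le(2)] by metis
  then show ?thesis
    using coef_orb[OF o(2,1)] orb_in[OF o(1)] wtm_profile[OF D' le(2)] le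
    by (simp add: depth_coef_def depth_mono_def d jmono_def)
qed

text \<open>The square of an orbit sum is the sum of the squares, as the cross terms vanish in
  characteristic 2.\<close>

lemma sq_orb:
  assumes E: "E \<in> orbits d n"
  shows "sq (F d) n n (orb E) = orb (image_mset Suc E)"
proof -
  let ?E = "image_mset Suc E"
  have w: "wtm (image_mset Suc E) = 2 * wtm E" for E by (induction E) simp_all
  have E': "?E \<in> orbits d (n + n)" using E w[of E] by (simp add: orbits_def)
  have s: "sq (F d) n n (orb E) \<in> el (F d) (n + n)" by (rule Fn.sq_closed[OF orb_in[OF E]])
  have "hat d (n + n) (sq (F d) n n (orb E)) l = hat d (n + n) (orb ?E) l" for l
  proof -
    have 1: "hat d (n + n) (sq (F d) n n (orb E)) l =
        (if 0 \<in> set l then 0 else if mset (map (\<lambda>e. e - 1) l) = E then 1 else 0)"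
      using psq_top[OF hat_in[OF orb_in[OF E]]] orb(2)[of E] E
      by (simp add: hat_sq[OF orb_in[OF E]] orbits_def)
    have 2: "hat d (n + n) (orb ?E) l = (if mset l = ?E then 1 else 0)"
      using orb(2)[of ?E] E' by (simp add: orbits_def)
    have "mset l = ?E \<longleftrightarrow> 0 \<notin> set l \<and> mset (map (\<lambda>e. e - 1) l) = E"
    proof
      assume l: "mset l = ?E"
      then have "set l = set_mset ?E" by (metis set_mset_mset)
      then show "0 \<notin> set l \<and> mset (map (\<lambda>e. e - 1) l) = E"
        by (auto simp: l image_mset.compositionality o_def)
    next
      assume "0 \<notin> set l \<and> mset (map (\<lambda>e. e - 1) l) = E"
      moreover have "map Suc (map (\<lambda>e. e - 1) l) = l" if "0 \<notin> set l"
        using that by (induction l) auto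
      ultimately show "mset l = ?E" by (metis mset_map)
    qed
    then show ?thesis unfolding 1 2 by simp
  qed
  then have e: "hat d (n + n) (sq (F d) n n (orb E)) = hat d (n + n) (orb ?E)" by (rule ext)
  show ?thesis
  proof (rule F_add_eq_zero[OF s orb_in[OF E']])
    show "sq (F d) n n (orb E) \<oplus>\<^bsub>comp (F d) (n + n)\<^esub> orb ?E = \<zero>\<^bsub>comp (F d) (n + n)\<^esub>"
      by (rule hat_inject) (simp_all add: s orb_in[OF E'] hat_add e)
  qed
qed

text \<open>Compatibility with \<open>dot_Sq\<close>, the transpose of Sq_0, equates the value at an
  orbit sum with the value of the next stage at its square; raising all entries by one is precisely
  the passage from q - j to q + 1 - j.\<close>

lemma K_stable_coef:
  assumes x: "x \<in> el (K 1) d" and D: "D \<in> profiles d" and le: "\<forall>j\<in>#D. j \<le> q"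
  shows "x (q + r) (orb (image_mset (\<lambda>j. q + r - j) D)) = x q (orb (image_mset (\<lambda>j. q - j) D))"
proof (induction r)
  case (Suc r)
  let ?q = "q + r"
  have le': "\<forall>j\<in>#D. j \<le> ?q" using le by auto
  let ?E = "image_mset (\<lambda>j. ?q - j) D"
  note E = depths_orbit[OF D le']
  have "image_mset Suc ?E = image_mset (\<lambda>j. Suc ?q - j) D"
    unfolding image_mset.compositionality
    by (rule image_mset_cong) (use le' in \<open>auto simp: Suc_diff_le\<close>)
  then have "x (Suc ?q) (orb (image_mset (\<lambda>j. Suc ?q - j) D)) = x (Suc ?q) (sq (F d) (2 ^ ?q) (2 ^ ?q) (orb ?E))"
    by (simp only: sq_orb[OF E])
  also have "\<dots> = dot_Sq (2 ^ ?q) d (x (Suc ?q)) (orb ?E)"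
    using dot_Sq_apply[OF _ orb_in[OF E]] el_K_J[OF x, of "Suc ?q"] by simp
  also have "\<dots> = x ?q (orb ?E)" by (simp only: el_K_dot[OF x])
  finally show ?case using Suc.IH by simp
qed simp

lemma K_separating:
  assumes x: "x \<in> el (K 1) d" and z: "\<And>D. D \<in> profiles d \<Longrightarrow> depth_coef D x = 0"
  shows "x = \<zero>\<^bsub>comp (K 1) d\<^esub>"
proof -
  have "x q \<theta> = 0" for q \<theta>
  proof (cases "\<theta> \<in> el (F d) (2 ^ q)")
    case False then show ?thesis by (rule J_off[OF el_K_J[OF x]])
  next
    case True
    note xq = el_K_J[OF x, of q]
    note sp = F_vector_space[of d "2 ^ q"] orb_Pi[of d "2 ^ q"]
    show ?thesis using F_span[OF True]
    proof (induction rule: f2_span_induct[OF sp, consumes 1, case_names z s])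
      case z show ?case by (rule J_zero[OF xq])
    next
      case (s \<theta> E)
      have E: "size E = d" "wtm E = 2 ^ q" using s.hyps(2) by (simp_all add: orbits_def)
      \<comment> \<open>A variable of weight greater than 2^q does not fit, so every orbit of this
        stage arises from a multiset of depths.\<close>
      have Eq: "\<forall>e\<in>#E. e \<le> q"
      proof
        fix e assume "e \<in># E"
        then obtain E' where "E = add_mset e E'" by (metis mset_add)
        then have "(2::nat) ^ e \<le> 2 ^ q" using E(2) by (metis wtm_simps(2) le_add1)
        then show "e \<le> q" by simp
      qed
      define D where "D = image_mset (\<lambda>e. q - e) E"
      have le: "\<forall>j\<in>#D. j \<le> q" by (auto simp: D_def)
      have ED: "image_mset (\<lambda>j. q - j) D = E" unfolding D_def by (rule image_diff_diff[OF Eq])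
      have "kraft D = 1" using wtm_depths[OF le] unfolding ED E(2) by simp
      then have D: "D \<in> profiles d" using E(1) by (simp add: profiles_def D_def)
      \<comment> \<open>The coordinate is defined at stage \<open>d\<close>, which may come before
        or after \<open>q\<close>; both are compared with stage \<open>q + d\<close>.\<close>
      have "x q (orb E) = x (q + d) (orb (image_mset (\<lambda>j. q + d - j) D))"
        using K_stable_coef[OF x D le, of d] by (simp add: ED)
      also have "\<dots> = depth_coef D x"
        using K_stable_coef[OF x D profile_le[OF D], of q] D by (simp add: depth_coef_def profiles_def add.commute)
      also have "\<dots> = 0" by (rule z[OF D])
      finally have "x q (orb E) = 0" .
      moreover have "\<theta> \<in> el (F d) (2 ^ q)" by (rule f2_span_closed[OF sp s.hyps(1)])
      ultimately show ?case
        using s.IH xq[unfolded el_J, THEN conjunct1, rule_format, of \<theta> "orb E"] orb_in[OF s.hyps(2)] by simp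
    qed
  qed
  then show ?thesis by (simp add: zero_K zero_J fun_eq_iff)
qed

lemma depth_mono_Pi: "depth_mono \<in> profiles d \<rightarrow> el (K 1) d"
  using depth_mono_in by blast

theorem K_span: "x \<in> el (K 1) d \<Longrightarrow> x \<in> f2_span (comp (K 1) d) depth_mono (profiles d)"
  by (rule f2_span_separating[OF K_vector_space depth_mono_Pi finite_profiles lin_depth_coef depth_coef_mono K_separating])

lemma K_induct [consumes 1, case_names zero mono add]:
  assumes x: "x \<in> el (K 1) d" and z: "P \<zero>\<^bsub>comp (K 1) d\<^esub>" and m: "\<And>D. D \<in> profiles d \<Longrightarrow> P (depth_mono D)"
    and a: "\<And>x y. x \<in> el (K 1) d \<Longrightarrow> y \<in> el (K 1) d \<Longrightarrow> P x \<Longrightarrow> P y \<Longrightarrow> P (x \<oplus>\<^bsub>comp (K 1) d\<^esub> y)"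
  shows "P x"
  using K_span[OF x]
proof (induction rule: f2_span_induct[OF K_vector_space depth_mono_Pi, consumes 1, case_names z s])
  case (s y D)
  then show ?case using f2_span_closed[OF K_vector_space depth_mono_Pi s.hyps(1)] depth_mono_in m a by blast
qed (rule z)

lemma K_lin_ext:
  assumes V: "module F2 V" and f: "f \<in> lin (comp (K 1) d) V" and g: "g \<in> lin (comp (K 1) d) V"
    and e: "\<And>D. D \<in> profiles d \<Longrightarrow> f (depth_mono D) = g (depth_mono D)" and x: "x \<in> el (K 1) d"
  shows "f x = g x"
  using x
proof (induction rule: K_induct)
  case zero show ?case by (simp add: lin_zero[OF K_vector_space V f] lin_zero[OF K_vector_space V g])
next
  case (mono D) then show ?case by (rule e)
next
  case (add x y) then show ?case by (simp add: lin_add[OF f] lin_add[OF g])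
qed

subsection \<open>The internal product\<close>

lemma int_prod_zero:
  shows "y \<in> el (J n) b \<Longrightarrow> int_prod n a b (\<lambda>\<theta>. 0) y = (\<lambda>\<theta>. 0)"
    and "x \<in> el (J n) a \<Longrightarrow> int_prod n a b x (\<lambda>\<theta>. 0) = (\<lambda>\<theta>. 0)"
proof -
  show "int_prod n a b (\<lambda>\<theta>. 0) y = (\<lambda>\<theta>. 0)" if "y \<in> el (J n) b"
    using lin_zero[OF J_vector_space J_vector_space linI[where f = "\<lambda>x. int_prod n a b x y", OF J_vector_space J_vector_space
          int_prod_closed[OF _ that] int_prod_add_left[OF _ _ that]]]
    by (simp add: zero_J)
  show "int_prod n a b x (\<lambda>\<theta>. 0) = (\<lambda>\<theta>. 0)" if "x \<in> el (J n) a"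
    using lin_zero[OF J_vector_space J_vector_space linI[where f = "int_prod n a b x", OF J_vector_space J_vector_space
          int_prod_closed[OF that] int_prod_add_right[OF that]]]
    by (simp add: zero_J)
qed

lemma profiles_node: "A \<in> profiles a \<Longrightarrow> B \<in> profiles b \<Longrightarrow> image_mset Suc (A + B) \<in> profiles (a + b)"
  by (simp add: profiles_def kraft_Suc)

text \<open>At stage q the external product lies in J(2^(q+1)), which belongs to stage q + 1, and q
  - j = (q + 1) - (j + 1): read there, every depth has grown by one. \<open>dot_Sq\<close> only
  leads back to stage q.\<close>

lemma star_depth_mono:
  assumes A: "A \<in> profiles a" and B: "B \<in> profiles b"
  shows "star (K 1) a b (depth_mono A) (depth_mono B) = depth_mono (image_mset Suc (A + B))"
proof
  fix q
  have sz: "size A = a" "size B = b" using A B by (simp_all add: profiles_def)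
  show "star (K 1) a b (depth_mono A) (depth_mono B) q = depth_mono (image_mset Suc (A + B)) q"
  proof (cases "(\<forall>j\<in>#A. j \<le> q) \<and> (\<forall>j\<in>#B. j \<le> q)")
    case True
    let ?S = "image_mset Suc (A + B)"
    have le: "\<forall>j\<in>#?S. j \<le> Suc q" using True by auto
    have i: "image_mset (\<lambda>j. Suc q - j) ?S = image_mset (\<lambda>j. q - j) A + image_mset (\<lambda>j. q - j) B"
      by (simp add: image_mset.compositionality o_def)
    have w: "wtm (image_mset (\<lambda>j. q - j) A) = 2 ^ q" "wtm (image_mset (\<lambda>j. q - j) B) = 2 ^ q"
      using wtm_profile[OF A] wtm_profile[OF B] True by blast+
    have "star (K 1) a b (depth_mono A) (depth_mono B) q =
        dot_Sq (2 ^ q) (size ?S) (jmono (image_mset (\<lambda>j. Suc q - j) ?S))"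
      using int_prod_jmono[OF w] True unfolding i by (simp add: star_K depth_mono_def sz)
    also have "\<dots> = depth_mono ?S q"
      unfolding depth_mono_def by (rule dot_Sq_depths[OF _ le]) (simp add: i w del: image_mset_union)
    finally show ?thesis .
  next
    case False
    then have "depth_mono A q = (\<lambda>\<theta>. 0) \<or> depth_mono B q = (\<lambda>\<theta>. 0)" by (auto simp: depth_mono_def)
    then have "star (K 1) a b (depth_mono A) (depth_mono B) q = (\<lambda>\<theta>. 0)"
      using int_prod_zero[of "depth_mono B q" "2 ^ q" b a] int_prod_zero(2)[of "depth_mono A q" "2 ^ q" a b]
        depth_mono_J[OF A, of q] depth_mono_J[OF B, of q] by (auto simp: star_K)
    moreover have "\<not> (\<forall>j\<in>#image_mset Suc (A + B). j \<le> q)"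
    proof
      assume "\<forall>j\<in>#image_mset Suc (A + B). j \<le> q"
      then have "\<forall>j\<in>#A + B. Suc j \<le> q" by auto
      then show False using False by (auto dest: Suc_leD)
    qed
    then have "depth_mono (image_mset Suc (A + B)) q = (\<lambda>\<theta>. 0)"
      unfolding depth_mono_def by (rule if_not_P)
    ultimately show ?thesis by (simp only:)
  qed
qed

lemma K_star_add:
  assumes "x \<in> el (K 1) a" "x' \<in> el (K 1) a" "y \<in> el (K 1) b" "y' \<in> el (K 1) b"
  shows "star (K 1) a b (x \<oplus>\<^bsub>comp (K 1) a\<^esub> x') y = star (K 1) a b x y \<oplus>\<^bsub>comp (K 1) (a + b)\<^esub> star (K 1) a b x' y"
    and "star (K 1) a b x (y \<oplus>\<^bsub>comp (K 1) b\<^esub> y') = star (K 1) a b x y \<oplus>\<^bsub>comp (K 1) (a + b)\<^esub> star (K 1) a b x y'"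
  using assms by (simp_all add: star_K add_K int_prod_add_left int_prod_add_right el_K_J)

lemma K_star_zero:
  "y \<in> el (K 1) b \<Longrightarrow> star (K 1) a b \<zero>\<^bsub>comp (K 1) a\<^esub> y = \<zero>\<^bsub>comp (K 1) (a + b)\<^esub>"
  "x \<in> el (K 1) a \<Longrightarrow> star (K 1) a b x \<zero>\<^bsub>comp (K 1) b\<^esub> = \<zero>\<^bsub>comp (K 1) (a + b)\<^esub>"
  by (simp_all add: star_K zero_K zero_J int_prod_zero el_K_J)

text \<open>Compatibility of the product with the transition maps is verified on the basis, where a
  product is again a basis element; bilinearity does the rest.\<close>

lemma K_star_closed:
  assumes x: "x \<in> el (K 1) a" and y: "y \<in> el (K 1) b"
  shows "star (K 1) a b x y \<in> el (K 1) (a + b)"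
  using x
proof (induction rule: K_induct)
  case zero show ?case using y by (simp add: K_star_zero)
next
  case (add x x') then show ?case using y by (simp add: K_star_add)
next
  case (mono A)
  note A = depth_mono_in[OF mono]
  show ?case using y
  proof (induction rule: K_induct)
    case zero show ?case using A by (simp add: K_star_zero)
  next
    case (add y y') then show ?case using A by (simp add: K_star_add)
  next
    case (mono B)
    show ?case unfolding star_depth_mono[OF \<open>A \<in> profiles a\<close> mono]
      by (rule depth_mono_in[OF profiles_node[OF \<open>A \<in> profiles a\<close> mono]])
  qed
qed

lemma K_star_lin1: "y \<in> el (K 1) b \<Longrightarrow> (\<lambda>x. star (K 1) a b x y) \<in> lin (comp (K 1) a) (comp (K 1) (a + b))"
  by (rule linI[OF K_vector_space K_vector_space]) (simp_all add: K_star_closed K_star_add(1))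

lemma K_star_lin2: "x \<in> el (K 1) a \<Longrightarrow> (\<lambda>y. star (K 1) a b x y) \<in> lin (comp (K 1) b) (comp (K 1) (a + b))"
  by (rule linI[OF K_vector_space K_vector_space]) (simp_all add: K_star_closed K_star_add(2))

lemma K_star_comm:
  assumes x: "x \<in> el (K 1) a" and y: "y \<in> el (K 1) b"
  shows "star (K 1) a b x y = star (K 1) b a y x"
proof (rule K_lin_ext[OF K_vector_space K_star_lin1[OF y] _ _ x])
  show "(\<lambda>x. star (K 1) b a y x) \<in> lin (comp (K 1) a) (comp (K 1) (a + b))"
    using K_star_lin2[OF y, of a] by (simp only: add.commute[of b a])
  fix A assume A: "A \<in> profiles a"
  show "star (K 1) a b (depth_mono A) y = star (K 1) b a y (depth_mono A)"
  proof (rule K_lin_ext[OF K_vector_space K_star_lin2[OF depth_mono_in[OF A]] _ _ y])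
    show "(\<lambda>y. star (K 1) b a y (depth_mono A)) \<in> lin (comp (K 1) b) (comp (K 1) (a + b))"
      using K_star_lin1[OF depth_mono_in[OF A], of b] by (simp only: add.commute[of b a])
    fix B assume B: "B \<in> profiles b"
    show "star (K 1) a b (depth_mono A) (depth_mono B) = star (K 1) b a (depth_mono B) (depth_mono A)"
      by (simp only: star_depth_mono[OF A B] star_depth_mono[OF B A] add.commute[of A B])
  qed
qed

text \<open>On basis elements both sides carry the depths of all four factors increased by two. The
  identity is then extended by linearity in one argument after another.\<close>

lemma K_level:
  assumes x: "x \<in> el (K 1) a" and y: "y \<in> el (K 1) b" and z: "z \<in> el (K 1) c" and w: "w \<in> el (K 1) e"
  shows "star (K 1) (a + b) (c + e) (star (K 1) a b x y) (star (K 1) c e z w) =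
    star (K 1) (a + c) (b + e) (star (K 1) a c x z) (star (K 1) b e y w)"
proof -
  let ?L = "\<lambda>x y z w. star (K 1) (a + b) (c + e) (star (K 1) a b x y) (star (K 1) c e z w)"
  let ?R = "\<lambda>x y z w. star (K 1) (a + c) (b + e) (star (K 1) a c x z) (star (K 1) b e y w)"
  let ?n = "a + b + (c + e)"
  have n: "a + c + (b + e) = ?n" by simp
  note cl = K_star_closed
  have L1: "(\<lambda>x. ?L x y z w) \<in> lin (comp (K 1) a) (comp (K 1) ?n)" if "y \<in> el (K 1) b" "z \<in> el (K 1) c" "w \<in> el (K 1) e" for y z w
    by (rule lin_comp[OF K_star_lin1 K_star_lin1]) (intro that cl)+
  have R1: "(\<lambda>x. ?R x y z w) \<in> lin (comp (K 1) a) (comp (K 1) ?n)" if "y \<in> el (K 1) b" "z \<in> el (K 1) c" "w \<in> el (K 1) e" for y z w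
    unfolding n[symmetric] by (rule lin_comp[OF K_star_lin1 K_star_lin1]) (intro that cl)+
  have L2: "(\<lambda>y. ?L x y z w) \<in> lin (comp (K 1) b) (comp (K 1) ?n)" if "x \<in> el (K 1) a" "z \<in> el (K 1) c" "w \<in> el (K 1) e" for x z w
    by (rule lin_comp[OF K_star_lin2 K_star_lin1]) (intro that cl)+
  have R2: "(\<lambda>y. ?R x y z w) \<in> lin (comp (K 1) b) (comp (K 1) ?n)" if "x \<in> el (K 1) a" "z \<in> el (K 1) c" "w \<in> el (K 1) e" for x z w
    unfolding n[symmetric] by (rule lin_comp[OF K_star_lin1 K_star_lin2]) (intro that cl)+
  have L3: "(\<lambda>z. ?L x y z w) \<in> lin (comp (K 1) c) (comp (K 1) ?n)" if "x \<in> el (K 1) a" "y \<in> el (K 1) b" "w \<in> el (K 1) e" for x y w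
    by (rule lin_comp[OF K_star_lin1 K_star_lin2]) (intro that cl)+
  have R3: "(\<lambda>z. ?R x y z w) \<in> lin (comp (K 1) c) (comp (K 1) ?n)" if "x \<in> el (K 1) a" "y \<in> el (K 1) b" "w \<in> el (K 1) e" for x y w
    unfolding n[symmetric] by (rule lin_comp[OF K_star_lin2 K_star_lin1]) (intro that cl)+
  have L4: "(\<lambda>w. ?L x y z w) \<in> lin (comp (K 1) e) (comp (K 1) ?n)" if "x \<in> el (K 1) a" "y \<in> el (K 1) b" "z \<in> el (K 1) c" for x y z
    by (rule lin_comp[OF K_star_lin2 K_star_lin2]) (intro that cl)+
  have R4: "(\<lambda>w. ?R x y z w) \<in> lin (comp (K 1) e) (comp (K 1) ?n)" if "x \<in> el (K 1) a" "y \<in> el (K 1) b" "z \<in> el (K 1) c" for x y z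
    unfolding n[symmetric] by (rule lin_comp[OF K_star_lin2 K_star_lin2]) (intro that cl)+
  note ext = K_lin_ext[OF K_vector_space]
  note m = depth_mono_in
  have 4: "?L (depth_mono A) (depth_mono B) (depth_mono C) (depth_mono E) = ?R (depth_mono A) (depth_mono B) (depth_mono C) (depth_mono E)"
    if "A \<in> profiles a" "B \<in> profiles b" "C \<in> profiles c" "E \<in> profiles e" for A B C E
  proof -
    have "image_mset Suc (image_mset Suc (A + B) + image_mset Suc (C + E)) =
        image_mset Suc (image_mset Suc (A + C) + image_mset Suc (B + E))" by (simp add: ac_simps)
    then show ?thesis using that by (simp only: star_depth_mono profiles_node)
  qed
  have 3: "?L (depth_mono A) (depth_mono B) (depth_mono C) w = ?R (depth_mono A) (depth_mono B) (depth_mono C) w"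
    if "A \<in> profiles a" "B \<in> profiles b" "C \<in> profiles c" for A B C
    by (rule ext[OF L4 R4 4 w]) (intro that m | assumption)+
  have 2: "?L (depth_mono A) (depth_mono B) z w = ?R (depth_mono A) (depth_mono B) z w"
    if "A \<in> profiles a" "B \<in> profiles b" for A B
    by (rule ext[OF L3 R3 3 z]) (intro that m w | assumption)+
  have 1: "?L (depth_mono A) y z w = ?R (depth_mono A) y z w" if "A \<in> profiles a" for A
    by (rule ext[OF L2 R2 2 y]) (intro that m z w | assumption)+
  show ?thesis by (rule ext[OF L1 R1 1 x]) (intro y z w | assumption)+
qed

lemma K_cartan:
  assumes x: "x \<in> el (K 1) a" and y: "y \<in> el (K 1) b"
  shows "sq (K 1) i (a + b) (star (K 1) a b x y) =
    (\<Oplus>\<^bsub>comp (K 1) (a + b + i)\<^esub>k\<in>{..i}. star (K 1) (a + k) (b + (i - k)) (sq (K 1) k a x) (sq (K 1) (i - k) b y))"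
proof
  fix q
  have c: "(\<lambda>k. star (K 1) (a + k) (b + (i - k)) (sq (K 1) k a x) (sq (K 1) (i - k) b y)) \<in> {..i} \<rightarrow> el (K 1) (a + b + i)"
  proof
    fix k assume "k \<in> {..i}"
    then have "a + k + (b + (i - k)) = a + b + i" by simp
    then show "star (K 1) (a + k) (b + (i - k)) (sq (K 1) k a x) (sq (K 1) (i - k) b y) \<in> el (K 1) (a + b + i)"
      using K_star_closed[OF K_sq_closed[OF x, of k] K_sq_closed[OF y, of "i - k"]] by (simp only:)
  qed
  show "sq (K 1) i (a + b) (star (K 1) a b x y) q =
    (\<Oplus>\<^bsub>comp (K 1) (a + b + i)\<^esub>k\<in>{..i}. star (K 1) (a + k) (b + (i - k)) (sq (K 1) k a x) (sq (K 1) (i - k) b y)) q"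
    by (subst finsum_K[OF finite_atMost c])
      (simp only: sq_K star_K int_prod_cartan[OF el_K_J[OF x] el_K_J[OF y]])
qed

text \<open>In the top degree, instability kills every Cartan term except the one with
  \<open>k = a\<close>, so Sq_0 is multiplicative.\<close>

lemma K_sq_top_star:
  assumes x: "x \<in> el (K 1) a" and y: "y \<in> el (K 1) b"
  shows "sq (K 1) (a + b) (a + b) (star (K 1) a b x y) = star (K 1) (a + a) (b + b) (sq (K 1) a a x) (sq (K 1) b b y)"
proof -
  let ?n = "a + b + (a + b)"
  let ?f = "\<lambda>k. star (K 1) (a + k) (b + (a + b - k)) (sq (K 1) k a x) (sq (K 1) (a + b - k) b y)"
  have c: "?f k \<in> el (K 1) ?n" if "k \<le> a + b" for k
  proof -
    have "a + k + (b + (a + b - k)) = ?n" using that by simp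
    then show ?thesis
      using K_star_closed[OF K_sq_closed[OF x, of k] K_sq_closed[OF y, of "a + b - k"]] by (simp only:)
  qed
  have z: "?f k = \<zero>\<^bsub>comp (K 1) ?n\<^esub>" if k: "k \<le> a + b" "k \<noteq> a" for k
  proof -
    have d: "a + k + (b + (a + b - k)) = ?n" using k by simp
    consider "a < k" | "b < a + b - k" using k by linarith
    then show ?thesis
    proof cases
      case 1
      show ?thesis unfolding Km.unstable'[OF 1 x] K_star_zero(1)[OF K_sq_closed[OF y]] d ..
    next
      case 2
      show ?thesis unfolding Km.unstable'[OF 2 y] K_star_zero(2)[OF K_sq_closed[OF x]] d ..
    qed
  qed
  have "(\<Oplus>\<^bsub>comp (K 1) ?n\<^esub>k\<in>{..a + b}. ?f k) = (\<Oplus>\<^bsub>comp (K 1) ?n\<^esub>k\<in>insert a ({..a + b} - {a}). ?f k)"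
    by (rule arg_cong[where f = "finsum (comp (K 1) ?n) ?f"]) auto
  also have "\<dots> = ?f a \<oplus>\<^bsub>comp (K 1) ?n\<^esub> (\<Oplus>\<^bsub>comp (K 1) ?n\<^esub>k\<in>{..a + b} - {a}. ?f k)"
    by (rule KV.finsum_insert) (simp, simp, use c in blast, rule c, simp)
  also have "(\<Oplus>\<^bsub>comp (K 1) ?n\<^esub>k\<in>{..a + b} - {a}. ?f k) = (\<Oplus>\<^bsub>comp (K 1) ?n\<^esub>k\<in>{..a + b} - {a}. \<zero>\<^bsub>comp (K 1) ?n\<^esub>)"
    by (rule KV.finsum_cong'[OF refl]) (use z in auto)
  also have "?f a \<oplus>\<^bsub>comp (K 1) ?n\<^esub> \<dots> = ?f a" using c[OF le_add1] by simp
  finally show ?thesis unfolding K_cartan[OF x y] by simp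
qed

abbreviation K_gen :: "nat \<Rightarrow> fterm set \<Rightarrow> bit" where
  "K_gen \<equiv> depth_mono {#0#}"

lemma leaf_profile: "{#0#} \<in> profiles 1"
  by (simp add: profiles_def)

text \<open>Both sides are the basis element with depths 1, 1: at stage q this is x_(q-1)^2, and 0
  for q = 0.\<close>

lemma sq_K_gen: "sq (K 1) 1 1 K_gen = star (K 1) 1 1 K_gen K_gen"
proof
  fix q
  show "sq (K 1) 1 1 K_gen q = star (K 1) 1 1 K_gen K_gen q"
    unfolding star_depth_mono[OF leaf_profile leaf_profile] sq_K
    using sq_jmono_generator[of q] by (simp add: depth_mono_def Suc_le_eq) (simp add: One_nat_def)
qed

text \<open>The star square is additive because the cross terms cancel by commutativity, so basis
  elements suffice. For those the identity spreads from the generator along a tree: Sq_0 is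
  multiplicative, and the level law rearranges the product of two squares into the square of the
  product.\<close>

lemma K_Sq0_star: "x \<in> el (K 1) d \<Longrightarrow> Sq0 (K 1) d x = star (K 1) d d x x"
proof (induction rule: K_induct)
  case zero
  show ?case using lin_zero[OF K_vector_space K_vector_space Km.sq_linear] by (simp add: Sq0_def K_star_zero)
next
  case (add x y)
  have s: "star (K 1) d d x y \<in> el (K 1) (d + d)" by (rule K_star_closed[OF add.hyps])
  have "star (K 1) d d (x \<oplus>\<^bsub>comp (K 1) d\<^esub> y) (x \<oplus>\<^bsub>comp (K 1) d\<^esub> y) =
      star (K 1) d d x x \<oplus>\<^bsub>comp (K 1) (d + d)\<^esub> star (K 1) d d y y \<oplus>\<^bsub>comp (K 1) (d + d)\<^esub>
      (star (K 1) d d x y \<oplus>\<^bsub>comp (K 1) (d + d)\<^esub> star (K 1) d d x y)"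
    using add.hyps K_star_comm[OF add.hyps] by (simp add: K_star_add K_star_closed KV.a_ac)
  also have "\<dots> = star (K 1) d d x x \<oplus>\<^bsub>comp (K 1) (d + d)\<^esub> star (K 1) d d y y"
    using add.hyps by (simp add: F2_add_self[OF K_vector_space s] K_star_closed)
  finally show ?case using add by (simp add: Sq0_def Km.sq_plus)
next
  case (mono D)
  have "kraft D = 1" using mono by (simp add: profiles_def)
  then have "sq (K 1) (size D) (size D) (depth_mono D) = star (K 1) (size D) (size D) (depth_mono D) (depth_mono D)"
  proof (induction rule: kraft_induct)
    case leaf show ?case using sq_K_gen by (simp add: One_nat_def)
  next
    case (node A B)
    have A: "A \<in> profiles (size A)" and B: "B \<in> profiles (size B)" using node by (simp_all add: profiles_def)
    note a = depth_mono_in[OF A] and b = depth_mono_in[OF B]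
    show ?case using K_sq_top_star[OF a b] K_level[OF a a b b]
      by (simp add: node.IH star_depth_mono[OF A B] flip: image_mset_union)
  qed
  then show ?case using mono by (simp add: Sq0_def profiles_def)
qed

theorem K_level_algebra: "unstable_level_algebra (K 1)"
  by (intro unstable_level_algebra.intro unstable_level_algebra_axioms.intro K_unstable
      K_star_lin1 K_star_lin2 K_star_comm K_level K_cartan K_Sq0_star)

interpretation Ka: unstable_level_algebra "K 1" by (rule K_level_algebra)

section \<open>The free unstable level algebra on \<open>F 1\<close>\<close>

abbreviation "FL \<equiv> free_ula (F 1)"

interpretation La: unstable_level_algebra FL by (rule free_ula_level_algebra)
interpretation LV: Module.module F2 "comp FL d" for d by (rule free_ula_vector_space)

definition gen :: "fterm set lterm set" where
  "gen = free_ula_unit (F 1) 1 (iota 1)"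

lemma gen_in: "gen \<in> el FL 1"
  unfolding gen_def by (rule umod_hom_closed[OF free_ula_unit_hom[OF F_unstable] iota_in])

text \<open>By \<open>tree_unique\<close> the chosen bracketing does not matter.\<close>

definition tree_elt :: "nat multiset \<Rightarrow> fterm set lterm set" where
  "tree_elt D = (SOME y. tree FL gen D y)"

lemma tree_elt: "D \<in> profiles d \<Longrightarrow> tree FL gen D (tree_elt D)"
  unfolding tree_elt_def by (rule someI_ex) (simp add: tree_exists profiles_def)

lemma tree_elt_eq: "D \<in> profiles d \<Longrightarrow> tree FL gen D y \<Longrightarrow> y = tree_elt D"
  by (rule La.tree_unique[OF gen_in _ tree_elt])

lemma tree_elt_in: "D \<in> profiles d \<Longrightarrow> tree_elt D \<in> el FL d"
  using La.tree_closed[OF gen_in tree_elt[of D d]] by (simp add: profiles_def)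

lemma tree_elt_Pi: "tree_elt \<in> profiles d \<rightarrow> el FL d"
  using tree_elt_in by blast

lemma tree_elt_leaf: "tree_elt {#0#} = gen"
  using tree_elt_eq[OF leaf_profile tree.leaf] by simp

lemma star_tree_elt:
  assumes A: "A \<in> profiles a" and B: "B \<in> profiles b"
  shows "star FL a b (tree_elt A) (tree_elt B) = tree_elt (image_mset Suc (A + B))"
proof -
  have "size A = a" "size B = b" using A B by (simp_all add: profiles_def)
  then show ?thesis
    using tree_elt_eq[OF profiles_node[OF A B] tree.node[OF tree_elt[OF A] tree_elt[OF B]]] by (simp only:)
qed

abbreviation FL_span :: "nat \<Rightarrow> fterm set lterm set set" where
  "FL_span d \<equiv> f2_span (comp FL d) tree_elt (profiles d)"

context
begin

lemmas FL_span_facts = free_ula_vector_space[of "F 1"] tree_elt_Pi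

lemma FL_span_star:
  assumes x: "x \<in> FL_span a" and y: "y \<in> FL_span b"
  shows "star FL a b x y \<in> FL_span (a + b)"
  using x
proof (induction rule: f2_span_induct[OF FL_span_facts, consumes 1, case_names z s])
  case z
  have "y \<in> el FL b" by (rule f2_span_closed[OF FL_span_facts y])
  then show ?case
    using lin_zero[OF free_ula_vector_space free_ula_vector_space La.star_linear1] f2_span_zero[OF FL_span_facts] by simp
next
  case (s x A)
  have yb: "y \<in> el FL b" by (rule f2_span_closed[OF FL_span_facts y])
  note A = tree_elt_in[OF s.hyps(2)]
  have "star FL a b (tree_elt A) y \<in> FL_span (a + b)" using y
  proof (induction rule: f2_span_induct[OF FL_span_facts, consumes 1, case_names z' s'])
    case z'
    show ?case
      using lin_zero[OF free_ula_vector_space free_ula_vector_space La.star_linear2[OF A]] f2_span_zero[OF FL_span_facts] by simp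
  next
    case (s' y B)
    have "tree_elt (image_mset Suc (A + B)) \<in> FL_span (a + b)"
      by (rule f2_span_base[OF FL_span_facts profiles_node[OF s.hyps(2) s'.hyps(2)]])
    then show ?case
      using s'.IH lin_add[OF La.star_linear2[OF A] f2_span_closed[OF FL_span_facts s'.hyps(1)] tree_elt_in[OF s'.hyps(2)]]
      by (simp only: star_tree_elt[OF s.hyps(2) s'.hyps(2)] f2_span_add[OF FL_span_facts])
  qed
  then show ?case
    using s.IH lin_add[OF La.star_linear1[OF yb] f2_span_closed[OF FL_span_facts s.hyps(1)] A]
    by (simp only: f2_span_add[OF FL_span_facts])
qed

lemma FL_span_sq:
  assumes "x \<in> FL_span d"
  shows "sq FL i d x \<in> FL_span (d + i)"
  using assms
proof (induction rule: f2_span_induct[OF FL_span_facts, consumes 1, case_names z s])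
  case z
  show ?case using lin_zero[OF free_ula_vector_space free_ula_vector_space La.sq_linear] f2_span_zero[OF FL_span_facts] by simp
next
  case (s x D)
  have "kraft D = 1" using s.hyps(2) by (simp add: profiles_def)
  then have "sq FL i (size D) (tree_elt D) \<in> FL_span (size D + i)"
  proof (induction arbitrary: i rule: kraft_induct)
    case leaf
    consider "i = 0" | "i = 1" | "1 < i" by linarith
    then show ?case
    proof cases
      case 1
      then show ?thesis using La.sq_zero'[OF gen_in] f2_span_base[OF FL_span_facts leaf_profile] by (simp add: tree_elt_leaf One_nat_def)
    next
      case 2
      have "sq FL 1 1 gen = star FL 1 1 gen gen" using La.Sq0_star[OF gen_in] by (simp add: Sq0_def)
      moreover have "star FL 1 1 (tree_elt {#0#}) (tree_elt {#0#}) \<in> FL_span (1 + 1)"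
        by (intro FL_span_star f2_span_base[OF FL_span_facts leaf_profile])
      ultimately show ?thesis using 2 by (simp add: tree_elt_leaf One_nat_def)
    next
      case 3
      then show ?thesis using La.unstable'[OF 3 gen_in] f2_span_zero[OF FL_span_facts] by (simp add: tree_elt_leaf One_nat_def)
    qed
  next
    case (node A B)
    have A: "A \<in> profiles (size A)" and B: "B \<in> profiles (size B)" using node.hyps by (simp_all add: profiles_def)
    let ?f = "\<lambda>k. star FL (size A + k) (size B + (i - k)) (sq FL k (size A) (tree_elt A)) (sq FL (i - k) (size B) (tree_elt B))"
    have "?f k \<in> FL_span (size A + size B + i)" if "k \<in> {..i}" for k
    proof -
      have "size A + k + (size B + (i - k)) = size A + size B + i" using that by simp
      then show ?thesis using FL_span_star[OF node.IH(1)[of k] node.IH(2)[of "i - k"]] by (simp only:)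
    qed
    then have "(\<Oplus>\<^bsub>comp FL (size A + size B + i)\<^esub>k\<in>{..i}. ?f k) \<in> FL_span (size A + size B + i)"
      by (intro f2_span_finsum[OF FL_span_facts]) simp_all
    then show ?case
      unfolding La.cartan'[OF tree_elt_in[OF A] tree_elt_in[OF B], symmetric] star_tree_elt[OF A B] by simp
  qed
  then have "sq FL i d (tree_elt D) \<in> FL_span (d + i)" using s.hyps(2) by (simp add: profiles_def)
  then show ?case using s.IH La.sq_plus[OF f2_span_closed[OF FL_span_facts s.hyps(1)] tree_elt_in[OF s.hyps(2)]]
    by (simp only: f2_span_add[OF FL_span_facts])
qed

lemma FL_span_unit:
  assumes "x \<in> el (F 1) d"
  shows "free_ula_unit (F 1) d x \<in> FL_span d"
proof -
  note u = free_ula_unit_hom[OF F_unstable, of 1]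
  show ?thesis using assms
  proof (induction rule: F_induct)
    case iota show ?case using f2_span_base[OF FL_span_facts leaf_profile] by (simp add: tree_elt_leaf gen_def)
  next
    case (zero d)
    show ?case using lin_zero[OF F_vector_space free_ula_vector_space umod_hom_lin[OF u]] f2_span_zero[OF FL_span_facts] by simp
  next
    case (add d x y) then show ?case by (simp only: umod_hom_add[OF u] f2_span_add[OF FL_span_facts])
  next
    case (sq d i x) then show ?case by (simp only: umod_hom_sq[OF u] FL_span_sq)
  qed
qed

theorem FL_spanned: "x \<in> el FL d \<Longrightarrow> x \<in> FL_span d"
proof -
  have "lwf (F 1) d t \<Longrightarrow> Collect (lrel (F 1) d t) \<in> FL_span d" for t
  proof (induction t arbitrary: d)
    case (LGen x) then show ?case using FL_span_unit[of x d] by (simp add: free_ula_unit_def)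
  next
    case LZero
    show ?case using f2_span_zero[OF FL_span_facts] by (simp add: comp_free_ula lrel.zero_quot)
  next
    case (LAdd s t)
    then have "lrel (F 1) d s s" "lrel (F 1) d t t" by (simp_all flip: lwf_iff[OF F_unstable])
    then show ?case using f2_span_add[OF FL_span_facts LAdd.IH] LAdd.prems by (simp flip: add_free_ula)
  next
    case (LSq i t)
    then have t: "i \<le> d" "lwf (F 1) (d - i) t" by simp_all
    then have "lrel (F 1) (d - i) t t" by (simp flip: lwf_iff[OF F_unstable])
    then show ?case using FL_span_sq[OF LSq.IH[OF t(2)], of i] t(1) by (simp add: sq_free_ula)
  next
    case (LStar a s b t)
    then have st: "d = a + b" "lwf (F 1) a s" "lwf (F 1) b t" by simp_all
    then have "lrel (F 1) a s s" "lrel (F 1) b t t" by (simp_all flip: lwf_iff[OF F_unstable])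
    then show ?case using FL_span_star[OF LStar.IH(1)[OF st(2)] LStar.IH(2)[OF st(3)]] st(1) by (simp add: star_free_ula)
  qed
  then show "x \<in> el FL d \<Longrightarrow> x \<in> FL_span d" by (auto elim!: el_free_ulaE simp: lwf_iff[OF F_unstable])
qed

end

text \<open>The universal property yields a morphism out of the free algebra, while the isomorphism
  is asked for in the other direction. The inverse is restricted to the carriers because morphisms
  are \<open>undefined\<close> off them.\<close>

lemma ula_isomorphic_sym:
  assumes L: "unstable_level_algebra L" and L': "unstable_level_algebra L'"
    and \<psi>: "\<psi> \<in> ula_hom L' L" and bij: "\<And>d. bij_betw (\<psi> d) (el L' d) (el L d)"
  shows "ula_isomorphic L L'"
proof -
  interpret L: unstable_level_algebra L by (rule L)
  interpret L': unstable_level_algebra L' by (rule L')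
  interpret V: Module.module F2 "comp L d" for d by (rule L.vector_space)
  interpret V': Module.module F2 "comp L' d" for d by (rule L'.vector_space)
  define \<phi> where "\<phi> d = restrict (the_inv_into (el L' d) (\<psi> d)) (el L d)" for d
  have h: "\<psi> \<in> umod_hom L' L" using \<psi> by (simp add: ula_hom_def)
  have \<phi>_in: "\<phi> d x \<in> el L' d" and \<psi>\<phi>: "\<psi> d (\<phi> d x) = x" if "x \<in> el L d" for d x
    using that bij[of d] by (auto simp: \<phi>_def bij_betw_def the_inv_into_into f_the_inv_into_f)
  have eq: "\<phi> d x = y" if "y \<in> el L' d" "\<psi> d y = x" for d x y
    using that bij[of d] umod_hom_closed[OF h that(1)]
    by (auto simp: \<phi>_def bij_betw_def the_inv_into_f_f)
  have "\<phi> \<in> umod_hom L L'"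
  proof (rule umod_homI[OF L.vector_space L'.vector_space])
    fix d x i assume x: "x \<in> el L d"
    show "\<phi> d x \<in> el L' d" by (rule \<phi>_in[OF x])
    show "\<phi> (d + i) (sq L i d x) = sq L' i d (\<phi> d x)"
      by (rule eq) (simp_all add: L'.sq_closed \<phi>_in[OF x] umod_hom_sq[OF h] \<psi>\<phi>[OF x])
    fix y assume y: "y \<in> el L d"
    show "\<phi> d (x \<oplus>\<^bsub>comp L d\<^esub> y) = \<phi> d x \<oplus>\<^bsub>comp L' d\<^esub> \<phi> d y"
      by (rule eq) (simp_all add: \<phi>_in x y umod_hom_add[OF h] \<psi>\<phi>)
  qed (simp add: \<phi>_def)
  moreover have "\<phi> (a + b) (star L a b x y) = star L' a b (\<phi> a x) (\<phi> b y)"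
    if x: "x \<in> el L a" and y: "y \<in> el L b" for a b x y
    using \<psi> by (intro eq) (simp_all add: L'.star_closed \<phi>_in[OF x] \<phi>_in[OF y] ula_hom_def \<psi>\<phi>[OF x] \<psi>\<phi>[OF y])
  moreover have "bij_betw (\<phi> d) (el L d) (el L' d)" for d
    using bij_betw_the_inv_into[OF bij[of d]] by (simp add: \<phi>_def cong: bij_betw_cong)
  ultimately show ?thesis using L L' by (auto simp: ula_isomorphic_def ula_hom_def)
qed

theorem proposition9p9:
  shows "ula_isomorphic (K 1) (free_ula (F 1))"
proof -
  have g: "K_gen \<in> el (K 1) 1" by (rule depth_mono_in[OF leaf_profile])
  obtain \<psi> where \<psi>: "\<psi> \<in> ula_hom FL (K 1)"
    and unit: "\<And>d x. x \<in> el (F 1) d \<Longrightarrow> \<psi> d (free_ula_unit (F 1) d x) = classify (K 1) 1 K_gen d x"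
    using Ka.free_ula_universal[OF F_unstable Km.classify_hom[OF g]] by blast
  have h: "\<psi> \<in> umod_hom FL (K 1)" using \<psi> by (simp add: ula_hom_def)
  have star: "\<psi> (a + b) (star FL a b x y) = star (K 1) a b (\<psi> a x) (\<psi> b y)" if "x \<in> el FL a" "y \<in> el FL b" for a b x y
    using \<psi> that by (simp add: ula_hom_def)
  \<comment> \<open>Both families follow the same product rule, so agreement on the generator
    suffices.\<close>
  have "\<psi> (size D) (tree_elt D) = depth_mono D" if "kraft D = 1" for D
    using that
  proof (induction rule: kraft_induct)
    case leaf
    have "\<psi> 1 gen = K_gen" unfolding gen_def unit[OF iota_in] by (rule Km.classify_iota[OF g])
    then show ?case by (simp add: tree_elt_leaf One_nat_def)
  next
    case (node A B)
    have A: "A \<in> profiles (size A)" and B: "B \<in> profiles (size B)" using node.hyps by (simp_all add: profiles_def)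
    have "\<psi> (size A + size B) (star FL (size A) (size B) (tree_elt A) (tree_elt B)) =
        star (K 1) (size A) (size B) (depth_mono A) (depth_mono B)"
      by (simp only: star[OF tree_elt_in[OF A] tree_elt_in[OF B]] node.IH)
    then show ?case by (simp only: star_tree_elt[OF A B] star_depth_mono[OF A B] size_image_mset size_union)
  qed
  then have tree: "\<psi> d (tree_elt D) = depth_mono D" if "D \<in> profiles d" for d D
    using that by (auto simp: profiles_def)
  have "bij_betw (\<psi> d) (el FL d) (el (K 1) d)" for d
  proof -
    \<comment> \<open>The tree products have only been shown to span; their independence now comes
      from the coordinates of their images in K(1).\<close>
    have ker: "x = \<zero>\<^bsub>comp FL d\<^esub>" if x: "x \<in> el FL d" and z: "\<psi> d x = \<zero>\<^bsub>comp (K 1) d\<^esub>" for x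
    proof (rule f2_span_coordinates[OF free_ula_vector_space tree_elt_Pi FL_spanned[OF x]])
      fix D assume D: "D \<in> profiles d"
      show "(\<lambda>x. depth_coef D (\<psi> d x)) \<in> lin (comp FL d) F2"
        by (rule lin_comp[OF umod_hom_lin[OF h] lin_depth_coef])
      show "depth_coef D (\<psi> d x) = 0"
        using lin_zero[OF K_vector_space F2_module lin_depth_coef] by (simp add: z)
      show "depth_coef D (\<psi> d (tree_elt D')) = (if D = D' then 1 else 0)" if "D' \<in> profiles d" for D'
        by (simp only: tree[OF that] depth_coef_mono[OF D that])
    qed
    have "inj_on (\<psi> d) (el FL d)"
    proof (rule inj_onI)
      fix x y assume xy: "x \<in> el FL d" "y \<in> el FL d" "\<psi> d x = \<psi> d y"
      have "\<psi> d (x \<oplus>\<^bsub>comp FL d\<^esub> y) = \<zero>\<^bsub>comp (K 1) d\<^esub>"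
        using xy by (simp add: umod_hom_add[OF h] F2_add_self[OF K_vector_space umod_hom_closed[OF h]])
      then have "x \<oplus>\<^bsub>comp FL d\<^esub> y = \<zero>\<^bsub>comp FL d\<^esub>" using xy by (intro ker) simp_all
      moreover have "x \<oplus>\<^bsub>comp FL d\<^esub> y \<oplus>\<^bsub>comp FL d\<^esub> y = x"
        using xy by (simp add: LV.a_assoc F2_add_self[OF free_ula_vector_space])
      ultimately show "x = y" using xy by simp
    qed
    moreover have "x \<in> \<psi> d ` el FL d" if "x \<in> el (K 1) d" for x
      using that
    proof (induction rule: K_induct)
      case zero
      show ?case using lin_zero[OF free_ula_vector_space K_vector_space umod_hom_lin[OF h]] LV.zero_closed
        by (metis image_eqI)
    next
      case (mono D) then show ?case using tree tree_elt_in by (metis image_eqI)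
    next
      case (add x y)
      then obtain u v where "u \<in> el FL d" "v \<in> el FL d" "x = \<psi> d u" "y = \<psi> d v" by blast
      then show ?case using umod_hom_add[OF h] LV.a_closed by (metis image_eqI)
    qed
    ultimately show ?thesis using umod_hom_closed[OF h] by (auto simp: bij_betw_def)
  qed
  then show ?thesis by (rule ula_isomorphic_sym[OF K_level_algebra free_ula_level_algebra \<psi>])
qed

end
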